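(* In the setting of the context, if the evolution family $(\mathbf{V}_h(t,s))_{t\ge s\ge0}$ (spatially homogeneous problem) is honest in $\mathcal{E}_h=L^1(V,\mathrm{d}\mu)$, then the evolution family $(\mathbf{V}(t,s))_{t\ge s\ge0}$ (spatially inhomogeneous problem) is honest in $\mathcal{E}=L^1(\mathbf{\Omega}\times V,\mathrm{d}x\otimes\mathrm{d}\mu(v))$.
   Context: Let $\mathbf{\Omega}\subset\mathbb{R}^d$ be open, $\mu$ a Borel measure on $\mathbb{R}^d$ ($d\ge1$) with support $V$. Assume: (1) $(t,v)\in\mathbb{R}_+\times V\mapsto\Sigma(t,v)$ is measurable and non-negative and, for $\mu$-a.e. $v$, $t\mapsto\Sigma(t,v)$ is locally integrable on $\mathbb{R}_+$; (2) $(t,v,v')\in\mathbb{R}_+\times V\times V\mapsto b(t,v,v')$ is measurable and non-negative and $\int_Vb(t,v,v')\,\mathrm{d}\mu(v)\le\Sigma(t,v')$ for a.e. $(t,v')\in\mathbb{R}_+\times V$. Put $\sigma(t,v)=\int_Vb(t,v',v)\,\mathrm{d}\mu(v')$. Homogeneous problem: in $\mathcal{E}_h=L^1(V,\mathrm{d}\mu)$, $[\mathbf{U}_h(t,s)\varphi](v)=\exp\big(-\int_s^t\Sigma(\tau,v)\,\mathrm{d}\tau\big)\varphi(v)$ for $t\ge s\ge 0$, and $[\mathbf{B}_h(t)\varphi](v)=\int_Vb(t,v,v')\varphi(v')\,\mathrm{d}\mu(v')$ with domain $\mathscr{D}(\mathbf{B}_h(t))=\{\varphi\in\mathcal{E}_h:\int_V\sigma(t,v)|\varphi(v)|\,\mathrm{d}\mu(v)<\infty\}$.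 Inhomogeneous problem: in $\mathcal{E}=L^1(\mathbf{\Omega}\times V,\mathrm{d}x\otimes\mathrm{d}\mu(v))$, with $\tau(x,v)=\inf\{t>0:x-tv\notin\mathbf{\Omega}\}$ ($\inf\emptyset=+\infty$), $[\mathbf{U}(t,s)\varphi](x,v)=\exp\big(-\int_s^t\Sigma(r,v)\,\mathrm{d}r\big)\varphi(x-(t-s)v,v)\chi_{\{t-s<\tau(x,v)\}}(x,v)$ for $t\ge s\ge0$, and $[\mathbf{B}(t)\varphi](x,v)=\int_Vb(t,v,v')\varphi(x,v')\,\mathrm{d}\mu(v')$ with domain $\mathscr{D}(\mathbf{B}(t))=\{\varphi\in\mathcal{E}:\int_{\mathbf{\Omega}\times V}\sigma(t,v)|\varphi(x,v)|\,\mathrm{d}x\,\mathrm{d}\mu(v)<\infty\}$. General construction: the following applies both to the triple $(\mathcal{E}_h,\mathbf{U}_h,\mathbf{B}_h)$, yielding $\mathbf{V}_h$, and to $(\mathcal{E},\mathbf{U},\mathbf{B})$, yielding $\mathbf{V}$. Write $(\mathcal{F},\mathbf{U},\mathbf{B})$ for either triple. For any $\varphi\in\mathcal{F}$ and $s\ge0$, $\mathbf{U}(t,s)\varphi\in\mathscr{D}(\mathbf{B}(t))$ for a.e. $t\ge s$. Set $\mathbf{V}_0=\mathbf{U}$, $\mathbf{V}_{n+1}(t,s)\varphi=\int_s^t\mathbf{V}_n(t,r)\mathbf{B}(r)\mathbf{U}(r,s)\varphi\,\mathrm{d}r$, $\mathbf{V}(t,s)\varphi=\sum_{n\ge0}\mathbf{V}_n(t,s)\varphi$;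 the series converges and $(\mathbf{V}(t,s))_{t\ge s\ge0}$ is a strongly continuous evolution family of positive operators, contractive on the positive cone. Definition of honesty of $(\mathbf{V}(t,s))_{t\ge s\ge 0}$ in $\mathcal{F}$: let $\mathfrak{X}=L^1(\mathbb{R}_+,\mathcal{F})$ with norm $\|f\|_{\mathfrak{X}}=\int_0^\infty\|f(s)\|\,\mathrm{d}s$, $\mathfrak{X}_+$ the cone of functions that are a.e. non-negative, and $\mathbf{\Psi}$ the bounded linear functional on $\mathfrak{X}$ equal to the norm on $\mathfrak{X}_+$. For $n\ge0$ put $[\mathcal{T}_n(t)f](s)=\mathbf{V}_n(s,s-t)f(s-t)$ if $s\ge t$, $0$ if $0\le s<t$, and $[\mathcal{T}(t)f](s)=\mathbf{V}(s,s-t)f(s-t)$ if $s\ge t$, $0$ if $0\le s<t$. $(\mathcal{T}_0(t))_{t\ge0}$ and $(\mathcal{T}(t))_{t\ge0}$ are $C_0$-semigroups on $\mathfrak{X}$ with generators $\mathcal{Z}$ and $\mathcal{G}$; $\mathscr{D}(\mathcal{Z})\subset\mathscr{D}(\mathcal{G})$ and $\widehat{\mathfrak{B}}f=\mathcal{G}f-\mathcal{Z}f$ for $f\in\mathscr{D}(\mathcal{Z})$. For $f\in\mathscr{D}(\mathcal{Z})$ put $\mathfrak{a}(f)=-\langle\mathbf{\Psi},\mathcal{Z}f+\widehat{\mathfrak{B}}f\rangle$; for $f\in\mathscr{D}(\mathcal{G})$ the limit $\widehat{\mathfrak{a}}(f)=\lim_{t\to0^+}\frac1t\sum_{n=0}^\infty\mathfrak{a}\big(\int_0^t\mathcal{T}_n(s)f\,\mathrm{d}s\big)$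 exists (known). $(\mathbf{V}(t,s))_{t\ge s\ge 0}$ is honest in $\mathcal{F}$ if $\|\mathcal{T}(t)f\|_{\mathfrak{X}}=\|f\|_{\mathfrak{X}}-\widehat{\mathfrak{a}}\big(\int_0^t\mathcal{T}(s)f\,\mathrm{d}s\big)$ for all $f\in\mathfrak{X}_+$ and $t\ge0$. *)

theory Defs
  imports "HOL-Analysis.Analysis" "HOL-Library.Function_Algebras"
begin

section \<open>Functions as a real vector space\<close>

instantiation "fun" :: (type, real_vector) real_vector
begin

definition scaleR_fun :: "real \<Rightarrow> ('a \<Rightarrow> 'b) \<Rightarrow> 'a \<Rightarrow> 'b" where
  "scaleR_fun c f = (\<lambda>x. c *\<^sub>R f x)"

instance
  by standard (simp_all add: scaleR_fun_def plus_fun_def fun_eq_iff scaleR_add_right scaleR_add_left)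

end


section \<open>Spaces of representatives\<close>

text \<open>
  An $L^1$ space depends on a measure, so it is not a type here. It is represented by the set of
  its representatives (a subspace of a vector space of functions) together with the seminorm that
  becomes the norm on almost-everywhere classes, and the representatives of its positive cone.
  Elements are only meaningful modulo vectors of seminorm 0: limits, integrals and generators
  below are formulated with the seminorm and determine their values modulo such vectors.
\<close>

record 'v space_rep =
  Car :: "'v set"
  Nrm :: "'v \<Rightarrow> real"
  Pos :: "'v set"

definition L1 :: "'a measure \<Rightarrow> ('a \<Rightarrow> real) space_rep" where
  "L1 M = \<lparr> Car = {\<phi>. integrable M \<phi>},
            Nrm = (\<lambda>\<phi>. LINT x|M. \<bar>\<phi> x\<bar>),
            Pos = {\<phi>. integrable M \<phi> \<and> (AE x in M. 0 \<le> \<phi> x)} \<rparr>"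


section \<open>Bochner integral with values in such a space\<close>

text \<open>
  The library's \<^const>\<open>has_bochner_integral\<close> needs the value space to be a separable normed type; this is the
  same definition with the norm replaced by the seminorm of \<open>F\<close>. Strong measurability of \<open>g\<close> is the
  almost-everywhere convergence of the simple functions.
\<close>

definition bochner_approx ::
  "('v::real_vector) space_rep \<Rightarrow> 'b measure \<Rightarrow> ('b \<Rightarrow> 'v) \<Rightarrow> (nat \<Rightarrow> 'b \<Rightarrow> 'v) \<Rightarrow> bool" where
  "bochner_approx F N g S \<longleftrightarrow>
     (\<forall>i. Bochner_Integration.simple_bochner_integrable N (S i) \<and> S i ` space N \<subseteq> Car F) \<and>
     (AE r in N. g r \<in> Car F \<and> (\<lambda>i. Nrm F (g r - S i r)) \<longlonglongrightarrow> 0) \<and>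
     (\<lambda>i. \<integral>\<^sup>+ r. ennreal (Nrm F (g r - S i r)) \<partial>N) \<longlonglongrightarrow> 0"

definition bochner_integrable ::
  "('v::real_vector) space_rep \<Rightarrow> 'b measure \<Rightarrow> ('b \<Rightarrow> 'v) \<Rightarrow> bool" where
  "bochner_integrable F N g \<longleftrightarrow> (\<exists>S. bochner_approx F N g S)"

definition has_bochner_int ::
  "('v::real_vector) space_rep \<Rightarrow> 'b measure \<Rightarrow> ('b \<Rightarrow> 'v) \<Rightarrow> 'v \<Rightarrow> bool" where
  "has_bochner_int F N g y \<longleftrightarrow>
     y \<in> Car F \<and>
     (\<exists>S. bochner_approx F N g S \<and>
          (\<lambda>i. Nrm F (Bochner_Integration.simple_bochner_integral N (S i) - y)) \<longlonglongrightarrow> 0)"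

definition bochner_int ::
  "('v::real_vector) space_rep \<Rightarrow> 'b measure \<Rightarrow> ('b \<Rightarrow> 'v) \<Rightarrow> 'v" where
  "bochner_int F N g = (SOME y. has_bochner_int F N g y)"

text \<open>
  Completed Lebesgue measure on the time axis: by completeness, the norm of a strongly measurable
  function is measurable although strong measurability is only an almost-everywhere condition.
\<close>

definition L1_time :: "('v::real_vector) space_rep \<Rightarrow> (real \<Rightarrow> 'v) space_rep" where
  "L1_time F = \<lparr> Car = {f. bochner_integrable F (lebesgue_on {0..}) f},
                 Nrm = (\<lambda>f. LINT s|lebesgue_on {0..}. Nrm F (f s)),
                 Pos = {f. bochner_integrable F (lebesgue_on {0..}) f \<and>
                           (AE s in lebesgue_on {0..}. f s \<in> Pos F)} \<rparr>"

text \<open>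
  The bounded linear functional that agrees with the norm on the cone; when the cone is generating,
  its values on \<open>Car X\<close> do not depend on the choice.
\<close>

definition norm_functional :: "('v::real_vector) space_rep \<Rightarrow> 'v \<Rightarrow> real" where
  "norm_functional X = (SOME P.
     (\<forall>f\<in>Car X. \<forall>g\<in>Car X. P (f + g) = P f + P g) \<and>
     (\<forall>c. \<forall>f\<in>Car X. P (c *\<^sub>R f) = c * P f) \<and>
     (\<exists>K. \<forall>f\<in>Car X. \<bar>P f\<bar> \<le> K * Nrm X f) \<and>
     (\<forall>f\<in>Pos X. P f = Nrm X f))"


section \<open>Generators\<close>

definition is_generator_value ::
  "('v::real_vector) space_rep \<Rightarrow> (real \<Rightarrow> 'v \<Rightarrow> 'v) \<Rightarrow> 'v \<Rightarrow> 'v \<Rightarrow> bool" where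
  "is_generator_value X T f g \<longleftrightarrow>
     f \<in> Car X \<and> g \<in> Car X \<and>
     ((\<lambda>h. Nrm X ((1 / h) *\<^sub>R (T h f - f) - g)) \<longlongrightarrow> 0) (at_right 0)"

definition generator ::
  "('v::real_vector) space_rep \<Rightarrow> (real \<Rightarrow> 'v \<Rightarrow> 'v) \<Rightarrow> 'v \<Rightarrow> 'v" where
  "generator X T f = (SOME g. is_generator_value X T f g)"


section \<open>Dyson--Phillips series and honesty\<close>

type_synonym 'v evolution = "real \<Rightarrow> real \<Rightarrow> 'v \<Rightarrow> 'v"

primrec dyson ::
  "('v::real_vector) space_rep \<Rightarrow> 'v evolution \<Rightarrow> (real \<Rightarrow> 'v \<Rightarrow> 'v) \<Rightarrow> nat \<Rightarrow> 'v evolution" where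
  "dyson F U B 0 = U"
| "dyson F U B (Suc n) =
     (\<lambda>t s \<phi>. bochner_int F (lebesgue_on {s..t}) (\<lambda>r. dyson F U B n t r (B r (U r s \<phi>))))"

definition perturbed ::
  "('v::real_vector) space_rep \<Rightarrow> 'v evolution \<Rightarrow> (real \<Rightarrow> 'v \<Rightarrow> 'v) \<Rightarrow> 'v evolution" where
  "perturbed F U B t s \<phi> =
     (SOME \<psi>. \<psi> \<in> Car F \<and> (\<lambda>N. Nrm F ((\<Sum>n<N. dyson F U B n t s \<phi>) - \<psi>)) \<longlonglongrightarrow> 0)"

definition lift_semigroup ::
  "('v::zero) evolution \<Rightarrow> real \<Rightarrow> (real \<Rightarrow> 'v) \<Rightarrow> real \<Rightarrow> 'v" where
  "lift_semigroup W t f s = (if t \<le> s then W s (s - t) (f (s - t)) else 0)"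

context
  fixes F :: "('v::real_vector) space_rep"
    and U :: "'v evolution"
    and B :: "real \<Rightarrow> 'v \<Rightarrow> 'v"
begin

definition Tn :: "nat \<Rightarrow> real \<Rightarrow> (real \<Rightarrow> 'v) \<Rightarrow> real \<Rightarrow> 'v" where
  "Tn n = lift_semigroup (dyson F U B n)"

definition TV :: "real \<Rightarrow> (real \<Rightarrow> 'v) \<Rightarrow> real \<Rightarrow> 'v" where
  "TV = lift_semigroup (perturbed F U B)"

definition gen_Z :: "(real \<Rightarrow> 'v) \<Rightarrow> real \<Rightarrow> 'v" where
  "gen_Z = generator (L1_time F) (Tn 0)"

definition gen_G :: "(real \<Rightarrow> 'v) \<Rightarrow> real \<Rightarrow> 'v" where
  "gen_G = generator (L1_time F) TV"

definition B_hat :: "(real \<Rightarrow> 'v) \<Rightarrow> real \<Rightarrow> 'v" where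
  "B_hat f = gen_G f - gen_Z f"

definition a_fun :: "(real \<Rightarrow> 'v) \<Rightarrow> real" where
  "a_fun f = - norm_functional (L1_time F) (gen_Z f + B_hat f)"

definition a_hat :: "(real \<Rightarrow> 'v) \<Rightarrow> real" where
  "a_hat f = Lim (at_right 0)
     (\<lambda>t. (1 / t) *
        (\<Sum>n. a_fun (bochner_int (L1_time F) (lebesgue_on {0..t}) (\<lambda>s. Tn n s f))))"

definition honest :: bool where
  "honest \<longleftrightarrow>
     (\<forall>f \<in> Pos (L1_time F). \<forall>t\<ge>0.
        Nrm (L1_time F) (TV t f) =
        Nrm (L1_time F) f
          - a_hat (bochner_int (L1_time F) (lebesgue_on {0..t}) (\<lambda>s. TV s f)))"

end


section \<open>The kinetic problems\<close>

definition measure_support :: "('a::topological_space) measure \<Rightarrow> 'a set" where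
  "measure_support \<mu> = {v. \<forall>S. open S \<and> v \<in> S \<longrightarrow> emeasure \<mu> S \<noteq> 0}"

abbreviation velocities :: "('a::topological_space) measure \<Rightarrow> 'a measure" where
  "velocities \<mu> \<equiv> restrict_space \<mu> (measure_support \<mu>)"

abbreviation half_line :: "real measure" where
  "half_line \<equiv> restrict_space lborel {0..}"

text \<open>The function $\sigma$, kept extended-valued: it may be infinite for exceptional \<open>(t, v)\<close>.\<close>

definition scatter_rate ::
  "'a::topological_space measure \<Rightarrow> (real \<Rightarrow> 'a \<Rightarrow> 'a \<Rightarrow> real) \<Rightarrow> real \<Rightarrow> 'a \<Rightarrow> ennreal" where
  "scatter_rate \<mu> b t v = (\<integral>\<^sup>+ v'. ennreal (b t v' v) \<partial>velocities \<mu>)"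

definition E_hom :: "'a::topological_space measure \<Rightarrow> ('a \<Rightarrow> real) space_rep" where
  "E_hom \<mu> = L1 (velocities \<mu>)"

definition U_hom :: "(real \<Rightarrow> 'a \<Rightarrow> real) \<Rightarrow> ('a \<Rightarrow> real) evolution" where
  "U_hom \<Sigma> t s \<phi> = (\<lambda>v. exp (- (LINT r:{s..t}|lborel. \<Sigma> r v)) * \<phi> v)"

definition dom_B_hom ::
  "'a::topological_space measure \<Rightarrow> (real \<Rightarrow> 'a \<Rightarrow> 'a \<Rightarrow> real) \<Rightarrow> real \<Rightarrow> ('a \<Rightarrow> real) set" where
  "dom_B_hom \<mu> b t =
     {\<phi> \<in> Car (E_hom \<mu>). (\<integral>\<^sup>+ v. scatter_rate \<mu> b t v * ennreal \<bar>\<phi> v\<bar> \<partial>velocities \<mu>) < \<infinity>}"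

text \<open>
  The unbounded operators are given the value 0 outside their domain. The Dyson--Phillips
  integrals apply them outside the domain only for a null set of times.
\<close>

definition B_hom ::
  "'a::topological_space measure \<Rightarrow> (real \<Rightarrow> 'a \<Rightarrow> 'a \<Rightarrow> real) \<Rightarrow>
     real \<Rightarrow> ('a \<Rightarrow> real) \<Rightarrow> 'a \<Rightarrow> real" where
  "B_hom \<mu> b t \<phi> =
     (if \<phi> \<in> dom_B_hom \<mu> b t then (\<lambda>v. LINT v'|velocities \<mu>. b t v v' * \<phi> v') else 0)"

definition phase_space ::
  "'a::euclidean_space set \<Rightarrow> 'a measure \<Rightarrow> ('a \<times> 'a) measure" where
  "phase_space \<Omega> \<mu> = restrict_space lborel \<Omega> \<Otimes>\<^sub>M velocities \<mu>"

definition E_inhom ::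
  "'a::euclidean_space set \<Rightarrow> 'a measure \<Rightarrow> ('a \<times> 'a \<Rightarrow> real) space_rep" where
  "E_inhom \<Omega> \<mu> = L1 (phase_space \<Omega> \<mu>)"

definition exit_time :: "'a::real_vector set \<Rightarrow> 'a \<Rightarrow> 'a \<Rightarrow> ereal" where
  "exit_time \<Omega> x v = Inf (ereal ` {t. 0 < t \<and> x - t *\<^sub>R v \<notin> \<Omega>})"

definition U_inhom ::
  "'a::real_vector set \<Rightarrow> (real \<Rightarrow> 'a \<Rightarrow> real) \<Rightarrow> ('a \<times> 'a \<Rightarrow> real) evolution" where
  "U_inhom \<Omega> \<Sigma> t s \<phi> =
     (\<lambda>(x, v). exp (- (LINT r:{s..t}|lborel. \<Sigma> r v)) * \<phi> (x - (t - s) *\<^sub>R v, v)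
                 * (if ereal (t - s) < exit_time \<Omega> x v then 1 else 0))"

definition dom_B_inhom ::
  "'a::euclidean_space set \<Rightarrow> 'a measure \<Rightarrow> (real \<Rightarrow> 'a \<Rightarrow> 'a \<Rightarrow> real) \<Rightarrow>
     real \<Rightarrow> ('a \<times> 'a \<Rightarrow> real) set" where
  "dom_B_inhom \<Omega> \<mu> b t =
     {\<phi> \<in> Car (E_inhom \<Omega> \<mu>).
        (\<integral>\<^sup>+ (x, v). scatter_rate \<mu> b t v * ennreal \<bar>\<phi> (x, v)\<bar> \<partial>phase_space \<Omega> \<mu>) < \<infinity>}"

definition B_inhom ::
  "'a::euclidean_space set \<Rightarrow> 'a measure \<Rightarrow> (real \<Rightarrow> 'a \<Rightarrow> 'a \<Rightarrow> real) \<Rightarrow>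
     real \<Rightarrow> ('a \<times> 'a \<Rightarrow> real) \<Rightarrow> 'a \<times> 'a \<Rightarrow> real" where
  "B_inhom \<Omega> \<mu> b t \<phi> =
     (if \<phi> \<in> dom_B_inhom \<Omega> \<mu> b t
      then (\<lambda>(x, v). LINT v'|velocities \<mu>. b t v v' * \<phi> (x, v'))
      else 0)"

end

theory Submission
  imports Defs
begin

text \<open>
Honesty says that no mass is lost through infinitely many collisions in finite time, and this
loss can be compared between the two problems. Integrating an inhomogeneous density over
\<open>\<Omega>\<close> leaves a density of velocities. Free transport followed by this integration is dominated by
homogeneous damping, since what leaves \<open>\<Omega>\<close> is lost (\<open>marginal_transport_le\<close>). Scattering does not
move particles, so it commutes with the integration (\<open>marginal_scattering\<close>). By induction, the part of
an inhomogeneous solution that has collided \<open>n\<close> times has a marginal below the corresponding part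
of the homogeneous solution (\<open>spatial_marginal_T_le\<close>), so less mass escapes
(\<open>inhomogeneous_escape_le\<close>).

The work is to express honesty by escaping mass. For a non-negative \<open>G\<close> on time and state, \<open>T n t G\<close>
is the \<open>n\<close>-th Dyson--Phillips term of the lifted semigroup and \<open>gain n t G\<close> the mass produced by
collision number \<open>n + 1\<close> up to time \<open>t\<close>. It decreases in \<open>n\<close>; the limit \<open>escape t G\<close> is the
escaping mass. In \<open>a_fun\<close> the generator \<open>gen_Z\<close> cancels, so that \<open>a_fun\<close> is minus the integral of
the generator of the perturbed semigroup. On \<open>accum n t G\<close>, the time integral of \<open>T n\<close>, this
generator is computed from an exact identity (\<open>TT_T_late\<close>, \<open>right_derivative_accum\<close>), and its integral is
\<open>T n t G\<close> plus \<open>gain n t G\<close> minus \<open>gain (n - 1) t G\<close>, in mass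
(for \<open>n = 0\<close>, minus the mass of \<open>G\<close>). The series in \<open>a_hat\<close> telescopes:
on any \<open>J\<close> it gives the mass of \<open>J\<close> minus that of \<open>TT h J\<close> minus \<open>escape h J\<close>. For
\<open>J = TT_accum t G\<close>, division by \<open>h\<close> and the limit \<open>h\<close> to 0 leave the
mass of \<open>G\<close> minus that of \<open>TT t G\<close> minus \<open>escape t G\<close> (\<open>defect_limit\<close>). The equation that defines honesty therefore
holds exactly when \<open>escape t G = 0\<close> (\<open>honest_iff_escape\<close>), for either problem.

Masses are computed with measurable functions into the extended non-negative reals, where Tonelli's
theorem requires no integrability. The relations \<open>represents\<close> and \<open>nonneg_rep\<close> connect them with
Bochner integrals, generators and series of representatives.
\<close>

notation (input) pair_measure (infixr "\<otimes>" 80)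
notation (input) LIMSEQ ("((_)/ ----> (_))" [60, 60] 60)
abbreviation (input) bm :: "'a measure => ('a => 'b::topological_space) set" where
  "bm == borel_measurable"

section \<open>Distance of extended non-negative reals\<close>

text \<open>Subtraction of extended non-negative reals is truncated at 0; the maximum is the distance.\<close>

definition ediff :: "ennreal => ennreal => ennreal" where
 "ediff a b = max (a - b) (b - a)"

lemma ediff_commute: "ediff a b = ediff b a"
 by (simp add: ediff_def max.commute)

lemma le_add_ediff: "a <= b + ediff a b"
proof (cases "b = top")
 case False
 have "a - b <= ediff a b" by (simp add: ediff_def)
 then show ?thesis using False by (simp add: ennreal_minus_le_iff add.commute)
qed simp

lemma le_add_ediff': "b <= a + ediff a b"
 using le_add_ediff[of b a] by (simp add: ediff_commute)

lemma ediff_leI: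
 assumes "a <= b + e" "b <= a + e" "a ~= top \<or> b ~= top"
 shows "ediff a b <= e"
 using assms by (auto simp: ediff_def ennreal_minus_le_iff)

lemma ediff_top [simp]: "ediff top b = top" "ediff b top = top"
 by (simp_all add: ediff_def max_def top_unique)

lemma ediff_triangle: "ediff a c <= ediff a b + ediff b c"
proof (cases "a = top \<or> c = top")
 case True
 then show ?thesis by auto
next
 case False
 have "a <= b + ediff a b" by (rule le_add_ediff)
 also have "b + ediff a b <= (c + ediff b c) + ediff a b" by (intro add_right_mono le_add_ediff)
 finally have 1: "a <= c + (ediff a b + ediff b c)" by (simp only: ac_simps)
 have "c <= b + ediff b c" by (rule le_add_ediff')
 also have "b + ediff b c <= (a + ediff a b) + ediff b c" by (intro add_right_mono le_add_ediff')
 finally have 2: "c <= a + (ediff a b + ediff b c)" by (simp only: ac_simps)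
 show ?thesis by (rule ediff_leI[OF 1 2]) (use False in blast)
qed

lemma ediff_add_le: "ediff (a + a') (b + b') <= ediff a b + ediff a' b'"
proof (cases "a + a' = top & b + b' = top")
 case True
 then show ?thesis by auto
next
 case False
 have "a + a' <= (b + ediff a b) + (b' + ediff a' b')" "b + b' <= (a + ediff a b) + (a' + ediff a' b')"
  by (intro add_mono le_add_ediff le_add_ediff')+
 then show ?thesis using False by (intro ediff_leI) (auto simp: ac_simps)
qed

lemma ediff_zero [simp]: "ediff a 0 = a" "ediff 0 a = a"
 by (simp_all add: ediff_def)

lemma borel_measurable_ediff [measurable]:
 assumes [measurable]: "f \<in> bm M" "g \<in> bm M"
 shows "(%x. ediff (f x) (g x)) \<in> bm M"
 unfolding ediff_def by measurable

lemma ediff_finite: "a ~= top ==> b ~= top ==> ediff a b = ennreal \<bar>enn2real a - enn2real b\<bar>"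
 by (cases a; cases b) (auto simp: ediff_def ennreal_minus max_def ennreal_le_iff2 abs_if)

lemma nn_integral_ediff_le:
 assumes [measurable]: "f \<in> bm M" "g \<in> bm M"
 assumes fin: "(\<integral>\<^sup>+x. f x \<partial>M) ~= top \<or> (\<integral>\<^sup>+x. g x \<partial>M) ~= top"
 shows "ediff (\<integral>\<^sup>+x. f x \<partial>M) (\<integral>\<^sup>+x. g x \<partial>M) <= (\<integral>\<^sup>+x. ediff (f x) (g x) \<partial>M)"
proof (rule ediff_leI[OF _ _ fin])
 show "(\<integral>\<^sup>+x. f x \<partial>M) <= (\<integral>\<^sup>+x. g x \<partial>M) + (\<integral>\<^sup>+x. ediff (f x) (g x) \<partial>M)"
  by (subst nn_integral_add[symmetric]) (auto intro!: nn_integral_mono le_add_ediff)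
 show "(\<integral>\<^sup>+x. g x \<partial>M) <= (\<integral>\<^sup>+x. f x \<partial>M) + (\<integral>\<^sup>+x. ediff (f x) (g x) \<partial>M)"
  by (subst nn_integral_add[symmetric]) (auto intro!: nn_integral_mono le_add_ediff')
qed

section \<open>Integrals over time intervals\<close>

lemma nn_integral_interval_split:
 fixes f :: "real => ennreal"
 assumes [measurable]: "f \<in> bm borel" and "a <= b" "b <= c"
 shows "(\<integral>\<^sup>+q\<in>{a..c}. f q \<partial>lborel) = (\<integral>\<^sup>+q\<in>{a..b}. f q \<partial>lborel) + (\<integral>\<^sup>+q\<in>{b..c}. f q \<partial>lborel)"
proof -
 have "(\<integral>\<^sup>+q\<in>{a..c}. f q \<partial>lborel) = (\<integral>\<^sup>+q. f q * indicator {a..b} q + f q * indicator {b..c} q \<partial>lborel)"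
 proof (rule nn_integral_cong_AE)
  show "AE q in lborel. f q * indicator {a..c} q = f q * indicator {a..b} q + f q * indicator {b..c} q"
   using AE_lborel_singleton[of b]
   by eventually_elim (use assms in \<open>auto split: split_indicator\<close>)
 qed
 also have "... = (\<integral>\<^sup>+q\<in>{a..b}. f q \<partial>lborel) + (\<integral>\<^sup>+q\<in>{b..c}. f q \<partial>lborel)"
  by (rule nn_integral_add) auto
 finally show ?thesis .
qed

lemma nn_integral_interval_shift:
 fixes f :: "real => ennreal"
 assumes [measurable]: "f \<in> bm borel"
 shows "(\<integral>\<^sup>+q\<in>{a+c..b+c}. f q \<partial>lborel) = (\<integral>\<^sup>+q\<in>{a..b}. f (q + c) \<partial>lborel)"
proof -
 have "(\<integral>\<^sup>+q\<in>{a+c..b+c}. f q \<partial>lborel) = (\<integral>\<^sup>+q. f (c + 1 * q) * indicator {a+c..b+c} (c + 1 * q) \<partial>lborel)"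
  by (subst nn_integral_real_affine[where c=1 and t=c]) auto
 also have "... = (\<integral>\<^sup>+q\<in>{a..b}. f (q + c) \<partial>lborel)"
  by (intro nn_integral_cong) (auto split: split_indicator simp: add.commute)
 finally show ?thesis .
qed

lemma nn_integral_half_line_shift:
 fixes f :: "real => ennreal"
 assumes [measurable]: "f \<in> bm borel"
 shows "(\<integral>\<^sup>+q\<in>{c..}. f q \<partial>lborel) = (\<integral>\<^sup>+q\<in>{0..}. f (q + c) \<partial>lborel)"
proof -
 have "(\<integral>\<^sup>+q\<in>{c..}. f q \<partial>lborel) = (\<integral>\<^sup>+q. f (c + 1 * q) * indicator {c..} (c + 1 * q) \<partial>lborel)"
  by (subst nn_integral_real_affine[where c=1 and t=c]) auto
 also have "... = (\<integral>\<^sup>+q\<in>{0..}. f (q + c) \<partial>lborel)"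
  by (intro nn_integral_cong) (auto split: split_indicator simp: add.commute)
 finally show ?thesis .
qed

text \<open>Tonelli on the triangle \<open>0 <= p <= q <= h\<close>, with the time elapsed since \<open>p\<close> as new inner variable.\<close>

lemma nn_integral_triangle_swap:
 fixes f :: "real => real => ennreal"
 assumes [measurable]: "(%(q, p). f q p) \<in> bm (borel \<otimes> borel)"
 shows "(\<integral>\<^sup>+q\<in>{0..h}. (\<integral>\<^sup>+p\<in>{0..q}. f q p \<partial>lborel) \<partial>lborel)
    = (\<integral>\<^sup>+p\<in>{0..h}. (\<integral>\<^sup>+r\<in>{0..h - p}. f (p + r) p \<partial>lborel) \<partial>lborel)"
proof -
 let ?I = "indicator {(q, p). 0 <= p & p <= q & q <= h} :: real \<times> real => ennreal"
 have [measurable]: "(%p. f q p) \<in> bm borel" "(%q. f q p) \<in> bm borel" for q p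
  by measurable
 have [measurable]: "?I \<in> bm (borel \<otimes> borel)"
 proof (rule borel_measurable_indicator)
  have "{w \<in> space (borel \<otimes> borel). 0 <= snd w & snd w <= fst w & fst w <= h} \<in> sets (borel \<otimes> borel)"
   by measurable
  then show "{(q, p). 0 <= p & p <= q & q <= h} \<in> sets (borel \<otimes> borel)"
   by (simp add: space_pair_measure case_prod_beta')
 qed
 have "(\<integral>\<^sup>+q\<in>{0..h}. (\<integral>\<^sup>+p\<in>{0..q}. f q p \<partial>lborel) \<partial>lborel)
   = (\<integral>\<^sup>+q. (\<integral>\<^sup>+p. f q p * ?I (q, p) \<partial>lborel) \<partial>lborel)"
 proof (rule nn_integral_cong)
  fix q
  have "(\<integral>\<^sup>+p. f q p * ?I (q, p) \<partial>lborel) = (\<integral>\<^sup>+p. f q p * indicator {0..q} p * indicator {0..h} q \<partial>lborel)"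
   by (rule nn_integral_cong) (simp split: split_indicator)
  then show "(\<integral>\<^sup>+p\<in>{0..q}. f q p \<partial>lborel) * indicator {0..h} q = (\<integral>\<^sup>+p. f q p * ?I (q, p) \<partial>lborel)"
   by (simp add: nn_integral_multc)
 qed
 also have "... = (\<integral>\<^sup>+p. (\<integral>\<^sup>+q. f q p * ?I (q, p) \<partial>lborel) \<partial>lborel)"
  by (rule lborel_pair.Fubini') simp
 also have "... = (\<integral>\<^sup>+p. (\<integral>\<^sup>+q\<in>{p..h}. f q p \<partial>lborel) * indicator {0..h} p \<partial>lborel)"
 proof (rule nn_integral_cong)
  fix p
  have "(\<integral>\<^sup>+q. f q p * ?I (q, p) \<partial>lborel) = (\<integral>\<^sup>+q. f q p * indicator {p..h} q * indicator {0..h} p \<partial>lborel)"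
   by (rule nn_integral_cong) (simp split: split_indicator)
  then show "(\<integral>\<^sup>+q. f q p * ?I (q, p) \<partial>lborel) = (\<integral>\<^sup>+q\<in>{p..h}. f q p \<partial>lborel) * indicator {0..h} p"
   by (simp add: nn_integral_multc)
 qed
 also have "... = (\<integral>\<^sup>+p\<in>{0..h}. (\<integral>\<^sup>+r\<in>{0..h - p}. f (p + r) p \<partial>lborel) \<partial>lborel)"
 proof (rule nn_integral_cong)
  fix p
  have "(\<integral>\<^sup>+q\<in>{0+p..(h-p)+p}. f q p \<partial>lborel) = (\<integral>\<^sup>+r\<in>{0..h - p}. f (r + p) p \<partial>lborel)"
   by (rule nn_integral_interval_shift) measurable
  then show "(\<integral>\<^sup>+q\<in>{p..h}. f q p \<partial>lborel) * indicator {0..h} p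
    = (\<integral>\<^sup>+r\<in>{0..h - p}. f (p + r) p \<partial>lborel) * indicator {0..h} p"
   by (simp add: add.commute)
 qed
 finally show ?thesis .
qed

lemma indicator_interval_measurable [measurable (raw)]:
 fixes f g h :: "'p => real"
 assumes [measurable]: "f \<in> bm P" "g \<in> bm P" "h \<in> bm P"
 shows "(%p. indicator {f p..g p} (h p) :: ennreal) \<in> bm P"
proof -
 have "(%p. if f p <= h p & h p <= g p then 1 else 0 :: ennreal) \<in> bm P"
  by measurable
 then show ?thesis by (simp add: indicator_def)
qed

section \<open>Perturbed transport on the time-state space\<close>

text \<open>Damped transport with scattering: \<open>E t s x\<close> is the fraction that survives from time \<open>s\<close> to \<open>t\<close> when the
backward characteristic from \<open>x\<close> leads to \<open>\<theta> t s x\<close>, and \<open>k t x z\<close> weighs the state \<open>\<pi> x z\<close> before a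
collision. In the homogeneous problem \<open>\<theta>\<close> is trivial; in the inhomogeneous one \<open>\<pi>\<close> replaces the velocity
and keeps the position. Dissipativity is the integrated form of the bound of the scattering rate by the damping rate:
survivors and first collisions together have at most the initial mass.\<close>

locale transport =
 fixes M :: "'a measure" and K :: "'k measure"
  and E :: "real => real => 'a => ennreal"
  and \<theta> :: "real => real => 'a => 'a"
  and k :: "real => 'a => 'k => ennreal"
  and \<pi> :: "'a => 'k => 'a"
 assumes sigma_finite_M: "sigma_finite_measure M"
  and sigma_finite_K: "sigma_finite_measure K"
  and E_measurable: "(%(t, s, x). E t s x) \<in> bm (borel \<otimes> (borel \<otimes> M))"
  and \<theta>_measurable: "(%(t, s, x). \<theta> t s x) \<in> borel \<otimes> (borel \<otimes> M) \<rightarrow>\<^sub>M M"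
  and k_measurable: "(%(t, x, z). k t x z) \<in> bm (borel \<otimes> (M \<otimes> K))"
  and \<pi>_measurable: "(%(x, z). \<pi> x z) \<in> M \<otimes> K \<rightarrow>\<^sub>M M"
  and E_refl: "!!s x. 0 <= s ==> x \<in> space M ==> E s s x = 1"
  and \<theta>_refl: "!!s x. 0 <= s ==> x \<in> space M ==> \<theta> s s x = x"
  and E_comp: "!!r s t x. 0 <= r ==> r <= s ==> s <= t ==> x \<in> space M
         ==> E t r x = E t s x * E s r (\<theta> t s x)"
  and \<theta>_comp: "!!r s t x. 0 <= r ==> r <= s ==> s <= t ==> x \<in> space M ==> E t r x ~= 0
         ==> \<theta> t r x = \<theta> s r (\<theta> t s x)"
  and dissipative: "!!\<Phi> s t. \<Phi> \<in> bm M ==> 0 <= s ==> s <= t ==>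
     (\<integral>\<^sup>+x. E t s x * \<Phi> (\<theta> t s x) \<partial>M)
     + (\<integral>\<^sup>+r\<in>{s..t}. (\<integral>\<^sup>+x. (\<integral>\<^sup>+z. k r x z * (E r s (\<pi> x z) * \<Phi> (\<theta> r s (\<pi> x z))) \<partial>K) \<partial>M) \<partial>lborel)
     <= (\<integral>\<^sup>+x. \<Phi> x \<partial>M)"
begin

sublocale M: sigma_finite_measure M by (rule sigma_finite_M)
sublocale K: sigma_finite_measure K by (rule sigma_finite_K)
sublocale half_line: sigma_finite_measure half_line
 by (rule sigma_finite_measure_restrict_space) (auto intro: sigma_finite_lborel)

abbreviation Y :: "(real \<times> 'a) measure" where
 "Y \<equiv> half_line \<otimes> M"

sublocale Y: pair_sigma_finite half_line M ..

lemma space_Y: "space Y = {0..} \<times> space M"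
 by (simp add: space_pair_measure)

lemma measurable_into_Y:
 assumes "f \<in> bm P" "g \<in> P \<rightarrow>\<^sub>M M" "!!p. p \<in> space P ==> 0 <= f p"
 shows "(%p. (f p, g p)) \<in> P \<rightarrow>\<^sub>M Y"
 using assms by (intro measurable_Pair measurable_restrict_space2) auto

lemma measurable_from_Y:
 "fst \<in> bm Y" "snd \<in> Y \<rightarrow>\<^sub>M M"
proof -
 have "fst \<in> Y \<rightarrow>\<^sub>M half_line" by simp
 then show "fst \<in> bm Y"
  by (metis measurable_restrict_space2_iff measurable_lborel1)
qed simp

lemma measurable_family:
 assumes G: "(%(p, y). G p y) \<in> bm (P \<otimes> Y)" and g: "g \<in> P \<rightarrow>\<^sub>M Y"
 shows "(%p. G p (g p)) \<in> bm P"
 using measurable_compose[OF measurable_Pair[OF measurable_ident g] G] by simp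

text \<open>The evolution semigroup on functions of time and state, whose part at time \<open>s\<close> comes from time \<open>s - t\<close>.\<close>

definition S :: "real => (real \<times> 'a => ennreal) => real \<times> 'a => ennreal" where
 "S t G = (%(s, x). if t <= s then E s (s - t) x * G (s - t, \<theta> s (s - t) x) else 0)"

definition Bo :: "(real \<times> 'a => ennreal) => real \<times> 'a => ennreal" where
 "Bo G = (%(s, x). \<integral>\<^sup>+z. k s x z * G (s, \<pi> x z) \<partial>K)"

lemma \<theta>_space: "x \<in> space M ==> \<theta> t s x \<in> space M"
 using measurable_space[OF \<theta>_measurable, of "(t, s, x)"] by (simp add: space_pair_measure)

lemma \<pi>_space: "x \<in> space M ==> z \<in> space K ==> \<pi> x z \<in> space M"
 using measurable_space[OF \<pi>_measurable, of "(x, z)"] by (simp add: space_pair_measure)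

lemma S_measurable [measurable (raw)]:
 assumes G: "(%(p, y). G p y) \<in> bm (P \<otimes> Y)"
  and f[measurable]: "f \<in> bm P" and g: "g \<in> P \<rightarrow>\<^sub>M Y"
 shows "(%p. S (f p) (G p) (g p)) \<in> bm P"
proof -
 have s[measurable]: "(%p. fst (g p)) \<in> bm P"
  by (rule measurable_compose[OF g measurable_from_Y(1)])
 have x[measurable]: "(%p. snd (g p)) \<in> P \<rightarrow>\<^sub>M M"
  by (rule measurable_compose[OF g measurable_from_Y(2)])
 have tup: "(%p. (fst (g p), fst (g p) - f p, snd (g p))) \<in> P \<rightarrow>\<^sub>M borel \<otimes> (borel \<otimes> M)"
  by measurable
 have E[measurable]: "(%p. E (fst (g p)) (fst (g p) - f p) (snd (g p))) \<in> bm P"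
  using measurable_compose[OF tup E_measurable] by simp
 have \<theta>: "(%p. \<theta> (fst (g p)) (fst (g p) - f p) (snd (g p))) \<in> P \<rightarrow>\<^sub>M M"
  using measurable_compose[OF tup \<theta>_measurable] by simp
 have [measurable]: "(%p. G p (max 0 (fst (g p) - f p), \<theta> (fst (g p)) (fst (g p) - f p) (snd (g p)))) \<in> bm P"
  by (rule measurable_family[OF G measurable_into_Y[OF _ \<theta>]]) auto
 have "(%p. if f p <= fst (g p) then E (fst (g p)) (fst (g p) - f p) (snd (g p)) *
      G p (max 0 (fst (g p) - f p), \<theta> (fst (g p)) (fst (g p) - f p) (snd (g p))) else 0) \<in> bm P"
  by measurable
 also have "?this \<longleftrightarrow> ?thesis"
  by (intro measurable_cong) (auto simp: S_def split_beta)
 finally show ?thesis .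
qed

lemma Bo_measurable [measurable (raw)]:
 assumes G: "(%(p, y). G p y) \<in> bm (P \<otimes> Y)" and g: "g \<in> P \<rightarrow>\<^sub>M Y"
 shows "(%p. Bo (G p) (g p)) \<in> bm P"
proof -
 have s[measurable]: "(%p. fst (g p)) \<in> bm P"
  by (rule measurable_compose[OF g measurable_from_Y(1)])
 have x[measurable]: "(%p. snd (g p)) \<in> P \<rightarrow>\<^sub>M M"
  by (rule measurable_compose[OF g measurable_from_Y(2)])
 have tup: "(%w. (fst (g (fst w)), snd (g (fst w)), snd w)) \<in> P \<otimes> K \<rightarrow>\<^sub>M borel \<otimes> (M \<otimes> K)"
  by measurable
 have kk[measurable]: "(%w. k (fst (g (fst w))) (snd (g (fst w))) (snd w)) \<in> bm (P \<otimes> K)"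
  using measurable_compose[OF tup k_measurable] by simp
 have "(%w. (snd (g (fst w)), snd w)) \<in> P \<otimes> K \<rightarrow>\<^sub>M M \<otimes> K" by measurable
 from measurable_compose[OF this \<pi>_measurable]
 have \<pi>: "(%w. \<pi> (snd (g (fst w))) (snd w)) \<in> P \<otimes> K \<rightarrow>\<^sub>M M" by simp
 have pos: "0 <= fst (g p)" if "p \<in> space P" for p
  using measurable_space[OF g that] by (auto simp: space_pair_measure)
 have "(%w. (fst w, (fst (g (fst w)), \<pi> (snd (g (fst w))) (snd w)))) \<in> P \<otimes> K \<rightarrow>\<^sub>M P \<otimes> Y"
  by (intro measurable_Pair measurable_into_Y[OF _ \<pi>, unfolded] measurable_fst \<pi> measurable_restrict_space2)
    (auto simp: space_pair_measure pos intro: measurable_into_Y)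
 from measurable_compose[OF this G]
 have [measurable]: "(%w. G (fst w) (fst (g (fst w)), \<pi> (snd (g (fst w))) (snd w))) \<in> bm (P \<otimes> K)"
  by simp
 have "(%p. \<integral>\<^sup>+z. k (fst (g p)) (snd (g p)) z * G p (fst (g p), \<pi> (snd (g p)) z) \<partial>K) \<in> bm P"
  by (rule K.borel_measurable_nn_integral) (simp add: split_beta')
 then show ?thesis by (simp add: Bo_def split_beta)
qed

primrec T :: "nat => real => (real \<times> 'a => ennreal) => real \<times> 'a => ennreal" where
 "T 0 t G = S t G"
| "T (Suc n) t G = (%y. \<integral>\<^sup>+q\<in>{0..t}. S (t - q) (Bo (T n q G)) y \<partial>lborel)"

lemma T_measurable_aux:
 assumes G: "(%(p, y). G p y) \<in> bm (P \<otimes> Y)"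
 shows "(%(t, p, y). T n t (G p) y) \<in> bm (borel \<otimes> (P \<otimes> Y))"
proof (induction n)
 case 0
 have "(%w. (fst (snd (fst w)), snd w)) \<in> (borel \<otimes> (P \<otimes> Y)) \<otimes> Y \<rightarrow>\<^sub>M P \<otimes> Y" by measurable
 from measurable_compose[OF this G]
 have [measurable]: "(%(w, y). G (fst (snd w)) y) \<in> bm ((borel \<otimes> (P \<otimes> Y)) \<otimes> Y)"
  by (simp add: split_beta')
 have "(%w. S (fst w) (G (fst (snd w))) (snd (snd w))) \<in> bm (borel \<otimes> (P \<otimes> Y))"
  by measurable
 then show ?case by (simp add: split_beta')
next
 case (Suc n)
 let ?W = "borel \<otimes> (P \<otimes> Y) :: (real \<times> _) measure"
 let ?V = "(?W \<otimes> (lborel :: real measure))"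
 have "(%v. (snd (fst (fst v)), fst (snd (fst (fst (fst v)))), snd v)) \<in> ((?V \<otimes> Y) \<otimes> Y) \<rightarrow>\<^sub>M borel \<otimes> (P \<otimes> Y)"
  by measurable
 from measurable_compose[OF this Suc]
 have 1: "(%(v, y). T n (snd (fst v)) (G (fst (snd (fst (fst v))))) y) \<in> bm ((?V \<otimes> Y) \<otimes> Y)"
  by (simp add: split_beta')
 have 2: "(%(v, y). Bo (T n (snd v) (G (fst (snd (fst v))))) y) \<in> bm (?V \<otimes> Y)"
  using Bo_measurable[OF 1 measurable_snd] by (simp add: split_beta')
 have [measurable]: "(%v. S (fst (fst v) - snd v) (Bo (T n (snd v) (G (fst (snd (fst v)))))) (snd (snd (fst v)))) \<in> bm ?V"
  by (rule S_measurable[OF 2]) measurable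
 have "(%w. \<integral>\<^sup>+q. S (fst w - q) (Bo (T n q (G (fst (snd w))))) (snd (snd w)) * indicator {0..fst w} q \<partial>lborel) \<in> bm ?W"
  by (rule lborel.borel_measurable_nn_integral) (simp add: split_beta', measurable)
 then show ?case by (simp add: split_beta')
qed

lemma T_measurable [measurable (raw)]:
 assumes G: "(%(p, y). G p y) \<in> bm (P \<otimes> Y)"
  and f[measurable]: "f \<in> bm P" and g: "g \<in> P \<rightarrow>\<^sub>M Y"
 shows "(%p. T n (f p) (G p) (g p)) \<in> bm P"
proof -
 have "(%p. (f p, p, g p)) \<in> P \<rightarrow>\<^sub>M borel \<otimes> (P \<otimes> Y)" using g by measurable
 from measurable_compose[OF this T_measurable_aux[OF G]] show ?thesis by simp
qed

end

context transport begin

lemma measurable_reparam: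
 assumes G: "(%(p, y). G p y) \<in> bm (P \<otimes> Y)" and f: "f \<in> W \<rightarrow>\<^sub>M P"
 shows "(%(w, y). G (f w) y) \<in> bm (W \<otimes> Y)"
proof -
 have "(%v. (f (fst v), snd v)) \<in> W \<otimes> Y \<rightarrow>\<^sub>M P \<otimes> Y" using f by measurable
 from measurable_compose[OF this G] show ?thesis by (simp add: split_beta')
qed

lemma measurable_const_family:
 assumes "G \<in> bm Y"
 shows "(%(p, y). G y) \<in> bm (P \<otimes> Y)"
 using measurable_compose[OF measurable_snd assms] by (simp add: split_beta')

lemma measurable_section:
 assumes G: "(%(p, y). G p y) \<in> bm (P \<otimes> Y)"
 shows "y \<in> space Y ==> (%p. G p y) \<in> bm P"
  and "p \<in> space P ==> G p \<in> bm Y"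
 using measurable_family[OF G measurable_const] measurable_compose[OF measurable_Pair1' G] by auto

lemma S_family:
 assumes G: "(%(p, y). G p y) \<in> bm (P \<otimes> Y)" and [measurable]: "f \<in> bm P"
 shows "(%(p, y). S (f p) (G p) y) \<in> bm (P \<otimes> Y)"
 using S_measurable[OF measurable_reparam[OF G measurable_fst], of "%w. f (fst w)" Y snd]
 by (simp add: split_beta')

lemma Bo_family:
 assumes G: "(%(p, y). G p y) \<in> bm (P \<otimes> Y)"
 shows "(%(p, y). Bo (G p) y) \<in> bm (P \<otimes> Y)"
 using Bo_measurable[OF measurable_reparam[OF G measurable_fst] measurable_snd]
 by (simp add: split_beta')

lemma T_family:
 assumes G: "(%(p, y). G p y) \<in> bm (P \<otimes> Y)" and [measurable]: "f \<in> bm P"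
 shows "(%(p, y). T n (f p) (G p) y) \<in> bm (P \<otimes> Y)"
 using T_measurable[OF measurable_reparam[OF G measurable_fst], of "%w. f (fst w)" Y snd]
 by (simp add: split_beta')

lemma S_borel: "G \<in> bm Y ==> S t G \<in> bm Y"
 using measurable_section(2)[OF S_family[OF measurable_const_family[of G "count_space UNIV"]], of "%_. t" "()"] by simp

lemma Bo_borel: "G \<in> bm Y ==> Bo G \<in> bm Y"
 using measurable_section(2)[OF Bo_family[OF measurable_const_family[of G "count_space UNIV"]], of "()"] by simp

lemma T_borel: "G \<in> bm Y ==> T n t G \<in> bm Y"
 using measurable_section(2)[OF T_family[OF measurable_const_family[of G "count_space UNIV"]], of "%_. t" "()"] by simp

lemma S_cong:
 assumes "!!y. y \<in> space Y ==> G y = H y" "y \<in> space Y"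
 shows "S t G y = S t H y"
 using assms by (auto simp: S_def space_Y \<theta>_space split: prod.split)

lemma Bo_cong:
 assumes "!!y. y \<in> space Y ==> G y = H y" "y \<in> space Y"
 shows "Bo G y = Bo H y"
 using assms by (auto simp: Bo_def space_Y \<pi>_space split: prod.split intro!: nn_integral_cong)

lemma T_cong:
 assumes "!!y. y \<in> space Y ==> G y = H y" "y \<in> space Y"
 shows "T n t G y = T n t H y"
 using assms(2)
proof (induction n arbitrary: t y)
 case 0 then show ?case using S_cong[OF assms(1)] by simp
next
 case (Suc n)
 have "S (t - q) (Bo (T n q G)) y = S (t - q) (Bo (T n q H)) y" for q
  by (intro S_cong Bo_cong Suc)
 then show ?case by simp
qed

lemma S_nn_integral:
 assumes G: "(%(p, y). G p y) \<in> bm (P \<otimes> Y)" and y: "y \<in> space Y"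
 shows "S t (%y. \<integral>\<^sup>+p. G p y \<partial>P) y = (\<integral>\<^sup>+p. S t (G p) y \<partial>P)"
 using y
 by (auto simp: S_def space_Y \<theta>_space split: prod.split
    intro!: nn_integral_cmult[symmetric] measurable_section[OF G])

lemma Bo_nn_integral:
 assumes P: "sigma_finite_measure P"
  and G: "(%(p, y). G p y) \<in> bm (P \<otimes> Y)" and y: "y \<in> space Y"
 shows "Bo (%y. \<integral>\<^sup>+p. G p y \<partial>P) y = (\<integral>\<^sup>+p. Bo (G p) y \<partial>P)"
proof -
 interpret P: sigma_finite_measure P by (rule P)
 interpret PK: pair_sigma_finite K P ..
 obtain s x where yy: "y = (s, x)" "0 <= s" "x \<in> space M" using y by (auto simp: space_Y)
 have [measurable]: "(%z. \<pi> x z) \<in> K \<rightarrow>\<^sub>M M"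
  using measurable_compose[OF measurable_Pair1'[OF yy(3)] \<pi>_measurable] by simp
 have "(%z. (s, x, z)) \<in> K \<rightarrow>\<^sub>M borel \<otimes> (M \<otimes> K)" using yy by measurable
 from measurable_compose[OF this k_measurable] have [measurable]: "(%z. k s x z) \<in> bm K" by simp
 have "(%w. (snd w, (s, \<pi> x (fst w)))) \<in> K \<otimes> P \<rightarrow>\<^sub>M P \<otimes> Y"
  using yy by (intro measurable_Pair measurable_snd measurable_into_Y) auto
 from measurable_compose[OF this G]
 have Gm[measurable]: "(%w. G (snd w) (s, \<pi> x (fst w))) \<in> bm (K \<otimes> P)" by simp
 have "Bo (%y. \<integral>\<^sup>+p. G p y \<partial>P) y = (\<integral>\<^sup>+z. (\<integral>\<^sup>+p. k s x z * G p (s, \<pi> x z) \<partial>P) \<partial>K)"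
  unfolding Bo_def yy prod.case
  by (intro nn_integral_cong nn_integral_cmult[symmetric] measurable_section[OF G])
    (use yy in \<open>auto simp: space_Y \<pi>_space\<close>)
 also have "... = (\<integral>\<^sup>+p. (\<integral>\<^sup>+z. k s x z * G p (s, \<pi> x z) \<partial>K) \<partial>P)"
  by (rule PK.Fubini'[symmetric]) (simp add: split_beta')
 finally show ?thesis by (simp add: Bo_def yy)
qed

lemma T_nn_integral:
 assumes P: "sigma_finite_measure P"
  and G: "(%(p, y). G p y) \<in> bm (P \<otimes> Y)" and y: "y \<in> space Y"
 shows "T n t (%y. \<integral>\<^sup>+p. G p y \<partial>P) y = (\<integral>\<^sup>+p. T n t (G p) y \<partial>P)"
 using y
proof (induction n arbitrary: t y)
 case 0 then show ?case using S_nn_integral[OF G] by simp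
next
 case (Suc n)
 interpret P: sigma_finite_measure P by (rule P)
 interpret PL: pair_sigma_finite "lborel :: real measure" P ..
 have BT: "(%(p, y). Bo (T n q (G p)) y) \<in> bm (P \<otimes> Y)" for q
  by (intro Bo_family T_family G) simp
 have step: "S (t - q) (Bo (T n q (%y. \<integral>\<^sup>+p. G p y \<partial>P))) y = (\<integral>\<^sup>+p. S (t - q) (Bo (T n q (G p))) y \<partial>P)" for q
 proof -
  have "S (t - q) (Bo (T n q (%y. \<integral>\<^sup>+p. G p y \<partial>P))) y = S (t - q) (Bo (%y. \<integral>\<^sup>+p. T n q (G p) y \<partial>P)) y"
   by (intro S_cong Bo_cong Suc)
  also have "... = S (t - q) (%y. \<integral>\<^sup>+p. Bo (T n q (G p)) y \<partial>P) y"
   by (intro S_cong Bo_nn_integral P T_family G Suc) simp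
  also have "... = (\<integral>\<^sup>+p. S (t - q) (Bo (T n q (G p))) y \<partial>P)"
   by (intro S_nn_integral BT Suc)
  finally show ?thesis .
 qed
 have G2: "(%(w, y). G (snd w) y) \<in> bm ((lborel \<otimes> P) \<otimes> Y)"
  by (rule measurable_reparam[OF G]) simp
 have [measurable]: "(%w. S (t - fst w) (Bo (T n (fst w) (G (snd w)))) y) \<in> bm (lborel \<otimes> P)"
  by (intro S_measurable Bo_family T_family G2 measurable_const Suc) measurable
 have Sp: "(%p. S (t - q) (Bo (T n q (G p))) y) \<in> bm P" for q
  by (intro S_measurable BT measurable_const Suc) simp
 have "T (Suc n) t (%y. \<integral>\<^sup>+p. G p y \<partial>P) y
   = (\<integral>\<^sup>+q. (\<integral>\<^sup>+p. S (t - q) (Bo (T n q (G p))) y * indicator {0..t} q \<partial>P) \<partial>lborel)"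
  unfolding T.simps step by (intro nn_integral_cong nn_integral_multc[symmetric] Sp)
 also have "... = (\<integral>\<^sup>+p. (\<integral>\<^sup>+q. S (t - q) (Bo (T n q (G p))) y * indicator {0..t} q \<partial>lborel) \<partial>P)"
  by (rule PL.Fubini'[symmetric])
    (simp add: split_beta')
 finally show ?case by simp
qed

lemma set_nn_integral_restrict:
 assumes "(A :: real set) \<in> sets borel"
 shows "(\<integral>\<^sup>+q\<in>A. f q \<partial>lborel) = (\<integral>\<^sup>+q. f q \<partial>restrict_space lborel A)"
 using assms by (subst nn_integral_restrict_space) auto

lemma sigma_finite_restrict_lborel: "A \<in> sets borel ==> sigma_finite_measure (restrict_space (lborel :: real measure) A)"
 by (rule sigma_finite_measure_restrict_space) (auto intro: sigma_finite_lborel)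

lemma family_restrict:
 assumes "(%(q, y). G q y) \<in> bm (borel \<otimes> Y)"
 shows "(%(q, y). G q y) \<in> bm (restrict_space lborel A \<otimes> Y)"
 by (rule measurable_reparam[OF assms]) (auto intro!: measurable_restrict_space1)

lemma S_time_integral:
 fixes G :: "real => real \<times> 'a => ennreal"
 assumes A: "A \<in> sets borel" and G: "(%(q, y). G q y) \<in> bm (borel \<otimes> Y)" and y: "y \<in> space Y"
 shows "S t (%y. \<integral>\<^sup>+q\<in>A. G q y \<partial>lborel) y = (\<integral>\<^sup>+q\<in>A. S t (G q) y \<partial>lborel)"
 unfolding set_nn_integral_restrict[OF A] by (rule S_nn_integral[OF family_restrict[OF G] y])

lemma Bo_time_integral:
 fixes G :: "real => real \<times> 'a => ennreal"
 assumes A: "A \<in> sets borel" and G: "(%(q, y). G q y) \<in> bm (borel \<otimes> Y)" and y: "y \<in> space Y"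
 shows "Bo (%y. \<integral>\<^sup>+q\<in>A. G q y \<partial>lborel) y = (\<integral>\<^sup>+q\<in>A. Bo (G q) y \<partial>lborel)"
 unfolding set_nn_integral_restrict[OF A]
 by (rule Bo_nn_integral[OF sigma_finite_restrict_lborel[OF A] family_restrict[OF G] y])

lemma T_time_integral:
 fixes G :: "real => real \<times> 'a => ennreal"
 assumes A: "A \<in> sets borel" and G: "(%(q, y). G q y) \<in> bm (borel \<otimes> Y)" and y: "y \<in> space Y"
 shows "T n t (%y. \<integral>\<^sup>+q\<in>A. G q y \<partial>lborel) y = (\<integral>\<^sup>+q\<in>A. T n t (G q) y \<partial>lborel)"
 unfolding set_nn_integral_restrict[OF A]
 by (rule T_nn_integral[OF sigma_finite_restrict_lborel[OF A] family_restrict[OF G] y])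

lemma measurable_countable_family:
 fixes G :: "'i::countable => real \<times> 'a => ennreal"
 assumes "!!i. i \<in> I ==> G i \<in> bm Y"
 shows "(%(i, y). G i y) \<in> bm (count_space I \<otimes> Y)"
proof (rule measurable_pair_measure_countable1)
 show "countable I" by (rule countableI_type)
qed (use assms in auto)

lemma T_suminf:
 assumes G: "!!i. G i \<in> bm Y" and y: "y \<in> space Y"
 shows "T n t (%y. \<Sum>i. G i y) y = (\<Sum>i. T n t (G i) y)"
 using T_nn_integral[OF sigma_finite_measure_count_space measurable_countable_family y, of UNIV G n t] G
 by (simp add: nn_integral_count_space_nat)

lemma Bo_suminf:
 assumes G: "!!i. G i \<in> bm Y" and y: "y \<in> space Y"
 shows "Bo (%y. \<Sum>i. G i y) y = (\<Sum>i. Bo (G i) y)"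
 using Bo_nn_integral[OF sigma_finite_measure_count_space measurable_countable_family y, of UNIV G] G
 by (simp add: nn_integral_count_space_nat)

lemma T_sum:
 fixes G :: "nat => real \<times> 'a => ennreal"
 assumes G: "!!i. i \<in> I ==> G i \<in> bm Y" and I: "finite I" and y: "y \<in> space Y"
 shows "T n t (%y. \<Sum>i\<in>I. G i y) y = (\<Sum>i\<in>I. T n t (G i) y)"
 using T_nn_integral[OF sigma_finite_measure_count_space_finite[OF I] measurable_countable_family y, of G n t] G I
 by (simp add: nn_integral_count_space_finite)

lemma Bo_sum:
 fixes G :: "nat => real \<times> 'a => ennreal"
 assumes G: "!!i. i \<in> I ==> G i \<in> bm Y" and I: "finite I" and y: "y \<in> space Y"
 shows "Bo (%y. \<Sum>i\<in>I. G i y) y = (\<Sum>i\<in>I. Bo (G i) y)"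
 using Bo_nn_integral[OF sigma_finite_measure_count_space_finite[OF I] measurable_countable_family y, of G] G I
 by (simp add: nn_integral_count_space_finite)

lemma T_add:
 assumes G: "G \<in> bm Y" "H \<in> bm Y" and y: "y \<in> space Y"
 shows "T n t (%y. G y + H y) y = T n t G y + T n t H y"
proof -
 have "T n t (%y. \<Sum>i\<in>{0, 1::nat}. (if i = 0 then G else H) y) y = (\<Sum>i\<in>{0, 1::nat}. T n t (if i = 0 then G else H) y)"
  by (rule T_sum[OF _ _ y]) (use G in auto)
 then show ?thesis by simp
qed

lemma T_mono:
 assumes G: "G \<in> bm Y" "H \<in> bm Y" and y: "y \<in> space Y"
  and le: "!!y. y \<in> space Y ==> G y <= H y"
 shows "T n t G y <= T n t H y"
proof -
 have "T n t H y = T n t (%y. G y + (H y - G y)) y"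
  by (rule T_cong[OF _ y]) (simp add: le add_diff_inverse_ennreal)
 also have "... = T n t G y + T n t (%y. H y - G y) y"
  by (rule T_add) (use G y in auto)
 finally show ?thesis by simp
qed

subsection \<open>The Dyson--Phillips identities\<close>

lemma S_0: "y \<in> space Y ==> S 0 G y = G y"
 by (auto simp: S_def space_Y E_refl \<theta>_refl)

lemma S_S:
 assumes "y \<in> space Y" "0 <= t" "0 <= u"
 shows "S t (S u G) y = S (t + u) G y"
proof -
 obtain s x where y: "y = (s, x)" "0 <= s" "x \<in> space M" using assms(1) by (auto simp: space_Y)
 show ?thesis
 proof (cases "t + u <= s")
  case True
  have e: "s - t - u = s - (t + u)" by simp
  have "E s (s - (t + u)) x = E s (s - t) x * E (s - t) (s - (t + u)) (\<theta> s (s - t) x)"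
   by (rule E_comp) (use True y assms in auto)
  moreover have "E s (s - (t + u)) x ~= 0 ==> \<theta> s (s - (t + u)) x = \<theta> (s - t) (s - (t + u)) (\<theta> s (s - t) x)"
   by (rule \<theta>_comp) (use True y assms in auto)
  ultimately show ?thesis using True y assms
   by (cases "E s (s - (t + u)) x = 0") (auto simp: S_def e mult.assoc[symmetric])
 qed (use y assms in \<open>auto simp: S_def\<close>)
qed

text \<open>The recursion peels off the last free flight. By splitting at an arbitrary collision instead, the first \<open>m\<close> collisions
are separated from the last \<open>j\<close>; the proof moves one collision at a time across, by exchanging time integrals.\<close>

lemma T_split:
 assumes G: "G \<in> bm Y" and y: "y \<in> space Y"
 shows "T (Suc (j + m)) h G y = (\<integral>\<^sup>+q\<in>{0..h}. T j (h - q) (Bo (T m q G)) y \<partial>lborel)"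
 using y
proof (induction j arbitrary: h y)
 case 0 then show ?case by simp
next
 case (Suc j)
 have BT: "(%(p, y). Bo (T m p G) y) \<in> bm (borel \<otimes> Y)"
  by (intro Bo_family T_family measurable_const_family G) simp
 have TBT: "(%(p, y). T j (q - p) (Bo (T m p G)) y) \<in> bm (borel \<otimes> Y)" for q
  by (intro T_family BT) simp
 have BT2: "(%(w, y). Bo (T m (snd w) G) y) \<in> bm ((borel \<otimes> borel) \<otimes> Y)"
  by (intro Bo_family T_family measurable_const_family G) simp
 have m2: "(%w. S (h - fst w) (Bo (T j (fst w - snd w) (Bo (T m (snd w) G)))) y) \<in> bm (borel \<otimes> borel)"
  by (intro S_measurable Bo_family T_family BT2 measurable_const Suc) measurable
 have "T (Suc (Suc j + m)) h G y = (\<integral>\<^sup>+q\<in>{0..h}. S (h - q) (Bo (T (Suc (j + m)) q G)) y \<partial>lborel)"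
  by simp
 also have "... = (\<integral>\<^sup>+q\<in>{0..h}. (\<integral>\<^sup>+p\<in>{0..q}. S (h - q) (Bo (T j (q - p) (Bo (T m p G)))) y \<partial>lborel) \<partial>lborel)"
 proof (intro nn_integral_cong arg_cong2[where f="(*)"] refl)
  fix q :: real
  have "S (h - q) (Bo (T (Suc (j + m)) q G)) y = S (h - q) (Bo (%y. \<integral>\<^sup>+p\<in>{0..q}. T j (q - p) (Bo (T m p G)) y \<partial>lborel)) y"
   by (intro S_cong Bo_cong Suc)
  also have "... = S (h - q) (%y. \<integral>\<^sup>+p\<in>{0..q}. Bo (T j (q - p) (Bo (T m p G))) y \<partial>lborel) y"
   by (intro S_cong Bo_time_integral TBT Suc) simp
  also have "... = (\<integral>\<^sup>+p\<in>{0..q}. S (h - q) (Bo (T j (q - p) (Bo (T m p G)))) y \<partial>lborel)"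
   by (intro S_time_integral Bo_family TBT Suc) simp
  finally show "S (h - q) (Bo (T (Suc (j + m)) q G)) y = ..." .
 qed
 also have "... = (\<integral>\<^sup>+p\<in>{0..h}. (\<integral>\<^sup>+r\<in>{0..h - p}. S (h - (p + r)) (Bo (T j (p + r - p) (Bo (T m p G)))) y \<partial>lborel) \<partial>lborel)"
  by (rule nn_integral_triangle_swap) (use m2 in \<open>simp add: split_beta'\<close>)
 also have "... = (\<integral>\<^sup>+p\<in>{0..h}. T (Suc j) (h - p) (Bo (T m p G)) y \<partial>lborel)"
  by (simp add: algebra_simps)
 finally show ?case .
qed

text \<open>Every history with \<open>m\<close> collisions up to \<open>h + s\<close> is cut at time \<open>s\<close>: \<open>m - j\<close> collisions before and \<open>j\<close> after. By induction on
\<open>m\<close>, the integral over the time of a collision is split at \<open>s\<close>.\<close>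

lemma T_add_time:
 assumes G: "G \<in> bm Y" and y: "y \<in> space Y" and "0 <= h" "0 <= s"
 shows "T m (h + s) G y = (\<Sum>j\<le>m. T j h (T (m - j) s G) y)"
 using y \<open>0 <= h\<close>
proof (induction m arbitrary: h y)
 case 0 then show ?case using S_S \<open>0 <= s\<close> by simp
next
 case (Suc m)
 have BT: "(%(p, y). Bo (T m p G) y) \<in> bm (borel \<otimes> Y)"
  by (intro Bo_family T_family measurable_const_family G) simp
 have meas: "(%q. S (h + s - q) (Bo (T m q G)) y) \<in> bm borel"
  by (intro S_measurable BT measurable_const Suc) measurable
 have "T (Suc m) (h + s) G y = (\<integral>\<^sup>+q\<in>{0..h + s}. S (h + s - q) (Bo (T m q G)) y \<partial>lborel)"
  by simp
 also have "... = (\<integral>\<^sup>+q\<in>{0..s}. S (h + s - q) (Bo (T m q G)) y \<partial>lborel)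
         + (\<integral>\<^sup>+q\<in>{s..h + s}. S (h + s - q) (Bo (T m q G)) y \<partial>lborel)"
  by (rule nn_integral_interval_split[OF meas]) (use Suc \<open>0 <= s\<close> in auto)
 also have "(\<integral>\<^sup>+q\<in>{0..s}. S (h + s - q) (Bo (T m q G)) y \<partial>lborel) = S h (T (Suc m) s G) y"
 proof -
  have "S h (T (Suc m) s G) y = (\<integral>\<^sup>+q\<in>{0..s}. S h (S (s - q) (Bo (T m q G))) y \<partial>lborel)"
   unfolding T.simps by (intro S_time_integral S_family BT Suc) auto
  also have "... = (\<integral>\<^sup>+q\<in>{0..s}. S (h + s - q) (Bo (T m q G)) y \<partial>lborel)"
   by (intro nn_integral_cong) (auto split: split_indicator simp: S_S Suc add_diff_eq)
  finally show ?thesis by simp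
 qed
 also have "(\<integral>\<^sup>+q\<in>{s..h + s}. S (h + s - q) (Bo (T m q G)) y \<partial>lborel)
   = (\<integral>\<^sup>+q\<in>{0..h}. S (h - q) (Bo (T m (q + s) G)) y \<partial>lborel)"
  using nn_integral_interval_shift[OF meas, of 0 s h] by (simp add: algebra_simps)
 also have "... = (\<integral>\<^sup>+q\<in>{0..h}. (\<Sum>j\<le>m. S (h - q) (Bo (T j q (T (m - j) s G))) y) \<partial>lborel)"
 proof (intro nn_integral_cong)
  fix q :: real
  have "S (h - q) (Bo (T m (q + s) G)) y = (\<Sum>j\<le>m. S (h - q) (Bo (T j q (T (m - j) s G))) y)" if q: "0 <= q"
  proof -
   have "S (h - q) (Bo (T m (q + s) G)) y = S (h - q) (Bo (%y. \<Sum>j\<le>m. T j q (T (m - j) s G) y)) y"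
    by (intro S_cong Bo_cong Suc q)
   also have "... = S (h - q) (%y. \<Sum>j\<le>m. Bo (T j q (T (m - j) s G)) y) y"
    by (intro S_cong Bo_sum T_borel G Suc) auto
   also have "... = (\<Sum>j\<le>m. S (h - q) (Bo (T j q (T (m - j) s G))) y)"
    using T_sum[where n=0 and t="h - q" and I="{..m}" and G="%j. Bo (T j q (T (m - j) s G))", OF _ _ Suc(2)]
    by (simp add: Bo_borel T_borel G)
   finally show ?thesis .
  qed
  then show "S (h - q) (Bo (T m (q + s) G)) y * indicator {0..h} q
       = (\<Sum>j\<le>m. S (h - q) (Bo (T j q (T (m - j) s G))) y) * indicator {0..h} q"
   by (simp split: split_indicator)
 qed
 also have "... = (\<Sum>j\<le>m. T (Suc j) h (T (m - j) s G) y)"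
 proof -
  have [measurable]: "(%q. S (h - q) (Bo (T j q (T (m - j) s G))) y) \<in> bm borel" for j
   by (intro S_measurable Bo_family T_family measurable_const_family T_borel G measurable_const Suc) measurable
  show ?thesis
   by (subst sum_distrib_right, subst nn_integral_sum) auto
 qed
 finally have "T (Suc m) (h + s) G y = T 0 h (T (Suc m) s G) y + (\<Sum>j\<le>m. T (Suc j) h (T (m - j) s G) y)"
  by simp
 then show ?case by (simp only: sum.atMost_Suc_shift) simp
qed

end

text \<open>The Cauchy product, rearranged freely because all terms are non-negative.\<close>

lemma suminf_ennreal_Cauchy:
 fixes a :: "nat => nat => ennreal"
 shows "(\<Sum>m. \<Sum>j\<le>m. a j (m - j)) = (\<Sum>j. \<Sum>l. a j l)"
proof -
 let ?b = "%j m. if j <= m then a j (m - j) else 0"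
 interpret C: sigma_finite_measure "count_space UNIV :: nat measure"
  by (rule sigma_finite_measure_count_space)
 interpret CC: pair_sigma_finite "count_space UNIV :: nat measure" "count_space UNIV :: nat measure" ..
 have 1: "(\<Sum>l. a j l) = (\<Sum>m. ?b j m)" for j
  by (subst suminf_offset[where i=j]) auto
 have 2: "(\<Sum>j\<le>m. a j (m - j)) = (\<Sum>j. ?b j m)" for m
  by (subst suminf_finite[where N="{..m}"]) auto
 have "(\<Sum>m. \<Sum>j. ?b j m) = (\<Sum>j. \<Sum>m. ?b j m)"
  using CC.Fubini'[of ?b] by (simp add: nn_integral_count_space_nat pair_measure_countable split_beta')
 then show ?thesis by (simp add: 1 2)
qed

context transport begin

subsection \<open>Mass at a fixed time and total mass\<close>

definition mass :: "real => (real \<times> 'a => ennreal) => ennreal" where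
 "mass s G = (if 0 <= s then \<integral>\<^sup>+x. G (s, x) \<partial>M else 0)"

definition tmass :: "(real \<times> 'a => ennreal) => ennreal" where
 "tmass G = (\<integral>\<^sup>+y. G y \<partial>Y)"

lemma mass_measurable [measurable (raw)]:
 assumes G: "(%(p, y). G p y) \<in> bm (P \<otimes> Y)" and [measurable]: "f \<in> bm P"
 shows "(%p. mass (f p) (G p)) \<in> bm P"
proof -
 have "(%w. (fst w, (max 0 (f (fst w)), snd w))) \<in> P \<otimes> M \<rightarrow>\<^sub>M P \<otimes> Y"
  by (intro measurable_Pair measurable_fst measurable_into_Y) auto
 from measurable_compose[OF this G]
 have [measurable]: "(%p. \<integral>\<^sup>+x. G p (max 0 (f p), x) \<partial>M) \<in> bm P"
  by (intro M.borel_measurable_nn_integral) (simp add: split_beta')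
 have "(%p. if 0 <= f p then \<integral>\<^sup>+x. G p (max 0 (f p), x) \<partial>M else 0) \<in> bm P"
  by measurable
 also have "?this \<longleftrightarrow> ?thesis" by (intro measurable_cong) (simp add: mass_def)
 finally show ?thesis .
qed

lemma tmass_measurable [measurable (raw)]:
 assumes G: "(%(p, y). G p y) \<in> bm (P \<otimes> Y)"
 shows "(%p. tmass (G p)) \<in> bm P"
 unfolding tmass_def by (rule Y.P.borel_measurable_nn_integral[OF G])

lemma mass_cong: "(!!y. y \<in> space Y ==> G y = H y) ==> mass s G = mass s H"
 by (auto simp: mass_def space_Y intro!: nn_integral_cong)

lemma tmass_cong: "(!!y. y \<in> space Y ==> G y = H y) ==> tmass G = tmass H"
 unfolding tmass_def by (rule nn_integral_cong)

lemma tmass_mono: "(!!y. y \<in> space Y ==> G y <= H y) ==> tmass G <= tmass H"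
 unfolding tmass_def by (rule nn_integral_mono)

lemma tmass_add: "G \<in> bm Y ==> H \<in> bm Y ==> tmass (%y. G y + H y) = tmass G + tmass H"
 unfolding tmass_def by (rule nn_integral_add)

lemma section_borel: "G \<in> bm Y ==> 0 <= s ==> (%x. G (s, x)) \<in> bm M"
 by (rule measurable_compose[OF measurable_into_Y]) auto

lemma tmass_eq_mass:
 assumes G: "G \<in> bm Y"
 shows "tmass G = (\<integral>\<^sup>+s. mass s G \<partial>lborel)"
proof -
 have "tmass G = (\<integral>\<^sup>+s. (\<integral>\<^sup>+x. G (s, x) \<partial>M) \<partial>half_line)"
  unfolding tmass_def using M.nn_integral_fst[of "G" half_line] G by simp
 also have "... = (\<integral>\<^sup>+s\<in>{0..}. (\<integral>\<^sup>+x. G (s, x) \<partial>M) \<partial>lborel)"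
  by (rule nn_integral_restrict_space) auto
 also have "... = (\<integral>\<^sup>+s. mass s G \<partial>lborel)"
  by (intro nn_integral_cong) (auto simp: mass_def split: split_indicator)
 finally show ?thesis .
qed

lemma mass_time_integral:
 fixes G :: "real => real \<times> 'a => ennreal"
 assumes A[measurable]: "A \<in> sets borel" and G: "(%(q, y). G q y) \<in> bm (borel \<otimes> Y)"
 shows "mass s (%y. \<integral>\<^sup>+q\<in>A. G q y \<partial>lborel) = (\<integral>\<^sup>+q\<in>A. mass s (G q) \<partial>lborel)"
proof (cases "0 <= s")
 case True
 interpret LM: pair_sigma_finite "lborel :: real measure" M ..
 have "(%w. (fst w, (s, snd w))) \<in> lborel \<otimes> M \<rightarrow>\<^sub>M borel \<otimes> Y"
  using True by (intro measurable_Pair measurable_into_Y) auto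
 from measurable_compose[OF this G] have [measurable]: "(%w. G (fst w) (s, snd w)) \<in> bm (lborel \<otimes> M)"
  by simp
 have sec: "(%x. G q (s, x)) \<in> bm M" for q
  by (rule section_borel[OF measurable_section(2)[OF G] True]) simp
 have "mass s (%y. \<integral>\<^sup>+q\<in>A. G q y \<partial>lborel) = (\<integral>\<^sup>+q. (\<integral>\<^sup>+x. G q (s, x) * indicator A q \<partial>M) \<partial>lborel)"
  using True unfolding mass_def by (simp, intro LM.Fubini') (simp add: split_beta')
 then show ?thesis using True by (simp add: mass_def nn_integral_multc[OF sec])
qed (simp add: mass_def)

lemma tmass_nn_integral:
 assumes "sigma_finite_measure P" and G: "(%(p, y). G p y) \<in> bm (P \<otimes> Y)"
 shows "tmass (%y. \<integral>\<^sup>+p. G p y \<partial>P) = (\<integral>\<^sup>+p. tmass (G p) \<partial>P)"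
proof -
 interpret P: sigma_finite_measure P by fact
 interpret PY: pair_sigma_finite P Y ..
 show ?thesis unfolding tmass_def by (rule PY.Fubini') (rule G)
qed

lemma tmass_time_integral:
 fixes G :: "real => real \<times> 'a => ennreal"
 assumes A: "A \<in> sets borel" and G: "(%(q, y). G q y) \<in> bm (borel \<otimes> Y)"
 shows "tmass (%y. \<integral>\<^sup>+q\<in>A. G q y \<partial>lborel) = (\<integral>\<^sup>+q\<in>A. tmass (G q) \<partial>lborel)"
 unfolding set_nn_integral_restrict[OF A]
 by (rule tmass_nn_integral[OF sigma_finite_restrict_lborel[OF A] family_restrict[OF G]])

lemma tmass_suminf:
 assumes "!!i. G i \<in> bm Y"
 shows "tmass (%y. \<Sum>i. G i y) = (\<Sum>i. tmass (G i))"
 unfolding tmass_def using assms by (rule nn_integral_suminf)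

lemma tmass_sum:
 assumes "!!i. i \<in> I ==> G i \<in> bm Y"
 shows "tmass (%y. \<Sum>i\<in>I. G i y) = (\<Sum>i\<in>I. tmass (G i))"
 unfolding tmass_def using assms by (rule nn_integral_sum)

lemma T_before: "s < t ==> T n t G (s, x) = 0"
proof (induction n arbitrary: t x s)
 case 0 then show ?case by (simp add: S_def)
next
 case (Suc n)
 have "S (t - q) (Bo (T n q G)) (s, x) = 0" for q
  using Suc by (auto simp: S_def Bo_def)
 then show ?case by simp
qed

lemma Bo_T_before: "s < t ==> Bo (T n t G) (s, x) = 0"
 by (simp add: Bo_def T_before)

lemma tmass_delayed:
 assumes H: "H \<in> bm Y" and "0 <= t" and 0: "!!s x. s < t ==> H (s, x) = 0"
 shows "tmass H = (\<integral>\<^sup>+s\<in>{0..}. mass (s + t) H \<partial>lborel)"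
proof -
 have [measurable]: "(%s. mass s H) \<in> bm borel"
  by (rule mass_measurable[OF measurable_const_family[OF H]]) simp
 have "tmass H = (\<integral>\<^sup>+s\<in>{t..}. mass s H \<partial>lborel)"
  unfolding tmass_eq_mass[OF H]
  by (intro nn_integral_cong) (auto simp: mass_def 0 split: split_indicator)
 also have "... = (\<integral>\<^sup>+s\<in>{0..}. mass (s + t) H \<partial>lborel)"
  by (rule nn_integral_half_line_shift) simp
 finally show ?thesis .
qed

subsection \<open>Contraction estimates\<close>

lemma S_dissipative:
 assumes G: "G \<in> bm Y" and st: "0 <= s" "0 <= t"
 shows "mass (s + t) (S t G) + (\<integral>\<^sup>+r\<in>{0..t}. mass (s + r) (Bo (S r G)) \<partial>lborel) <= mass s G"
proof -
 let ?\<Phi> = "%x. G (s, x)"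
 let ?I = "%r. \<integral>\<^sup>+x. (\<integral>\<^sup>+z. k r x z * (E r s (\<pi> x z) * ?\<Phi> (\<theta> r s (\<pi> x z))) \<partial>K) \<partial>M"
 have [measurable]: "(%r. mass r (Bo (S (r - s) G))) \<in> bm borel"
  by (intro mass_measurable Bo_family S_family measurable_const_family G) measurable
 have eq: "mass r (Bo (S (r - s) G)) = ?I r" if "s <= r" for r
  using that st by (simp add: mass_def Bo_def S_def)
 have "(\<integral>\<^sup>+r\<in>{0..t}. mass (s + r) (Bo (S r G)) \<partial>lborel) = (\<integral>\<^sup>+r\<in>{s..s+t}. mass r (Bo (S (r - s) G)) \<partial>lborel)"
  using nn_integral_interval_shift[of "%r. mass r (Bo (S (r - s) G))" 0 s t] by (simp add: add.commute)
 also have "... = (\<integral>\<^sup>+r\<in>{s..s+t}. ?I r \<partial>lborel)"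
  by (intro nn_integral_cong) (auto simp: eq split: split_indicator)
 finally show ?thesis
  using dissipative[OF section_borel[OF G st(1)], of s "s + t"] st by (simp add: mass_def S_def)
qed

lemma Bo_T_family:
 assumes "G \<in> bm Y"
 shows "(%(q, y). Bo (T n q G) y) \<in> bm (borel \<otimes> Y)"
 by (intro Bo_family T_family measurable_const_family assms) simp

text \<open>Dissipativity is applied from the time \<open>s + q\<close> of the collision number \<open>n + 1\<close>: what enters there either survives or collides again. Integration over
\<open>q\<close> bounds the survivors and the next collisions by the present ones.\<close>

lemma fibre_step:
 assumes G: "G \<in> bm Y" and st: "0 <= s" "0 <= t"
 shows "mass (s + t) (T (Suc n) t G) + (\<integral>\<^sup>+r\<in>{0..t}. mass (s + r) (Bo (T (Suc n) r G)) \<partial>lborel)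
   <= (\<integral>\<^sup>+r\<in>{0..t}. mass (s + r) (Bo (T n r G)) \<partial>lborel)"
proof -
 let ?\<psi> = "%q. Bo (T n q G)"
 note BT = Bo_T_family[OF G, of n]
 have BT2: "(%(w, y). ?\<psi> (snd w) y) \<in> bm ((borel \<otimes> borel) \<otimes> Y)"
  by (rule measurable_reparam[OF BT]) simp
 have S\<psi>: "(%(q, y). S (r - q) (?\<psi> q) y) \<in> bm (borel \<otimes> Y)" for r
  by (intro S_family BT) simp
 have a: "mass (s + t) (T (Suc n) t G) = (\<integral>\<^sup>+q\<in>{0..t}. mass (s + q + (t - q)) (S (t - q) (?\<psi> q)) \<partial>lborel)"
  unfolding T.simps by (subst mass_time_integral[OF _ S\<psi>]) auto
 have "mass (s + r) (Bo (T (Suc n) r G)) = (\<integral>\<^sup>+q\<in>{0..r}. mass (s + r) (Bo (S (r - q) (?\<psi> q))) \<partial>lborel)" for r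
 proof -
  have "mass (s + r) (Bo (T (Suc n) r G)) = mass (s + r) (%y. \<integral>\<^sup>+q\<in>{0..r}. Bo (S (r - q) (?\<psi> q)) y \<partial>lborel)"
   unfolding T.simps by (intro mass_cong Bo_time_integral S\<psi>) auto
  then show ?thesis by (subst (asm) mass_time_integral[OF _ Bo_family[OF S\<psi>]]) auto
 qed
 then have "(\<integral>\<^sup>+r\<in>{0..t}. mass (s + r) (Bo (T (Suc n) r G)) \<partial>lborel)
   = (\<integral>\<^sup>+r\<in>{0..t}. (\<integral>\<^sup>+q\<in>{0..r}. mass (s + r) (Bo (S (r - q) (?\<psi> q))) \<partial>lborel) \<partial>lborel)"
  by simp
 also have "... = (\<integral>\<^sup>+q\<in>{0..t}. (\<integral>\<^sup>+r\<in>{0..t - q}. mass (s + (q + r)) (Bo (S (q + r - q) (?\<psi> q))) \<partial>lborel) \<partial>lborel)"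
 proof (rule nn_integral_triangle_swap)
  have "(%w. mass (s + fst w) (Bo (S (fst w - snd w) (?\<psi> (snd w))))) \<in> bm (borel \<otimes> borel)"
   by (intro mass_measurable Bo_family S_family BT2) measurable
  then show "(%(r, q). mass (s + r) (Bo (S (r - q) (?\<psi> q)))) \<in> bm (borel \<otimes> borel)"
   by (simp add: split_beta')
 qed
 finally have b: "(\<integral>\<^sup>+r\<in>{0..t}. mass (s + r) (Bo (T (Suc n) r G)) \<partial>lborel)
  = (\<integral>\<^sup>+q\<in>{0..t}. (\<integral>\<^sup>+r\<in>{0..t - q}. mass (s + q + r) (Bo (S r (?\<psi> q))) \<partial>lborel) \<partial>lborel)"
  by (simp add: add.assoc)
 have [measurable]: "(%q. mass (s + t) (S (t - q) (?\<psi> q))) \<in> bm borel"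
  by (intro mass_measurable S_family BT) measurable
 have "mass (s + t) (T (Suc n) t G) + (\<integral>\<^sup>+r\<in>{0..t}. mass (s + r) (Bo (T (Suc n) r G)) \<partial>lborel)
  = (\<integral>\<^sup>+q. mass (s + q + (t - q)) (S (t - q) (?\<psi> q)) * indicator {0..t} q
    + (\<integral>\<^sup>+r\<in>{0..t - q}. mass (s + q + r) (Bo (S r (?\<psi> q))) \<partial>lborel) * indicator {0..t} q \<partial>lborel)"
  unfolding a b
 proof (rule nn_integral_add[symmetric])
  have [measurable]: "(%w. mass (s + fst w + snd w) (Bo (S (snd w) (?\<psi> (fst w))))) \<in> bm (borel \<otimes> borel)"
   by (intro mass_measurable Bo_family S_family measurable_reparam[OF BT]) measurable
  have "(%q. \<integral>\<^sup>+r\<in>{0..t - q}. mass (s + q + r) (Bo (S r (?\<psi> q))) \<partial>lborel) \<in> bm borel"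
   by (rule lborel.borel_measurable_nn_integral) (simp add: split_beta')
  then show "(%q. (\<integral>\<^sup>+r\<in>{0..t - q}. mass (s + q + r) (Bo (S r (?\<psi> q))) \<partial>lborel) * indicator {0..t} q) \<in> bm lborel"
   by simp
 qed simp
 also have "... <= (\<integral>\<^sup>+q\<in>{0..t}. mass (s + q) (?\<psi> q) \<partial>lborel)"
 proof (intro nn_integral_mono)
  fix q :: real
  show "mass (s + q + (t - q)) (S (t - q) (?\<psi> q)) * indicator {0..t} q
    + (\<integral>\<^sup>+r\<in>{0..t - q}. mass (s + q + r) (Bo (S r (?\<psi> q))) \<partial>lborel) * indicator {0..t} q
    <= mass (s + q) (?\<psi> q) * indicator {0..t} q"
   using S_dissipative[OF measurable_section(2)[OF BT], of q "s + q" "t - q"] st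
   by (auto split: split_indicator)
 qed
 finally show ?thesis .
qed

text \<open>Sum of the estimates \<open>fibre_step\<close>: the collision terms telescope.\<close>

lemma fibre_contraction:
 assumes G: "G \<in> bm Y" and st: "0 <= s" "0 <= t"
 shows "(\<Sum>n\<le>N. mass (s + t) (T n t G)) + (\<integral>\<^sup>+r\<in>{0..t}. mass (s + r) (Bo (T N r G)) \<partial>lborel) <= mass s G"
proof (induction N)
 case 0 then show ?case using S_dissipative[OF G st] by simp
next
 case (Suc N)
 have "(\<Sum>n\<le>Suc N. mass (s + t) (T n t G)) + (\<integral>\<^sup>+r\<in>{0..t}. mass (s + r) (Bo (T (Suc N) r G)) \<partial>lborel)
   <= (\<Sum>n\<le>N. mass (s + t) (T n t G)) + (\<integral>\<^sup>+r\<in>{0..t}. mass (s + r) (Bo (T N r G)) \<partial>lborel)"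
  using fibre_step[OF G st, of N] by (simp add: add.assoc add_left_mono del: T.simps)
 then show ?case using Suc by (rule order_trans)
qed

definition gain :: "nat => real => (real \<times> 'a => ennreal) => ennreal" where
 "gain n t G = (\<integral>\<^sup>+r\<in>{0..t}. tmass (Bo (T n r G)) \<partial>lborel)"

lemma tmass_T_eq:
 assumes G: "G \<in> bm Y" and "0 <= t"
 shows "tmass (T n t G) = (\<integral>\<^sup>+s\<in>{0..}. mass (s + t) (T n t G) \<partial>lborel)"
 by (rule tmass_delayed[OF T_borel[OF G]]) (use assms in \<open>auto simp: T_before\<close>)

text \<open>In coordinates where \<open>s\<close> is the starting time, the mass created at time \<open>s + r\<close> comes from the single fibre \<open>s\<close>, so estimates can be integrated over \<open>s\<close>.\<close>

lemma gain_eq: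
 assumes G: "G \<in> bm Y"
 shows "gain n t G = (\<integral>\<^sup>+s\<in>{0..}. (\<integral>\<^sup>+r\<in>{0..t}. mass (s + r) (Bo (T n r G)) \<partial>lborel) \<partial>lborel)"
proof -
 have sec: "Bo (T n r G) \<in> bm Y" for r
  by (rule measurable_section(2)[OF Bo_T_family[OF G]]) simp
 have m[measurable]: "(%w. mass (snd w + fst w) (Bo (T n (fst w) G))) \<in> bm (borel \<otimes> borel)"
  by (intro mass_measurable measurable_reparam[OF Bo_T_family[OF G]]) measurable
 have [measurable]: "(%s. mass (s + r) (Bo (T n r G))) \<in> bm borel"
  "(%r. mass (s + r) (Bo (T n r G))) \<in> bm borel" for r s
  by (intro mass_measurable Bo_T_family[OF G] measurable_const_family sec; simp)+
 have "gain n t G = (\<integral>\<^sup>+r. (\<integral>\<^sup>+s. mass (s + r) (Bo (T n r G)) * indicator {0..} s * indicator {0..t} r \<partial>lborel) \<partial>lborel)"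
  unfolding gain_def
  by (intro nn_integral_cong)
    (auto simp: nn_integral_multc tmass_delayed[OF sec] Bo_T_before split: split_indicator)
 also have "... = (\<integral>\<^sup>+s. (\<integral>\<^sup>+r. mass (s + r) (Bo (T n r G)) * indicator {0..} s * indicator {0..t} r \<partial>lborel) \<partial>lborel)"
  by (rule lborel_pair.Fubini'[symmetric]) (simp add: split_beta')
 also have "... = (\<integral>\<^sup>+s\<in>{0..}. (\<integral>\<^sup>+r\<in>{0..t}. mass (s + r) (Bo (T n r G)) \<partial>lborel) \<partial>lborel)"
  by (intro nn_integral_cong) (auto split: split_indicator)
 finally show ?thesis .
qed

lemma fibre_gain_measurable:
 assumes G: "G \<in> bm Y"
 shows "(%s. \<integral>\<^sup>+r\<in>{0..t}. mass (s + r) (Bo (T n r G)) \<partial>lborel) \<in> bm borel"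
proof -
 have [measurable]: "(%w. mass (fst w + snd w) (Bo (T n (snd w) G))) \<in> bm (borel \<otimes> borel)"
  by (intro mass_measurable measurable_reparam[OF Bo_T_family[OF G]]) measurable
 show ?thesis by (rule lborel.borel_measurable_nn_integral) (simp add: split_beta')
qed

lemma fibre_T_measurable:
 assumes G: "G \<in> bm Y"
 shows "(%s. mass (s + t) (T n t G)) \<in> bm borel"
 by (intro mass_measurable measurable_const_family T_borel G) simp

lemma tmass_gain_0:
 assumes G: "G \<in> bm Y" and t: "0 <= t"
 shows "tmass (T 0 t G) + gain 0 t G <= tmass G"
proof -
 note [measurable] = fibre_gain_measurable[OF G] fibre_T_measurable[OF G]
 have "tmass (T 0 t G) + gain 0 t G = (\<integral>\<^sup>+s. mass (s + t) (T 0 t G) * indicator {0..} s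
   + (\<integral>\<^sup>+r\<in>{0..t}. mass (s + r) (Bo (T 0 r G)) \<partial>lborel) * indicator {0..} s \<partial>lborel)"
  unfolding tmass_T_eq[OF G t] gain_eq[OF G] by (rule nn_integral_add[symmetric]) measurable
 also have "... <= (\<integral>\<^sup>+s. mass s G \<partial>lborel)"
  using S_dissipative[OF G _ t] by (intro nn_integral_mono) (auto split: split_indicator)
 finally show ?thesis by (simp add: tmass_eq_mass[OF G])
qed

lemma tmass_gain_Suc:
 assumes G: "G \<in> bm Y" and t: "0 <= t"
 shows "tmass (T (Suc n) t G) + gain (Suc n) t G <= gain n t G"
proof -
 note [measurable] = fibre_gain_measurable[OF G] fibre_T_measurable[OF G]
 have "tmass (T (Suc n) t G) + gain (Suc n) t G = (\<integral>\<^sup>+s. mass (s + t) (T (Suc n) t G) * indicator {0..} s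
   + (\<integral>\<^sup>+r\<in>{0..t}. mass (s + r) (Bo (T (Suc n) r G)) \<partial>lborel) * indicator {0..} s \<partial>lborel)"
  unfolding tmass_T_eq[OF G t] gain_eq[OF G] by (rule nn_integral_add[symmetric]) measurable
 also have "... <= (\<integral>\<^sup>+s\<in>{0..}. (\<integral>\<^sup>+r\<in>{0..t}. mass (s + r) (Bo (T n r G)) \<partial>lborel) \<partial>lborel)"
  using fibre_step[OF G _ t, of _ n] by (intro nn_integral_mono) (auto split: split_indicator simp del: T.simps)
 finally show ?thesis by (simp only: gain_eq[OF G])
qed

lemma tmass_gain:
 assumes G: "G \<in> bm Y" and t: "0 <= t"
 shows "(\<Sum>n\<le>N. tmass (T n t G)) + gain N t G <= tmass G"
proof (induction N)
 case 0 then show ?case using tmass_gain_0[OF G t] by simp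
next
 case (Suc N)
 have "(\<Sum>n\<le>Suc N. tmass (T n t G)) + gain (Suc N) t G <= (\<Sum>n\<le>N. tmass (T n t G)) + gain N t G"
  using tmass_gain_Suc[OF G t, of N] by (simp add: add.assoc add_left_mono del: T.simps)
 then show ?case using Suc by (rule order_trans)
qed

lemma gain_le_tmass: "G \<in> bm Y ==> 0 <= t ==> gain n t G <= tmass G"
 by (rule order_trans[OF add_increasing[OF zero_le order_refl] tmass_gain])

lemma gain_decreasing: "G \<in> bm Y ==> 0 <= t ==> decseq (%n. gain n t G)"
 by (intro decseq_SucI order_trans[OF add_increasing[OF zero_le order_refl] tmass_gain_Suc])

lemma tmass_T_le: "G \<in> bm Y ==> 0 <= t ==> tmass (T n t G) <= tmass G"
proof -
 assume a: "G \<in> bm Y" "0 <= t"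
 have "tmass (T n t G) <= (\<Sum>n\<le>n. tmass (T n t G))"
  by (rule member_le_sum) auto
 also have "... <= tmass G" by (rule order_trans[OF add_increasing2[OF zero_le order_refl] tmass_gain[OF a]])
 finally show ?thesis .
qed

subsection \<open>The perturbed semigroup\<close>

definition TT :: "real => (real \<times> 'a => ennreal) => real \<times> 'a => ennreal" where
 "TT t G y = (\<Sum>n. T n t G y)"

lemma TT_measurable [measurable (raw)]:
 assumes G: "(%(p, y). G p y) \<in> bm (P \<otimes> Y)"
  and [measurable]: "f \<in> bm P" and g: "g \<in> P \<rightarrow>\<^sub>M Y"
 shows "(%p. TT (f p) (G p) (g p)) \<in> bm P"
 unfolding TT_def by (intro borel_measurable_suminf_order T_measurable[OF G _ g]) simp

lemma TT_family:
 assumes G: "(%(p, y). G p y) \<in> bm (P \<otimes> Y)" and [measurable]: "f \<in> bm P"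
 shows "(%(p, y). TT (f p) (G p) y) \<in> bm (P \<otimes> Y)"
 using TT_measurable[OF measurable_reparam[OF G measurable_fst], of "%w. f (fst w)" Y snd]
 by (simp add: split_beta')

lemma TT_borel: "G \<in> bm Y ==> TT t G \<in> bm Y"
 unfolding TT_def[abs_def] by (intro borel_measurable_suminf_order T_borel)

lemma TT_mono:
 "G \<in> bm Y ==> H \<in> bm Y ==> y \<in> space Y ==> (!!y. y \<in> space Y ==> G y <= H y)
  ==> TT t G y <= TT t H y"
 unfolding TT_def by (intro suminf_le T_mono) auto

lemma TT_add:
 "G \<in> bm Y ==> H \<in> bm Y ==> y \<in> space Y
  ==> TT t (%y. G y + H y) y = TT t G y + TT t H y"
 unfolding TT_def by (simp add: T_add suminf_add[symmetric])

lemma TT_time_integral: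
 fixes G :: "real => real \<times> 'a => ennreal"
 assumes A[measurable]: "A \<in> sets borel" and G: "(%(q, y). G q y) \<in> bm (borel \<otimes> Y)" and y: "y \<in> space Y"
 shows "TT t (%y. \<integral>\<^sup>+q\<in>A. G q y \<partial>lborel) y = (\<integral>\<^sup>+q\<in>A. TT t (G q) y \<partial>lborel)"
proof -
 have [measurable]: "(%q. T n t (G q) y) \<in> bm borel" for n
  by (rule T_measurable[OF G]) (use y in auto)
 have "TT t (%y. \<integral>\<^sup>+q\<in>A. G q y \<partial>lborel) y = (\<Sum>n. \<integral>\<^sup>+q\<in>A. T n t (G q) y \<partial>lborel)"
  unfolding TT_def by (simp add: T_time_integral[OF A G y])
 also have "... = (\<integral>\<^sup>+q. (\<Sum>n. T n t (G q) y * indicator A q) \<partial>lborel)"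
  by (rule nn_integral_suminf[symmetric]) simp
 finally show ?thesis by (simp add: TT_def ennreal_suminf_multc)
qed

text \<open>The semigroup law: the binomial-type law \<open>T_add_time\<close> is a Cauchy product of the Dyson--Phillips series.\<close>

lemma TT_TT:
 assumes G: "G \<in> bm Y" and y: "y \<in> space Y" and "0 <= h" "0 <= s"
 shows "TT h (TT s G) y = TT (h + s) G y"
proof -
 have "TT h (TT s G) y = (\<Sum>j. \<Sum>l. T j h (T l s G) y)"
  unfolding TT_def[abs_def] by (intro suminf_cong T_suminf T_borel G y)
 also have "... = (\<Sum>m. \<Sum>j\<le>m. T j h (T (m - j) s G) y)"
  by (rule suminf_ennreal_Cauchy[symmetric])
 also have "... = TT (h + s) G y"
  unfolding TT_def using T_add_time[OF G y assms(3,4)] by simp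
 finally show ?thesis .
qed

lemma tmass_TT: "G \<in> bm Y ==> tmass (TT t G) = (\<Sum>n. tmass (T n t G))"
 unfolding TT_def[abs_def] by (intro tmass_suminf T_borel)

lemma tmass_TT_le:
 assumes "G \<in> bm Y" "0 <= t"
 shows "tmass (TT t G) <= tmass G"
 unfolding tmass_TT[OF assms(1)]
proof (rule suminf_le_const)
 fix n
 have "(\<Sum>i<n. tmass (T i t G)) <= (\<Sum>i\<le>n. tmass (T i t G)) + gain n t G"
  by (intro add_increasing2 sum_mono2) auto
 also have "... <= tmass G" by (rule tmass_gain[OF assms])
 finally show "(\<Sum>i<n. tmass (T i t G)) <= tmass G" .
qed auto

lemma mass_TT_le:
 assumes G: "G \<in> bm Y" and st: "0 <= s" "0 <= t"
 shows "mass (s + t) (TT t G) <= mass s G"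
proof -
 have "mass (s + t) (TT t G) = (\<Sum>n. mass (s + t) (T n t G))"
  using st by (simp add: mass_def TT_def nn_integral_suminf section_borel[OF T_borel[OF G]])
 also have "... <= mass s G"
 proof (rule suminf_le_const)
  fix n
  have "(\<Sum>i<n. mass (s + t) (T i t G)) <= (\<Sum>i\<le>n. mass (s + t) (T i t G)) + (\<integral>\<^sup>+r\<in>{0..t}. mass (s + r) (Bo (T n r G)) \<partial>lborel)"
   by (intro add_increasing2 sum_mono2) auto
  also have "... <= mass s G" by (rule fibre_contraction[OF G st])
  finally show "(\<Sum>i<n. mass (s + t) (T i t G)) <= mass s G" .
 qed auto
 finally show ?thesis .
qed

end

section \<open>Limits as the time step tends to zero\<close>

text \<open>The intervals decrease to a point, which has measure zero; the integrals are finite, so they decrease to zero.\<close>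

lemma nn_integral_short_interval:
 fixes f :: "real => ennreal"
 assumes [measurable]: "f \<in> bm borel" and fin: "!!b. (\<integral>\<^sup>+q\<in>{a..b}. f q \<partial>lborel) ~= top"
 shows "((%h. \<integral>\<^sup>+q\<in>{a..a+h}. f q \<partial>lborel) \<longlongrightarrow> 0) (at_right 0)"
proof (rule order_tendstoI)
 fix e :: ennreal assume e: "0 < e"
 let ?F = "%h. \<integral>\<^sup>+q\<in>{a..a+h}. f q \<partial>lborel"
 let ?u = "%n q. f q * indicator {a..a + 1 / real (Suc n)} q"
 have "(%n. \<integral>\<^sup>+q. ?u n q \<partial>lborel) ----> (\<integral>\<^sup>+q. 0 \<partial>(lborel::real measure))"
 proof (rule nn_integral_dominated_convergence[where w="%q. f q * indicator {a..a+1} q"])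
  show "AE q in lborel. ?u n q <= f q * indicator {a..a+1} q" for n
  proof (rule AE_I2)
   have "1 / real (Suc n) <= 1" by simp
   then have le: "q <= a + 1" if "q <= a + 1 / real (Suc n)" for q using that by linarith
   then show "?u n q <= f q * indicator {a..a+1} q" for q
    using le[of q] by (auto split: split_indicator simp del: of_nat_Suc)
  qed
  show "AE q in lborel. (%n. ?u n q) ----> 0"
   using AE_lborel_singleton[of a]
  proof eventually_elim
   fix q assume "q ~= a"
   have "\<forall>\<^sub>F n in sequentially. ?u n q = 0"
   proof (cases "q < a")
    case False
    then obtain n where n: "1 / real (Suc n) < q - a"
     using \<open>q ~= a\<close> reals_Archimedean[of "q - a"] by (auto simp: inverse_eq_divide)
    show ?thesis
    proof (rule eventually_sequentiallyI[of n])
     fix m assume "n <= m"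
     then have "1 / real (Suc m) <= 1 / real (Suc n)" by (simp add: frac_le)
     then show "?u m q = 0" using n by (simp split: split_indicator)
    qed
   qed (auto split: split_indicator)
   then show "(%n. ?u n q) ----> 0" by (rule tendsto_eventually)
  qed
  show "(\<integral>\<^sup>+q. f q * indicator {a..a+1} q \<partial>lborel) < \<infinity>"
   using fin[of "a+1"] by (simp add: less_top)
 qed auto
 then have "\<forall>\<^sub>F n in sequentially. ?F (1 / real (Suc n)) < e"
  using e by (auto dest: order_tendstoD(2))
 then obtain n where n: "?F (1 / real (Suc n)) < e" by (auto simp: eventually_sequentially)
 show "\<forall>\<^sub>F h in at_right 0. ?F h < e"
  unfolding eventually_at_right_field
 proof (intro exI[of _ "1 / real (Suc n)"] conjI allI impI)
  fix h :: real assume "0 < h" "h < 1 / real (Suc n)"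
  then have "?F h <= ?F (1 / real (Suc n))"
   by (intro nn_integral_mono) (auto split: split_indicator)
  then show "?F h < e" using n by simp
 qed simp
qed simp

lemma SUP_initial_tendsto_0:
 fixes \<phi> :: "real => ennreal"
 assumes "(\<phi> \<longlongrightarrow> 0) (at_right 0)" and 0: "\<phi> 0 = 0"
 shows "((%h. SUP u\<in>{0..h}. \<phi> u) \<longlongrightarrow> 0) (at_right 0)"
proof (rule order_tendstoI)
 fix e :: ennreal assume "0 < e"
 then obtain e' where e': "0 < e'" "e' < e" using dense by blast
 then have "\<forall>\<^sub>F u in at_right 0. \<phi> u < e'" using assms(1) order_tendstoD(2) by blast
 then obtain d where d: "d > 0" "!!u. 0 < u ==> u < d ==> \<phi> u < e'"
  by (auto simp: eventually_at_right_field)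
 show "\<forall>\<^sub>F h in at_right 0. (SUP u\<in>{0..h}. \<phi> u) < e"
  unfolding eventually_at_right_field
 proof (intro exI[of _ d] conjI allI impI)
  fix h assume h: "0 < h" "h < d"
  have "(SUP u\<in>{0..h}. \<phi> u) <= e'"
  proof (rule SUP_least)
   fix u assume "u \<in> {0..h}"
   then show "\<phi> u <= e'" using d(2)[of u] h 0 by (cases "u = 0") auto
  qed
  then show "(SUP u\<in>{0..h}. \<phi> u) < e" using e' by simp
 qed (rule d)
qed simp

lemma tendsto_0_le_ennreal:
 fixes f g :: "real => ennreal"
 assumes "(g \<longlongrightarrow> 0) (at_right 0)" "!!h. 0 < h ==> f h <= g h"
 shows "(f \<longlongrightarrow> 0) (at_right 0)"
proof (rule tendsto_sandwich[OF _ _ tendsto_const assms(1)])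
 show "\<forall>\<^sub>F h in at_right 0. f h <= g h"
  using assms(2) by (auto simp: eventually_at_right_field intro: exI[of _ 1])
qed simp

context transport begin

text \<open>The distance in the space of integrable functions, for extended-valued representatives.\<close>

definition dist1 :: "(real \<times> 'a => ennreal) => (real \<times> 'a => ennreal) => ennreal" where
 "dist1 A B = tmass (%y. ediff (A y) (B y))"

lemma dist1_triangle:
 assumes [measurable]: "A \<in> bm Y" "B \<in> bm Y" "C \<in> bm Y"
 shows "dist1 A C <= dist1 A B + dist1 B C"
proof -
 have "dist1 A B + dist1 B C = tmass (%y. ediff (A y) (B y) + ediff (B y) (C y))"
  unfolding dist1_def by (rule tmass_add[symmetric]) auto
 then show ?thesis unfolding dist1_def by (simp add: tmass_mono ediff_triangle)
qed

lemma finite_AE: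
 assumes [measurable]: "G \<in> bm Y" and "tmass G ~= top"
 shows "AE y in Y. G y ~= top"
 using assms nn_integral_PInf_AE[of G Y] by (simp add: tmass_def)

lemma dist1_leI:
 assumes [measurable]: "A \<in> bm Y" "B \<in> bm Y" "e \<in> bm Y"
  and fin: "tmass A ~= top \<or> tmass B ~= top"
  and le: "!!y. y \<in> space Y ==> A y <= B y + e y" "!!y. y \<in> space Y ==> B y <= A y + e y"
 shows "dist1 A B <= tmass e"
proof -
 have "AE y in Y. A y ~= top \<or> B y ~= top"
  using fin finite_AE[OF assms(1)] finite_AE[OF assms(2)] by (elim disjE) auto
 then have "AE y in Y. ediff (A y) (B y) <= e y"
  using AE_space by eventually_elim (auto intro!: ediff_leI le)
 then show ?thesis unfolding dist1_def tmass_def by (rule nn_integral_mono_AE)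
qed

lemma dist1_refl: "tmass G ~= top ==> G \<in> bm Y ==> dist1 G G = 0"
 using dist1_leI[of G G "%_. 0"] by (simp add: tmass_def)

lemma dist1_add:
 assumes [measurable]: "A \<in> bm Y" "B \<in> bm Y" "C \<in> bm Y" "D \<in> bm Y"
 shows "dist1 (%y. A y + B y) (%y. C y + D y) <= dist1 A C + dist1 B D"
proof -
 have "dist1 A C + dist1 B D = tmass (%y. ediff (A y) (C y) + ediff (B y) (D y))"
  unfolding dist1_def by (rule tmass_add[symmetric]) auto
 then show ?thesis unfolding dist1_def by (simp add: tmass_mono ediff_add_le)
qed

lemma tmass_ediff_le:
 assumes "A \<in> bm Y" "B \<in> bm Y" "tmass A ~= top \<or> tmass B ~= top"
 shows "ediff (tmass A) (tmass B) <= dist1 A B"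
 using assms unfolding tmass_def dist1_def by (rule nn_integral_ediff_le)

text \<open>Without subtraction, contractivity follows from monotonicity: \<open>A <= B + \<bar>A - B\<bar>\<close> and its mirror image are
preserved by the positive additive operator \<open>TT t\<close>, which does not increase mass.\<close>

lemma dist1_TT:
 assumes A: "A \<in> bm Y" "tmass A ~= top" and B: "B \<in> bm Y" and t: "0 <= t"
 shows "dist1 (TT t A) (TT t B) <= dist1 A B"
proof -
 have [measurable]: "A \<in> bm Y" "B \<in> bm Y" by fact+
 have e: "(%y. ediff (A y) (B y)) \<in> bm Y" by measurable
 have "dist1 (TT t A) (TT t B) <= tmass (TT t (%y. ediff (A y) (B y)))"
 proof (rule dist1_leI)
  show "tmass (TT t A) ~= top \<or> tmass (TT t B) ~= top"
   using tmass_TT_le[OF A(1) t] A(2) by (auto simp: top_unique)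
  fix y assume y: "y \<in> space Y"
  show "TT t A y <= TT t B y + TT t (%y. ediff (A y) (B y)) y"
   unfolding TT_add[OF B e y, symmetric] by (intro TT_mono y) (auto simp: le_add_ediff)
  show "TT t B y <= TT t A y + TT t (%y. ediff (A y) (B y)) y"
   unfolding TT_add[OF A(1) e y, symmetric] by (intro TT_mono y) (auto simp: le_add_ediff')
 qed (intro TT_borel A B e)+
 also have "... <= dist1 A B" unfolding dist1_def by (rule tmass_TT_le[OF e t])
 finally show ?thesis .
qed

subsection \<open>Late collisions\<close>

text \<open>The part that enters its collision number \<open>n + 1\<close> between \<open>s\<close> and \<open>s + h\<close>, carried on by the perturbed flow up to time
\<open>s + h\<close>.\<close>

definition late :: "nat => real => real => (real \<times> 'a => ennreal) => real \<times> 'a => ennreal" where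
 "late n h s G y = (\<integral>\<^sup>+q\<in>{0..h}. TT (h - q) (Bo (T n (s + q) G)) y \<partial>lborel)"

lemma Bo_T_shift_family:
 assumes "G \<in> bm Y"
 shows "(%(q, y). Bo (T n (s + q) G) y) \<in> bm (borel \<otimes> Y)"
 by (intro Bo_family T_family measurable_const_family assms) simp

text \<open>The same histories, cut at time \<open>s\<close>: at most \<open>n\<close> collisions before \<open>s\<close>, and more than \<open>n\<close> in total.\<close>

lemma late_eq:
 assumes G: "G \<in> bm Y" and y: "y \<in> space Y" and s: "0 <= s"
 shows "late n h s G y = (\<Sum>i\<le>n. \<Sum>j. T (Suc (j + i)) h (T (n - i) s G) y)"
proof -
 have Ts: "T i s G \<in> bm Y" for i by (rule T_borel[OF G])
 have m[measurable]: "(%q. T j (h - q) (Bo (T i q (T l s G))) y) \<in> bm borel" for i j l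
  by (intro T_measurable Bo_T_family Ts measurable_const y) simp
 have pt: "TT (h - q) (Bo (T n (s + q) G)) y = (\<Sum>j. \<Sum>i\<le>n. T j (h - q) (Bo (T i q (T (n - i) s G))) y)"
  if q: "0 <= q" for q
 proof -
  have "T j (h - q) (Bo (T n (s + q) G)) y = T j (h - q) (%y. \<Sum>i\<le>n. Bo (T i q (T (n - i) s G)) y) y" for j
  proof (rule T_cong[OF _ y])
   fix y assume y: "y \<in> space Y"
   have "Bo (T n (s + q) G) y = Bo (%y. \<Sum>i\<le>n. T i q (T (n - i) s G) y) y"
    using T_add_time[OF G _ q s, of _ n] by (intro Bo_cong y) (simp add: add.commute)
   also have "... = (\<Sum>i\<le>n. Bo (T i q (T (n - i) s G)) y)"
    by (intro Bo_sum T_borel Ts y) simp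
   finally show "Bo (T n (s + q) G) y = ..." .
  qed
  also have "T j (h - q) (%y. \<Sum>i\<le>n. Bo (T i q (T (n - i) s G)) y) y
    = (\<Sum>i\<le>n. T j (h - q) (Bo (T i q (T (n - i) s G))) y)" for j
   by (intro T_sum Bo_borel T_borel Ts y) simp
  finally show ?thesis by (simp add: TT_def)
 qed
 have "late n h s G y = (\<integral>\<^sup>+q. (\<Sum>j. \<Sum>i\<le>n. T j (h - q) (Bo (T i q (T (n - i) s G))) y * indicator {0..h} q) \<partial>lborel)"
  unfolding late_def
  by (intro nn_integral_cong) (auto simp: pt sum_distrib_right[symmetric] split: split_indicator)
 also have "... = (\<Sum>j. \<Sum>i\<le>n. \<integral>\<^sup>+q\<in>{0..h}. T j (h - q) (Bo (T i q (T (n - i) s G))) y \<partial>lborel)"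
  by (subst nn_integral_suminf) (measurable, intro suminf_cong nn_integral_sum, measurable)
 also have "... = (\<Sum>j. \<Sum>i\<le>n. T (Suc (j + i)) h (T (n - i) s G) y)"
  by (simp only: T_split[OF Ts y])
 also have "... = (\<Sum>i\<le>n. \<Sum>j. T (Suc (j + i)) h (T (n - i) s G) y)"
  by (rule suminf_sum) simp
 finally show ?thesis .
qed

text \<open>Both sides count histories with at least \<open>n\<close> collisions by time \<open>h + s\<close>, of which at most \<open>n\<close> have occurred by time \<open>s\<close>. On the left they are split by whether
exactly \<open>n\<close> have occurred at time \<open>s\<close>, on the right by whether exactly \<open>n\<close> have occurred at time \<open>h + s\<close>. The identity replaces a
computation of the generator on its domain.\<close>

lemma TT_T_late:
 assumes G: "G \<in> bm Y" and y: "y \<in> space Y" and s: "0 <= s" and h: "0 <= h"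
 shows "TT h (T n s G) y + (case n of 0 => 0 | Suc m => late m h s G y)
    = T n (h + s) G y + late n h s G y"
proof -
 let ?a = "%i l. T i h (T l s G) y"
 have "T n (h + s) G y + late n h s G y = (\<Sum>i\<le>n. ?a i (n - i) + (\<Sum>j. ?a (Suc (j + i)) (n - i)))"
  unfolding T_add_time[OF G y h s] late_eq[OF G y s] by (simp only: sum.distrib)
 also have "... = (\<Sum>i\<le>n. \<Sum>j. ?a (j + i) (n - i))"
 proof (rule sum.cong[OF refl])
  fix i
  show "?a i (n - i) + (\<Sum>j. ?a (Suc (j + i)) (n - i)) = (\<Sum>j. ?a (j + i) (n - i))"
   by (subst (2) suminf_offset[where i=1]) (simp_all add: add.commute del: T.simps)
 qed
 also have "... = (\<Sum>j. ?a j n) + (case n of 0 => 0 | Suc m => \<Sum>i\<le>m. \<Sum>j. ?a (Suc (j + i)) (m - i))"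
 proof (cases n)
  case (Suc m)
  show ?thesis unfolding Suc by (subst sum.atMost_Suc_shift) (simp del: T.simps)
 qed simp
 also have "... = TT h (T n s G) y + (case n of 0 => 0 | Suc m => late m h s G y)"
  by (simp add: TT_def late_eq[OF G y s] del: T.simps split: nat.split)
 finally show ?thesis by simp
qed

lemma late_family:
 assumes G: "G \<in> bm Y"
 shows "(%(s, y). late n h s G y) \<in> bm (borel \<otimes> Y)"
proof -
 have "(%(v, y). Bo (T n (fst (fst v) + snd v) G) y) \<in> bm (((borel \<otimes> Y) \<otimes> borel) \<otimes> Y)"
  by (intro Bo_family T_family measurable_const_family G) measurable
 from TT_measurable[OF this, of "%v. h - snd v" "%v. snd (fst v)"]
 have [measurable]: "(%v. TT (h - snd v) (Bo (T n (fst (fst v) + snd v) G)) (snd (fst v))) \<in> bm ((borel \<otimes> Y) \<otimes> lborel)"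
  by (simp cong: measurable_cong_sets)
 have "(%w. \<integral>\<^sup>+q. TT (h - q) (Bo (T n (fst w + q) G)) (snd w) * indicator {0..h} q \<partial>lborel) \<in> bm (borel \<otimes> Y)"
  by (rule lborel.borel_measurable_nn_integral) (simp add: split_beta')
 then show ?thesis by (simp add: late_def split_beta')
qed

lemma late_borel: "G \<in> bm Y ==> late n h s G \<in> bm Y"
 using measurable_section(2)[OF late_family] by simp

lemma gain_measurable:
 assumes G: "G \<in> bm Y"
 shows "(%r. tmass (Bo (T n r G))) \<in> bm borel"
 by (rule tmass_measurable[OF Bo_T_family[OF G]])

lemma tmass_late:
 assumes G: "G \<in> bm Y"
 shows "tmass (late n h s G) <= (\<integral>\<^sup>+r\<in>{s..s+h}. tmass (Bo (T n r G)) \<partial>lborel)"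
proof -
 have "tmass (late n h s G) = (\<integral>\<^sup>+q\<in>{0..h}. tmass (TT (h - q) (Bo (T n (s + q) G))) \<partial>lborel)"
  unfolding late_def[abs_def] by (intro tmass_time_integral TT_family Bo_T_shift_family G) auto
 also have "... <= (\<integral>\<^sup>+q\<in>{0..h}. tmass (Bo (T n (s + q) G)) \<partial>lborel)"
  by (intro nn_integral_mono) (auto split: split_indicator intro!: tmass_TT_le Bo_borel T_borel G)
 also have "... = (\<integral>\<^sup>+r\<in>{s..s+h}. tmass (Bo (T n r G)) \<partial>lborel)"
  using nn_integral_interval_shift[OF gain_measurable[OF G, of n], of 0 s h] by (simp add: add.commute)
 finally show ?thesis .
qed

lemma gain_interval_finite:
 assumes G: "G \<in> bm Y" and fin: "tmass G ~= top" and "0 <= a"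
 shows "(\<integral>\<^sup>+r\<in>{a..b}. tmass (Bo (T n r G)) \<partial>lborel) ~= top"
proof (cases "b \<ge> 0")
 case True
 have "(\<integral>\<^sup>+r\<in>{a..b}. tmass (Bo (T n r G)) \<partial>lborel) <= gain n b G"
  unfolding gain_def using assms by (intro nn_integral_mono) (auto split: split_indicator)
 also have "... <= tmass G" by (rule gain_le_tmass[OF G True])
 finally show ?thesis using fin by (auto simp: top_unique)
next
 case False
 then have "(\<integral>\<^sup>+r\<in>{a..b}. tmass (Bo (T n r G)) \<partial>lborel) = (\<integral>\<^sup>+r. 0 \<partial>(lborel :: real measure))"
  using assms by (intro nn_integral_cong) (auto split: split_indicator)
 then show ?thesis by simp
qed

lemma T_zero_time: "y \<in> space Y ==> T n 0 G y = (if n = 0 then G y else 0)"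
proof (cases n)
 case (Suc m)
 have "(\<integral>\<^sup>+q\<in>{0..0}. S (0 - q) (Bo (T m q G)) y \<partial>lborel) = (\<integral>\<^sup>+q. 0 \<partial>(lborel :: real measure))"
 proof (rule nn_integral_cong_AE)
  show "AE q in lborel. S (0 - q) (Bo (T m q G)) y * indicator {0..0} q = 0"
   using AE_lborel_singleton[of "0::real"] by eventually_elim simp
 qed
 then show ?thesis using Suc by simp
qed (simp add: S_0)

lemma TT_zero_time: "y \<in> space Y ==> TT 0 G y = G y"
 unfolding TT_def by (subst suminf_finite[where N="{0}"]) (auto simp: T_zero_time simp del: T.simps)

definition average :: "real => (real => real \<times> 'a => ennreal) => real \<times> 'a => ennreal" where
 "average h A y = (\<integral>\<^sup>+q\<in>{0..h}. A q y \<partial>lborel) / ennreal h"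

lemma nn_integral_average_const:
 assumes "0 < h"
 shows "(\<integral>\<^sup>+q\<in>{0..h}. c \<partial>lborel) / ennreal h = c"
 using assms by (subst nn_integral_cmult_indicator) (auto simp: mult_divide_eq_ennreal)

text \<open>An average stays in every ball that contains all averaged functions.\<close>

lemma average_dist1:
 assumes A: "(%(q, y). A q y) \<in> bm (borel \<otimes> Y)" and B: "B \<in> bm Y"
  and fin: "tmass B ~= top" and h: "0 < h"
  and le: "!!q. 0 <= q ==> q <= h ==> dist1 (A q) B <= e"
 shows "dist1 (average h A) B <= e"
proof -
 have [measurable]: "B \<in> bm Y" "(%w. A (fst w) (snd w)) \<in> bm (borel \<otimes> Y)"
  using A B by (simp_all add: split_beta')
 have "(%w. (snd w, fst w)) \<in> Y \<otimes> lborel \<rightarrow>\<^sub>M borel \<otimes> Y" by measurable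
 from measurable_compose[OF this A]
 have [measurable]: "(%w. A (snd w) (fst w)) \<in> bm (Y \<otimes> lborel)" by simp
 have D: "(%(q, y). ediff (A q y) (B y)) \<in> bm (borel \<otimes> Y)"
  by (simp add: split_beta')
 let ?e = "%y. (\<integral>\<^sup>+q\<in>{0..h}. ediff (A q y) (B y) \<partial>lborel) / ennreal h"
 have avg: "average h A \<in> bm Y"
  unfolding average_def[abs_def]
  by (intro borel_measurable_divide_ennreal lborel.borel_measurable_nn_integral measurable_const)
    (simp_all add: split_beta')
 have em: "?e \<in> bm Y"
  by (intro borel_measurable_divide_ennreal lborel.borel_measurable_nn_integral measurable_const)
    (simp_all add: split_beta')
 have "dist1 (average h A) B <= tmass ?e"
 proof (rule dist1_leI[OF avg B em])
  show "tmass (average h A) ~= top \<or> tmass B ~= top" using fin by simp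
  fix y assume y: "y \<in> space Y"
  have Ay[measurable]: "(%q. A q y) \<in> bm borel" by (rule measurable_section(1)[OF A y])
  have "average h A y <= (\<integral>\<^sup>+q. B y * indicator {0..h} q + ediff (A q y) (B y) * indicator {0..h} q \<partial>lborel) / ennreal h"
   unfolding average_def
   by (intro divide_right_mono_ennreal nn_integral_mono) (auto split: split_indicator simp: le_add_ediff)
  also have "... = (\<integral>\<^sup>+q\<in>{0..h}. B y \<partial>lborel) / ennreal h + ?e y"
   by (subst nn_integral_add) (auto simp: add_divide_distrib_ennreal)
  finally show "average h A y <= B y + ?e y" by (simp only: nn_integral_average_const[OF h])
  have "B y = (\<integral>\<^sup>+q\<in>{0..h}. B y \<partial>lborel) / ennreal h" by (simp only: nn_integral_average_const[OF h])
  also have "... <= (\<integral>\<^sup>+q. A q y * indicator {0..h} q + ediff (A q y) (B y) * indicator {0..h} q \<partial>lborel) / ennreal h"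
   by (intro divide_right_mono_ennreal nn_integral_mono) (auto split: split_indicator simp: le_add_ediff')
  also have "... = average h A y + ?e y"
   unfolding average_def by (subst nn_integral_add) (auto simp: add_divide_distrib_ennreal)
  finally show "B y <= average h A y + ?e y" .
 qed
 also have "tmass ?e = (\<integral>\<^sup>+q\<in>{0..h}. dist1 (A q) B \<partial>lborel) / ennreal h"
 proof -
  have "(%y. \<integral>\<^sup>+q\<in>{0..h}. ediff (A q y) (B y) \<partial>lborel) \<in> bm Y"
   by (intro lborel.borel_measurable_nn_integral) (simp add: split_beta')
  then have "tmass ?e = tmass (%y. \<integral>\<^sup>+q\<in>{0..h}. ediff (A q y) (B y) \<partial>lborel) / ennreal h"
   unfolding tmass_def by (rule nn_integral_divide)
  then show ?thesis unfolding dist1_def by (subst (asm) tmass_time_integral[OF _ D]) auto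
 qed
 also have "... <= (\<integral>\<^sup>+q\<in>{0..h}. e \<partial>lborel) / ennreal h"
  using le by (intro divide_right_mono_ennreal nn_integral_mono) (auto split: split_indicator)
 also have "... = e" by (rule nn_integral_average_const[OF h])
 finally show ?thesis .
qed

end

lemma nn_integral_time_swap:
 fixes f :: "real => real => ennreal"
 assumes [measurable]: "(%(s, q). f s q) \<in> bm (borel \<otimes> borel)"
 shows "(\<integral>\<^sup>+s\<in>{a..b}. (\<integral>\<^sup>+q\<in>{c..d}. f s q \<partial>lborel) \<partial>lborel) = (\<integral>\<^sup>+q\<in>{c..d}. (\<integral>\<^sup>+s\<in>{a..b}. f s q \<partial>lborel) \<partial>lborel)"
proof -
 have [measurable]: "(%s. f s q) \<in> bm borel" "(%q. f s q) \<in> bm borel" for s q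
  by measurable
 have "(\<integral>\<^sup>+s\<in>{a..b}. (\<integral>\<^sup>+q\<in>{c..d}. f s q \<partial>lborel) \<partial>lborel)
   = (\<integral>\<^sup>+s. (\<integral>\<^sup>+q. f s q * indicator {c..d} q * indicator {a..b} s \<partial>lborel) \<partial>lborel)"
  by (intro nn_integral_cong nn_integral_multc[symmetric]) simp
 also have "... = (\<integral>\<^sup>+q. (\<integral>\<^sup>+s. f s q * indicator {c..d} q * indicator {a..b} s \<partial>lborel) \<partial>lborel)"
  by (rule lborel_pair.Fubini'[symmetric]) (simp add: split_beta')
 also have "... = (\<integral>\<^sup>+q. (\<integral>\<^sup>+s. f s q * indicator {a..b} s * indicator {c..d} q \<partial>lborel) \<partial>lborel)"
  by (simp only: mult.assoc mult.commute[of "indicator {c..d} _"])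
 also have "... = (\<integral>\<^sup>+q\<in>{c..d}. (\<integral>\<^sup>+s\<in>{a..b}. f s q \<partial>lborel) \<partial>lborel)"
  by (intro nn_integral_cong nn_integral_multc) simp
 finally show ?thesis .
qed

text \<open>Strong continuity at 0 of the unperturbed semigroup, the only continuity to be checked for a concrete model.\<close>

locale continuous_transport = transport +
 assumes S_continuous: "!!G. G \<in> bm Y ==> tmass G ~= top
      ==> ((%h. dist1 (S h G) G) \<longlongrightarrow> 0) (at_right 0)"
begin

text \<open>The part of \<open>TT h G\<close> with at least one collision has at most the mass that \<open>S h G\<close> has lost, by contractivity; this loss is bounded by the distance from \<open>S h G\<close> to \<open>G\<close>.\<close>

lemma TT_continuous:
 assumes G: "G \<in> bm Y" and fin: "tmass G ~= top"
 shows "((%h. dist1 (TT h G) G) \<longlongrightarrow> 0) (at_right 0)"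
proof (rule tendsto_0_le_ennreal)
 show "((%h. dist1 (S h G) G + dist1 (S h G) G) \<longlongrightarrow> 0) (at_right 0)"
  using tendsto_add[OF S_continuous[OF assms] S_continuous[OF assms]] by simp
 fix h :: real assume h: "0 < h"
 let ?Q = "%y. \<Sum>n. T (Suc n) h G y"
 have Sb: "S h G \<in> bm Y" by (rule S_borel[OF G])
 have Q: "?Q \<in> bm Y" by (intro borel_measurable_suminf_order T_borel G)
 have TTeq: "TT h G y = S h G y + ?Q y" for y
  unfolding TT_def by (subst suminf_offset[where i=1]) (simp_all add: add.commute)
 have sum: "tmass (S h G) + tmass ?Q <= tmass G"
 proof -
  have "tmass (S h G) + tmass ?Q = tmass (TT h G)"
   by (simp add: tmass_add[OF Sb Q, symmetric] TTeq[abs_def] del: T.simps)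
  then show ?thesis using tmass_TT_le[OF G, of h] h by simp
 qed
 have finS: "tmass (S h G) ~= top" using sum fin by (auto simp: top_unique)
 have "ediff (tmass (S h G)) (tmass G) <= dist1 (S h G) G"
  by (rule tmass_ediff_le[OF Sb G]) (use fin in simp)
 then have "tmass G <= tmass (S h G) + dist1 (S h G) G"
  using le_add_ediff'[of "tmass G" "tmass (S h G)"] by (meson add_left_mono order_trans)
 with sum have "tmass (S h G) + tmass ?Q <= tmass (S h G) + dist1 (S h G) G" by (rule order_trans)
 then have Qle: "tmass ?Q <= dist1 (S h G) G"
  using finS by (simp add: ennreal_add_left_cancel_le)
 have "dist1 (TT h G) G = dist1 (%y. S h G y + ?Q y) (%y. G y + 0)" by (simp add: TTeq[abs_def])
 also have "... <= dist1 (S h G) G + dist1 ?Q (%y. 0)"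
  by (rule dist1_add[OF Sb Q G]) simp
 also have "dist1 ?Q (%y. 0) = tmass ?Q" by (simp add: dist1_def)
 finally show "dist1 (TT h G) G <= dist1 (S h G) G + dist1 (S h G) G"
  using Qle by (meson add_left_mono order_trans)
qed

lemma gain_short:
 assumes G: "G \<in> bm Y" and fin: "tmass G ~= top" and t: "0 <= t"
 shows "((%h. \<integral>\<^sup>+r\<in>{t..t+h}. tmass (Bo (T n r G)) \<partial>lborel) \<longlongrightarrow> 0) (at_right 0)"
 by (intro nn_integral_short_interval gain_measurable gain_interval_finite assms)

text \<open>The identity \<open>TT_T_late\<close> compares \<open>T n (t + h) G\<close> with \<open>TT h (T n t G)\<close> up to two late parts, whose masses are bounded by what collisions produce between \<open>t\<close> and \<open>t + h\<close>.\<close>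

lemma T_right_continuous:
 assumes G: "G \<in> bm Y" and fin: "tmass G ~= top" and t: "0 <= t"
 shows "((%h. dist1 (T n (t + h) G) (T n t G)) \<longlongrightarrow> 0) (at_right 0)"
proof (rule tendsto_0_le_ennreal)
 let ?g = "T n t G"
 let ?l = "%m h. \<integral>\<^sup>+r\<in>{t..t+h}. tmass (Bo (T m r G)) \<partial>lborel"
 have g: "?g \<in> bm Y" "tmass ?g ~= top"
  using tmass_T_le[OF G t, of n] fin by (auto simp: top_unique intro: T_borel[OF G])
 show "((%h. dist1 (TT h ?g) ?g + (?l n h + ?l (n - 1) h)) \<longlongrightarrow> 0) (at_right 0)"
  using tendsto_add[OF TT_continuous[OF g] tendsto_add[OF gain_short[OF assms] gain_short[OF assms]]] by simp
 fix h :: real assume h: "0 < h"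
 have L: "late m h t G \<in> bm Y" for m by (rule late_borel[OF G])
 let ?r' = "%y. case n of 0 => 0 | Suc m => late m h t G y"
 let ?d = "%y. ediff (TT h ?g y) (?g y)"
 let ?e = "%y. ?d y + (late n h t G y + late (n - 1) h t G y)"
 have [measurable]: "?g \<in> bm Y" "TT h ?g \<in> bm Y" "late m h t G \<in> bm Y" for m
  by (intro g L TT_borel)+
 have "dist1 (T n (t + h) G) ?g <= tmass ?e"
 proof (rule dist1_leI)
  show "tmass (T n (t + h) G) ~= top \<or> tmass ?g ~= top" using g by simp
  fix y assume y: "y \<in> space Y"
  have id: "TT h ?g y + ?r' y = T n (t + h) G y + late n h t G y"
   using TT_T_late[OF G y t, of h n] h by (simp add: add.commute del: T.simps)
  have r': "?r' y <= late (n - 1) h t G y" by (cases n) auto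
  have "T n (t + h) G y <= TT h ?g y + ?r' y" unfolding id by simp
  also have "... <= (?g y + ?d y) + late (n - 1) h t G y" by (intro add_mono le_add_ediff r')
  also have "... <= ?g y + ?e y" by (simp add: add.assoc add_left_mono)
  finally show "T n (t + h) G y <= ?g y + ?e y" .
  have "?g y <= TT h ?g y + ?d y" by (rule le_add_ediff')
  also have "... <= (TT h ?g y + ?r' y) + ?d y" by (simp add: add_right_mono)
  also have "... <= T n (t + h) G y + ?e y" unfolding id by (simp add: ac_simps add_left_mono)
  finally show "?g y <= T n (t + h) G y + ?e y" .
 qed (rule T_borel[OF G], rule g(1), measurable)
 also have "tmass ?e = dist1 (TT h ?g) ?g + (tmass (late n h t G) + tmass (late (n - 1) h t G))"
  unfolding dist1_def by (simp add: tmass_add)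
 also have "... <= dist1 (TT h ?g) ?g + (?l n h + ?l (n - 1) h)"
  by (intro add_left_mono add_mono tmass_late G)
 finally show "dist1 (T n (t + h) G) ?g <= dist1 (TT h ?g) ?g + (?l n h + ?l (n - 1) h)" .
qed

text \<open>Elements of the domain of the generator: time integrals of the terms of the series.\<close>

definition accum :: "nat => real => (real \<times> 'a => ennreal) => real \<times> 'a => ennreal" where
 "accum n t G y = (\<integral>\<^sup>+s\<in>{0..t}. T n s G y \<partial>lborel)"

lemma T_G_family: "G \<in> bm Y ==> f \<in> bm P ==> (%(q, y). T n (f q) G y) \<in> bm (P \<otimes> Y)"
 by (intro T_family measurable_const_family)

lemma time_integral_borel:
 fixes G :: "real => real \<times> 'a => ennreal"
 assumes "(%(q, y). G q y) \<in> bm (borel \<otimes> Y)" and [measurable]: "A \<in> sets borel"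
 shows "(%y. \<integral>\<^sup>+q\<in>A. G q y \<partial>lborel) \<in> bm Y"
proof -
 have "(%w. (snd w, fst w)) \<in> Y \<otimes> lborel \<rightarrow>\<^sub>M borel \<otimes> Y" by measurable
 from measurable_compose[OF this assms(1)]
 have [measurable]: "(%w. G (snd w) (fst w)) \<in> bm (Y \<otimes> lborel)" by simp
 show ?thesis by (rule lborel.borel_measurable_nn_integral) (simp add: split_beta')
qed

lemma accum_borel: "G \<in> bm Y ==> accum n t G \<in> bm Y"
 unfolding accum_def[abs_def] by (intro time_integral_borel T_G_family) auto

lemma tmass_Bo_accum:
 assumes G: "G \<in> bm Y"
 shows "tmass (Bo (accum n t G)) = gain n t G"
proof -
 have "tmass (Bo (accum n t G)) = tmass (%y. \<integral>\<^sup>+s\<in>{0..t}. Bo (T n s G) y \<partial>lborel)"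
  unfolding accum_def[abs_def] by (intro tmass_cong Bo_time_integral T_G_family G) auto
 then show ?thesis unfolding gain_def by (subst (asm) tmass_time_integral[OF _ Bo_T_family[OF G]]) auto
qed

lemma T_average:
 assumes G: "G \<in> bm Y" and fin: "tmass G ~= top" and t: "0 <= t"
 shows "((%h. dist1 (average h (%q. T n (t + q) G)) (T n t G)) \<longlongrightarrow> 0) (at_right 0)"
proof (rule tendsto_0_le_ennreal)
 let ?g = "T n t G"
 have g: "?g \<in> bm Y" "tmass ?g ~= top"
  using tmass_T_le[OF G t, of n] fin by (auto simp: top_unique intro: T_borel[OF G])
 show "((%h. SUP u\<in>{0..h}. dist1 (T n (t + u) G) ?g) \<longlongrightarrow> 0) (at_right 0)"
  by (intro SUP_initial_tendsto_0 T_right_continuous assms) (simp add: dist1_refl g del: T.simps)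
 show "dist1 (average h (%q. T n (t + q) G)) ?g <= (SUP u\<in>{0..h}. dist1 (T n (t + u) G) ?g)" if "0 < h" for h
  by (intro average_dist1 T_G_family G g that) (auto intro!: SUP_upper)
qed

text \<open>Divided by \<open>h\<close>, the integral over \<open>s\<close> of \<open>late n h s G\<close> is an average over \<open>q\<close> in \<open>{0..h}\<close> of the functions obtained by applying \<open>TT (h - q)\<close> to the scattered
mass of \<open>T n\<close> over \<open>{q..t + q}\<close>. Each of these is close to \<open>Bo (accum n t G)\<close> for small \<open>h\<close>, uniformly in \<open>q\<close>.\<close>

lemma late_average:
 assumes G: "G \<in> bm Y" and fin: "tmass G ~= top" and t: "0 <= t"
 shows "((%h. dist1 (%y. (\<integral>\<^sup>+s\<in>{0..t}. late n h s G y \<partial>lborel) / ennreal h) (Bo (accum n t G))) \<longlongrightarrow> 0) (at_right 0)"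
proof (rule tendsto_0_le_ennreal)
 let ?Q = "%q y. \<integral>\<^sup>+s\<in>{0..t}. Bo (T n (s + q) G) y \<partial>lborel"
 let ?J = "Bo (accum n t G)"
 let ?f = "%a h. \<integral>\<^sup>+r\<in>{a..a+h}. tmass (Bo (T n r G)) \<partial>lborel"
 have J: "?J \<in> bm Y" by (intro Bo_borel accum_borel G)
 have finJ: "tmass ?J ~= top"
  unfolding tmass_Bo_accum[OF G] using gain_le_tmass[OF G t, of n] fin by (auto simp: top_unique)
 have Qfam: "(%(q, y). ?Q q y) \<in> bm (borel \<otimes> Y)"
 proof -
  have "(%(v, y). Bo (T n (snd v + fst (fst v)) G) y) \<in> bm (((borel \<otimes> Y) \<otimes> lborel) \<otimes> Y)"
   by (intro Bo_family T_G_family G) measurable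
  from measurable_family[OF this, of "%v. snd (fst v)"]
  have [measurable]: "(%v. Bo (T n (snd v + fst (fst v)) G) (snd (fst v))) \<in> bm ((borel \<otimes> Y) \<otimes> lborel)"
   by simp
  have "(%w. \<integral>\<^sup>+s. Bo (T n (s + fst w) G) (snd w) * indicator {0..t} s \<partial>lborel) \<in> bm (borel \<otimes> Y)"
   by (rule lborel.borel_measurable_nn_integral) (simp add: split_beta')
  then show ?thesis by (simp add: split_beta')
 qed
 have Q: "?Q q \<in> bm Y" for q using measurable_section(2)[OF Qfam] by simp
 have J0: "?J y = ?Q 0 y" if "y \<in> space Y" for y
  unfolding accum_def[abs_def] using that by (subst Bo_time_integral[OF _ T_G_family[OF G]]) auto
 have shift: "?Q q y = (\<integral>\<^sup>+r\<in>{q..t+q}. Bo (T n r G) y \<partial>lborel)" if "y \<in> space Y" for q y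
  using nn_integral_interval_shift[of "%r. Bo (T n r G) y" 0 q t] measurable_section(1)[OF Bo_T_family[OF G] that]
  by simp
 have dQ: "dist1 (?Q q) ?J <= ?f 0 h + ?f t h" if q: "0 <= q" "q <= h" for q h
 proof -
  let ?a = "%y. \<integral>\<^sup>+r\<in>{0..q}. Bo (T n r G) y \<partial>lborel"
  let ?b = "%y. \<integral>\<^sup>+r\<in>{t..t+q}. Bo (T n r G) y \<partial>lborel"
  have [measurable]: "?a \<in> bm Y" "?b \<in> bm Y"
   by (intro time_integral_borel Bo_T_family G; simp)+
  have "dist1 (?Q q) ?J <= tmass (%y. ?a y + ?b y)"
  proof (rule dist1_leI[OF Q J])
   show "tmass (?Q q) ~= top \<or> tmass ?J ~= top" using finJ by simp
   fix y assume y: "y \<in> space Y"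
   have m: "(%r. Bo (T n r G) y) \<in> bm borel" by (rule measurable_section(1)[OF Bo_T_family[OF G] y])
   have J1: "?J y = (\<integral>\<^sup>+r\<in>{0..t}. Bo (T n r G) y \<partial>lborel)" using J0[OF y] by simp
   have e: "?a y + ?Q q y = ?J y + ?b y"
    unfolding shift[OF y] J1
    using nn_integral_interval_split[OF m, of 0 q "t + q"] nn_integral_interval_split[OF m, of 0 t "t + q"] q t
    by simp
   have "?Q q y <= ?J y + ?b y" unfolding e[symmetric] by simp
   then show "?Q q y <= ?J y + (?a y + ?b y)" by (rule order_trans) (simp add: add_left_mono)
   have "?J y <= ?a y + ?Q q y" unfolding e by simp
   then show "?J y <= ?Q q y + (?a y + ?b y)" by (rule order_trans) (simp add: ac_simps add_left_mono)
  qed simp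
  also have "... = ?f 0 q + ?f t q"
   by (simp add: tmass_add tmass_time_integral[OF _ Bo_T_family[OF G]])
  also have "... <= ?f 0 h + ?f t h"
   using q by (intro add_mono nn_integral_mono) (auto split: split_indicator)
  finally show ?thesis .
 qed
 show "((%h. (?f 0 h + ?f t h) + (SUP u\<in>{0..h}. dist1 (TT u ?J) ?J)) \<longlongrightarrow> 0) (at_right 0)"
 proof -
  have "((%h. SUP u\<in>{0..h}. dist1 (TT u ?J) ?J) \<longlongrightarrow> 0) (at_right 0)"
  proof (intro SUP_initial_tendsto_0 TT_continuous J finJ)
   have "dist1 (TT 0 ?J) ?J = dist1 ?J ?J"
    unfolding dist1_def by (intro tmass_cong) (simp add: TT_zero_time)
   then show "dist1 (TT 0 ?J) ?J = 0" by (simp add: dist1_refl J finJ)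
  qed
  from tendsto_add[OF tendsto_add[OF gain_short[OF G fin order_refl] gain_short[OF assms]] this]
  show ?thesis by simp
 qed
 fix h :: real assume h: "0 < h"
 have Afam: "(%(q, y). TT (h - q) (?Q q) y) \<in> bm (borel \<otimes> Y)"
  by (intro TT_family Qfam) simp
 have eq: "(\<integral>\<^sup>+s\<in>{0..t}. late n h s G y \<partial>lborel) / ennreal h = average h (%q. TT (h - q) (?Q q)) y"
  if y: "y \<in> space Y" for y
 proof -
  have [measurable]: "(%w. TT (h - snd w) (Bo (T n (fst w + snd w) G)) y) \<in> bm (borel \<otimes> borel)"
   by (intro TT_measurable Bo_family T_G_family G measurable_const y) measurable
  have "(\<integral>\<^sup>+s\<in>{0..t}. late n h s G y \<partial>lborel)
    = (\<integral>\<^sup>+q\<in>{0..h}. (\<integral>\<^sup>+s\<in>{0..t}. TT (h - q) (Bo (T n (s + q) G)) y \<partial>lborel) \<partial>lborel)"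
   unfolding late_def by (rule nn_integral_time_swap) (simp add: split_beta')
  also have "... = (\<integral>\<^sup>+q\<in>{0..h}. TT (h - q) (?Q q) y \<partial>lborel)"
   by (subst TT_time_integral[OF _ _ y]) (auto intro!: Bo_family T_G_family G)
  finally show ?thesis by (simp add: average_def)
 qed
 have "dist1 (%y. (\<integral>\<^sup>+s\<in>{0..t}. late n h s G y \<partial>lborel) / ennreal h) ?J = dist1 (average h (%q. TT (h - q) (?Q q))) ?J"
  unfolding dist1_def by (intro tmass_cong) (simp add: eq)
 also have "... <= (?f 0 h + ?f t h) + (SUP u\<in>{0..h}. dist1 (TT u ?J) ?J)"
 proof (rule average_dist1[OF Afam J finJ h])
  fix q assume q: "0 <= q" "q <= h"
  have "dist1 (TT (h - q) (?Q q)) ?J <= dist1 (TT (h - q) (?Q q)) (TT (h - q) ?J) + dist1 (TT (h - q) ?J) ?J"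
   by (intro dist1_triangle TT_borel Q J)
  also have "dist1 (TT (h - q) (?Q q)) (TT (h - q) ?J) <= dist1 (?Q q) ?J"
  proof (rule dist1_TT[OF Q _ J])
   have "tmass (?Q q) = (\<integral>\<^sup>+r\<in>{q..t+q}. tmass (Bo (T n r G)) \<partial>lborel)"
    by (subst tmass_time_integral[OF _ Bo_T_family[OF G], symmetric]) (auto intro!: tmass_cong simp: shift)
   then show "tmass (?Q q) ~= top" using gain_interval_finite[OF G fin q(1)] by simp
  qed (use q in simp)
  also have "... <= ?f 0 h + ?f t h" by (rule dQ[OF q])
  also have "dist1 (TT (h - q) ?J) ?J <= (SUP u\<in>{0..h}. dist1 (TT u ?J) ?J)"
   using q by (intro SUP_upper) auto
  finally show "dist1 (TT (h - q) (?Q q)) ?J <= (?f 0 h + ?f t h) + (SUP u\<in>{0..h}. dist1 (TT u ?J) ?J)"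
   by (simp add: add_right_mono add_mono)
 qed
 finally show "dist1 (%y. (\<integral>\<^sup>+s\<in>{0..t}. late n h s G y \<partial>lborel) / ennreal h) ?J
   <= (?f 0 h + ?f t h) + (SUP u\<in>{0..h}. dist1 (TT u ?J) ?J)" .
qed

end

context continuous_transport begin

text \<open>The right derivative of \<open>TT h J\<close> at \<open>h = 0\<close> is \<open>C0 - A0\<close>. Losses \<open>A\<close> and gains \<open>C\<close> are kept apart because extended
non-negative functions cannot be subtracted.\<close>

definition right_derivative ::
 "(real \<times> 'a => ennreal) => (real \<times> 'a => ennreal) => (real \<times> 'a => ennreal) => bool" where
 "right_derivative J A0 C0 \<longleftrightarrow> (\<exists>A C.
   (\<forall>h>0. A h \<in> bm Y & C h \<in> bm Y &
       (\<forall>y\<in>space Y. TT h J y + A h y = J y + C h y)) &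
   ((%h. dist1 (%y. A h y / ennreal h) A0) \<longlongrightarrow> 0) (at_right 0) &
   ((%h. dist1 (%y. C h y / ennreal h) C0) \<longlongrightarrow> 0) (at_right 0))"

text \<open>Integrating \<open>TT_T_late\<close> over \<open>s\<close> in \<open>{0..t}\<close> turns \<open>T n (h + s) G\<close> into a shifted integral, whose boundary terms divided by \<open>h\<close> tend to \<open>T n t G\<close> and to \<open>T n 0 G\<close>,
which is \<open>G\<close> for \<open>n = 0\<close> and 0 otherwise. The late parts divided by \<open>h\<close> tend to the scattering terms by \<open>late_average\<close>.\<close>

lemma right_derivative_accum:
 assumes G: "G \<in> bm Y" and fin: "tmass G ~= top" and t: "0 <= t"
 shows "right_derivative (accum n t G)
      (case n of 0 => G | Suc m => Bo (accum m t G))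
      (%y. T n t G y + Bo (accum n t G) y)"
 unfolding right_derivative_def
proof (intro exI conjI allI impI ballI)
 let ?C = "%h y. (\<integral>\<^sup>+q\<in>{0..h}. T n (t + q) G y \<partial>lborel) + (\<integral>\<^sup>+s\<in>{0..t}. late n h s G y \<partial>lborel)"
 let ?L = "%h s y. case n of 0 => 0 | Suc m => late m h s G y"
 let ?A = "%h y. (\<integral>\<^sup>+q\<in>{0..h}. T n (0 + q) G y \<partial>lborel) + (\<integral>\<^sup>+s\<in>{0..t}. ?L h s y \<partial>lborel)"
 have Lfam: "(%(s, y). ?L h s y) \<in> bm (borel \<otimes> Y)" for h
  by (cases n) (auto simp: late_family[OF G])
 have Tq: "(%y. \<integral>\<^sup>+q\<in>{0..h}. T n (a + q) G y \<partial>lborel) \<in> bm Y" for a h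
  by (intro time_integral_borel T_G_family G) auto
 have Lt: "(%y. \<integral>\<^sup>+s\<in>{0..t}. ?L h s y \<partial>lborel) \<in> bm Y"
  "(%y. \<integral>\<^sup>+s\<in>{0..t}. late n h s G y \<partial>lborel) \<in> bm Y" for h
  by (intro time_integral_borel Lfam late_family G; simp)+
 note [measurable] = Tq Lt
 show "?A h \<in> bm Y" "?C h \<in> bm Y" for h by measurable
 show "TT h (accum n t G) y + ?A h y = accum n t G y + ?C h y" if h: "0 < h" and y: "y \<in> space Y" for h y
 proof -
  have m[measurable]: "(%s. T n s G y) \<in> bm borel" "(%s. T n (a + s) G y) \<in> bm borel" for a
   using y by (intro measurable_section(1)[OF T_G_family[OF G]]; simp)+
  have [measurable]: "(%s. TT h (T n s G) y) \<in> bm borel"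
   using y by (intro measurable_section(1)[OF TT_family[OF T_G_family[OF G]]]) auto
  have [measurable]: "(%s. ?L h s y) \<in> bm borel" "(%s. late n h s G y) \<in> bm borel"
   using measurable_section(1)[OF Lfam y] measurable_section(1)[OF late_family[OF G] y] by auto
  have "TT h (accum n t G) y + (\<integral>\<^sup>+s\<in>{0..t}. ?L h s y \<partial>lborel)
    = (\<integral>\<^sup>+s. TT h (T n s G) y * indicator {0..t} s + ?L h s y * indicator {0..t} s \<partial>lborel)"
   unfolding accum_def[abs_def]
   by (subst TT_time_integral[OF _ T_G_family[OF G] y]) (auto intro!: nn_integral_add[symmetric])
  also have "... = (\<integral>\<^sup>+s. T n (h + s) G y * indicator {0..t} s + late n h s G y * indicator {0..t} s \<partial>lborel)"
   using TT_T_late[OF G y _, of _ h n] h by (intro nn_integral_cong) (auto split: split_indicator simp del: T.simps)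
  also have "... = (\<integral>\<^sup>+s\<in>{0..t}. T n (h + s) G y \<partial>lborel) + (\<integral>\<^sup>+s\<in>{0..t}. late n h s G y \<partial>lborel)"
   by (rule nn_integral_add) auto
  finally have 1: "TT h (accum n t G) y + (\<integral>\<^sup>+s\<in>{0..t}. ?L h s y \<partial>lborel)
    = (\<integral>\<^sup>+s\<in>{0..t}. T n (h + s) G y \<partial>lborel) + (\<integral>\<^sup>+s\<in>{0..t}. late n h s G y \<partial>lborel)" .
  have "(\<integral>\<^sup>+q\<in>{0..h}. T n (0 + q) G y \<partial>lborel) + (\<integral>\<^sup>+s\<in>{0..t}. T n (h + s) G y \<partial>lborel)
    = (\<integral>\<^sup>+q\<in>{0..h+t}. T n q G y \<partial>lborel)"
   using nn_integral_interval_split[OF m(1), of 0 h "h + t"] nn_integral_interval_shift[OF m(1), of 0 h t] h t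
   by (simp add: add.commute del: T.simps)
  also have "... = accum n t G y + (\<integral>\<^sup>+q\<in>{0..h}. T n (t + q) G y \<partial>lborel)"
   using nn_integral_interval_split[OF m(1), of 0 t "t + h"] nn_integral_interval_shift[OF m(1), of 0 t h] h t
   by (simp add: add.commute accum_def del: T.simps)
  finally have 2: "(\<integral>\<^sup>+q\<in>{0..h}. T n (0 + q) G y \<partial>lborel) + (\<integral>\<^sup>+s\<in>{0..t}. T n (h + s) G y \<partial>lborel)
    = accum n t G y + (\<integral>\<^sup>+q\<in>{0..h}. T n (t + q) G y \<partial>lborel)" .
  have "TT h (accum n t G) y + ?A h y
    = (\<integral>\<^sup>+q\<in>{0..h}. T n (0 + q) G y \<partial>lborel) + (TT h (accum n t G) y + (\<integral>\<^sup>+s\<in>{0..t}. ?L h s y \<partial>lborel))"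
   by (simp only: ac_simps)
  also have "... = ((\<integral>\<^sup>+q\<in>{0..h}. T n (0 + q) G y \<partial>lborel) + (\<integral>\<^sup>+s\<in>{0..t}. T n (h + s) G y \<partial>lborel))
    + (\<integral>\<^sup>+s\<in>{0..t}. late n h s G y \<partial>lborel)"
   unfolding 1 by (simp only: ac_simps)
  also have "... = accum n t G y + ?C h y" unfolding 2 by (simp only: ac_simps)
  finally show ?thesis .
 qed
 have lateq: "(%y. (\<integral>\<^sup>+s\<in>{0..t}. late m h s G y \<partial>lborel) / ennreal h) \<in> bm Y" for m h
  by (intro borel_measurable_divide_ennreal time_integral_borel late_family G) auto
 have avgT: "average h (%q. T n (a + q) G) \<in> bm Y" for a h
  unfolding average_def[abs_def] by (intro borel_measurable_divide_ennreal Tq measurable_const) simp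
 show "((%h. dist1 (%y. ?C h y / ennreal h) (%y. T n t G y + Bo (accum n t G) y)) \<longlongrightarrow> 0) (at_right 0)"
 proof (rule tendsto_0_le_ennreal)
  show "((%h. dist1 (average h (%q. T n (t + q) G)) (T n t G)
    + dist1 (%y. (\<integral>\<^sup>+s\<in>{0..t}. late n h s G y \<partial>lborel) / ennreal h) (Bo (accum n t G))) \<longlongrightarrow> 0) (at_right 0)"
   using tendsto_add[OF T_average[OF assms] late_average[OF assms]] by simp
  show "dist1 (%y. ?C h y / ennreal h) (%y. T n t G y + Bo (accum n t G) y)
    <= dist1 (average h (%q. T n (t + q) G)) (T n t G)
    + dist1 (%y. (\<integral>\<^sup>+s\<in>{0..t}. late n h s G y \<partial>lborel) / ennreal h) (Bo (accum n t G))" for h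
   using dist1_add[OF avgT[of h t] lateq[of n h] T_borel[OF G, of n t] Bo_borel[OF accum_borel[OF G, of n t]]]
   by (simp only: average_def[abs_def] add_divide_distrib_ennreal)
 qed
 have L0: "((%h. dist1 (%y. (\<integral>\<^sup>+s\<in>{0..t}. ?L h s y \<partial>lborel) / ennreal h)
    (case n of 0 => (%y. 0) | Suc m => Bo (accum m t G))) \<longlongrightarrow> 0) (at_right 0)"
  using late_average[OF assms] by (cases n) (simp_all add: dist1_def tmass_def)
 have lq: "(%y. (\<integral>\<^sup>+s\<in>{0..t}. ?L h s y \<partial>lborel) / ennreal h) \<in> bm Y" for h
  by (intro borel_measurable_divide_ennreal Lt measurable_const) simp
 have B0: "(case n of 0 => (%y. 0) | Suc m => Bo (accum m t G)) \<in> bm Y"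
  by (cases n) (auto intro!: Bo_borel accum_borel G)
 show "((%h. dist1 (%y. ?A h y / ennreal h) (case n of 0 => G | Suc m => Bo (accum m t G))) \<longlongrightarrow> 0) (at_right 0)"
 proof (rule tendsto_0_le_ennreal)
  show "((%h. dist1 (average h (%q. T n (0 + q) G)) (T n 0 G)
    + dist1 (%y. (\<integral>\<^sup>+s\<in>{0..t}. ?L h s y \<partial>lborel) / ennreal h)
      (case n of 0 => (%y. 0) | Suc m => Bo (accum m t G))) \<longlongrightarrow> 0) (at_right 0)"
   using tendsto_add[OF T_average[OF G fin order_refl] L0] by simp
  fix h :: real
  have "dist1 (%y. ?A h y / ennreal h) (case n of 0 => G | Suc m => Bo (accum m t G))
    = dist1 (%y. ?A h y / ennreal h) (%y. T n 0 G y + (case n of 0 => (%y. 0) | Suc m => Bo (accum m t G)) y)"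
   unfolding dist1_def by (intro tmass_cong) (cases n, simp_all add: T_zero_time del: T.simps)
  also have "... <= dist1 (average h (%q. T n (0 + q) G)) (T n 0 G)
    + dist1 (%y. (\<integral>\<^sup>+s\<in>{0..t}. ?L h s y \<partial>lborel) / ennreal h)
      (case n of 0 => (%y. 0) | Suc m => Bo (accum m t G))"
   using dist1_add[OF avgT[of h 0] lq[of h] T_borel[OF G, of n 0] B0]
   by (simp only: average_def[abs_def] add_divide_distrib_ennreal)
  finally show "dist1 (%y. ?A h y / ennreal h) (case n of 0 => G | Suc m => Bo (accum m t G))
   <= dist1 (average h (%q. T n (0 + q) G)) (T n 0 G)
    + dist1 (%y. (\<integral>\<^sup>+s\<in>{0..t}. ?L h s y \<partial>lborel) / ennreal h)
      (case n of 0 => (%y. 0) | Suc m => Bo (accum m t G))" .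
 qed
qed

subsection \<open>The escaping mass\<close>

definition escape :: "real => (real \<times> 'a => ennreal) => ennreal" where
 "escape t G = (INF n. gain n t G)"

lemma gain_tendsto_escape:
 "G \<in> bm Y ==> 0 <= t ==> (%n. gain n t G) ----> escape t G"
 unfolding escape_def by (intro LIMSEQ_INF gain_decreasing)

lemma TT_escape_le:
 assumes G: "G \<in> bm Y" and t: "0 <= t"
 shows "tmass (TT t G) + escape t G <= tmass G"
proof (rule LIMSEQ_le_const2)
 have "(%n. \<Sum>i\<le>n. tmass (T i t G)) ----> tmass (TT t G)"
  unfolding tmass_TT[OF G] using summable_LIMSEQ'[of "%i. tmass (T i t G)"] by simp
 then show "(%n. (\<Sum>i\<le>n. tmass (T i t G)) + gain n t G) ----> tmass (TT t G) + escape t G"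
  by (intro tendsto_add gain_tendsto_escape assms)
qed (use tmass_gain[OF assms] in auto)

lemma gain_family_measurable:
 assumes F: "(%(q, y). F q y) \<in> bm (P \<otimes> Y)" and [measurable]: "f \<in> bm P"
 shows "(%q. gain n (f q) (F q)) \<in> bm P"
proof -
 have "(%w. tmass (Bo (T n (snd w) (F (fst w))))) \<in> bm (P \<otimes> lborel)"
  by (intro tmass_measurable Bo_family T_family measurable_reparam[OF F]) measurable
 then have [measurable]: "(%w. tmass (Bo (T n (snd w) (F (fst w)))) * indicator {0..f (fst w)} (snd w)) \<in> bm (P \<otimes> lborel)"
  by measurable
 show ?thesis unfolding gain_def
  by (rule lborel.borel_measurable_nn_integral) (simp add: split_beta')
qed

lemma gain_suminf:
 fixes F :: "nat => real \<times> 'a => ennreal"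
 assumes F: "!!l. F l \<in> bm Y"
 shows "gain n h (%y. \<Sum>l. F l y) = (\<Sum>l. gain n h (F l))"
proof -
 have "tmass (Bo (T n r (%y. \<Sum>l. F l y))) = (\<Sum>l. tmass (Bo (T n r (F l))))" for r
 proof -
  have "tmass (Bo (T n r (%y. \<Sum>l. F l y))) = tmass (Bo (%y. \<Sum>l. T n r (F l) y))"
   by (intro tmass_cong Bo_cong T_suminf F)
  also have "... = tmass (%y. \<Sum>l. Bo (T n r (F l)) y)"
   by (intro tmass_cong Bo_suminf T_borel F)
  finally show ?thesis by (simp add: tmass_suminf Bo_borel T_borel F)
 qed
 moreover have [measurable]: "(%r. tmass (Bo (T n r (F l)))) \<in> bm borel" for l
  by (rule gain_measurable[OF F])
 ultimately show ?thesis unfolding gain_def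
  by (subst nn_integral_suminf[symmetric]) simp_all
qed

lemma gain_time_integral:
 fixes F :: "real => real \<times> 'a => ennreal"
 assumes F: "(%(q, y). F q y) \<in> bm (borel \<otimes> Y)"
 shows "gain n h (%y. \<integral>\<^sup>+q\<in>{0..t}. F q y \<partial>lborel) = (\<integral>\<^sup>+q\<in>{0..t}. gain n h (F q) \<partial>lborel)"
proof -
 have "tmass (Bo (T n r (%y. \<integral>\<^sup>+q\<in>{0..t}. F q y \<partial>lborel))) = (\<integral>\<^sup>+q\<in>{0..t}. tmass (Bo (T n r (F q))) \<partial>lborel)" for r
 proof -
  have Tf: "(%(q, y). T n r (F q) y) \<in> bm (borel \<otimes> Y)" by (intro T_family F) simp
  have "tmass (Bo (T n r (%y. \<integral>\<^sup>+q\<in>{0..t}. F q y \<partial>lborel))) = tmass (Bo (%y. \<integral>\<^sup>+q\<in>{0..t}. T n r (F q) y \<partial>lborel))"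
   by (intro tmass_cong Bo_cong T_time_integral F) auto
  also have "... = tmass (%y. \<integral>\<^sup>+q\<in>{0..t}. Bo (T n r (F q)) y \<partial>lborel)"
   by (intro tmass_cong Bo_time_integral Tf) auto
  also have "... = (\<integral>\<^sup>+q\<in>{0..t}. tmass (Bo (T n r (F q))) \<partial>lborel)"
   by (intro tmass_time_integral Bo_family Tf) simp
  finally show ?thesis .
 qed
 moreover have "(%w. tmass (Bo (T n (fst w) (F (snd w))))) \<in> bm (borel \<otimes> borel)"
  by (intro tmass_measurable Bo_family T_family measurable_reparam[OF F]) measurable
 ultimately show ?thesis unfolding gain_def
  by (simp only:) (rule nn_integral_time_swap, simp add: split_beta')
qed

text \<open>By \<open>T_add_time\<close>, collisions after time \<open>t\<close> are sorted by the number \<open>l\<close> of collisions before \<open>t\<close>.\<close>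

lemma gain_add_time:
 assumes G: "G \<in> bm Y" and t: "0 <= t" and h: "0 <= h"
 shows "gain n (t + h) G = gain n t G + (\<Sum>l\<le>n. gain (n - l) h (T l t G))"
proof -
 have Tl: "T l t G \<in> bm Y" for l by (rule T_borel[OF G])
 note [measurable] = gain_measurable[OF Tl]
 have "gain n (t + h) G = gain n t G + (\<integral>\<^sup>+r\<in>{0+t..h+t}. tmass (Bo (T n r G)) \<partial>lborel)"
  unfolding gain_def using nn_integral_interval_split[OF gain_measurable[OF G], of 0 t "t + h" n] t h
  by (simp add: add.commute)
 also have "(\<integral>\<^sup>+r\<in>{0+t..h+t}. tmass (Bo (T n r G)) \<partial>lborel) = (\<integral>\<^sup>+r\<in>{0..h}. tmass (Bo (T n (r + t) G)) \<partial>lborel)"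
  by (rule nn_integral_interval_shift[OF gain_measurable[OF G]])
 also have "... = (\<integral>\<^sup>+r. (\<Sum>j\<le>n. tmass (Bo (T j r (T (n - j) t G))) * indicator {0..h} r) \<partial>lborel)"
 proof (intro nn_integral_cong)
  fix r :: real
  have "tmass (Bo (T n (r + t) G)) = (\<Sum>j\<le>n. tmass (Bo (T j r (T (n - j) t G))))" if r: "0 <= r"
  proof -
   have "tmass (Bo (T n (r + t) G)) = tmass (Bo (%y. \<Sum>j\<le>n. T j r (T (n - j) t G) y))"
    by (intro tmass_cong Bo_cong T_add_time G r t)
   also have "... = tmass (%y. \<Sum>j\<le>n. Bo (T j r (T (n - j) t G)) y)"
    by (intro tmass_cong Bo_sum T_borel Tl) auto
   also have "... = (\<Sum>j\<le>n. tmass (Bo (T j r (T (n - j) t G))))"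
    by (intro tmass_sum Bo_borel T_borel Tl)
   finally show ?thesis .
  qed
  then show "tmass (Bo (T n (r + t) G)) * indicator {0..h} r = (\<Sum>j\<le>n. tmass (Bo (T j r (T (n - j) t G))) * indicator {0..h} r)"
   by (auto simp: sum_distrib_right[symmetric] split: split_indicator)
 qed
 also have "... = (\<Sum>j\<le>n. gain j h (T (n - j) t G))"
  unfolding gain_def by (rule nn_integral_sum) measurable
 also have "... = (\<Sum>l\<le>n. gain (n - l) h (T l t G))"
  by (rule sum.reindex_bij_witness[where i="%l. n - l" and j="%l. n - l"]) auto
 finally show ?thesis .
qed

text \<open>Limit of \<open>gain_add_time\<close>. Each term \<open>gain (n - l) h (T l t G)\<close> tends to \<open>escape h (T l t G)\<close> and is dominated by the summable mass of \<open>T l t G\<close>.\<close>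

lemma escape_add_time:
 assumes G: "G \<in> bm Y" and fin: "tmass G ~= top" and t: "0 <= t" and h: "0 <= h"
 shows "escape (t + h) G = escape t G + escape h (TT t G)"
proof -
 have Tl: "T l t G \<in> bm Y" for l by (rule T_borel[OF G])
 have dom: "(\<integral>\<^sup>+l. tmass (T l t G) \<partial>count_space UNIV) < \<infinity>"
  using tmass_TT_le[OF G t] fin unfolding tmass_TT[OF G]
  by (auto simp: nn_integral_count_space_nat less_top[symmetric] top_unique)
 have "(%n. \<integral>\<^sup>+l. (if l <= n then gain (n - l) h (T l t G) else 0) \<partial>count_space UNIV)
   ----> (\<integral>\<^sup>+l. escape h (T l t G) \<partial>count_space UNIV)"
 proof (rule nn_integral_dominated_convergence[OF _ _ _ _ dom])
  show "AE l in count_space UNIV. (%n. if l <= n then gain (n - l) h (T l t G) else 0) ----> escape h (T l t G)"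
  proof (rule AE_I2)
   fix l
   have "(%n. gain (n + l - l) h (T l t G)) ----> escape h (T l t G)"
    using gain_tendsto_escape[OF Tl h, of l] by simp
   then have "(%n. (if l <= n + l then gain (n + l - l) h (T l t G) else 0)) ----> escape h (T l t G)" by simp
   then show "(%n. if l <= n then gain (n - l) h (T l t G) else 0) ----> escape h (T l t G)"
    by (rule LIMSEQ_offset)
  qed
 qed (auto intro!: gain_le_tmass Tl h)
 moreover have "(\<integral>\<^sup>+l. (if l <= n then gain (n - l) h (T l t G) else 0) \<partial>count_space UNIV)
   = (\<Sum>l\<le>n. gain (n - l) h (T l t G))" for n
  by (subst nn_integral_count_space_nat, subst suminf_finite[where N="{..n}"]) auto
 ultimately have 1: "(%n. \<Sum>l\<le>n. gain (n - l) h (T l t G)) ----> (\<integral>\<^sup>+l. escape h (T l t G) \<partial>count_space UNIV)"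
  by simp
 have "(%n. \<integral>\<^sup>+l. gain n h (T l t G) \<partial>count_space UNIV) ----> (\<integral>\<^sup>+l. escape h (T l t G) \<partial>count_space UNIV)"
  by (rule nn_integral_dominated_convergence[OF _ _ _ _ dom])
    (auto intro!: gain_le_tmass Tl h gain_tendsto_escape)
 moreover have "(\<integral>\<^sup>+l. gain n h (T l t G) \<partial>count_space UNIV) = gain n h (TT t G)" for n
  unfolding TT_def[abs_def] by (subst gain_suminf[OF Tl]) (simp add: nn_integral_count_space_nat)
 ultimately have 2: "(%n. gain n h (TT t G)) ----> (\<integral>\<^sup>+l. escape h (T l t G) \<partial>count_space UNIV)"
  by simp
 have 3: "(\<integral>\<^sup>+l. escape h (T l t G) \<partial>count_space UNIV) = escape h (TT t G)"
  by (rule LIMSEQ_unique[OF 2 gain_tendsto_escape[OF TT_borel[OF G] h]])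
 have "(%n. gain n (t + h) G) ----> escape t G + escape h (TT t G)"
  unfolding gain_add_time[OF G t h] 3[symmetric] by (intro tendsto_add gain_tendsto_escape G t 1)
 then show ?thesis using gain_tendsto_escape[OF G, of "t + h"] t h
  by (auto intro: LIMSEQ_unique)
qed

lemma escape_measurable:
 assumes F: "(%(q, y). F q y) \<in> bm (P \<otimes> Y)" and f: "f \<in> bm P"
 shows "(%q. escape (f q) (F q)) \<in> bm P"
 unfolding escape_def by (intro borel_measurable_INF gain_family_measurable assms) simp

lemma escape_time_integral:
 fixes F :: "real => real \<times> 'a => ennreal"
 assumes F: "(%(q, y). F q y) \<in> bm (borel \<otimes> Y)" and h: "0 <= h"
  and fin: "(\<integral>\<^sup>+q\<in>{0..t}. tmass (F q) \<partial>lborel) ~= top"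
 shows "escape h (%y. \<integral>\<^sup>+q\<in>{0..t}. F q y \<partial>lborel) = (\<integral>\<^sup>+q\<in>{0..t}. escape h (F q) \<partial>lborel)"
proof -
 have Fq: "F q \<in> bm Y" for q using measurable_section(2)[OF F] by simp
 note [measurable] = gain_family_measurable[OF F, of "%_. h"]
 have ind: "(INF n. gain n h (F q)) * indicator {0..t} q = (INF n. gain n h (F q) * indicator {0..t} q)" for q
  by (auto split: split_indicator)
 have "(\<integral>\<^sup>+q. (INF n. gain n h (F q) * indicator {0..t} q) \<partial>lborel)
   = (INF n. \<integral>\<^sup>+q. gain n h (F q) * indicator {0..t} q \<partial>lborel)"
 proof (rule nn_integral_monotone_convergence_INF_decseq)
  show "decseq (%n q. gain n h (F q) * indicator {0..t} q)"
   by (intro decseq_SucI le_funI mult_right_mono decseqD[OF gain_decreasing[OF Fq h]]) auto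
  have "(\<integral>\<^sup>+q. gain 0 h (F q) * indicator {0..t} q \<partial>lborel) <= (\<integral>\<^sup>+q\<in>{0..t}. tmass (F q) \<partial>lborel)"
   by (intro nn_integral_mono mult_right_mono gain_le_tmass Fq h) simp
  then show "(\<integral>\<^sup>+q. gain 0 h (F q) * indicator {0..t} q \<partial>lborel) < \<infinity>"
   using fin by (auto simp: less_top[symmetric] top_unique)
 qed simp
 then show ?thesis unfolding escape_def by (simp add: ind gain_time_integral[OF F])
qed

end

context continuous_transport begin

definition TT_accum :: "real => (real \<times> 'a => ennreal) => real \<times> 'a => ennreal" where
 "TT_accum t G y = (\<integral>\<^sup>+s\<in>{0..t}. TT s G y \<partial>lborel)"

text \<open>The mass that has not been absorbed: it is still in the system or has escaped.\<close>

definition retained :: "real => (real \<times> 'a => ennreal) => ennreal" where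
 "retained t G = tmass (TT t G) + escape t G"

lemma TT_G_family: "G \<in> bm Y ==> (%(q, y). TT q G y) \<in> bm (borel \<otimes> Y)"
 by (intro TT_family measurable_const_family) simp_all

lemma TT_accum_borel: "G \<in> bm Y ==> TT_accum t G \<in> bm Y"
 unfolding TT_accum_def[abs_def] by (intro time_integral_borel TT_G_family) auto

lemma tmass_TT_accum:
 "G \<in> bm Y ==> tmass (TT_accum t G) = (\<integral>\<^sup>+s\<in>{0..t}. tmass (TT s G) \<partial>lborel)"
 unfolding TT_accum_def[abs_def] by (intro tmass_time_integral TT_G_family) auto

lemma time_integral_le:
 assumes "!!s. 0 <= s ==> f s <= c"
 shows "(\<integral>\<^sup>+s\<in>{0..t}. f s \<partial>lborel) <= c * ennreal t"
proof -
 have "(\<integral>\<^sup>+s\<in>{0..t}. f s \<partial>lborel) <= (\<integral>\<^sup>+s\<in>{0..t}. c \<partial>lborel)"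
  using assms by (intro nn_integral_mono) (auto split: split_indicator)
 also have "... = c * ennreal t"
  by (subst nn_integral_cmult_indicator) (simp, cases "0 <= t", auto simp: ennreal_neg)
 finally show ?thesis .
qed

lemma tmass_TT_accum_finite:
 assumes "G \<in> bm Y" "tmass G ~= top"
 shows "tmass (TT_accum t G) ~= top"
proof -
 have "tmass (TT_accum t G) <= tmass G * ennreal t"
  unfolding tmass_TT_accum[OF assms(1)] by (intro time_integral_le tmass_TT_le assms)
 then show ?thesis using assms(2) by (auto simp: top_unique ennreal_mult_eq_top_iff)
qed

lemma retained_measurable:
 assumes G: "G \<in> bm Y"
 shows "(%s. retained s G) \<in> bm borel"
 unfolding retained_def
 by (intro borel_measurable_add tmass_measurable TT_G_family escape_measurable measurable_const_family G) simp

lemma retained_le: "G \<in> bm Y ==> 0 <= t ==> retained t G <= tmass G"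
 unfolding retained_def by (rule TT_escape_le)

text \<open>By \<open>escape_add_time\<close> both sides contain \<open>escape t G\<close>. What \<open>TT q\<close> removes from \<open>TT t G\<close> is non-negative and at most the distance moved.\<close>

lemma retained_short:
 assumes G: "G \<in> bm Y" and fin: "tmass G ~= top" and t: "0 <= t" and q: "0 <= q"
 shows "retained (t + q) G <= retained t G"
  and "retained t G <= retained (t + q) G + dist1 (TT q (TT t G)) (TT t G)"
proof -
 let ?g = "TT t G"
 have g: "?g \<in> bm Y" by (rule TT_borel[OF G])
 have "tmass (TT (q + t) G) = tmass (TT q ?g)" by (intro tmass_cong TT_TT[symmetric] G q t)
 then have e: "retained (t + q) G = escape t G + (tmass (TT q ?g) + escape q ?g)"
  unfolding retained_def escape_add_time[OF G fin t q] by (simp add: ac_simps)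
 show "retained (t + q) G <= retained t G"
  unfolding e unfolding retained_def
  using TT_escape_le[OF g q] by (simp add: add.commute add_right_mono)
 have "ediff (tmass (TT q ?g)) (tmass ?g) <= dist1 (TT q ?g) ?g"
  using tmass_TT_le[OF G t] fin by (intro tmass_ediff_le TT_borel g) (auto simp: top_unique)
 then have "tmass ?g <= tmass (TT q ?g) + dist1 (TT q ?g) ?g"
  using le_add_ediff'[of "tmass ?g" "tmass (TT q ?g)"] by (meson add_left_mono order_trans)
 then have "escape t G + tmass ?g <= escape t G + (tmass (TT q ?g) + dist1 (TT q ?g) ?g)"
  by (rule add_left_mono)
 also have "... <= retained (t + q) G + dist1 (TT q ?g) ?g"
 proof -
  have "retained (t + q) G + dist1 (TT q ?g) ?g
    = (escape t G + (tmass (TT q ?g) + dist1 (TT q ?g) ?g)) + escape q ?g"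
   unfolding e by (simp only: ac_simps)
  then show ?thesis by (simp only: add_increasing2[OF zero_le order_refl])
 qed
 finally show "retained t G <= retained (t + q) G + dist1 (TT q ?g) ?g"
  unfolding retained_def by (simp add: add.commute)
qed

lemma retained_average:
 assumes G: "G \<in> bm Y" and fin: "tmass G ~= top" and t: "0 <= t"
 shows "((%h. (\<integral>\<^sup>+s\<in>{t..t+h}. retained s G \<partial>lborel) / ennreal h) \<longlongrightarrow> retained t G) (at_right 0)"
proof -
 let ?g = "TT t G"
 let ?r = "retained t G"
 let ?a = "%h. (\<integral>\<^sup>+s\<in>{t..t+h}. retained s G \<partial>lborel) / ennreal h"
 let ?\<epsilon> = "%h. SUP u\<in>{0..h}. dist1 (TT u ?g) ?g"
 have g: "?g \<in> bm Y" "tmass ?g ~= top"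
  using tmass_TT_le[OF G t] fin by (auto simp: top_unique TT_borel[OF G])
 have "dist1 (TT 0 ?g) ?g = dist1 ?g ?g"
  unfolding dist1_def by (intro tmass_cong) (simp add: TT_zero_time)
 then have \<epsilon>: "(?\<epsilon> \<longlongrightarrow> 0) (at_right 0)"
  using g by (intro SUP_initial_tendsto_0 TT_continuous) (auto simp: dist1_refl)
 have a: "?a h = (\<integral>\<^sup>+q\<in>{0..h}. retained (t + q) G \<partial>lborel) / ennreal h" for h
  using nn_integral_interval_shift[OF retained_measurable[OF G], of 0 t h] by (simp add: add.commute)
 have rfin: "?r ~= top" using retained_le[OF G t] fin by (auto simp: top_unique)
 have up: "?a h <= ?r" if h: "0 < h" for h
 proof -
  have "?a h <= (\<integral>\<^sup>+q\<in>{0..h}. ?r \<partial>lborel) / ennreal h"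
   unfolding a using retained_short(1)[OF G fin t]
   by (intro divide_right_mono_ennreal nn_integral_mono) (auto split: split_indicator)
  then show ?thesis by (simp only: nn_integral_average_const[OF h])
 qed
 have low: "?r <= ?a h + ?\<epsilon> h" if h: "0 < h" for h
 proof -
  have [measurable]: "(%q. retained (t + q) G) \<in> bm borel"
   using measurable_compose[OF _ retained_measurable[OF G], of "%q. t + q"] by simp
  have "?r = (\<integral>\<^sup>+q\<in>{0..h}. ?r \<partial>lborel) / ennreal h" by (simp only: nn_integral_average_const[OF h])
  also have "... <= (\<integral>\<^sup>+q. retained (t + q) G * indicator {0..h} q + ?\<epsilon> h * indicator {0..h} q \<partial>lborel) / ennreal h"
  proof (intro divide_right_mono_ennreal nn_integral_mono)
   fix q :: real
   have "?r <= retained (t + q) G + ?\<epsilon> h" if "0 <= q" "q <= h"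
   proof -
    have "dist1 (TT q ?g) ?g <= ?\<epsilon> h" using that by (intro SUP_upper) auto
    then show ?thesis using retained_short(2)[OF G fin t that(1)] by (meson add_left_mono order_trans)
   qed
   then show "?r * indicator {0..h} q <= retained (t + q) G * indicator {0..h} q + ?\<epsilon> h * indicator {0..h} q"
    by (simp split: split_indicator)
  qed
  also have "... = ?a h + (\<integral>\<^sup>+q\<in>{0..h}. ?\<epsilon> h \<partial>lborel) / ennreal h"
   unfolding a by (subst nn_integral_add) (auto simp: add_divide_distrib_ennreal)
  finally show ?thesis by (simp only: nn_integral_average_const[OF h])
 qed
 show ?thesis
 proof (rule ennreal_tendsto_const_minus)
  show "\<forall>\<^sub>F h in at_right 0. ?a h <= ?r"
   using up by (auto simp: eventually_at_right_field intro: exI[of _ 1])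
  show "((%h. ?r - ?a h) \<longlongrightarrow> 0) (at_right 0)"
  proof (rule tendsto_0_le_ennreal[OF \<epsilon>])
   fix h :: real assume h: "0 < h"
   show "?r - ?a h <= ?\<epsilon> h"
    using low[OF h] rfin by (simp add: ennreal_minus_le_iff)
  qed
 qed
qed

lemma TT_TT_accum:
 assumes G: "G \<in> bm Y" and t: "0 <= t" and h: "0 <= h"
 shows "tmass (TT h (TT_accum t G)) = (\<integral>\<^sup>+s\<in>{0..t}. tmass (TT (s + h) G) \<partial>lborel)"
proof -
 have "tmass (TT h (TT_accum t G)) = tmass (%y. \<integral>\<^sup>+s\<in>{0..t}. TT h (TT s G) y \<partial>lborel)"
  unfolding TT_accum_def[abs_def] by (intro tmass_cong TT_time_integral TT_G_family G) auto
 also have "... = (\<integral>\<^sup>+s\<in>{0..t}. tmass (TT h (TT s G)) \<partial>lborel)"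
  by (intro tmass_time_integral TT_family TT_G_family G) auto
 also have "... = (\<integral>\<^sup>+s\<in>{0..t}. tmass (TT (s + h) G) \<partial>lborel)"
  using TT_TT[OF G _ h] by (intro nn_integral_cong) (auto split: split_indicator intro!: tmass_cong simp: add.commute)
 finally show ?thesis .
qed

text \<open>By \<open>escape_add_time\<close>, the first two terms plus the integral of \<open>escape\<close> over \<open>{0..t}\<close> are the integral of \<open>retained\<close> over \<open>{h..t + h}\<close>; the mass of \<open>TT_accum t G\<close>
plus the same integral is that of \<open>retained\<close> over \<open>{0..t}\<close>. All terms are added to the side where they are positive.\<close>

lemma balance_TT_accum:
 assumes G: "G \<in> bm Y" and fin: "tmass G ~= top" and t: "0 <= t" and h: "0 <= h"
 shows "tmass (TT h (TT_accum t G)) + escape h (TT_accum t G) + (\<integral>\<^sup>+s\<in>{0..h}. retained s G \<partial>lborel)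
    = tmass (TT_accum t G) + (\<integral>\<^sup>+s\<in>{t..t+h}. retained s G \<partial>lborel)"
proof -
 let ?\<Gamma> = "TT_accum t G"
 let ?E = "\<integral>\<^sup>+s\<in>{0..t}. escape s G \<partial>lborel"
 let ?R = "%a b. \<integral>\<^sup>+s\<in>{a..b}. retained s G \<partial>lborel"
 note rm = retained_measurable[OF G]
 have [measurable]: "(%s. tmass (TT s G)) \<in> bm borel"
  by (intro tmass_measurable TT_G_family G)
 have [measurable]: "(%s. tmass (TT (s + h) G)) \<in> bm borel"
  by (intro tmass_measurable TT_family measurable_const_family G) simp
 have [measurable]: "(%s. escape s G) \<in> bm borel"
  by (intro escape_measurable measurable_const_family G) simp
 have [measurable]: "(%s. escape h (TT s G)) \<in> bm borel"
  by (intro escape_measurable TT_G_family G) simp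
 have esc: "escape h ?\<Gamma> = (\<integral>\<^sup>+s\<in>{0..t}. escape h (TT s G) \<partial>lborel)"
  unfolding TT_accum_def[abs_def]
  by (rule escape_time_integral[OF TT_G_family[OF G] h])
    (use tmass_TT_accum_finite[OF G fin, of t] in \<open>simp add: tmass_TT_accum[OF G]\<close>)
 have "tmass (TT h ?\<Gamma>) + escape h ?\<Gamma> + ?E
   = (\<integral>\<^sup>+s. tmass (TT (s + h) G) * indicator {0..t} s + escape h (TT s G) * indicator {0..t} s
      + escape s G * indicator {0..t} s \<partial>lborel)"
  unfolding TT_TT_accum[OF G t h] esc by (simp add: nn_integral_add)
 also have "... = (\<integral>\<^sup>+s\<in>{0..t}. retained (s + h) G \<partial>lborel)"
  using escape_add_time[OF G fin _ h]
  by (intro nn_integral_cong) (auto simp: retained_def ac_simps split: split_indicator)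
 also have "... = ?R h (t + h)" using nn_integral_interval_shift[OF rm, of 0 h t] by simp
 finally have 1: "tmass (TT h ?\<Gamma>) + escape h ?\<Gamma> + ?E = ?R h (t + h)" .
 have 2: "tmass ?\<Gamma> + ?E = ?R 0 t"
  unfolding tmass_TT_accum[OF G]
  by (subst nn_integral_add[symmetric]) (auto simp: retained_def intro!: nn_integral_cong split: split_indicator)
 have "?R 0 h + ?R h (t + h) = ?R 0 t + ?R t (t + h)"
  using nn_integral_interval_split[OF rm, of 0 h "t + h"] nn_integral_interval_split[OF rm, of 0 t "t + h"] t h by simp
 then have "?E + (tmass (TT h ?\<Gamma>) + escape h ?\<Gamma> + ?R 0 h) = ?E + (tmass ?\<Gamma> + ?R t (t + h))"
  unfolding 1[symmetric] 2[symmetric] by (simp only: ac_simps)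
 moreover have "?E ~= top"
 proof -
  have "escape s G <= tmass G" if "0 <= s" for s
   by (rule order_trans[OF add_increasing[OF zero_le order_refl] TT_escape_le[OF G that]])
  then have "?E <= tmass G * ennreal t" by (rule time_integral_le)
  then show ?thesis using fin by (auto simp: top_unique ennreal_mult_eq_top_iff)
 qed
 ultimately show ?thesis by (simp add: ennreal_add_left_cancel)
qed

text \<open>By \<open>balance_TT_accum\<close> the left-hand side is the difference of the averages of \<open>retained\<close> over \<open>{0..h}\<close> and \<open>{t..t + h}\<close>, which converge to
its values at \<open>0\<close> and \<open>t\<close>.\<close>

lemma defect_limit:
 assumes G: "G \<in> bm Y" and fin: "tmass G ~= top" and t: "0 <= t"
 shows "((%h. (1 / h) * (enn2real (tmass (TT_accum t G)) - enn2real (tmass (TT h (TT_accum t G)))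
       - enn2real (escape h (TT_accum t G))))
   \<longlongrightarrow> enn2real (tmass G) - enn2real (tmass (TT t G)) - enn2real (escape t G)) (at_right 0)"
proof -
 let ?\<Gamma> = "TT_accum t G"
 let ?R = "%a h. \<integral>\<^sup>+s\<in>{a..a+h}. retained s G \<partial>lborel"
 have Rfin: "?R a h ~= top" if "0 <= a" for a h
 proof -
  have "?R a h <= (\<integral>\<^sup>+s\<in>{0..a+h}. retained s G \<partial>lborel)"
   using that by (intro nn_integral_mono) (auto split: split_indicator)
  also have "... <= tmass G * ennreal (a + h)" by (intro time_integral_le retained_le G)
  finally show ?thesis using fin by (auto simp: top_unique ennreal_mult_eq_top_iff)
 qed
 have rr: "((%h. enn2real (?R a h) / h) \<longlongrightarrow> enn2real (retained a G)) (at_right 0)" if a: "0 <= a" for a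
 proof -
  have "retained a G ~= top" using retained_le[OF G a] fin by (auto simp: top_unique)
  then have "((%h. ?R a h / ennreal h) \<longlongrightarrow> ennreal (enn2real (retained a G))) (at_right 0)"
   using retained_average[OF G fin a] by (simp add: less_top)
  then have "((%h. enn2real (?R a h / ennreal h)) \<longlongrightarrow> enn2real (retained a G)) (at_right 0)"
   by (rule tendsto_enn2real) simp
  moreover have "\<forall>\<^sub>F h in at_right 0. enn2real (?R a h / ennreal h) = enn2real (?R a h) / h"
  proof -
   have "enn2real (?R a h / ennreal h) = enn2real (?R a h) / h" if "0 < h" for h
    using Rfin[OF a, of h] that by (cases "?R a h") (auto simp: divide_ennreal)
   then show ?thesis by (auto simp: eventually_at_right_field intro: exI[of _ 1])
  qed
  ultimately show ?thesis by (rule Lim_transform_eventually)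
 qed
 have "tmass (TT t G) <= tmass G" by (rule tmass_TT_le[OF G t])
 have esc_fin: "escape u H ~= top" "tmass (TT u H) ~= top"
  if "H \<in> bm Y" "tmass H ~= top" "0 <= u" for u H
  using TT_escape_le[OF that(1,3)] that(2) by (auto simp: top_unique)
 have r0: "retained 0 G = tmass G"
 proof -
  have "gain 0 0 G = 0"
  proof -
   have "gain 0 0 G = (\<integral>\<^sup>+r. 0 \<partial>(lborel :: real measure))"
    unfolding gain_def
   proof (rule nn_integral_cong_AE)
    show "AE r in lborel. tmass (Bo (T 0 r G)) * indicator {0..0} r = 0"
     using AE_lborel_singleton[of "0::real"] by eventually_elim simp
   qed
   then show ?thesis by simp
  qed
  moreover have "escape 0 G <= gain 0 0 G" unfolding escape_def by (rule INF_lower) simp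
  moreover have "tmass (TT 0 G) = tmass G" by (intro tmass_cong TT_zero_time)
  ultimately show ?thesis by (simp add: retained_def)
 qed
 have rt: "enn2real (retained t G) = enn2real (tmass (TT t G)) + enn2real (escape t G)"
  unfolding retained_def using esc_fin[OF G fin t] by (simp add: enn2real_plus less_top)
 have "((%h. enn2real (?R 0 h) / h - enn2real (?R t h) / h)
   \<longlongrightarrow> enn2real (retained 0 G) - enn2real (retained t G)) (at_right 0)"
  by (intro tendsto_diff rr t order_refl)
 moreover have "\<forall>\<^sub>F h in at_right 0. enn2real (?R 0 h) / h - enn2real (?R t h) / h
   = (1 / h) * (enn2real (tmass ?\<Gamma>) - enn2real (tmass (TT h ?\<Gamma>)) - enn2real (escape h ?\<Gamma>))"
 proof -
  have "enn2real (?R 0 h) / h - enn2real (?R t h) / h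
   = (1 / h) * (enn2real (tmass ?\<Gamma>) - enn2real (tmass (TT h ?\<Gamma>)) - enn2real (escape h ?\<Gamma>))" if h: "0 < h" for h
  proof -
   have h0: "0 <= h" using h by simp
   note f = esc_fin[OF TT_accum_borel[OF G] tmass_TT_accum_finite[OF G fin] h0, of t]
    Rfin[of 0 h] Rfin[OF t, of h] tmass_TT_accum_finite[OF G fin, of t]
   have "enn2real (tmass (TT h ?\<Gamma>)) + enn2real (escape h ?\<Gamma>) + enn2real (?R 0 h)
     = enn2real (tmass ?\<Gamma>) + enn2real (?R t h)"
    using arg_cong[OF balance_TT_accum[OF G fin t h0], of enn2real] f
    by (simp add: enn2real_plus less_top)
   then have "enn2real (?R 0 h) - enn2real (?R t h)
     = enn2real (tmass ?\<Gamma>) - enn2real (tmass (TT h ?\<Gamma>)) - enn2real (escape h ?\<Gamma>)" by linarith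
   then show ?thesis by (simp add: diff_divide_distrib[symmetric])
  qed
  then show ?thesis by (auto simp: eventually_at_right_field intro: exI[of _ 1])
 qed
 ultimately have "((%h. (1 / h) * (enn2real (tmass ?\<Gamma>) - enn2real (tmass (TT h ?\<Gamma>)) - enn2real (escape h ?\<Gamma>)))
   \<longlongrightarrow> enn2real (retained 0 G) - enn2real (retained t G)) (at_right 0)"
  by (rule Lim_transform_eventually)
 then show ?thesis unfolding r0 rt by (simp add: diff_diff_eq)
qed

end

section \<open>Bochner integrals with values in a space of integrable functions\<close>

lemma L1_simps [simp]:
 "Car (L1 M) = {\<phi>. integrable M \<phi>}"
 "Nrm (L1 M) \<phi> = (LINT x|M. \<bar>\<phi> x\<bar>)"
 "Pos (L1 M) = {\<phi>. integrable M \<phi> & (AE x in M. 0 <= \<phi> x)}"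
 by (simp_all add: L1_def)

lemma sum_function_apply: "(\<Sum>i\<in>A. f i) x = (\<Sum>i\<in>A. f i x)"
 by (induction A rule: infinite_finite_induct) auto

lemma simple_value_eq:
 assumes "simple_function N S" "r \<in> space N"
 shows "S r x = (\<Sum>c\<in>S ` space N. indicator (S -` {c} \<inter> space N) r * (c x :: real))"
proof -
 have "finite (S ` space N)" using assms by (simp add: simple_function_def)
 then have "(\<Sum>c\<in>S ` space N. indicator (S -` {c} \<inter> space N) r * c x)
   = (\<Sum>c\<in>S ` space N. if c = S r then c x else 0)"
  using assms(2) by (intro sum.cong) (auto split: split_indicator)
 also have "... = S r x" using \<open>finite _\<close> assms(2) by simp
 finally show ?thesis by simp
qed

lemma simple_joint_measurable:
 fixes S :: "'b => 'a => real"
 assumes S: "simple_function N S" and m: "!!r. r \<in> space N ==> S r \<in> bm M"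
 shows "(%w. S (fst w) (snd w)) \<in> bm (N \<otimes> M)"
proof -
 have "(%w. \<Sum>c\<in>S ` space N. indicator (S -` {c} \<inter> space N) (fst w) * (c (snd w) :: real)) \<in> bm (N \<otimes> M)"
 proof (intro borel_measurable_sum borel_measurable_times)
  fix c assume c: "c \<in> S ` space N"
  have "S -` {c} \<inter> space N \<in> sets N" using S c by (auto simp: simple_function_def)
  then show "(%w. indicator (S -` {c} \<inter> space N) (fst w) :: real) \<in> bm (N \<otimes> M)"
   by measurable
  have "c \<in> bm M" using c m by auto
  then show "(%w. c (snd w)) \<in> bm (N \<otimes> M)" by measurable
 qed
 also have "?this \<longleftrightarrow> ?thesis"
  by (intro measurable_cong) (auto simp: space_pair_measure intro!: simple_value_eq[OF S, symmetric])
 finally show ?thesis .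
qed

text \<open>Simple functions of the first variable with integrable sections, as used in the Bochner integral.\<close>

definition simple_L1 :: "'b measure => 'a measure => ('b => 'a => real) => bool" where
 "simple_L1 N M S \<longleftrightarrow> Bochner_Integration.simple_bochner_integrable N S & (\<forall>r\<in>space N. integrable M (S r))"

lemma simple_L1_measurable:
 "simple_L1 N M S ==> (%w. S (fst w) (snd w)) \<in> bm (N \<otimes> M)"
 by (rule simple_joint_measurable)
   (auto simp: simple_L1_def elim: Bochner_Integration.simple_bochner_integrable.cases)

text \<open>Density of simple functions among jointly integrable ones. It holds for rectangles, passes to measurable sets by the
Dynkin argument, and from there to integrable functions.\<close>

definition approximable :: "'b measure => 'a measure => ('b \<times> 'a => real) => bool" where
 "approximable N M G \<longleftrightarrow> G \<in> bm (N \<otimes> M) &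
   (\<forall>e>0. \<exists>S. simple_L1 N M S & (\<integral>\<^sup>+w. ennreal \<bar>G w - S (fst w) (snd w)\<bar> \<partial>(N \<otimes> M)) < ennreal e)"

lemma approximable_add:
 assumes A: "approximable N M G" and B: "approximable N M H"
 shows "approximable N M (%w. G w + H w)"
 unfolding approximable_def
proof (intro conjI allI impI)
 have [measurable]: "G \<in> bm (N \<otimes> M)" "H \<in> bm (N \<otimes> M)"
  using A B by (auto simp: approximable_def)
 show "(%w. G w + H w) \<in> bm (N \<otimes> M)" by measurable
 fix e :: real assume e: "0 < e"
 obtain S where S: "simple_L1 N M S" "(\<integral>\<^sup>+w. ennreal \<bar>G w - S (fst w) (snd w)\<bar> \<partial>(N \<otimes> M)) < ennreal (e / 2)"
  using A e unfolding approximable_def by (meson half_gt_zero)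
 obtain S' where S': "simple_L1 N M S'" "(\<integral>\<^sup>+w. ennreal \<bar>H w - S' (fst w) (snd w)\<bar> \<partial>(N \<otimes> M)) < ennreal (e / 2)"
  using B e unfolding approximable_def by (meson half_gt_zero)
 note [measurable] = simple_L1_measurable[OF S(1)] simple_L1_measurable[OF S'(1)]
 have "Bochner_Integration.simple_bochner_integrable N (%r. S r + S' r)"
  by (rule Bochner_Integration.simple_bochner_integrable_compose2[where p="(+)"])
    (use S(1) S'(1) in \<open>auto simp: simple_L1_def\<close>)
 then have "simple_L1 N M (%r. S r + S' r)"
  using S(1) S'(1) by (simp add: simple_L1_def) (simp add: plus_fun_def)
 moreover have "(\<integral>\<^sup>+w. ennreal \<bar>G w + H w - (S (fst w) + S' (fst w)) (snd w)\<bar> \<partial>(N \<otimes> M)) < ennreal e"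
 proof -
  have "(\<integral>\<^sup>+w. ennreal \<bar>G w + H w - (S (fst w) + S' (fst w)) (snd w)\<bar> \<partial>(N \<otimes> M))
    <= (\<integral>\<^sup>+w. ennreal \<bar>G w - S (fst w) (snd w)\<bar> + ennreal \<bar>H w - S' (fst w) (snd w)\<bar> \<partial>(N \<otimes> M))"
   by (intro nn_integral_mono) (simp flip: ennreal_plus)
  also have "... = (\<integral>\<^sup>+w. ennreal \<bar>G w - S (fst w) (snd w)\<bar> \<partial>(N \<otimes> M)) + (\<integral>\<^sup>+w. ennreal \<bar>H w - S' (fst w) (snd w)\<bar> \<partial>(N \<otimes> M))"
   by (rule nn_integral_add) measurable
  also have "... < ennreal (e / 2) + ennreal (e / 2)"
   by (rule add_strict_mono[OF S(2) S'(2)])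
  also have "... = ennreal e" using e by (simp flip: ennreal_plus)
  finally show ?thesis .
 qed
 ultimately show "\<exists>S. simple_L1 N M S & (\<integral>\<^sup>+w. ennreal \<bar>G w + H w - S (fst w) (snd w)\<bar> \<partial>(N \<otimes> M)) < ennreal e"
  by blast
qed

lemma approximable_cmult:
 assumes A: "approximable N M G"
 shows "approximable N M (%w. c * G w)"
 unfolding approximable_def
proof (intro conjI allI impI)
 have [measurable]: "G \<in> bm (N \<otimes> M)"
  using A by (auto simp: approximable_def)
 show "(%w. c * G w) \<in> bm (N \<otimes> M)" by measurable
 fix e :: real assume e: "0 < e"
 then have "0 < e / (\<bar>c\<bar> + 1)" by simp
 then obtain S where S: "simple_L1 N M S" "(\<integral>\<^sup>+w. ennreal \<bar>G w - S (fst w) (snd w)\<bar> \<partial>(N \<otimes> M)) < ennreal (e / (\<bar>c\<bar> + 1))"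
  using A unfolding approximable_def by meson
 note [measurable] = simple_L1_measurable[OF S(1)]
 have "Bochner_Integration.simple_bochner_integrable N (%r. c *\<^sub>R S r)"
  by (rule Bochner_Integration.simple_bochner_integrable_compose2[where p="%_ s. c *\<^sub>R s"])
    (use S(1) in \<open>auto simp: simple_L1_def\<close>)
 then have "simple_L1 N M (%r. c *\<^sub>R S r)"
  using S(1) by (simp add: simple_L1_def) (simp add: scaleR_fun_def)
 moreover have "(\<integral>\<^sup>+w. ennreal \<bar>c * G w - (c *\<^sub>R S (fst w)) (snd w)\<bar> \<partial>(N \<otimes> M)) < ennreal e"
 proof -
  have "(\<integral>\<^sup>+w. ennreal \<bar>c * G w - (c *\<^sub>R S (fst w)) (snd w)\<bar> \<partial>(N \<otimes> M))
    = (\<integral>\<^sup>+w. ennreal \<bar>c\<bar> * ennreal \<bar>G w - S (fst w) (snd w)\<bar> \<partial>(N \<otimes> M))"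
   by (intro nn_integral_cong) (simp add: scaleR_fun_def right_diff_distrib[symmetric] abs_mult ennreal_mult)
  also have "... = ennreal \<bar>c\<bar> * (\<integral>\<^sup>+w. ennreal \<bar>G w - S (fst w) (snd w)\<bar> \<partial>(N \<otimes> M))"
   by (rule nn_integral_cmult) measurable
  also have "... <= ennreal \<bar>c\<bar> * ennreal (e / (\<bar>c\<bar> + 1))"
   using S(2) by (intro mult_left_mono) auto
  also have "... = ennreal (\<bar>c\<bar> * (e / (\<bar>c\<bar> + 1)))" by (rule ennreal_mult[symmetric]) (use e in auto)
  also have "... < ennreal e"
   using e by (intro ennreal_lessI) (auto simp: field_simps)
  finally show ?thesis .
 qed
 ultimately show "\<exists>S. simple_L1 N M S & (\<integral>\<^sup>+w. ennreal \<bar>c * G w - S (fst w) (snd w)\<bar> \<partial>(N \<otimes> M)) < ennreal e"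
  by blast
qed

lemma approximable_limit:
 assumes G: "G \<in> bm (N \<otimes> M)" and A: "!!i::nat. approximable N M (s i)"
  and lim: "(%i. \<integral>\<^sup>+w. ennreal \<bar>G w - s i w\<bar> \<partial>(N \<otimes> M)) ----> 0"
 shows "approximable N M G"
 unfolding approximable_def
proof (intro conjI allI impI G)
 note [measurable] = G
 have [measurable]: "s i \<in> bm (N \<otimes> M)" for i using A by (auto simp: approximable_def)
 fix e :: real assume e: "0 < e"
 have "\<forall>\<^sub>F i in sequentially. (\<integral>\<^sup>+w. ennreal \<bar>G w - s i w\<bar> \<partial>(N \<otimes> M)) < ennreal (e / 2)"
  by (rule order_tendstoD(2)[OF lim]) (use e in simp)
 then obtain i where i: "(\<integral>\<^sup>+w. ennreal \<bar>G w - s i w\<bar> \<partial>(N \<otimes> M)) < ennreal (e / 2)"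
  by (auto simp: eventually_sequentially)
 obtain S where S: "simple_L1 N M S" "(\<integral>\<^sup>+w. ennreal \<bar>s i w - S (fst w) (snd w)\<bar> \<partial>(N \<otimes> M)) < ennreal (e / 2)"
  using A[of i] e unfolding approximable_def by (meson half_gt_zero)
 note [measurable] = simple_L1_measurable[OF S(1)]
 have "(\<integral>\<^sup>+w. ennreal \<bar>G w - S (fst w) (snd w)\<bar> \<partial>(N \<otimes> M))
   <= (\<integral>\<^sup>+w. ennreal \<bar>G w - s i w\<bar> + ennreal \<bar>s i w - S (fst w) (snd w)\<bar> \<partial>(N \<otimes> M))"
  by (intro nn_integral_mono) (simp flip: ennreal_plus)
 also have "... = (\<integral>\<^sup>+w. ennreal \<bar>G w - s i w\<bar> \<partial>(N \<otimes> M)) + (\<integral>\<^sup>+w. ennreal \<bar>s i w - S (fst w) (snd w)\<bar> \<partial>(N \<otimes> M))"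
  by (rule nn_integral_add) measurable
 also have "... < ennreal (e / 2) + ennreal (e / 2)" by (rule add_strict_mono[OF i S(2)])
 also have "... = ennreal e" using e by (simp flip: ennreal_plus)
 finally show "\<exists>S. simple_L1 N M S & (\<integral>\<^sup>+w. ennreal \<bar>G w - S (fst w) (snd w)\<bar> \<partial>(N \<otimes> M)) < ennreal e"
  using S(1) by blast
qed

lemma approximable_rectangle:
 assumes a: "a \<in> sets N" "emeasure N a < \<infinity>" and b: "b \<in> sets M" "emeasure M b < \<infinity>"
 shows "approximable N M (indicator (a \<times> b))"
 unfolding approximable_def
proof (intro conjI allI impI)
 show "(indicator (a \<times> b) :: _ => real) \<in> bm (N \<otimes> M)" using a b by measurable
 fix e :: real assume e: "0 < e"
 let ?S = "%r. if r \<in> a then indicator b else (0 :: _ => real)"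
 have "simple_function N ?S" using a by (intro simple_function_If_set simple_function_const) (auto intro: sets.sets_into_space)
 moreover have "emeasure N {r \<in> space N. ?S r ~= 0} <= emeasure N a"
  using a by (intro emeasure_mono) auto
 ultimately have "simple_L1 N M ?S"
  unfolding simple_L1_def using a b
  by (auto intro!: Bochner_Integration.simple_bochner_integrable.intros simp: top_unique zero_fun_def)
 moreover have "(\<integral>\<^sup>+w. ennreal \<bar>indicator (a \<times> b) w - ?S (fst w) (snd w)\<bar> \<partial>(N \<otimes> M)) = (\<integral>\<^sup>+w. 0 \<partial>(N \<otimes> M))"
  by (intro nn_integral_cong) (auto split: split_indicator)
 then have "(\<integral>\<^sup>+w. ennreal \<bar>indicator (a \<times> b) w - ?S (fst w) (snd w)\<bar> \<partial>(N \<otimes> M)) < ennreal e"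
  using e by simp
 ultimately show "\<exists>S. simple_L1 N M S & (\<integral>\<^sup>+w. ennreal \<bar>indicator (a \<times> b) w - S (fst w) (snd w)\<bar> \<partial>(N \<otimes> M)) < ennreal e"
  by blast
qed

lemma approximable_empty: "approximable N M (indicator {})"
proof -
 have "approximable N M (indicator ({} \<times> {}))" by (rule approximable_rectangle) auto
 then show ?thesis by (simp only: Sigma_empty1)
qed

lemma nn_integral_tendsto_0_dominated:
 fixes s :: "nat => 'c => real"
 assumes [measurable]: "!!i. s i \<in> bm M" "f \<in> bm M" "w \<in> bm M"
  and "!!j. AE x in M. \<bar>s j x\<bar> <= w x" "(\<integral>\<^sup>+x. ennreal (w x) \<partial>M) < \<infinity>" "AE x in M. (%i. s i x) ----> f x"
 shows "(%i. \<integral>\<^sup>+x. ennreal \<bar>f x - s i x\<bar> \<partial>M) ----> 0"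
 using nn_integral_dominated_convergence_norm[of s M f w] assms by simp

lemma approximable_indicator:
 assumes N: "sigma_finite_measure N" and M: "sigma_finite_measure M"
  and A: "A \<in> sets (N \<otimes> M)" "emeasure (N \<otimes> M) A < \<infinity>"
 shows "approximable N M (indicator A)"
proof -
 interpret N: sigma_finite_measure N by (rule N)
 interpret M: sigma_finite_measure M by (rule M)
 obtain n where n: "range n \<subseteq> sets N" "(\<Union>i. n i) = space N" "!!i. emeasure N (n i) ~= \<infinity>" "incseq n"
  using N.sigma_finite_incseq by blast
 obtain m where m: "range m \<subseteq> sets M" "(\<Union>i. m i) = space M" "!!i. emeasure M (m i) ~= \<infinity>" "incseq m"
  using M.sigma_finite_incseq by blast
 let ?R = "%i. n i \<times> m i"
 have R[measurable]: "?R i \<in> sets (N \<otimes> M)" for i using n m by auto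
 have Rsub: "?R i \<subseteq> space N \<times> space M" for i
  using sets.sets_into_space[OF R[of i]] by (simp add: space_pair_measure)
 have nfin: "n i \<in> sets N" "emeasure N (n i) < \<infinity>" "m i \<in> sets M" "emeasure M (m i) < \<infinity>" for i
  using n(1) m(1) n(3)[of i] m(3)[of i] by (auto simp: less_top)
 have Rfin: "(\<integral>\<^sup>+x. ennreal (indicator (?R i) x) \<partial>(N \<otimes> M)) < \<infinity>" for i
  using nfin[of i] M.emeasure_pair_measure_Times[of "n i" N "m i"]
  by (simp add: ennreal_mult_less_top ennreal_indicator)
 have part: "approximable N M (indicator (A' \<inter> ?R i))" if "A' \<in> sets (N \<otimes> M)" for A' i
  using Int_stable_pair_measure_generator pair_measure_closed that
  unfolding sets_pair_measure
 proof (induct rule: sigma_sets_induct_disjoint)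
  case (basic B)
  then obtain a b where B: "B = a \<times> b" "a \<in> sets N" "b \<in> sets M" by auto
  have "approximable N M (indicator ((a \<inter> n i) \<times> (b \<inter> m i)))"
  proof (rule approximable_rectangle)
   have "emeasure N (a \<inter> n i) <= emeasure N (n i)" "emeasure M (b \<inter> m i) <= emeasure M (m i)"
    using nfin[of i] by (auto intro!: emeasure_mono)
   then show "emeasure N (a \<inter> n i) < \<infinity>" "emeasure M (b \<inter> m i) < \<infinity>"
    using nfin[of i] by (auto intro: le_less_trans)
  qed (use B nfin[of i] in auto)
  then show ?case by (simp only: B Times_Int_Times)
 next
  case empty
  show ?case using approximable_empty by (simp only: Int_empty_left)
 next
  case (compl B)
  have "approximable N M (%w. indicator (?R i) w + (-1) * indicator (B \<inter> ?R i) w)"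
   by (rule approximable_add[OF approximable_rectangle[OF nfin] approximable_cmult[OF compl(2)]])
  also have "(%w. indicator (?R i) w + (-1) * indicator (B \<inter> ?R i) w) = (indicator ((space N \<times> space M - B) \<inter> ?R i) :: _ => real)"
   using Rsub[of i] by (auto simp: fun_eq_iff split: split_indicator)
  finally show ?case .
 next
  case (union B)
  have B[measurable]: "B j \<in> sets (N \<otimes> M)" for j using union(2) by (auto simp: sets_pair_measure)
  have fin: "approximable N M (indicator ((\<Union>j<k. B j) \<inter> ?R i))" for k
  proof (induction k)
   case 0 show ?case using approximable_empty by (simp only: lessThan_0 UN_empty Int_empty_left)
  next
   case (Suc k)
   have "B k \<inter> B j = {}" if "j < k" for j
    using disjoint_family_onD[OF union(1), of k j] that by simp
   then have "B k \<inter> (\<Union>j<k. B j) = {}" by blast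
   then have eq: "indicator ((\<Union>j<Suc k. B j) \<inter> ?R i) = (%w. indicator ((\<Union>j<k. B j) \<inter> ?R i) w + indicator (B k \<inter> ?R i) w :: real)"
    by (auto simp: fun_eq_iff lessThan_Suc split: split_indicator)
   show ?case unfolding eq by (rule approximable_add[OF Suc union(3)])
  qed
  show ?case
  proof (rule approximable_limit[OF _ fin])
   show "(%k. \<integral>\<^sup>+w. ennreal \<bar>indicator (\<Union>(range B) \<inter> ?R i) w - indicator ((\<Union>j<k. B j) \<inter> ?R i) w\<bar> \<partial>(N \<otimes> M)) ----> 0"
   proof (rule nn_integral_tendsto_0_dominated[OF _ _ _ _ Rfin[of i]])
    show "AE w in N \<otimes> M. (%k. indicator ((\<Union>j<k. B j) \<inter> ?R i) w :: real) ----> indicator (\<Union>(range B) \<inter> ?R i) w"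
    proof (rule AE_I2)
     fix w
     show "(%k. indicator ((\<Union>j<k. B j) \<inter> ?R i) w :: real) ----> indicator (\<Union>(range B) \<inter> ?R i) w"
     proof (cases "w \<in> \<Union>(range B)")
      case True
      then obtain j where "w \<in> B j" by auto
      then have "w \<in> (\<Union>j<k. B j)" if "j < k" for k using that by auto
      then have "\<forall>\<^sub>F k in sequentially. (indicator ((\<Union>j<k. B j) \<inter> ?R i) w :: real) = indicator (\<Union>(range B) \<inter> ?R i) w"
       using True by (intro eventually_sequentiallyI[of "Suc j"]) (auto split: split_indicator)
      then show ?thesis by (rule tendsto_eventually)
     qed (auto split: split_indicator)
    qed
   qed (auto split: split_indicator)
  qed measurable
 qed
 show ?thesis
 proof (rule approximable_limit[OF _ part[OF A(1)]])
  note [measurable] = A(1)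
  show "(indicator A :: _ => real) \<in> bm (N \<otimes> M)" by measurable
  show "(%i. \<integral>\<^sup>+w. ennreal \<bar>indicator A w - indicator (A \<inter> ?R i) w\<bar> \<partial>(N \<otimes> M)) ----> 0"
  proof (rule nn_integral_tendsto_0_dominated[where w="indicator A"])
   show "(\<integral>\<^sup>+w. ennreal (indicator A w) \<partial>(N \<otimes> M)) < \<infinity>" using A by (simp add: ennreal_indicator)
   show "AE w in N \<otimes> M. (%i. indicator (A \<inter> ?R i) w :: real) ----> indicator A w"
   proof (rule AE_I2)
    fix w assume w: "w \<in> space (N \<otimes> M)"
    have "fst w \<in> (\<Union>i. n i)" "snd w \<in> (\<Union>i. m i)"
     unfolding n(2) m(2) using w by (auto simp: space_pair_measure)
    then obtain j l where j: "fst w \<in> n j" and l: "snd w \<in> m l" by blast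
    have "w \<in> ?R i" if "max j l <= i" for i
     using incseqD[OF n(4), of j i] incseqD[OF m(4), of l i] j l that by (cases w) auto
    then have "\<forall>\<^sub>F i in sequentially. (indicator (A \<inter> ?R i) w :: real) = indicator A w"
     by (intro eventually_sequentiallyI[of "max j l"]) (auto split: split_indicator)
    then show "(%i. indicator (A \<inter> ?R i) w :: real) ----> indicator A w" by (rule tendsto_eventually)
   qed
  qed (auto split: split_indicator)
 qed
qed

lemma integrable_approximable:
 fixes G :: "'b \<times> 'a => real"
 assumes N: "sigma_finite_measure N" and M: "sigma_finite_measure M" and G: "integrable (N \<otimes> M) G"
 shows "approximable N M G"
 using G
proof (induct rule: integrable_induct)
 case (base A c)
 then show ?case using approximable_cmult[OF approximable_indicator[OF N M], of A c] by (simp add: mult.commute)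
next
 case (add f g) show ?case by (rule approximable_add[OF add(2) add(4)])
next
 case (lim f s)
 note [measurable] = borel_measurable_integrable[OF lim(5)] borel_measurable_integrable[OF lim(1)]
 show ?case
 proof (rule approximable_limit[OF _ lim(2)])
  show "(%i. \<integral>\<^sup>+w. ennreal \<bar>f w - s i w\<bar> \<partial>(N \<otimes> M)) ----> 0"
  proof (rule nn_integral_tendsto_0_dominated[where w="%x. 2 * \<bar>f x\<bar>"])
   have "integrable (N \<otimes> M) (%x. 2 * \<bar>f x\<bar>)" using lim(5) by simp
   then have "(\<integral>\<^sup>+x. ennreal (norm (2 * \<bar>f x\<bar>)) \<partial>(N \<otimes> M)) < \<infinity>"
    unfolding integrable_iff_bounded by blast
   then show "(\<integral>\<^sup>+x. ennreal (2 * \<bar>f x\<bar>) \<partial>(N \<otimes> M)) < \<infinity>" by simp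
  qed (use lim(3,4) in auto)
 qed measurable
qed

lemma LIMSEQ_0_le_ennreal:
 fixes f g :: "nat => ennreal"
 assumes "g ----> 0" "!!i. f i <= g i"
 shows "f ----> 0"
 by (rule tendsto_sandwich[OF _ _ tendsto_const assms(1)]) (simp_all add: assms(2))

lemma simple_L1_section:
 assumes S: "simple_L1 N M S"
 shows "integrable N (%r. S r x)"
  and "Bochner_Integration.simple_bochner_integral N S x = (LINT r|N. S r x)"
proof -
 have sf: "simple_function N S" and fin: "emeasure N {r \<in> space N. S r ~= 0} ~= \<infinity>"
  using S by (auto simp: simple_L1_def elim: Bochner_Integration.simple_bochner_integrable.cases)
 let ?A = "%c. S -` {c} \<inter> space N"
 have A: "?A c \<in> sets N" for c using sf by (rule simple_functionD)
 have nz: "{r \<in> space N. S r ~= 0} \<in> sets N"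
 proof -
  have "{r \<in> space N. S r ~= 0} = space N - ?A 0" by auto
  then show ?thesis using A by auto
 qed
 have int: "has_bochner_integral N (%r. indicator (?A c) r * c x) (measure N (?A c) * c x)" for c
 proof (cases "c = 0")
  case False
  have "emeasure N (?A c) <= emeasure N {r \<in> space N. S r ~= 0}"
   using False nz by (intro emeasure_mono) auto
  then have "emeasure N (?A c) < \<infinity>" using fin by (auto simp: less_top[symmetric] top_unique)
  then show ?thesis
   by (intro has_bochner_integral_mult_left has_bochner_integral_real_indicator A)
 qed (simp add: has_bochner_integral_zero)
 have "has_bochner_integral N (%r. \<Sum>c\<in>S ` space N. indicator (?A c) r * c x) (\<Sum>c\<in>S ` space N. measure N (?A c) * c x)"
  by (intro has_bochner_integral_sum int)
 also have "?this \<longleftrightarrow> has_bochner_integral N (%r. S r x) (\<Sum>c\<in>S ` space N. measure N (?A c) * c x)"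
  by (intro has_bochner_integral_cong simple_value_eq[OF sf, symmetric] refl)
 finally have h: "has_bochner_integral N (%r. S r x) (\<Sum>c\<in>S ` space N. measure N (?A c) * c x)" .
 then show "integrable N (%r. S r x)" by (rule integrable.intros)
 have "{r \<in> space N. S r = c} = ?A c" for c by auto
 then show "Bochner_Integration.simple_bochner_integral N S x = (LINT r|N. S r x)"
  using has_bochner_integral_integral_eq[OF h]
  by (simp add: Bochner_Integration.simple_bochner_integral_def sum_function_apply scaleR_fun_def)
qed

lemma simple_L1_integral_integrable:
 assumes S: "simple_L1 N M S"
 shows "integrable M (Bochner_Integration.simple_bochner_integral N S)"
proof -
 have eq: "Bochner_Integration.simple_bochner_integral N S
   = (%x. \<Sum>c\<in>S ` space N. measure N {r \<in> space N. S r = c} * c x)"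
  by (simp add: Bochner_Integration.simple_bochner_integral_def sum_function_apply scaleR_fun_def fun_eq_iff)
 show ?thesis
  unfolding eq using S by (intro Bochner_Integration.integrable_sum integrable_mult_right) (auto simp: simple_L1_def)
qed

lemma AE_section_integrable:
 fixes G :: "'b \<times> 'a => real"
 assumes N: "sigma_finite_measure N" and M: "sigma_finite_measure M" and G: "integrable (N \<otimes> M) G"
 shows "AE x in M. integrable N (%r. G (r, x))"
proof -
 interpret N: sigma_finite_measure N by (rule N)
 interpret M: sigma_finite_measure M by (rule M)
 interpret NM: pair_sigma_finite N M ..
 interpret MN: pair_sigma_finite M N ..
 show ?thesis using MN.AE_integrable_fst'[OF NM.integrable_product_swap[OF G]] by simp
qed

lemma simple_integral_dist:
 fixes G :: "'b \<times> 'a => real"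
 assumes N: "sigma_finite_measure N" and M: "sigma_finite_measure M" and G: "integrable (N \<otimes> M) G"
  and S: "simple_L1 N M S"
 shows "(\<integral>\<^sup>+x. ennreal \<bar>Bochner_Integration.simple_bochner_integral N S x - (LINT r|N. G (r, x))\<bar> \<partial>M)
   <= (\<integral>\<^sup>+w. ennreal \<bar>G w - S (fst w) (snd w)\<bar> \<partial>(N \<otimes> M))"
proof -
 interpret N: sigma_finite_measure N by (rule N)
 interpret M: sigma_finite_measure M by (rule M)
 interpret NM: pair_sigma_finite N M ..
 have [measurable]: "G \<in> bm (N \<otimes> M)" "(%w. S (fst w) (snd w)) \<in> bm (N \<otimes> M)"
  using G simple_L1_measurable[OF S] by auto
 have "AE x in M. ennreal \<bar>Bochner_Integration.simple_bochner_integral N S x - (LINT r|N. G (r, x))\<bar>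
   <= (\<integral>\<^sup>+r. ennreal \<bar>G (r, x) - S r x\<bar> \<partial>N)"
  using AE_section_integrable[OF N M G]
 proof eventually_elim
  fix x assume x: "integrable N (%r. G (r, x))"
  have "Bochner_Integration.simple_bochner_integral N S x - (LINT r|N. G (r, x)) = (LINT r|N. S r x - G (r, x))"
   unfolding simple_L1_section(2)[OF S]
   by (rule Bochner_Integration.integral_diff[symmetric]) (use x simple_L1_section(1)[OF S] in auto)
  then show "ennreal \<bar>Bochner_Integration.simple_bochner_integral N S x - (LINT r|N. G (r, x))\<bar>
   <= (\<integral>\<^sup>+r. ennreal \<bar>G (r, x) - S r x\<bar> \<partial>N)"
   using integral_norm_bound_ennreal[of N "%r. S r x - G (r, x)"] x simple_L1_section(1)[OF S, of x]
   by (simp add: abs_minus_commute)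
 qed
 then have "(\<integral>\<^sup>+x. ennreal \<bar>Bochner_Integration.simple_bochner_integral N S x - (LINT r|N. G (r, x))\<bar> \<partial>M)
   <= (\<integral>\<^sup>+x. (\<integral>\<^sup>+r. ennreal \<bar>G (r, x) - S r x\<bar> \<partial>N) \<partial>M)"
  by (rule nn_integral_mono_AE)
 also have "... = (\<integral>\<^sup>+w. ennreal \<bar>G w - S (fst w) (snd w)\<bar> \<partial>(N \<otimes> M))"
  using NM.nn_integral_snd[of "%w. ennreal \<bar>G w - S (fst w) (snd w)\<bar>"] by simp
 finally show ?thesis .
qed

lemma integral_abs_eq_nn:
 fixes \<phi> :: "'a => real"
 assumes "integrable M \<phi>"
 shows "ennreal (LINT x|M. \<bar>\<phi> x\<bar>) = (\<integral>\<^sup>+x. ennreal \<bar>\<phi> x\<bar> \<partial>M)"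
 using assms by (subst nn_integral_eq_integral) auto

text \<open>A vector-valued function is represented by one jointly measurable function. The Bochner integral acts on the former, Fubini's theorem on the
latter.\<close>

definition represents :: "'b measure => 'a measure => ('b => 'a => real) => ('b \<times> 'a => real) => bool" where
 "represents N M g G \<longleftrightarrow> integrable (N \<otimes> M) G &
   (AE r in N. integrable M (g r) & (AE x in M. g r x = G (r, x)))"

lemma represents_dist:
 fixes g :: "'b => 'a => real"
 assumes N: "sigma_finite_measure N" and M: "sigma_finite_measure M"
  and rep: "represents N M g G" and S: "simple_L1 N M S"
 shows "AE r in N. ennreal (Nrm (L1 M) (g r - S r)) = (\<integral>\<^sup>+x. ennreal \<bar>G (r, x) - S r x\<bar> \<partial>M)"
  and "(\<integral>\<^sup>+r. ennreal (Nrm (L1 M) (g r - S r)) \<partial>N) = (\<integral>\<^sup>+w. ennreal \<bar>G w - S (fst w) (snd w)\<bar> \<partial>(N \<otimes> M))"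
proof -
 interpret M: sigma_finite_measure M by (rule M)
 have [measurable]: "G \<in> bm (N \<otimes> M)" "(%w. S (fst w) (snd w)) \<in> bm (N \<otimes> M)"
  using rep simple_L1_measurable[OF S] by (auto simp: represents_def)
 have "AE r in N. integrable M (g r) & (AE x in M. g r x = G (r, x))"
  using rep by (simp add: represents_def)
 then show AE: "AE r in N. ennreal (Nrm (L1 M) (g r - S r)) = (\<integral>\<^sup>+x. ennreal \<bar>G (r, x) - S r x\<bar> \<partial>M)"
  using AE_space
 proof eventually_elim
  fix r assume r: "integrable M (g r) & (AE x in M. g r x = G (r, x))" "r \<in> space N"
  have "integrable M (%x. g r x - S r x)" using r S by (auto simp: simple_L1_def)
  then have "ennreal (Nrm (L1 M) (g r - S r)) = (\<integral>\<^sup>+x. ennreal \<bar>g r x - S r x\<bar> \<partial>M)"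
   by (simp add: integral_abs_eq_nn)
  also have "... = (\<integral>\<^sup>+x. ennreal \<bar>G (r, x) - S r x\<bar> \<partial>M)"
   using r(1) by (intro nn_integral_cong_AE) auto
  finally show "ennreal (Nrm (L1 M) (g r - S r)) = (\<integral>\<^sup>+x. ennreal \<bar>G (r, x) - S r x\<bar> \<partial>M)" .
 qed
 show "(\<integral>\<^sup>+r. ennreal (Nrm (L1 M) (g r - S r)) \<partial>N) = (\<integral>\<^sup>+w. ennreal \<bar>G w - S (fst w) (snd w)\<bar> \<partial>(N \<otimes> M))"
  unfolding nn_integral_cong_AE[OF AE]
  using M.nn_integral_fst[of "%w. ennreal \<bar>G w - S (fst w) (snd w)\<bar>" N] by simp
qed

lemma bochner_approx_simple_L1:
 "bochner_approx (L1 M) N g S ==> simple_L1 N M (S i)"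
 by (auto simp: bochner_approx_def simple_L1_def)

text \<open>Simple approximations of \<open>G\<close> with summable errors converge in almost every section, so they also approximate \<open>g\<close>.\<close>

lemma has_bochner_int_exists:
 fixes g :: "'b => 'a => real"
 assumes N: "sigma_finite_measure N" and M: "sigma_finite_measure M" and rep: "represents N M g G"
 shows "has_bochner_int (L1 M) N g (%x. LINT r|N. G (r, x))"
proof -
 interpret N: sigma_finite_measure N by (rule N)
 interpret M: sigma_finite_measure M by (rule M)
 interpret NM: pair_sigma_finite N M ..
 have G: "integrable (N \<otimes> M) G" using rep by (simp add: represents_def)
 have "\<exists>S. simple_L1 N M S & (\<integral>\<^sup>+w. ennreal \<bar>G w - S (fst w) (snd w)\<bar> \<partial>(N \<otimes> M)) < ennreal ((1/2) ^ i)" for i :: nat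
  using integrable_approximable[OF N M G] unfolding approximable_def by simp
 then obtain S where S: "!!i. simple_L1 N M (S i)"
  and Slt: "!!i. (\<integral>\<^sup>+w. ennreal \<bar>G w - S i (fst w) (snd w)\<bar> \<partial>(N \<otimes> M)) < ennreal ((1/2) ^ i)"
  using choice[of "%i S. simple_L1 N M S & (\<integral>\<^sup>+w. ennreal \<bar>G w - S (fst w) (snd w)\<bar> \<partial>(N \<otimes> M)) < ennreal ((1/2) ^ i)"]
  by blast
 have [measurable]: "G \<in> bm (N \<otimes> M)" using G by auto
 note [measurable] = simple_L1_measurable[OF S]
 have half0: "(%i. ennreal ((1/2) ^ i)) ----> 0"
  using tendsto_ennrealI[OF LIMSEQ_realpow_zero[of "1/2"]] by simp
 have lim0: "(%i. \<integral>\<^sup>+w. ennreal \<bar>G w - S i (fst w) (snd w)\<bar> \<partial>(N \<otimes> M)) ----> 0"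
  by (rule LIMSEQ_0_le_ennreal[OF half0 less_imp_le[OF Slt]])
 let ?u = "%i r. \<integral>\<^sup>+x. ennreal \<bar>G (r, x) - S i r x\<bar> \<partial>M"
 have um[measurable]: "?u i \<in> bm N" for i
  by (rule M.borel_measurable_nn_integral) (simp add: split_beta')
 have ui: "(\<integral>\<^sup>+r. ?u i r \<partial>N) = (\<integral>\<^sup>+w. ennreal \<bar>G w - S i (fst w) (snd w)\<bar> \<partial>(N \<otimes> M))" for i
  using M.nn_integral_fst[of "%w. ennreal \<bar>G w - S i (fst w) (snd w)\<bar>" N] by simp
 have "(\<integral>\<^sup>+r. (\<Sum>i. ?u i r) \<partial>N) = (\<Sum>i. \<integral>\<^sup>+r. ?u i r \<partial>N)" by (rule nn_integral_suminf) simp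
 also have "... <= (\<Sum>i. ennreal ((1/2) ^ i))"
  unfolding ui by (intro suminf_le less_imp_le[OF Slt]) auto
 also have "... = ennreal (1 / (1 - 1/2))"
  by (rule suminf_ennreal_eq[OF _ geometric_sums]) auto
 finally have "(\<integral>\<^sup>+r. (\<Sum>i. ?u i r) \<partial>N) ~= \<infinity>"
  by (auto simp: top_unique)
 then have "AE r in N. (\<Sum>i. ?u i r) ~= \<infinity>"
  by (intro nn_integral_PInf_AE) simp
 then have AE0: "AE r in N. (%i. ?u i r) ----> 0"
 proof eventually_elim
  fix r assume fin: "(\<Sum>i. ?u i r) ~= \<infinity>"
  have ufin: "?u i r ~= \<infinity>" for i
   using ennreal_suminf_lessD[of "%i. ?u i r" top i] fin by (simp add: less_top)
  have "summable (%i. enn2real (?u i r))"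
   by (rule summable_suminf_not_top) (use fin ufin in \<open>simp_all add: less_top\<close>)
  then have "(%i. enn2real (?u i r)) ----> 0" by (rule summable_LIMSEQ_zero)
  then have "(%i. ennreal (enn2real (?u i r))) ----> 0" using tendsto_ennrealI by fastforce
  then show "(%i. ?u i r) ----> 0" using ufin by (simp add: less_top)
 qed
 have "bochner_approx (L1 M) N g S"
  unfolding bochner_approx_def
 proof (intro conjI allI)
  show "Bochner_Integration.simple_bochner_integrable N (S i)" "S i ` space N \<subseteq> Car (L1 M)" for i
   using S[of i] by (auto simp: simple_L1_def)
  have AEu: "AE r in N. \<forall>i. ennreal (Nrm (L1 M) (g r - S i r)) = ?u i r"
   unfolding AE_all_countable by (intro allI represents_dist(1)[OF N M rep S])
  have "AE r in N. integrable M (g r) & (AE x in M. g r x = G (r, x))"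
   using rep by (simp add: represents_def)
  then show "AE r in N. g r \<in> Car (L1 M) & (%i. Nrm (L1 M) (g r - S i r)) ----> 0"
   using AEu AE0
  proof eventually_elim
   case (elim r)
   then have "(%i. ennreal (Nrm (L1 M) (g r - S i r))) ----> ennreal 0" by simp
   then have "(%i. Nrm (L1 M) (g r - S i r)) ----> 0"
    by (subst (asm) tendsto_ennreal_iff) auto
   then show ?case using elim by simp
  qed
  show "(%i. \<integral>\<^sup>+r. ennreal (Nrm (L1 M) (g r - S i r)) \<partial>N) ----> 0"
   unfolding represents_dist(2)[OF N M rep S] by (rule lim0)
 qed
 moreover have Gint: "integrable M (%x. LINT r|N. G (r, x))"
  using NM.integrable_snd[of "%r x. G (r, x)"] G by simp
 moreover have "(%i. Nrm (L1 M) (Bochner_Integration.simple_bochner_integral N (S i) - (%x. LINT r|N. G (r, x)))) ----> 0"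
 proof -
  have "ennreal (Nrm (L1 M) (Bochner_Integration.simple_bochner_integral N (S i) - (%x. LINT r|N. G (r, x))))
    <= (\<integral>\<^sup>+w. ennreal \<bar>G w - S i (fst w) (snd w)\<bar> \<partial>(N \<otimes> M))" for i
  proof -
   have "integrable M (%x. Bochner_Integration.simple_bochner_integral N (S i) x - (LINT r|N. G (r, x)))"
    by (intro Bochner_Integration.integrable_diff simple_L1_integral_integrable[OF S] Gint)
   then show ?thesis using simple_integral_dist[OF N M G S[of i]] by (simp add: integral_abs_eq_nn)
  qed
  then have "(%i. ennreal (Nrm (L1 M) (Bochner_Integration.simple_bochner_integral N (S i) - (%x. LINT r|N. G (r, x))))) ----> 0"
   by (rule LIMSEQ_0_le_ennreal[OF lim0])
  then have "(%i. ennreal (Nrm (L1 M) (Bochner_Integration.simple_bochner_integral N (S i) - (%x. LINT r|N. G (r, x))))) ----> ennreal 0"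
   by simp
  then show ?thesis by (subst (asm) tendsto_ennreal_iff) auto
 qed
 ultimately show ?thesis unfolding has_bochner_int_def by auto
qed

text \<open>Two approximating sequences have integrals whose distance is bounded by the sum of their mean distances to \<open>g\<close>.\<close>

lemma has_bochner_int_unique:
 fixes g :: "'b => 'a => real"
 assumes N: "sigma_finite_measure N" and M: "sigma_finite_measure M" and rep: "represents N M g G"
  and y: "has_bochner_int (L1 M) N g y"
 shows "integrable M y" and "AE x in M. y x = (LINT r|N. G (r, x))"
proof -
 interpret N: sigma_finite_measure N by (rule N)
 interpret M: sigma_finite_measure M by (rule M)
 interpret NM: pair_sigma_finite N M ..
 have G: "integrable (N \<otimes> M) G" using rep by (simp add: represents_def)
 show yint: "integrable M y" using y by (simp add: has_bochner_int_def)
 obtain S where S: "bochner_approx (L1 M) N g S"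
  and Sy: "(%i. Nrm (L1 M) (Bochner_Integration.simple_bochner_integral N (S i) - y)) ----> 0"
  using y by (auto simp: has_bochner_int_def)
 note Si = bochner_approx_simple_L1[OF S]
 let ?I = "%i. Bochner_Integration.simple_bochner_integral N (S i)"
 let ?G = "%x. LINT r|N. G (r, x)"
 have Gint: "integrable M ?G"
  using NM.integrable_snd[of "%r x. G (r, x)"] G by simp
 note [measurable] = borel_measurable_integrable[OF Gint] borel_measurable_integrable[OF yint]
  borel_measurable_integrable[OF simple_L1_integral_integrable[OF Si]]
 have "(%i. \<integral>\<^sup>+w. ennreal \<bar>G w - S i (fst w) (snd w)\<bar> \<partial>(N \<otimes> M)) ----> 0"
  using S unfolding bochner_approx_def represents_dist(2)[OF N M rep Si] by blast
 then have 1: "(%i. \<integral>\<^sup>+x. ennreal \<bar>?I i x - ?G x\<bar> \<partial>M) ----> 0"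
  by (rule LIMSEQ_0_le_ennreal) (rule simple_integral_dist[OF N M G Si])
 have "(%i. ennreal (Nrm (L1 M) (?I i - y))) ----> 0" using tendsto_ennrealI[OF Sy] by simp
 moreover have "ennreal (Nrm (L1 M) (?I i - y)) = (\<integral>\<^sup>+x. ennreal \<bar>?I i x - y x\<bar> \<partial>M)" for i
  using Bochner_Integration.integrable_diff[OF simple_L1_integral_integrable[OF Si] yint, of i] by (simp add: integral_abs_eq_nn)
 ultimately have 2: "(%i. \<integral>\<^sup>+x. ennreal \<bar>?I i x - y x\<bar> \<partial>M) ----> 0" by simp
 have "(\<integral>\<^sup>+x. ennreal \<bar>y x - ?G x\<bar> \<partial>M) <= (\<integral>\<^sup>+x. ennreal \<bar>?I i x - ?G x\<bar> \<partial>M) + (\<integral>\<^sup>+x. ennreal \<bar>?I i x - y x\<bar> \<partial>M)" for i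
 proof -
  have "(\<integral>\<^sup>+x. ennreal \<bar>y x - ?G x\<bar> \<partial>M) <= (\<integral>\<^sup>+x. ennreal \<bar>?I i x - ?G x\<bar> + ennreal \<bar>?I i x - y x\<bar> \<partial>M)"
   by (intro nn_integral_mono) (simp flip: ennreal_plus)
  also have "... = (\<integral>\<^sup>+x. ennreal \<bar>?I i x - ?G x\<bar> \<partial>M) + (\<integral>\<^sup>+x. ennreal \<bar>?I i x - y x\<bar> \<partial>M)"
   by (rule nn_integral_add) measurable
  finally show ?thesis .
 qed
 then have "(\<integral>\<^sup>+x. ennreal \<bar>y x - ?G x\<bar> \<partial>M) <= 0"
  using LIMSEQ_le_const[OF tendsto_add[OF 1 2]] by auto
 then have "(\<integral>\<^sup>+x. ennreal \<bar>y x - ?G x\<bar> \<partial>M) = 0" by simp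
 then have "AE x in M. ennreal \<bar>y x - ?G x\<bar> = 0"
  by (subst (asm) nn_integral_0_iff_AE) auto
 then show "AE x in M. y x = ?G x" by eventually_elim simp
qed

text \<open>A Bochner integral in \<open>F1\<close> becomes one in \<open>F2\<close> when \<open>R\<close> is a seminorm-preserving linear relation between them: approximating simple functions are replaced value by
value. It reduces integrals of functions of time, as elements of \<open>L1_time\<close>, to integrals in a space \<open>L1\<close> over time and state.\<close>

lemma has_bochner_int_transfer:
 fixes F1 :: "('v::real_vector) space_rep" and F2 :: "('w::real_vector) space_rep"
 assumes total: "!!f. f \<in> Car F1 ==> \<exists>G. R f G"
  and Car: "!!f G. R f G ==> f \<in> Car F1 & G \<in> Car F2"
  and zero: "R 0 0"
  and add: "!!f f' G G'. R f G ==> R f' G' ==> R (f + f') (G + G')"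
  and scale: "!!f G c. R f G ==> R (c *\<^sub>R f) (c *\<^sub>R G)"
  and Nrm: "!!f G. R f G ==> Nrm F1 f = Nrm F2 G"
  and g: "AE r in N. R (g r) (H r)"
  and y: "has_bochner_int F1 N g y" "R y z"
 shows "has_bochner_int F2 N H z"
proof -
 have diff: "R (f - f') (G - G')" if "R f G" "R f' G'" for f f' G G'
  using add[OF that(1) scale[OF that(2), of "-1"]] by simp
 obtain S where S: "bochner_approx F1 N g S"
  and Sy: "(%i. Nrm F1 (Bochner_Integration.simple_bochner_integral N (S i) - y)) ----> 0"
  using y by (auto simp: has_bochner_int_def)
 have Si: "Bochner_Integration.simple_bochner_integrable N (S i)" and SCar: "S i ` space N \<subseteq> Car F1" for i
  using S by (auto simp: bochner_approx_def)
 have sf: "simple_function N (S i)" and fin: "emeasure N {r \<in> space N. S i r ~= 0} ~= \<infinity>" for i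
  using Si[of i] by (auto elim: Bochner_Integration.simple_bochner_integrable.cases)
 define \<rho> where "\<rho> f = (if f = 0 then 0 else SOME G. R f G)" for f
 have \<rho>: "R f (\<rho> f)" if "f \<in> Car F1" for f
  using total[OF that] zero by (auto simp: \<rho>_def intro: someI_ex)
 let ?S = "%i r. \<rho> (S i r)"
 have sf2: "simple_function N (?S i)" for i by (rule simple_function_compose1[OF sf])
 have "{r \<in> space N. S i r ~= 0} \<in> sets N" for i
 proof -
  have "{r \<in> space N. S i r ~= 0} = space N - (S i -` {0} \<inter> space N)" by auto
  then show ?thesis using simple_functionD(2)[OF sf[of i], of "{0}"] by auto
 qed
 then have le: "emeasure N {r \<in> space N. ?S i r ~= 0} <= emeasure N {r \<in> space N. S i r ~= 0}" for i
  by (intro emeasure_mono) (auto simp: \<rho>_def)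
 have fin2: "emeasure N {r \<in> space N. ?S i r ~= 0} ~= \<infinity>" for i
 proof
  assume "emeasure N {r \<in> space N. ?S i r ~= 0} = \<infinity>"
  with le[of i] have "emeasure N {r \<in> space N. S i r ~= 0} = \<infinity>" by (simp only: infinity_ennreal_def top_unique)
  with fin[of i] show False by (rule notE)
 qed
 have simp2: "Bochner_Integration.simple_bochner_integrable N (?S i)" for i
  by (rule Bochner_Integration.simple_bochner_integrable.intros[OF sf2 fin2])
 have RS: "R (S i r) (?S i r)" if "r \<in> space N" for i r
  using SCar[of i] that by (intro \<rho>) auto
 have nrm: "AE r in N. \<forall>i. Nrm F2 (H r - ?S i r) = Nrm F1 (g r - S i r)"
  using g AE_space by eventually_elim (auto intro: Nrm[symmetric] diff RS)
 have RI: "R (Bochner_Integration.simple_bochner_integral N (S i)) (Bochner_Integration.simple_bochner_integral N (?S i))" for i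
 proof -
  have "R (\<Sum>c\<in>C. m c *\<^sub>R c) (\<Sum>c\<in>C. m c *\<^sub>R \<rho> c)" if "finite C" "C \<subseteq> Car F1" for C and m :: "'v => real"
   using that by (induction C rule: finite_induct) (auto intro!: zero add scale \<rho>)
  moreover have "Bochner_Integration.simple_bochner_integral N (?S i)
    = (\<Sum>c\<in>S i ` space N. measure N {r \<in> space N. S i r = c} *\<^sub>R \<rho> c)"
   by (rule Bochner_Integration.simple_bochner_integral_partition[OF simp2 sf]) auto
  moreover have "finite (S i ` space N)" using sf by (rule simple_functionD)
  ultimately show ?thesis
   using SCar by (simp add: Bochner_Integration.simple_bochner_integral_def)
 qed
 have "bochner_approx F2 N H ?S"
  unfolding bochner_approx_def
 proof (intro conjI allI)
  show "?S i ` space N \<subseteq> Car F2" for i using RS Car by blast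
  have "AE r in N. g r \<in> Car F1 & (%i. Nrm F1 (g r - S i r)) ----> 0"
   using S by (simp add: bochner_approx_def)
  then show "AE r in N. H r \<in> Car F2 & (%i. Nrm F2 (H r - ?S i r)) ----> 0"
   using nrm g by eventually_elim (use Car in auto)
  have "(\<integral>\<^sup>+r. ennreal (Nrm F2 (H r - ?S i r)) \<partial>N) = (\<integral>\<^sup>+r. ennreal (Nrm F1 (g r - S i r)) \<partial>N)" for i
   using nrm by (intro nn_integral_cong_AE) auto
  then show "(%i. \<integral>\<^sup>+r. ennreal (Nrm F2 (H r - ?S i r)) \<partial>N) ----> 0"
   using S by (simp add: bochner_approx_def)
 qed (rule simp2)
 moreover have "(%i. Nrm F2 (Bochner_Integration.simple_bochner_integral N (?S i) - z)) ----> 0"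
  using Sy Nrm[OF diff[OF RI y(2)]] by simp
 ultimately show ?thesis using Car[OF y(2)] by (auto simp: has_bochner_int_def)
qed

subsection \<open>Lebesgue measure on the time axis and its completion\<close>

lemma nn_integral_lebesgue_on:
 assumes "A \<in> sets borel"
 shows "(\<integral>\<^sup>+r. f r \<partial>lebesgue_on A) = (\<integral>\<^sup>+r. f r \<partial>restrict_space lborel A)"
 using assms by (simp add: nn_integral_restrict_space nn_integral_completion)

lemma AE_lebesgue_on:
 assumes "A \<in> sets borel"
 shows "(AE r in lebesgue_on A. P r) \<longleftrightarrow> (AE r in restrict_space lborel A. P r)"
 using assms by (simp add: AE_restrict_space_iff AE_completion_iff)

lemma measurable_lebesgue_on:
 assumes "A \<in> sets borel" "f \<in> restrict_space lborel A \<rightarrow>\<^sub>M L"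
 shows "f \<in> lebesgue_on A \<rightarrow>\<^sub>M L"
proof -
 have "(%r. r) \<in> lebesgue_on A \<rightarrow>\<^sub>M restrict_space lborel A"
  using assms(1) by (intro measurable_restrict_space3 measurable_completion) auto
 from measurable_compose[OF this assms(2)] show ?thesis .
qed

lemma sigma_finite_lborel_on: "A \<in> sets borel ==> sigma_finite_measure (restrict_space (lborel :: real measure) A)"
 by (rule sigma_finite_measure_restrict_space) (auto intro: sigma_finite_lborel)

lemma sigma_finite_lebesgue_on:
 assumes "A \<in> sets borel"
 shows "sigma_finite_measure (lebesgue_on (A :: real set))"
proof (rule sigma_finite_measure_restrict_space)
 show "sigma_finite_measure (lebesgue :: real measure)"
 proof
  obtain F :: "nat => real set" where F: "range F \<subseteq> sets lborel" "(\<Union>i. F i) = space lborel" "!!i. emeasure lborel (F i) ~= \<infinity>"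
   using lborel.sigma_finite by blast
  then show "\<exists>A. countable A & A \<subseteq> sets (lebesgue :: real measure) & \<Union> A = space (lebesgue :: real measure) & (\<forall>a\<in>A. emeasure (lebesgue :: real measure) a ~= \<infinity>)"
   by (intro exI[of _ "range F"]) (auto simp: range_subsetD)
 qed
qed (use assms in auto)

lemma complete_lebesgue_on:
 assumes "A \<in> sets borel"
 shows "complete_measure (lebesgue_on (A :: real set))"
proof
 fix B N assume "B \<subseteq> N" "N \<in> null_sets (lebesgue_on A)"
 then have N: "N \<subseteq> A" "N \<in> null_sets lebesgue" using assms by (auto simp: null_sets_restrict_space)
 then have "B \<in> sets lebesgue" using \<open>B \<subseteq> N\<close> by (metis completion.complete)
 then show "B \<in> sets (lebesgue_on A)"
  using N \<open>B \<subseteq> N\<close> assms by (subst sets_restrict_space_iff) auto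
qed

text \<open>Completed Lebesgue measure makes functions that agree almost everywhere with a Borel function measurable.\<close>

lemma borel_measurable_lebesgue_on_AE:
 fixes f g :: "real => real"
 assumes A: "A \<in> sets borel" and g: "g \<in> bm (lebesgue_on A)" and AE: "AE r in lebesgue_on A. f r = g r"
 shows "f \<in> bm (lebesgue_on A)"
proof (rule measurableI)
 interpret complete_measure "lebesgue_on A" by (rule complete_lebesgue_on[OF A])
 fix B :: "real set" assume B: "B \<in> sets borel"
 show "f -` B \<inter> space (lebesgue_on A) \<in> sets (lebesgue_on A)"
 proof (rule in_sets_AE[of "g -` B \<inter> space (lebesgue_on A)"])
  show "g -` B \<inter> space (lebesgue_on A) \<in> sets (lebesgue_on A)" by (rule measurable_sets[OF g B])
  show "AE x in lebesgue_on A. x \<in> g -` B \<inter> space (lebesgue_on A) \<longleftrightarrow> x \<in> f -` B \<inter> space (lebesgue_on A)"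
   using AE by eventually_elim auto
 qed auto
qed simp

lemma represents_lebesgue_on:
 assumes A: "A \<in> sets borel" and M: "sigma_finite_measure M"
  and rep: "represents (restrict_space lborel A) M g G"
 shows "represents (lebesgue_on A) M g G"
  and "AE x in M. (LINT r|lebesgue_on A. G (r, x)) = (LINT r|restrict_space lborel A. G (r, x))"
proof -
 interpret M: sigma_finite_measure M by (rule M)
 have G: "integrable (restrict_space lborel A \<otimes> M) G" using rep by (simp add: represents_def)
 have "(%r. r) \<in> lebesgue_on A \<rightarrow>\<^sub>M restrict_space lborel A"
  by (rule measurable_lebesgue_on[OF A]) simp
 then have "(%w. (fst w, snd w)) \<in> lebesgue_on A \<otimes> M \<rightarrow>\<^sub>M restrict_space lborel A \<otimes> M"
  by (intro measurable_Pair measurable_snd) (rule measurable_compose[OF measurable_fst])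
 then have "(%w. G (fst w, snd w)) \<in> bm (lebesgue_on A \<otimes> M)"
  by (rule measurable_compose) (use G in auto)
 then have Gm[measurable]: "G \<in> bm (lebesgue_on A \<otimes> M)" by simp
 have [measurable]: "G \<in> bm (restrict_space lborel A \<otimes> M)" using G by auto
 have "(\<integral>\<^sup>+w. ennreal (norm (G w)) \<partial>(lebesgue_on A \<otimes> M)) = (\<integral>\<^sup>+w. ennreal (norm (G w)) \<partial>(restrict_space lborel A \<otimes> M))"
  using M.nn_integral_fst[of "%w. ennreal (norm (G w))" "lebesgue_on A"]
   M.nn_integral_fst[of "%w. ennreal (norm (G w))" "restrict_space lborel A"]
  by (simp add: nn_integral_lebesgue_on[OF A])
 then have "integrable (lebesgue_on A \<otimes> M) G"
  using G Gm by (simp add: integrable_iff_bounded)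
 then show "represents (lebesgue_on A) M g G"
  using rep by (simp add: represents_def AE_lebesgue_on[OF A])
 show "AE x in M. (LINT r|lebesgue_on A. G (r, x)) = (LINT r|restrict_space lborel A. G (r, x))"
 proof (rule AE_I2)
  fix x assume "x \<in> space M"
  then have "(%r. G (r, x)) \<in> bm (restrict_space lborel A)" by measurable
  then have "(%r. G (r, x) * indicator A r) \<in> bm lborel"
   using A by (subst (asm) borel_measurable_restrict_space_iff) (auto simp: mult.commute)
  then show "(LINT r|lebesgue_on A. G (r, x)) = (LINT r|restrict_space lborel A. G (r, x))"
   using A by (simp add: integral_restrict_space integral_completion mult.commute)
 qed
qed

lemma simple_function_restrict_space:
 assumes f: "simple_function N f"
 shows "simple_function (restrict_space N A) f"
proof -
 have "f \<in> restrict_space N A \<rightarrow>\<^sub>M count_space UNIV"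
  by (rule measurable_restrict_space1[OF measurable_simple_function[OF f]])
 moreover have "finite (f ` space (restrict_space N A))"
  by (rule finite_subset[OF _ simple_functionD(1)[OF f]]) (auto simp: space_restrict_space)
 ultimately show ?thesis by (auto simp: simple_function_def intro: measurable_sets)
qed

lemma simple_function_lebesgue_on:
 assumes A: "A \<in> sets borel" and S: "simple_function (lebesgue_on A) S"
 shows "\<exists>S'. simple_function (restrict_space lborel A) S' & (AE r in restrict_space lborel A. S r = S' r)
      & S' ` A \<subseteq> insert z (S ` A)"
proof -
 let ?T = "%r. if r \<in> A then S r else z"
 have "simple_function (completion lborel) ?T"
  unfolding simple_function_def
 proof (intro conjI ballI)
  have "finite (S ` A)" using S by (simp add: simple_function_def)
  moreover have "?T ` space (completion lborel) \<subseteq> insert z (S ` A)" by auto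
  ultimately show "finite (?T ` space (completion lborel))" by (meson finite_insert finite_subset)
  fix c
  have "S -` {c} \<inter> A \<in> sets (lebesgue_on A)" using simple_functionD(2)[OF S, of "{c}"] by simp
  then have 1: "S -` {c} \<inter> A \<in> sets lebesgue" using A by (simp add: sets_restrict_space_iff)
  have "?T -` {c} \<inter> space (completion lborel) = (S -` {c} \<inter> A) \<union> (if c = z then - A else {})"
   by (auto split: if_splits)
  also have "... \<in> sets lebesgue"
  proof -
   have "- A \<in> sets lebesgue" using A by (intro sets_completionI_sets) auto
   then show ?thesis using 1 by auto
  qed
  finally show "?T -` {c} \<inter> space (completion lborel) \<in> sets (completion lborel)" .
 qed
 from completion_ex_simple_function[OF this] obtain T' where
  T': "simple_function lborel T'" "AE r in lborel. ?T r = T' r" by blast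
 let ?S' = "%r. if T' r \<in> S ` A then T' r else z"
 have "simple_function lborel ?S'"
  using simple_function_compose1[OF T'(1), of "%c. if c \<in> S ` A then c else z"] by simp
 then have "simple_function (restrict_space lborel A) ?S'"
  by (rule simple_function_restrict_space)
 moreover have "AE r in restrict_space lborel A. S r = ?S' r"
 proof -
  have "AE r in lborel. r \<in> A --> S r = ?S' r" using T'(2) by eventually_elim (simp, metis imageI)
  then show ?thesis using A by (simp add: AE_restrict_space_iff)
 qed
 ultimately show ?thesis by (intro exI[of _ ?S']) auto
qed

section \<open>Integrable functions of time and state\<close>

lemma simple_L1_integrable:
 assumes M: "sigma_finite_measure M" and S: "simple_L1 N M S"
 shows "integrable (N \<otimes> M) (%w. S (fst w) (snd w))"
proof (rule integrableI_bounded)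
 interpret M: sigma_finite_measure M by (rule M)
 note [measurable] = simple_L1_measurable[OF S]
 show "(%w. S (fst w) (snd w)) \<in> bm (N \<otimes> M)" by measurable
 have sf: "simple_function N S" and fin: "emeasure N {r \<in> space N. S r ~= 0} ~= \<infinity>"
  and int: "!!r. r \<in> space N ==> integrable M (S r)"
  using S by (auto simp: simple_L1_def elim: Bochner_Integration.simple_bochner_integrable.cases)
 have nz[measurable]: "{r \<in> space N. S r ~= 0} \<in> sets N"
 proof -
  have "{r \<in> space N. S r ~= 0} = space N - (S -` {0} \<inter> space N)" by auto
  then show ?thesis using simple_functionD(2)[OF sf, of "{0}"] by auto
 qed
 let ?n = "%c. \<integral>\<^sup>+x. ennreal \<bar>c x\<bar> \<partial>M"
 let ?K = "\<Sum>c\<in>S ` space N. ?n c"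
 have finS: "finite (S ` space N)" by (rule simple_functionD[OF sf])
 have K: "?K < \<infinity>"
  using finS int by (auto simp: integrable_iff_bounded less_top[symmetric])
 have "(\<integral>\<^sup>+w. ennreal (norm (S (fst w) (snd w))) \<partial>(N \<otimes> M)) = (\<integral>\<^sup>+r. ?n (S r) \<partial>N)"
  using M.nn_integral_fst[of "%w. ennreal (norm (S (fst w) (snd w)))" N] by simp
 also have "... <= (\<integral>\<^sup>+r. ?K * indicator {r \<in> space N. S r ~= 0} r \<partial>N)"
 proof (rule nn_integral_mono)
  fix r assume r: "r \<in> space N"
  then have "?n (S r) <= ?K" using finS by (intro member_le_sum) auto
  then show "?n (S r) <= ?K * indicator {r \<in> space N. S r ~= 0} r"
   using r by (auto split: split_indicator)
 qed
 also have "... = ?K * emeasure N {r \<in> space N. S r ~= 0}" by (rule nn_integral_cmult_indicator) measurable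
 also have "... < \<infinity>" using K fin by (simp add: ennreal_mult_less_top less_top)
 finally show "(\<integral>\<^sup>+w. ennreal (norm (S (fst w) (snd w))) \<partial>(N \<otimes> M)) < \<infinity>" .
qed

abbreviation time_represents :: "'a measure => (real => 'a => real) => (real \<times> 'a => real) => bool" where
 "time_represents \<equiv> represents half_line"

lemma half_line_borel: "{0..} \<in> sets (borel :: real measure)" by simp

lemma sigma_finite_half_line: "sigma_finite_measure half_line"
 by (rule sigma_finite_lborel_on) simp

lemma L1_time_simps:
 "Car (L1_time F) = {f. bochner_integrable F (lebesgue_on {0..}) f}"
 "Nrm (L1_time F) f = (LINT s|lebesgue_on {0..}. Nrm F (f s))"
 "Pos (L1_time F) = {f. bochner_integrable F (lebesgue_on {0..}) f & (AE s in lebesgue_on {0..}. f s \<in> Pos F)}"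
 by (simp_all add: L1_time_def)

lemma time_represents_Car:
 assumes M: "sigma_finite_measure M" and rep: "time_represents M f G"
 shows "f \<in> Car (L1_time (L1 M))"
 using has_bochner_int_exists[OF sigma_finite_lebesgue_on[OF half_line_borel] M represents_lebesgue_on(1)[OF half_line_borel M rep]]
 by (auto simp: L1_time_simps has_bochner_int_def bochner_integrable_def)

lemma time_integral_eq:
 assumes \<psi>: "\<psi> \<in> bm half_line" and AE: "AE s in half_line. \<phi> s = (\<psi> s :: real)"
 shows "(LINT s|lebesgue_on {0..}. \<phi> s) = (LINT s|half_line. \<psi> s)"
proof -
 have \<psi>': "\<psi> \<in> bm (lebesgue_on {0..})" by (rule measurable_lebesgue_on[OF half_line_borel \<psi>])
 have AE': "AE s in lebesgue_on {0..}. \<phi> s = \<psi> s" using AE by (simp add: AE_lebesgue_on)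
 have "(LINT s|lebesgue_on {0..}. \<phi> s) = (LINT s|lebesgue_on {0..}. \<psi> s)"
  by (rule integral_cong_AE[OF borel_measurable_lebesgue_on_AE[OF half_line_borel \<psi>' AE'] \<psi>' AE'])
 also have "... = (LINT s|half_line. \<psi> s)"
 proof -
  have "(%s. \<psi> s * indicator {0..} s) \<in> bm lborel"
   using \<psi> by (subst (asm) borel_measurable_restrict_space_iff) (auto simp: mult.commute)
  then show ?thesis by (simp add: integral_restrict_space integral_completion mult.commute)
 qed
 finally show ?thesis .
qed

lemma time_represents_integral:
 assumes M: "sigma_finite_measure M" and rep: "time_represents M f G"
 shows "(LINT s|lebesgue_on {0..}. LINT x|M. f s x) = (LINT w|(half_line \<otimes> M). G w)"
  and "(LINT s|lebesgue_on {0..}. LINT x|M. \<bar>f s x\<bar>) = (LINT w|(half_line \<otimes> M). \<bar>G w\<bar>)"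
  and "integrable (lebesgue_on {0..}) (%s. LINT x|M. f s x)"
  and "integrable (lebesgue_on {0..}) (%s. LINT x|M. \<bar>f s x\<bar>)"
proof -
 interpret M: sigma_finite_measure M by (rule M)
 interpret H: sigma_finite_measure half_line by (rule sigma_finite_half_line)
 interpret HM: pair_sigma_finite half_line M ..
 have G: "integrable (half_line \<otimes> M) G" "integrable (half_line \<otimes> M) (%w. \<bar>G w\<bar>)"
  using rep by (auto simp: represents_def)
 have [measurable]: "G \<in> bm (half_line \<otimes> M)" using G by auto
 have AE: "AE s in half_line. integrable M (f s) & (AE x in M. f s x = G (s, x))"
  using rep by (simp add: represents_def)
 have 1: "AE s in half_line. (LINT x|M. f s x) = (LINT x|M. G (s, x))"
  using AE AE_space
 proof eventually_elim
  fix s assume s: "integrable M (f s) & (AE x in M. f s x = G (s, x))" "s \<in> space half_line"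
  show "(LINT x|M. f s x) = (LINT x|M. G (s, x))"
   by (rule integral_cong_AE) (use s in auto)
 qed
 have 2: "AE s in half_line. (LINT x|M. \<bar>f s x\<bar>) = (LINT x|M. \<bar>G (s, x)\<bar>)"
  using AE AE_space
 proof eventually_elim
  fix s assume s: "integrable M (f s) & (AE x in M. f s x = G (s, x))" "s \<in> space half_line"
  show "(LINT x|M. \<bar>f s x\<bar>) = (LINT x|M. \<bar>G (s, x)\<bar>)"
   by (rule integral_cong_AE) (use s in auto)
 qed
 show "(LINT s|lebesgue_on {0..}. LINT x|M. f s x) = (LINT w|(half_line \<otimes> M). G w)"
  using time_integral_eq[OF _ 1] HM.integral_fst'[OF G(1)] by simp
 show "(LINT s|lebesgue_on {0..}. LINT x|M. \<bar>f s x\<bar>) = (LINT w|(half_line \<otimes> M). \<bar>G w\<bar>)"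
  using time_integral_eq[OF _ 2] HM.integral_fst'[OF G(2)] by simp
 have int: "integrable (lebesgue_on {0..}) \<phi>" if \<psi>: "integrable half_line \<psi>" and ae: "AE s in half_line. \<phi> s = \<psi> s"
  for \<phi> \<psi> :: "real => real"
 proof -
  have m: "\<psi> \<in> bm (lebesgue_on {0..})" by (rule measurable_lebesgue_on[OF half_line_borel]) (use \<psi> in auto)
  have ae': "AE s in lebesgue_on {0..}. \<phi> s = \<psi> s" using ae by (simp add: AE_lebesgue_on)
  have "integrable (lebesgue_on {0..}) \<psi>"
   using \<psi> m by (simp add: integrable_iff_bounded nn_integral_lebesgue_on)
  then show ?thesis
   using integrable_cong_AE[OF borel_measurable_lebesgue_on_AE[OF half_line_borel m ae'] m ae'] by simp
 qed
 show "integrable (lebesgue_on {0..}) (%s. LINT x|M. f s x)"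
  by (rule int[OF HM.integrable_fst'[OF G(1)] 1])
 show "integrable (lebesgue_on {0..}) (%s. LINT x|M. \<bar>f s x\<bar>)"
  by (rule int[OF HM.integrable_fst'[OF G(2)] 2])
qed

lemma time_represents_Nrm:
 "sigma_finite_measure M ==> time_represents M f G ==> Nrm (L1_time (L1 M)) f = (LINT w|(half_line \<otimes> M). \<bar>G w\<bar>)"
 using time_represents_integral(2) by (simp add: L1_time_simps)

lemma represents_add:
 assumes "represents N M f G" "represents N M f' G'"
 shows "represents N M (f + f') (G + G')"
proof -
 have "AE r in N. integrable M (f r) & (AE x in M. f r x = G (r, x))"
    "AE r in N. integrable M (f' r) & (AE x in M. f' r x = G' (r, x))"
  using assms by (auto simp: represents_def)
 then have "AE r in N. integrable M (%x. f r x + f' r x) & (AE x in M. f r x + f' r x = G (r, x) + G' (r, x))"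
  by eventually_elim auto
 moreover have "integrable (N \<otimes> M) (%w. G w + G' w)" using assms by (auto simp: represents_def)
 ultimately show ?thesis unfolding represents_def plus_fun_def by blast
qed

lemma represents_scale:
 assumes "represents N M f G"
 shows "represents N M (c *\<^sub>R f) (c *\<^sub>R G)"
proof -
 have "AE r in N. integrable M (f r) & (AE x in M. f r x = G (r, x))"
  using assms by (auto simp: represents_def)
 then have "AE r in N. integrable M (%x. c * f r x) & (AE x in M. c * f r x = c * G (r, x))"
  by eventually_elim auto
 moreover have "integrable (N \<otimes> M) (%w. c * G w)" using assms by (auto simp: represents_def)
 ultimately show ?thesis unfolding represents_def scaleR_fun_def by simp
qed

lemma represents_zero: "represents N M 0 0"
 by (simp add: represents_def zero_fun_def)

lemma represents_curry:
 fixes G :: "'b \<times> 'a => real"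
 assumes "sigma_finite_measure N" "sigma_finite_measure M" "integrable (N \<otimes> M) G"
 shows "represents N M (%r x. G (r, x)) G"
proof -
 interpret N: sigma_finite_measure N by fact
 interpret M: sigma_finite_measure M by fact
 interpret NM: pair_sigma_finite N M ..
 show ?thesis using assms(3) NM.AE_integrable_fst'[OF assms(3)] by (simp add: represents_def)
qed

text \<open>Elements of \<open>L1_time\<close> are only limits of simple functions for almost every time. The approximating simple functions are jointly
measurable; a subsequence converges so fast that it converges almost everywhere on the product, and its limit is
the representative.\<close>

lemma time_represents_total:
 assumes M: "sigma_finite_measure M" and f: "f \<in> Car (L1_time (L1 M))"
 shows "\<exists>G. time_represents M f G"
proof -
 interpret M: sigma_finite_measure M by (rule M)
 interpret H: sigma_finite_measure half_line by (rule sigma_finite_half_line)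
 interpret HM: pair_sigma_finite half_line M ..
 obtain S where S: "bochner_approx (L1 M) (lebesgue_on {0..}) f S"
  using f by (auto simp: L1_time_simps bochner_integrable_def)
 have sbi: "Bochner_Integration.simple_bochner_integrable (lebesgue_on {0..}) (S i)" for i
  using S by (simp add: bochner_approx_def)
 have sbS: "simple_function (lebesgue_on {0..}) (S i)" "emeasure (lebesgue_on {0..}) {r \<in> space (lebesgue_on {0..}). S i r ~= 0} ~= \<infinity>" for i
  using Bochner_Integration.simple_bochner_integrable.cases[OF sbi[of i]] by blast+
 have SCar: "integrable M (S i r)" if "0 <= r" for i r
  using S that by (auto simp: bochner_approx_def)
 have "\<exists>S'. simple_function half_line S' & (AE r in half_line. S i r = S' r) & S' ` {0..} \<subseteq> insert 0 (S i ` {0..})" for i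
  by (rule simple_function_lebesgue_on[OF half_line_borel sbS(1)])
 then obtain S' where S': "!!i. simple_function half_line (S' i)" "!!i. AE r in half_line. S i r = S' i r"
   "!!i. S' i ` {0..} \<subseteq> insert 0 (S i ` {0..})"
  using choice[of "%i S'. simple_function half_line S' & (AE r in half_line. S i r = S' r) & S' ` {0..} \<subseteq> insert 0 (S i ` {0..})"]
  by blast
 have S'L1: "simple_L1 half_line M (S' i)" for i
  unfolding simple_L1_def
 proof (intro conjI ballI Bochner_Integration.simple_bochner_integrable.intros S')
  have A': "{r \<in> space half_line. S' i r ~= 0} \<in> sets half_line"
  proof -
   have "{r \<in> space half_line. S' i r ~= 0} = space half_line - (S' i -` {0} \<inter> space half_line)" by auto
   then show ?thesis by (simp only:) (intro sets.compl_sets simple_functionD(2)[OF S'(1)])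
  qed
  have A: "{r \<in> space (lebesgue_on {0..}). S i r ~= 0} \<in> sets (lebesgue_on {0..})"
  proof -
   have "{r \<in> space (lebesgue_on {0..}). S i r ~= 0} = space (lebesgue_on {0..}) - (S i -` {0} \<inter> space (lebesgue_on {0..}))" by auto
   then show ?thesis by (simp only:) (intro sets.compl_sets simple_functionD(2)[OF sbS(1)])
  qed
  have "emeasure half_line {r \<in> space half_line. S' i r ~= 0} = (\<integral>\<^sup>+r. indicator {r \<in> space half_line. S' i r ~= 0} r \<partial>half_line)"
   using A' by simp
  also have "... = (\<integral>\<^sup>+r. indicator {r \<in> space (lebesgue_on {0..}). S i r ~= 0} r \<partial>half_line)"
   using S'(2)[of i] by (intro nn_integral_cong_AE) (auto split: split_indicator elim!: AE_mp)
  also have "... = (\<integral>\<^sup>+r. indicator {r \<in> space (lebesgue_on {0..}). S i r ~= 0} r \<partial>lebesgue_on {0..})"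
   by (rule nn_integral_lebesgue_on[symmetric]) simp
  also have "... = emeasure (lebesgue_on {0..}) {r \<in> space (lebesgue_on {0..}). S i r ~= 0}"
   using A by simp
  finally show "emeasure half_line {r \<in> space half_line. S' i r ~= 0} ~= \<infinity>" using sbS(2)[of i] by simp
  fix r assume "r \<in> space half_line"
  then have "0 <= r" by simp
  then have "S' i r \<in> insert 0 (S i ` {0..})" using S'(3)[of i] by auto
  then show "integrable M (S' i r)" using SCar by (auto simp: zero_fun_def)
 qed
 note [measurable] = simple_L1_measurable[OF S'L1]
 define e where "e i j r = (\<integral>\<^sup>+x. ennreal \<bar>S' i r x - S' j r x\<bar> \<partial>M)" for i j r
 define d where "d i r = ennreal (Nrm (L1 M) (f r - S i r))" for i r
 \<comment> \<open>\<open>d i\<close> need not be measurable; \<open>v i\<close> is, and both agree almost everywhere.\<close>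
 define v where "v i r = liminf (%j. e i j r)" for i r
 have e_meas[measurable]: "e i j \<in> bm half_line" for i j
  unfolding e_def by (rule M.borel_measurable_nn_integral) (simp add: split_beta')
 have v_meas[measurable]: "v i \<in> bm half_line" for i
  unfolding v_def[abs_def] by measurable
 have "AE r in half_line. f r \<in> Car (L1 M) & (%i. Nrm (L1 M) (f r - S i r)) ----> 0"
  using S unfolding bochner_approx_def AE_lebesgue_on[OF half_line_borel] by blast
 moreover have "AE r in half_line. \<forall>i. S i r = S' i r" unfolding AE_all_countable using S'(2) by simp
 ultimately have good: "AE r in half_line. integrable M (f r) & (\<forall>i. S i r = S' i r) & (%i. d i r) ----> 0
   & (\<forall>i. d i r = (\<integral>\<^sup>+x. ennreal \<bar>f r x - S' i r x\<bar> \<partial>M)) & (\<forall>i. d i r < top)"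
  using AE_space
 proof eventually_elim
  fix r assume r: "f r \<in> Car (L1 M) & (%i. Nrm (L1 M) (f r - S i r)) ----> 0" "\<forall>i. S i r = S' i r" "r \<in> space half_line"
  have "(%i. d i r) ----> 0" unfolding d_def using r tendsto_ennrealI by fastforce
  moreover have "d i r = (\<integral>\<^sup>+x. ennreal \<bar>f r x - S' i r x\<bar> \<partial>M)" for i
   using integral_abs_eq_nn[of M "%x. f r x - S i r x"] r SCar[of r i] by (simp add: d_def)
  moreover have "d i r < top" for i by (simp add: d_def)
  moreover have "integrable M (f r)" using r by simp
  ultimately show "integrable M (f r) & (\<forall>i. S i r = S' i r) & (%i. d i r) ----> 0
   & (\<forall>i. d i r = (\<integral>\<^sup>+x. ennreal \<bar>f r x - S' i r x\<bar> \<partial>M)) & (\<forall>i. d i r < top)"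
   using r(2) by blast
 qed
 have ed: "AE r in half_line. \<forall>i j. e i j r <= d i r + d j r & d i r <= e i j r + d j r"
  using good AE_space
 proof eventually_elim
  fix r assume r: "integrable M (f r) & (\<forall>i. S i r = S' i r) & (%i. d i r) ----> 0
   & (\<forall>i. d i r = (\<integral>\<^sup>+x. ennreal \<bar>f r x - S' i r x\<bar> \<partial>M)) & (\<forall>i. d i r < top)" "r \<in> space half_line"
  have [measurable]: "f r \<in> bm M" "S' i r \<in> bm M" for i
   using r S'L1[of i] by (auto simp: simple_L1_def)
  show "\<forall>i j. e i j r <= d i r + d j r & d i r <= e i j r + d j r"
  proof (intro allI conjI)
   fix i j
   have "e i j r <= (\<integral>\<^sup>+x. ennreal \<bar>f r x - S' i r x\<bar> + ennreal \<bar>f r x - S' j r x\<bar> \<partial>M)"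
    unfolding e_def by (intro nn_integral_mono) (simp flip: ennreal_plus)
   then show "e i j r <= d i r + d j r" using r by (subst (asm) nn_integral_add) auto
   have "d i r <= (\<integral>\<^sup>+x. ennreal \<bar>S' i r x - S' j r x\<bar> + ennreal \<bar>f r x - S' j r x\<bar> \<partial>M)"
    using r by (auto intro!: nn_integral_mono simp flip: ennreal_plus)
   then show "d i r <= e i j r + d j r" using r unfolding e_def by (subst (asm) nn_integral_add) auto
  qed
 qed
 have vd: "AE r in half_line. \<forall>i. v i r = d i r"
  using good ed
 proof eventually_elim
  fix r assume r: "integrable M (f r) & (\<forall>i. S i r = S' i r) & (%i. d i r) ----> 0
    & (\<forall>i. d i r = (\<integral>\<^sup>+x. ennreal \<bar>f r x - S' i r x\<bar> \<partial>M)) & (\<forall>i. d i r < top)"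
   "\<forall>i j. e i j r <= d i r + d j r & d i r <= e i j r + d j r"
  show "\<forall>i. v i r = d i r"
  proof
   fix i
   have d0: "(%j. d j r) ----> 0" using r by blast
   have lo: "(%j. d i r - d j r) ----> d i r - 0"
    using r by (intro tendsto_diff_ennreal tendsto_const d0) (auto simp: less_top)
   have up: "(%j. d i r + d j r) ----> d i r + 0" by (intro tendsto_add tendsto_const d0)
   have "(%j. e i j r) ----> d i r"
   proof (rule tendsto_sandwich[of "%j. d i r - d j r" _ _ "%j. d i r + d j r"])
    have "d i r - d j r <= e i j r" for j
    proof -
     have "d i r <= d j r + e i j r" using r(2) by (metis add.commute)
     moreover have "d j r ~= top" using r(1) by (metis less_irrefl)
     ultimately show ?thesis by (simp add: ennreal_minus_le_iff)
    qed
    then show "\<forall>\<^sub>F j in sequentially. d i r - d j r <= e i j r" by simp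
    show "\<forall>\<^sub>F j in sequentially. e i j r <= d i r + d j r" using r(2) by simp
   qed (use lo up in auto)
   then show "v i r = d i r" unfolding v_def by (intro lim_imp_Liminf) auto
  qed
 qed
 have v0: "(%i. \<integral>\<^sup>+r. v i r \<partial>half_line) ----> 0"
 proof -
  have "(%i. \<integral>\<^sup>+r. d i r \<partial>lebesgue_on {0..}) ----> 0"
   using S unfolding bochner_approx_def d_def by blast
  moreover have "(\<integral>\<^sup>+r. d i r \<partial>lebesgue_on {0..}) = (\<integral>\<^sup>+r. v i r \<partial>half_line)" for i
   unfolding nn_integral_lebesgue_on[OF half_line_borel] using vd by (intro nn_integral_cong_AE) auto
  ultimately show ?thesis by simp
 qed
 have "\<exists>i. (\<integral>\<^sup>+r. v i r \<partial>half_line) < ennreal ((1/2) ^ n)" for n :: nat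
 proof -
  have "\<forall>\<^sub>F i in sequentially. (\<integral>\<^sup>+r. v i r \<partial>half_line) < ennreal ((1/2) ^ n)"
   by (rule order_tendstoD(2)[OF v0]) simp
  then show ?thesis by (auto simp: eventually_sequentially)
 qed
 then obtain \<iota> where \<iota>: "!!n. (\<integral>\<^sup>+r. v (\<iota> n) r \<partial>half_line) < ennreal ((1/2) ^ n)"
  using choice[of "%n i. (\<integral>\<^sup>+r. v i r \<partial>half_line) < ennreal ((1/2) ^ n)"] by blast
 let ?P = "half_line \<otimes> M"
 define g where "g n w = S' (\<iota> n) (fst w) (snd w)" for n w
 have gm[measurable]: "g n \<in> bm ?P" for n unfolding g_def[abs_def] by measurable
 have gint: "integrable ?P (g n)" for n
  unfolding g_def[abs_def] by (rule simple_L1_integrable[OF M S'L1])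
 have half: "(\<Sum>n. ennreal ((1/2) ^ n)) = ennreal (1 / (1 - 1/2))"
  by (rule suminf_ennreal_eq[OF _ geometric_sums]) auto
 have step: "(\<integral>\<^sup>+w. ennreal \<bar>g (Suc n) w - g n w\<bar> \<partial>?P) <= ennreal ((1/2) ^ n) + ennreal ((1/2) ^ n)" for n
 proof -
  have "(\<integral>\<^sup>+w. ennreal \<bar>g (Suc n) w - g n w\<bar> \<partial>?P) = (\<integral>\<^sup>+r. e (\<iota> (Suc n)) (\<iota> n) r \<partial>half_line)"
   unfolding e_def using M.nn_integral_fst[of "%w. ennreal \<bar>g (Suc n) w - g n w\<bar>" half_line] by (simp add: g_def)
  also have "... <= (\<integral>\<^sup>+r. v (\<iota> (Suc n)) r + v (\<iota> n) r \<partial>half_line)"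
  proof (rule nn_integral_mono_AE)
   show "AE r in half_line. e (\<iota> (Suc n)) (\<iota> n) r <= v (\<iota> (Suc n)) r + v (\<iota> n) r"
    using vd ed by eventually_elim simp
  qed
  also have "... = (\<integral>\<^sup>+r. v (\<iota> (Suc n)) r \<partial>half_line) + (\<integral>\<^sup>+r. v (\<iota> n) r \<partial>half_line)"
   by (rule nn_integral_add) measurable
  also have "... <= ennreal ((1/2) ^ Suc n) + ennreal ((1/2) ^ n)"
   by (intro add_mono less_imp_le[OF \<iota>])
  also have "... <= ennreal ((1/2) ^ n) + ennreal ((1/2) ^ n)"
   by (intro add_mono ennreal_leI) auto
  finally show ?thesis .
 qed
 define D where "D w = (\<Sum>n. ennreal \<bar>g (Suc n) w - g n w\<bar>)" for w
 have Dm[measurable]: "D \<in> bm ?P" unfolding D_def[abs_def] by measurable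
 have Dfin: "(\<integral>\<^sup>+w. D w \<partial>?P) < \<infinity>"
 proof -
  have "(\<integral>\<^sup>+w. D w \<partial>?P) = (\<Sum>n. \<integral>\<^sup>+w. ennreal \<bar>g (Suc n) w - g n w\<bar> \<partial>?P)"
   unfolding D_def by (rule nn_integral_suminf) measurable
  also have "... <= (\<Sum>n. ennreal ((1/2) ^ n) + ennreal ((1/2) ^ n))"
   by (intro suminf_le step) auto
  also have "... = ennreal (1 / (1 - 1/2)) + ennreal (1 / (1 - 1/2))"
   by (subst suminf_add[symmetric]) (auto simp: half)
  also have "... < \<infinity>" by simp
  finally show ?thesis .
 qed
 have conv: "AE w in ?P. convergent (%n. g n w) & ennreal \<bar>lim (%n. g n w)\<bar> <= ennreal \<bar>g 0 w\<bar> + D w"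
 proof -
  have "AE w in ?P. D w ~= \<infinity>" using Dfin by (intro nn_integral_PInf_AE) auto
  then show ?thesis
  proof eventually_elim
   fix w assume "D w ~= \<infinity>"
   then have sa: "summable (%n. \<bar>g (Suc n) w - g n w\<bar>)"
    unfolding D_def by (intro summable_suminf_not_top) auto
   then have s: "summable (%n. g (Suc n) w - g n w)" by (rule summable_rabs_cancel)
   have "(%n. g 0 w + (\<Sum>k<n. g (Suc k) w - g k w)) ----> g 0 w + (\<Sum>k. g (Suc k) w - g k w)"
    by (intro tendsto_add tendsto_const summable_LIMSEQ s)
   then have l: "(%n. g n w) ----> g 0 w + (\<Sum>k. g (Suc k) w - g k w)"
    using sum_lessThan_telescope[of "%k. g k w"] by simp
   have "\<bar>g 0 w + (\<Sum>k. g (Suc k) w - g k w)\<bar> <= \<bar>g 0 w\<bar> + (\<Sum>k. \<bar>g (Suc k) w - g k w\<bar>)"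
    using summable_rabs[OF sa] by linarith
   also have "ennreal ... = ennreal \<bar>g 0 w\<bar> + D w"
    unfolding D_def using sa by (subst ennreal_plus) (auto intro!: suminf_nonneg suminf_ennreal2[symmetric])
   finally show "convergent (%n. g n w) & ennreal \<bar>lim (%n. g n w)\<bar> <= ennreal \<bar>g 0 w\<bar> + D w"
    using l by (auto simp: limI convergent_def ennreal_leI)
  qed
 qed
 define G where "G w = lim (%n. g n w)" for w
 have Gm[measurable]: "G \<in> bm ?P" unfolding G_def[abs_def] by measurable
 have Gint: "integrable ?P G"
 proof (rule integrableI_bounded[OF Gm])
  have "(\<integral>\<^sup>+w. ennreal (norm (G w)) \<partial>?P) <= (\<integral>\<^sup>+w. ennreal \<bar>g 0 w\<bar> + D w \<partial>?P)"
   using conv by (intro nn_integral_mono_AE) (auto simp: G_def)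
  also have "... = (\<integral>\<^sup>+w. ennreal \<bar>g 0 w\<bar> \<partial>?P) + (\<integral>\<^sup>+w. D w \<partial>?P)" by (rule nn_integral_add) measurable
  also have "... < \<infinity>" using gint[of 0] Dfin by (simp add: integrable_iff_bounded)
  finally show "(\<integral>\<^sup>+w. ennreal (norm (G w)) \<partial>?P) < \<infinity>" .
 qed
 have "AE w in ?P. (%n. g n w) ----> G w"
  using conv by eventually_elim (auto simp: G_def convergent_LIMSEQ_iff)
 then have gG: "AE r in half_line. AE x in M. (%n. g n (r, x)) ----> G (r, x)"
  using HM.AE_pair[of "%w. (%n. g n w) ----> G w"] by simp
 have dv0: "AE r in half_line. (%n. d (\<iota> n) r) ----> 0"
 proof -
  have "(\<integral>\<^sup>+r. (\<Sum>n. v (\<iota> n) r) \<partial>half_line) = (\<Sum>n. \<integral>\<^sup>+r. v (\<iota> n) r \<partial>half_line)"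
   by (rule nn_integral_suminf) measurable
  also have "... <= (\<Sum>n. ennreal ((1/2) ^ n))"
   by (intro suminf_le less_imp_le[OF \<iota>]) auto
  finally have "(\<integral>\<^sup>+r. (\<Sum>n. v (\<iota> n) r) \<partial>half_line) ~= \<infinity>" unfolding half by (auto simp: top_unique)
  then have "AE r in half_line. (\<Sum>n. v (\<iota> n) r) ~= \<infinity>" by (intro nn_integral_PInf_AE) measurable
  then show ?thesis using vd good
  proof eventually_elim
   case (elim r)
   have c: "ennreal (enn2real (d (\<iota> n) r)) = d (\<iota> n) r" for n
    by (rule ennreal_enn2real) (use elim in blast)
   have vdn: "v (\<iota> n) r = d (\<iota> n) r" for n using elim(2) by blast
   have fin: "(\<Sum>n. ennreal (enn2real (d (\<iota> n) r))) ~= top"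
    unfolding c using elim(1) unfolding vdn infinity_ennreal_def .
   then have "summable (%n. enn2real (d (\<iota> n) r))" by (intro summable_suminf_not_top) auto
   then have "(%n. ennreal (enn2real (d (\<iota> n) r))) ----> ennreal 0" by (intro tendsto_ennrealI summable_LIMSEQ_zero)
   then show ?case unfolding c by simp
  qed
 qed
 have "AE r in half_line. integrable M (f r) & (AE x in M. f r x = G (r, x))"
  using gG dv0 good AE_space
 proof eventually_elim
  fix r assume r: "AE x in M. (%n. g n (r, x)) ----> G (r, x)" "(%n. d (\<iota> n) r) ----> 0"
   "integrable M (f r) & (\<forall>i. S i r = S' i r) & (%i. d i r) ----> 0
    & (\<forall>i. d i r = (\<integral>\<^sup>+x. ennreal \<bar>f r x - S' i r x\<bar> \<partial>M)) & (\<forall>i. d i r < top)"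
   "r \<in> space half_line"
  have [measurable]: "f r \<in> bm M" "(%x. g n (r, x)) \<in> bm M" "(%x. G (r, x)) \<in> bm M" for n
   using r(3,4) by auto
  have dn: "d (\<iota> n) r = (\<integral>\<^sup>+x. ennreal \<bar>f r x - g n (r, x)\<bar> \<partial>M)" for n using r(3) by (simp add: g_def)
  have "(\<integral>\<^sup>+x. ennreal \<bar>f r x - G (r, x)\<bar> \<partial>M) <= (\<integral>\<^sup>+x. liminf (%n. ennreal \<bar>f r x - g n (r, x)\<bar>) \<partial>M)"
  proof (rule nn_integral_mono_AE)
   show "AE x in M. ennreal \<bar>f r x - G (r, x)\<bar> <= liminf (%n. ennreal \<bar>f r x - g n (r, x)\<bar>)"
    using r(1)
   proof eventually_elim
    fix x assume "(%n. g n (r, x)) ----> G (r, x)"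
    then have "(%n. ennreal \<bar>f r x - g n (r, x)\<bar>) ----> ennreal \<bar>f r x - G (r, x)\<bar>"
     by (intro tendsto_ennrealI tendsto_rabs tendsto_diff tendsto_const)
    then have "liminf (%n. ennreal \<bar>f r x - g n (r, x)\<bar>) = ennreal \<bar>f r x - G (r, x)\<bar>"
     by (intro lim_imp_Liminf) auto
    then show "ennreal \<bar>f r x - G (r, x)\<bar> <= liminf (%n. ennreal \<bar>f r x - g n (r, x)\<bar>)" by simp
   qed
  qed
  also have "... <= liminf (%n. \<integral>\<^sup>+x. ennreal \<bar>f r x - g n (r, x)\<bar> \<partial>M)"
   by (rule nn_integral_liminf) measurable
  also have "... = 0" unfolding dn[symmetric] using r(2) by (intro lim_imp_Liminf) auto
  finally have "(\<integral>\<^sup>+x. ennreal \<bar>f r x - G (r, x)\<bar> \<partial>M) = 0" by simp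
  then have "AE x in M. ennreal \<bar>f r x - G (r, x)\<bar> = 0" by (subst (asm) nn_integral_0_iff_AE) auto
  then have "AE x in M. f r x = G (r, x)" by eventually_elim simp
  then show "integrable M (f r) & (AE x in M. f r x = G (r, x))" using r(3) by simp
 qed
 then show ?thesis using Gint by (auto simp: represents_def)
qed

lemma has_bochner_int_bochner_int:
 assumes "has_bochner_int F N g y"
 shows "has_bochner_int F N g (bochner_int F N g)"
 using assms unfolding bochner_int_def by (rule someI[where P="has_bochner_int F N g"])

text \<open>The Bochner integral in \<open>L1_time\<close> is represented by the integral of the representatives; transfer reduces this to
an integral in the space over time and state, and back.\<close>

lemma time_bochner_int:
 fixes H :: "'b \<times> (real \<times> 'a) => real"
 assumes M: "sigma_finite_measure M" and N: "sigma_finite_measure N"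
  and H: "integrable (N \<otimes> (half_line \<otimes> M)) H"
  and g: "AE \<tau> in N. time_represents M (g \<tau>) (%w. H (\<tau>, w))"
 shows "time_represents M (bochner_int (L1_time (L1 M)) N g) (%w. LINT \<tau>|N. H (\<tau>, w))"
proof -
 let ?X = "L1_time (L1 M)" and ?Y = "half_line \<otimes> M"
 interpret M: sigma_finite_measure M by (rule M)
 interpret L: sigma_finite_measure half_line by (rule sigma_finite_half_line)
 interpret LM: pair_sigma_finite half_line M ..
 interpret N: sigma_finite_measure N by (rule N)
 interpret NY: pair_sigma_finite N ?Y ..
 have Y: "sigma_finite_measure ?Y" by (rule LM.P.sigma_finite_measure_axioms)
 let ?z = "%w. LINT \<tau>|N. H (\<tau>, w)"
 have rep: "represents N ?Y (%\<tau> w. H (\<tau>, w)) H" by (rule represents_curry[OF N Y H])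
 have z: "integrable ?Y ?z" using NY.integrable_snd[of "%\<tau> w. H (\<tau>, w)"] H by simp
 have Rz: "time_represents M (%s x. ?z (s, x)) ?z"
  by (rule represents_curry[OF sigma_finite_half_line M z])
 have ex: "has_bochner_int ?X N g (%s x. ?z (s, x))"
 proof (rule has_bochner_int_transfer[where R="%G f. time_represents M f G", OF _ _ _ _ _ _ g has_bochner_int_exists[OF N Y rep] Rz])
  show "\<exists>f. time_represents M f G" if "G \<in> Car (L1 ?Y)" for G
   using represents_curry[OF sigma_finite_half_line M, of G] that by auto
  show "G \<in> Car (L1 ?Y) & f \<in> Car ?X" if "time_represents M f G" for G f
   using time_represents_Car[OF M that] that by (simp add: represents_def)
  show "Nrm (L1 ?Y) G = Nrm ?X f" if "time_represents M f G" for G f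
   using time_represents_Nrm[OF M that] by simp
 qed (auto intro: represents_zero represents_add represents_scale)
 let ?y = "bochner_int ?X N g"
 have y: "has_bochner_int ?X N g ?y" by (rule has_bochner_int_bochner_int[OF ex])
 then have "?y \<in> Car ?X" by (simp add: has_bochner_int_def)
 then obtain Gy where Gy: "time_represents M ?y Gy" using time_represents_total[OF M] by blast
 have "has_bochner_int (L1 ?Y) N (%\<tau> w. H (\<tau>, w)) Gy"
 proof (rule has_bochner_int_transfer[where R="%f G. time_represents M f G", OF _ _ _ _ _ _ g y Gy])
  show "\<exists>G. time_represents M f G" if "f \<in> Car ?X" for f by (rule time_represents_total[OF M that])
  show "f \<in> Car ?X & G \<in> Car (L1 ?Y)" if "time_represents M f G" for G f
   using time_represents_Car[OF M that] that by (simp add: represents_def)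
  show "Nrm ?X f = Nrm (L1 ?Y) G" if "time_represents M f G" for G f
   using time_represents_Nrm[OF M that] by simp
 qed (auto intro: represents_zero represents_add represents_scale)
 from has_bochner_int_unique(2)[OF N Y rep this]
 have "AE w in ?Y. Gy w = ?z w" .
 then have "AE s in half_line. AE x in M. Gy (s, x) = ?z (s, x)" by (rule LM.AE_pair)
 moreover have "AE s in half_line. integrable M (?y s) & (AE x in M. ?y s x = Gy (s, x))"
  using Gy by (simp add: represents_def)
 ultimately have "AE s in half_line. integrable M (?y s) & (AE x in M. ?y s x = ?z (s, x))"
 proof eventually_elim
  case (elim s)
  have "AE x in M. ?y s x = ?z (s, x)"
   using elim(1) conjunct2[OF elim(2)] by eventually_elim (simp only:)
  then show ?case using elim by blast
 qed
 then show ?thesis using z by (simp add: represents_def)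
qed

text \<open>The integral over time and state is a bounded linear functional that equals the norm on the cone. The cone is generating, by positive and negative parts, so
every such functional agrees with it.\<close>

lemma norm_functional_eq:
 assumes M: "sigma_finite_measure M" and rep: "time_represents M f G"
 shows "norm_functional (L1_time (L1 M)) f = (LINT w|(half_line \<otimes> M). G w)"
proof -
 let ?X = "L1_time (L1 M)" and ?Y = "half_line \<otimes> M"
 let ?Q = "%P. (\<forall>f\<in>Car ?X. \<forall>g\<in>Car ?X. P (f + g) = P f + P g) &
   (\<forall>c. \<forall>f\<in>Car ?X. P (c *\<^sub>R f) = c * P f) &
   (\<exists>K. \<forall>f\<in>Car ?X. \<bar>P f\<bar> <= K * Nrm ?X f) &
   (\<forall>f\<in>Pos ?X. P f = Nrm ?X f)"
 have Pos_Car: "f \<in> Car ?X" if "f \<in> Pos ?X" for f using that by (simp add: L1_time_simps)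
 let ?P = "%f. LINT s|lebesgue_on {0..}. LINT x|M. f s x"
 have P: "?P f = (LINT w|?Y. G w)" if "time_represents M f G" for f G
  by (rule time_represents_integral(1)[OF M that])
 have "?Q ?P"
 proof (intro conjI ballI allI exI)
  fix f g assume "f \<in> Car ?X" "g \<in> Car ?X"
  then obtain F G where r: "time_represents M f F" "time_represents M g G"
   using time_represents_total[OF M] by blast
  have "?P (f + g) = (LINT w|?Y. (F + G) w)" by (rule P[OF represents_add[OF r]])
  also have "... = (LINT w|?Y. F w) + (LINT w|?Y. G w)"
   using r by (simp add: plus_fun_def represents_def)
  finally show "?P (f + g) = ?P f + ?P g" using r by (simp add: P)
 next
  fix c f assume "f \<in> Car ?X"
  then obtain F where r: "time_represents M f F" using time_represents_total[OF M] by blast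
  have "?P (c *\<^sub>R f) = (LINT w|?Y. (c *\<^sub>R F) w)" by (rule P[OF represents_scale[OF r]])
  then show "?P (c *\<^sub>R f) = c * ?P f" using r by (simp add: P scaleR_fun_def)
 next
  fix f assume "f \<in> Car ?X"
  then obtain F where r: "time_represents M f F" using time_represents_total[OF M] by blast
  show "\<bar>?P f\<bar> <= 1 * Nrm ?X f"
   unfolding P[OF r] time_represents_Nrm[OF M r] using integral_abs_bound[of ?Y F] by simp
 next
  fix f assume f: "f \<in> Pos ?X"
  then obtain F where r: "time_represents M f F" using time_represents_total[OF M Pos_Car] by blast
  have "AE s in lebesgue_on {0..}. f s \<in> Pos (L1 M)" using f by (simp add: L1_time_simps)
  then have "AE s in lebesgue_on {0..}. (LINT x|M. f s x) = (LINT x|M. \<bar>f s x\<bar>)"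
  proof eventually_elim
   fix s assume s: "f s \<in> Pos (L1 M)"
   show "(LINT x|M. f s x) = (LINT x|M. \<bar>f s x\<bar>)"
    by (rule integral_cong_AE) (use s in auto)
  qed
  then have "?P f = (LINT s|lebesgue_on {0..}. LINT x|M. \<bar>f s x\<bar>)"
   by (intro integral_cong_AE borel_measurable_integrable time_represents_integral(3,4)[OF M r])
  then show "?P f = Nrm ?X f" by (simp add: L1_time_simps)
 qed
 then have "Ex ?Q" by (rule exI[where P="?Q"])
 then have "?Q (Eps ?Q)" by (rule someI_ex[where P="?Q"])
 then have "?Q (norm_functional ?X)" unfolding norm_functional_def .
 then obtain K where
  add: "!!f g. f \<in> Car ?X ==> g \<in> Car ?X ==> norm_functional ?X (f + g) = norm_functional ?X f + norm_functional ?X g"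
  and scale: "!!c f. f \<in> Car ?X ==> norm_functional ?X (c *\<^sub>R f) = c * norm_functional ?X f"
  and bound: "!!f. f \<in> Car ?X ==> \<bar>norm_functional ?X f\<bar> <= K * Nrm ?X f"
  and pos: "!!f. f \<in> Pos ?X ==> norm_functional ?X f = Nrm ?X f"
  by blast
 have G: "integrable ?Y G" using rep by (simp add: represents_def)
 let ?p = "%w. max 0 (G w)" and ?n = "%w. max 0 (- G w)"
 have pn: "integrable ?Y ?p" "integrable ?Y ?n" using G by auto
 have pos_part: "norm_functional ?X (%s x. H (s, x)) = (LINT w|?Y. H w)" "(%s x. H (s, x)) \<in> Car ?X"
  if H: "integrable ?Y H" "!!w. 0 <= H w" for H
 proof -
  have r: "time_represents M (%s x. H (s, x)) H" by (rule represents_curry[OF sigma_finite_half_line M H(1)])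
  then show "(%s x. H (s, x)) \<in> Car ?X" by (rule time_represents_Car[OF M])
  then have "bochner_integrable (L1 M) (lebesgue_on {0..}) (%s x. H (s, x))" by (simp add: L1_time_simps)
  moreover have "AE s in lebesgue_on {0..}. (%x. H (s, x)) \<in> Pos (L1 M)"
   using r H(2) by (simp add: represents_def AE_lebesgue_on)
  ultimately have "(%s x. H (s, x)) \<in> Pos ?X" by (simp add: L1_time_simps)
  from pos[OF this] show "norm_functional ?X (%s x. H (s, x)) = (LINT w|?Y. H w)"
   using time_represents_Nrm[OF M r] H(2) by simp
 qed
 let ?fp = "%s x. ?p (s, x)" and ?fn = "%s x. ?n (s, x)"
 have fC: "f \<in> Car ?X" by (rule time_represents_Car[OF M rep])
 have rp: "time_represents M ?fp ?p" and rn: "time_represents M ?fn ?n"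
  by (intro represents_curry[OF sigma_finite_half_line M] pn)+
 let ?h = "(f + (-1) *\<^sub>R ?fp) + ?fn"
 have rh: "time_represents M ?h ((G + (-1) *\<^sub>R ?p) + ?n)"
  by (intro represents_add represents_scale rep rp rn)
 have "((G + (-1) *\<^sub>R ?p) + ?n) w = 0" for w by (simp add: scaleR_fun_def max_def)
 then have "Nrm ?X ?h = 0" unfolding time_represents_Nrm[OF M rh] by simp
 then have "norm_functional ?X ?h = 0" using bound[OF time_represents_Car[OF M rh]] by simp
 moreover have "norm_functional ?X ?h = norm_functional ?X f + (-1) * norm_functional ?X ?fp + norm_functional ?X ?fn"
 proof -
  have c1: "(-1) *\<^sub>R ?fp \<in> Car ?X" by (rule time_represents_Car[OF M represents_scale[OF rp]])
  have c2: "f + (-1) *\<^sub>R ?fp \<in> Car ?X" by (rule time_represents_Car[OF M represents_add[OF rep represents_scale[OF rp]]])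
  show ?thesis
   unfolding add[OF c2 time_represents_Car[OF M rn]] add[OF fC c1] scale[OF time_represents_Car[OF M rp]] ..
 qed
 moreover have "norm_functional ?X ?fp = (LINT w|?Y. ?p w)" by (rule pos_part(1)[OF pn(1)]) simp
 moreover have "norm_functional ?X ?fn = (LINT w|?Y. ?n w)" by (rule pos_part(1)[OF pn(2)]) simp
 moreover have "(LINT w|?Y. ?p w) - (LINT w|?Y. ?n w) = (LINT w|?Y. G w)"
  by (subst Bochner_Integration.integral_diff[symmetric]) (auto intro!: pn Bochner_Integration.integral_cong)
 ultimately show ?thesis by linarith
qed

section \<open>Non-negative representatives\<close>

text \<open>The passage from real functions to extended non-negative ones, where the mass computations take place.\<close>

definition nonneg_rep :: "'a measure => ('a => real) => ('a => ennreal) => bool" where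
 "nonneg_rep M \<phi> \<Phi> \<longleftrightarrow> \<phi> \<in> bm M & \<Phi> \<in> bm M & (\<integral>\<^sup>+x. \<Phi> x \<partial>M) < top &
   (AE x in M. 0 <= \<phi> x & ennreal (\<phi> x) = \<Phi> x)"

lemma nonneg_rep_integrable: "nonneg_rep M \<phi> \<Phi> ==> integrable M \<phi>"
proof (rule integrableI_bounded)
 assume r: "nonneg_rep M \<phi> \<Phi>"
 then have "AE x in M. 0 <= \<phi> x & ennreal (\<phi> x) = \<Phi> x" by (simp add: nonneg_rep_def)
 then have "(\<integral>\<^sup>+x. ennreal (norm (\<phi> x)) \<partial>M) = (\<integral>\<^sup>+x. \<Phi> x \<partial>M)"
  by (intro nn_integral_cong_AE) (auto elim!: AE_mp)
 then show "(\<integral>\<^sup>+x. ennreal (norm (\<phi> x)) \<partial>M) < \<infinity>" using r by (simp add: nonneg_rep_def)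
qed (simp add: nonneg_rep_def)

lemma nonneg_rep_AE:
 assumes "nonneg_rep M \<phi> \<Phi>"
 shows "AE x in M. \<phi> x = enn2real (\<Phi> x)"
proof -
 have "AE x in M. 0 <= \<phi> x & ennreal (\<phi> x) = \<Phi> x" using assms by (simp add: nonneg_rep_def)
 then show ?thesis by eventually_elim (metis enn2real_ennreal)
qed

lemma nonneg_repI:
 assumes "\<phi> \<in> bm M" "\<Phi> \<in> bm M" "(\<integral>\<^sup>+x. \<Phi> x \<partial>M) < top" "AE x in M. \<phi> x = enn2real (\<Phi> x)"
 shows "nonneg_rep M \<phi> \<Phi>"
proof -
 have "AE x in M. \<Phi> x ~= \<infinity>" using assms(2,3) by (intro nn_integral_PInf_AE) auto
 with assms(4) have "AE x in M. 0 <= \<phi> x & ennreal (\<phi> x) = \<Phi> x"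
  by eventually_elim (auto simp: less_top)
 then show ?thesis using assms by (simp add: nonneg_rep_def)
qed

lemma nonneg_marginal:
 fixes \<Gamma> :: "'b \<times> 'a => ennreal"
 assumes N: "sigma_finite_measure N" and M: "sigma_finite_measure M"
  and \<Gamma>: "\<Gamma> \<in> bm (N \<otimes> M)" and fin: "(\<integral>\<^sup>+w. \<Gamma> w \<partial>(N \<otimes> M)) < top"
 shows "integrable (N \<otimes> M) (%w. enn2real (\<Gamma> w))"
  and "AE x in M. (LINT r|N. enn2real (\<Gamma> (r, x))) = enn2real (\<integral>\<^sup>+r. \<Gamma> (r, x) \<partial>N)"
  and "(%x. \<integral>\<^sup>+r. \<Gamma> (r, x) \<partial>N) \<in> bm M"
  and "(\<integral>\<^sup>+x. (\<integral>\<^sup>+r. \<Gamma> (r, x) \<partial>N) \<partial>M) = (\<integral>\<^sup>+w. \<Gamma> w \<partial>(N \<otimes> M))"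
  and "AE r in N. (\<integral>\<^sup>+x. \<Gamma> (r, x) \<partial>M) < top"
proof -
 interpret N: sigma_finite_measure N by (rule N)
 interpret M: sigma_finite_measure M by (rule M)
 interpret NM: pair_sigma_finite N M ..
 note [measurable] = \<Gamma>
 have finAE: "AE w in N \<otimes> M. \<Gamma> w ~= \<infinity>" using fin by (intro nn_integral_PInf_AE) auto
 have "(\<integral>\<^sup>+w. ennreal (norm (enn2real (\<Gamma> w))) \<partial>(N \<otimes> M)) <= (\<integral>\<^sup>+w. \<Gamma> w \<partial>(N \<otimes> M))"
  by (intro nn_integral_mono) (simp add: ennreal_enn2real_if)
 then show int: "integrable (N \<otimes> M) (%w. enn2real (\<Gamma> w))"
  using fin by (intro integrableI_bounded) auto
 show m[measurable]: "(%x. \<integral>\<^sup>+r. \<Gamma> (r, x) \<partial>N) \<in> bm M" by measurable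
 show e: "(\<integral>\<^sup>+x. (\<integral>\<^sup>+r. \<Gamma> (r, x) \<partial>N) \<partial>M) = (\<integral>\<^sup>+w. \<Gamma> w \<partial>(N \<otimes> M))"
  using NM.nn_integral_snd[OF \<Gamma>] by simp
 have "AE x in M. (\<integral>\<^sup>+r. \<Gamma> (r, x) \<partial>N) ~= \<infinity>" using e fin by (intro nn_integral_PInf_AE) auto
 then show "AE x in M. (LINT r|N. enn2real (\<Gamma> (r, x))) = enn2real (\<integral>\<^sup>+r. \<Gamma> (r, x) \<partial>N)"
  using AE_space
 proof eventually_elim
  fix x assume x: "(\<integral>\<^sup>+r. \<Gamma> (r, x) \<partial>N) ~= \<infinity>" "x \<in> space M"
  have [measurable]: "(%r. \<Gamma> (r, x)) \<in> bm N" using x(2) by measurable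
  have "AE r in N. \<Gamma> (r, x) ~= \<infinity>" using x by (intro nn_integral_PInf_AE) auto
  then have "(\<integral>\<^sup>+r. ennreal (enn2real (\<Gamma> (r, x))) \<partial>N) = (\<integral>\<^sup>+r. \<Gamma> (r, x) \<partial>N)"
   by (intro nn_integral_cong_AE) (auto simp: less_top elim!: AE_mp)
  then show "(LINT r|N. enn2real (\<Gamma> (r, x))) = enn2real (\<integral>\<^sup>+r. \<Gamma> (r, x) \<partial>N)"
   by (subst integral_eq_nn_integral) auto
 qed
 have "(\<integral>\<^sup>+r. (\<integral>\<^sup>+x. \<Gamma> (r, x) \<partial>M) \<partial>N) ~= \<infinity>" using M.nn_integral_fst[OF \<Gamma>] fin by simp
 then have "AE r in N. (\<integral>\<^sup>+x. \<Gamma> (r, x) \<partial>M) ~= \<infinity>" by (intro nn_integral_PInf_AE) auto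
 then show "AE r in N. (\<integral>\<^sup>+x. \<Gamma> (r, x) \<partial>M) < top" by eventually_elim (simp add: less_top)
qed

lemma nonneg_rep_represents:
 assumes N: "sigma_finite_measure N" and M: "sigma_finite_measure M"
  and \<Gamma>: "\<Gamma> \<in> bm (N \<otimes> M)" and fin: "(\<integral>\<^sup>+w. \<Gamma> w \<partial>(N \<otimes> M)) < top"
  and rep: "AE r in N. nonneg_rep M (g r) (%x. \<Gamma> (r, x))"
 shows "represents N M g (%w. enn2real (\<Gamma> w))"
 unfolding represents_def
proof
 show "AE r in N. integrable M (g r) & (AE x in M. g r x = enn2real (\<Gamma> (r, x)))"
  using rep by eventually_elim (use nonneg_rep_integrable nonneg_rep_AE in blast)
qed (rule nonneg_marginal(1)[OF N M \<Gamma> fin])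

lemma nonneg_bochner_int:
 fixes \<Gamma> :: "real \<times> 'a => ennreal"
 assumes A: "A \<in> sets borel" and M: "sigma_finite_measure M"
  and \<Gamma>: "\<Gamma> \<in> bm (restrict_space lborel A \<otimes> M)"
  and fin: "(\<integral>\<^sup>+w. \<Gamma> w \<partial>(restrict_space lborel A \<otimes> M)) < top"
  and rep: "AE r in restrict_space lborel A. nonneg_rep M (g r) (%x. \<Gamma> (r, x))"
 shows "nonneg_rep M (bochner_int (L1 M) (lebesgue_on A) g) (%x. \<integral>\<^sup>+r. \<Gamma> (r, x) \<partial>restrict_space lborel A)"
proof -
 let ?N = "restrict_space lborel A"
 have N: "sigma_finite_measure ?N" by (rule sigma_finite_lborel_on[OF A])
 have r: "represents ?N M g (%w. enn2real (\<Gamma> w))" by (rule nonneg_rep_represents[OF N M \<Gamma> fin rep])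
 note r' = represents_lebesgue_on[OF A M r]
 note ex = has_bochner_int_exists[OF sigma_finite_lebesgue_on[OF A] M r'(1)]
 let ?y = "bochner_int (L1 M) (lebesgue_on A) g"
 have y: "has_bochner_int (L1 M) (lebesgue_on A) g ?y" by (rule has_bochner_int_bochner_int[OF ex])
 note u = has_bochner_int_unique[OF sigma_finite_lebesgue_on[OF A] M r'(1) y]
 have "AE x in M. ?y x = enn2real (\<integral>\<^sup>+r. \<Gamma> (r, x) \<partial>?N)"
  using u(2) r'(2) nonneg_marginal(2)[OF N M \<Gamma> fin] by eventually_elim simp
 then show ?thesis
  using u(1) nonneg_marginal(3,4)[OF N M \<Gamma> fin] fin by (intro nonneg_repI) auto
qed

lemma nonneg_rep_suminf:
 assumes rep: "!!n. nonneg_rep M (\<phi> n) (\<Phi> n)" and fin: "(\<integral>\<^sup>+x. (\<Sum>n. \<Phi> n x) \<partial>M) < top"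
 shows "nonneg_rep M (SOME \<psi>. \<psi> \<in> Car (L1 M) & (%N. Nrm (L1 M) ((\<Sum>n<N. \<phi> n) - \<psi>)) ----> 0) (%x. \<Sum>n. \<Phi> n x)"
proof -
 let ?Q = "%\<psi>. \<psi> \<in> Car (L1 M) & (%N. Nrm (L1 M) ((\<Sum>n<N. \<phi> n) - \<psi>)) ----> 0"
 let ?\<Psi> = "%x. \<Sum>n. \<Phi> n x" and ?\<psi> = "%x. enn2real (\<Sum>n. \<Phi> n x)"
 have [measurable]: "\<Phi> n \<in> bm M" "\<phi> n \<in> bm M" for n
  using rep by (auto simp: nonneg_rep_def)
 have r0: "nonneg_rep M ?\<psi> ?\<Psi>" by (rule nonneg_repI) (use fin in auto)
 have int: "integrable M (%x. (\<Sum>n<N. \<phi> n) x)" for N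
  using nonneg_rep_integrable[OF rep] by (simp add: sum_function_apply)
 have AE: "AE x in M. (\<Sum>n. \<Phi> n x) ~= \<infinity> & (\<forall>n. 0 <= \<phi> n x & ennreal (\<phi> n x) = \<Phi> n x)"
 proof -
  have "AE x in M. (\<Sum>n. \<Phi> n x) ~= \<infinity>" using fin by (intro nn_integral_PInf_AE) auto
  moreover have "AE x in M. \<forall>n. 0 <= \<phi> n x & ennreal (\<phi> n x) = \<Phi> n x"
   unfolding AE_all_countable using rep by (simp add: nonneg_rep_def)
  ultimately show ?thesis by eventually_elim simp
 qed
 have sums: "AE x in M. (%n. \<phi> n x) sums ?\<psi> x & (\<forall>n. 0 <= \<phi> n x)"
  using AE
 proof eventually_elim
  fix x assume x: "(\<Sum>n. \<Phi> n x) ~= \<infinity> & (\<forall>n. 0 <= \<phi> n x & ennreal (\<phi> n x) = \<Phi> n x)"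
  then have eq: "\<Phi> n x = ennreal (\<phi> n x)" for n by simp
  have s: "summable (%n. \<phi> n x)" using x unfolding eq by (intro summable_suminf_not_top) auto
  have nn: "0 <= \<phi> n x" for n using x by blast
  have "(\<Sum>n. ennreal (\<phi> n x)) = ennreal (\<Sum>n. \<phi> n x)" by (rule suminf_ennreal2[OF nn s])
  then have "?\<psi> x = (\<Sum>n. \<phi> n x)" unfolding eq by (simp add: suminf_nonneg s nn)
  then show "(%n. \<phi> n x) sums ?\<psi> x & (\<forall>n. 0 <= \<phi> n x)" using s x by (simp add: summable_sums)
 qed
 have lim: "(%N. \<integral>\<^sup>+x. ennreal \<bar>?\<psi> x - (\<Sum>n<N. \<phi> n) x\<bar> \<partial>M) ----> 0"
 proof (rule nn_integral_tendsto_0_dominated[where w="?\<psi>"])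
  show "AE x in M. \<bar>(\<Sum>n<N. \<phi> n) x\<bar> <= ?\<psi> x" for N
   using sums
  proof eventually_elim
   fix x assume x: "(%n. \<phi> n x) sums ?\<psi> x & (\<forall>n. 0 <= \<phi> n x)"
   then have "(\<Sum>n<N. \<phi> n x) <= ?\<psi> x" using sum_le_suminf[of "%n. \<phi> n x" "{..<N}"] by (auto simp: sums_iff)
   then show "\<bar>(\<Sum>n<N. \<phi> n) x\<bar> <= ?\<psi> x" using x by (simp add: sum_function_apply sum_nonneg)
  qed
  show "AE x in M. (%N. (\<Sum>n<N. \<phi> n) x) ----> ?\<psi> x"
   using sums by eventually_elim (simp add: sums_def sum_function_apply)
  show "(\<integral>\<^sup>+x. ennreal (?\<psi> x) \<partial>M) < \<infinity>"
   using nonneg_rep_integrable[OF r0] by (simp add: integrable_iff_bounded)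
 qed (simp_all add: sum_function_apply)
 have nrm: "ennreal (Nrm (L1 M) ((\<Sum>n<N. \<phi> n) - \<psi>)) = (\<integral>\<^sup>+x. ennreal \<bar>\<psi> x - (\<Sum>n<N. \<phi> n) x\<bar> \<partial>M)"
  if "integrable M \<psi>" for N \<psi>
  using integral_abs_eq_nn[OF Bochner_Integration.integrable_diff[OF int that], of N] by (simp add: abs_minus_commute)
 have "?Q ?\<psi>"
 proof
  show "?\<psi> \<in> Car (L1 M)" using nonneg_rep_integrable[OF r0] by simp
  have "(%N. ennreal (Nrm (L1 M) ((\<Sum>n<N. \<phi> n) - ?\<psi>))) ----> ennreal 0"
   unfolding nrm[OF nonneg_rep_integrable[OF r0]] using lim by simp
  then show "(%N. Nrm (L1 M) ((\<Sum>n<N. \<phi> n) - ?\<psi>)) ----> 0"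
   by (subst (asm) tendsto_ennreal_iff) auto
 qed
 then have "Ex ?Q" by (rule exI[where P="?Q"])
 then have Q: "?Q (SOME \<psi>. ?Q \<psi>)" by (rule someI_ex[where P="?Q"])
 define \<psi> where "\<psi> = (SOME \<psi>. ?Q \<psi>)"
 have \<psi>: "integrable M \<psi>" "(%N. Nrm (L1 M) ((\<Sum>n<N. \<phi> n) - \<psi>)) ----> 0"
  using Q unfolding \<psi>_def[symmetric] by simp_all
 have [measurable]: "\<psi> \<in> bm M" "?\<psi> \<in> bm M" "(%x. (\<Sum>n<N. \<phi> n) x) \<in> bm M" for N
  using \<psi>(1) int by auto
 have "(%N. ennreal (Nrm (L1 M) ((\<Sum>n<N. \<phi> n) - \<psi>))) ----> 0" using tendsto_ennrealI[OF \<psi>(2)] by simp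
 then have lim2: "(%N. \<integral>\<^sup>+x. ennreal \<bar>\<psi> x - (\<Sum>n<N. \<phi> n) x\<bar> \<partial>M) ----> 0" unfolding nrm[OF \<psi>(1)] .
 have "(\<integral>\<^sup>+x. ennreal \<bar>\<psi> x - ?\<psi> x\<bar> \<partial>M)
   <= (\<integral>\<^sup>+x. ennreal \<bar>\<psi> x - (\<Sum>n<N. \<phi> n) x\<bar> \<partial>M) + (\<integral>\<^sup>+x. ennreal \<bar>?\<psi> x - (\<Sum>n<N. \<phi> n) x\<bar> \<partial>M)" for N
 proof -
  have "(\<integral>\<^sup>+x. ennreal \<bar>\<psi> x - ?\<psi> x\<bar> \<partial>M)
   <= (\<integral>\<^sup>+x. ennreal \<bar>\<psi> x - (\<Sum>n<N. \<phi> n) x\<bar> + ennreal \<bar>?\<psi> x - (\<Sum>n<N. \<phi> n) x\<bar> \<partial>M)"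
   by (intro nn_integral_mono) (simp flip: ennreal_plus)
  also have "... = (\<integral>\<^sup>+x. ennreal \<bar>\<psi> x - (\<Sum>n<N. \<phi> n) x\<bar> \<partial>M) + (\<integral>\<^sup>+x. ennreal \<bar>?\<psi> x - (\<Sum>n<N. \<phi> n) x\<bar> \<partial>M)"
   by (rule nn_integral_add) measurable
  finally show ?thesis .
 qed
 then have "(\<integral>\<^sup>+x. ennreal \<bar>\<psi> x - ?\<psi> x\<bar> \<partial>M) <= 0"
  using LIMSEQ_le_const[OF tendsto_add[OF lim2 lim]] by auto
 then have "(\<integral>\<^sup>+x. ennreal \<bar>\<psi> x - ?\<psi> x\<bar> \<partial>M) = 0" by simp
 then have "AE x in M. ennreal \<bar>\<psi> x - ?\<psi> x\<bar> = 0" by (subst (asm) nn_integral_0_iff_AE) auto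
 then have "AE x in M. \<psi> x = ?\<psi> x" by eventually_elim simp
 then show ?thesis unfolding \<psi>_def[symmetric] by (intro nonneg_repI) (use fin in auto)
qed

definition time_nonneg_rep :: "'a measure => (real => 'a => real) => (real \<times> 'a => ennreal) => bool" where
 "time_nonneg_rep M f G \<longleftrightarrow> G \<in> bm (half_line \<otimes> M) & (\<integral>\<^sup>+w. G w \<partial>(half_line \<otimes> M)) < top &
   (AE s in half_line. nonneg_rep M (f s) (%x. G (s, x)))"

lemma time_nonneg_rep_represents:
 "sigma_finite_measure M ==> time_nonneg_rep M f G ==> time_represents M f (%w. enn2real (G w))"
 unfolding time_nonneg_rep_def by (intro nonneg_rep_represents sigma_finite_half_line) auto

lemma time_nonneg_rep_Nrm:
 assumes M: "sigma_finite_measure M" and r: "time_nonneg_rep M f G"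
 shows "Nrm (L1_time (L1 M)) f = enn2real (\<integral>\<^sup>+w. G w \<partial>(half_line \<otimes> M))"
proof -
 let ?Y = "half_line \<otimes> M"
 have G: "G \<in> bm ?Y" "(\<integral>\<^sup>+w. G w \<partial>?Y) < top" using r by (auto simp: time_nonneg_rep_def)
 have "AE w in ?Y. G w ~= \<infinity>" using G by (intro nn_integral_PInf_AE) auto
 then have "(\<integral>\<^sup>+w. ennreal (enn2real (G w)) \<partial>?Y) = (\<integral>\<^sup>+w. G w \<partial>?Y)"
  by (intro nn_integral_cong_AE) (auto simp: less_top elim!: AE_mp)
 then show ?thesis
  unfolding time_represents_Nrm[OF M time_nonneg_rep_represents[OF M r]]
  using G by (subst integral_eq_nn_integral) auto
qed

lemma time_nonneg_repI:
 assumes M: "sigma_finite_measure M" and rep: "time_represents M f G'"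
  and G: "G \<in> bm (half_line \<otimes> M)" "(\<integral>\<^sup>+w. G w \<partial>(half_line \<otimes> M)) < top"
  and eq: "AE w in half_line \<otimes> M. G' w = enn2real (G w)"
 shows "time_nonneg_rep M f G"
proof -
 interpret M: sigma_finite_measure M by (rule M)
 interpret L: sigma_finite_measure half_line by (rule sigma_finite_half_line)
 interpret LM: pair_sigma_finite half_line M ..
 have fin: "AE s in half_line. (\<integral>\<^sup>+x. G (s, x) \<partial>M) < top"
  by (rule nonneg_marginal(5)[OF sigma_finite_half_line M G])
 have "AE s in half_line. AE x in M. G' (s, x) = enn2real (G (s, x))" by (rule LM.AE_pair[OF eq])
 moreover have "AE s in half_line. integrable M (f s) & (AE x in M. f s x = G' (s, x))"
  using rep by (simp add: represents_def)
 ultimately have "AE s in half_line. nonneg_rep M (f s) (%x. G (s, x))"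
  using fin AE_space
 proof eventually_elim
  fix s assume s: "AE x in M. G' (s, x) = enn2real (G (s, x))" "integrable M (f s) & (AE x in M. f s x = G' (s, x))"
   "(\<integral>\<^sup>+x. G (s, x) \<partial>M) < top" "s \<in> space half_line"
  have "AE x in M. f s x = G' (s, x)" using s by blast
  with s(1) have "AE x in M. f s x = enn2real (G (s, x))" by eventually_elim simp
  then show "nonneg_rep M (f s) (%x. G (s, x))"
   using s G(1) by (intro nonneg_repI) (auto intro: measurable_compose[OF measurable_Pair1' G(1)])
 qed
 then show ?thesis using G by (simp add: time_nonneg_rep_def)
qed

lemma Pos_time_nonneg_rep:
 assumes M: "sigma_finite_measure M" and f: "f \<in> Pos (L1_time (L1 M))"
 shows "\<exists>G. time_nonneg_rep M f G"
proof -
 interpret M: sigma_finite_measure M by (rule M)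
 have "f \<in> Car (L1_time (L1 M))" using f by (simp add: L1_time_simps)
 then obtain G where G: "time_represents M f G" using time_represents_total[OF M] by blast
 have Gint: "integrable (half_line \<otimes> M) G" using G by (simp add: represents_def)
 have [measurable]: "G \<in> bm (half_line \<otimes> M)" using Gint by auto
 have pos: "AE s in half_line. f s \<in> Pos (L1 M)" using f by (simp add: L1_time_simps AE_lebesgue_on)
 have "AE s in half_line. integrable M (f s) & (AE x in M. f s x = G (s, x))"
  using G by (simp add: represents_def)
 then have "AE s in half_line. nonneg_rep M (f s) (%x. ennreal (G (s, x)))"
  using pos AE_space
 proof eventually_elim
  fix s assume s: "integrable M (f s) & (AE x in M. f s x = G (s, x))" "f s \<in> Pos (L1 M)" "s \<in> space half_line"
  have [measurable]: "(%x. G (s, x)) \<in> bm M" using s(3) by measurable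
  have 1: "AE x in M. f s x = G (s, x)" using s by blast
  have 2: "AE x in M. 0 <= f s x" using s by simp
  have AE: "AE x in M. 0 <= f s x & ennreal (f s x) = ennreal (G (s, x))" using 1 2 by eventually_elim simp
  then have "(\<integral>\<^sup>+x. ennreal (G (s, x)) \<partial>M) = (\<integral>\<^sup>+x. ennreal (norm (f s x)) \<partial>M)"
   by (intro nn_integral_cong_AE) (auto elim!: AE_mp)
  also have "... < \<infinity>" using s by (simp add: integrable_iff_bounded)
  finally show "nonneg_rep M (f s) (%x. ennreal (G (s, x)))"
   using s AE borel_measurable_integrable[of M "f s"] by (simp add: nonneg_rep_def)
 qed
 moreover have "(\<integral>\<^sup>+w. ennreal (G w) \<partial>(half_line \<otimes> M)) < top"
 proof -
  have "(\<integral>\<^sup>+w. ennreal (G w) \<partial>(half_line \<otimes> M)) <= (\<integral>\<^sup>+w. ennreal (norm (G w)) \<partial>(half_line \<otimes> M))"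
   by (intro nn_integral_mono ennreal_leI) simp
  also have "... < \<infinity>" using Gint by (simp add: integrable_iff_bounded)
  finally show ?thesis by simp
 qed
 ultimately show ?thesis by (intro exI[of _ "%w. ennreal (G w)"]) (simp add: time_nonneg_rep_def)
qed

lemma time_nonneg_rep_Pos:
 assumes M: "sigma_finite_measure M" and r: "time_nonneg_rep M f G"
 shows "f \<in> Pos (L1_time (L1 M))"
proof -
 have "f \<in> Car (L1_time (L1 M))" by (rule time_represents_Car[OF M time_nonneg_rep_represents[OF M r]])
 moreover have "AE s in half_line. nonneg_rep M (f s) (%x. G (s, x))" using r by (simp add: time_nonneg_rep_def)
 then have "AE s in half_line. f s \<in> Pos (L1 M)"
 proof eventually_elim
  case (elim s)
  then have "AE x in M. 0 <= f s x & ennreal (f s x) = G (s, x)" by (simp add: nonneg_rep_def)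
  then have "AE x in M. 0 <= f s x" by eventually_elim simp
  then show ?case using nonneg_rep_integrable[OF elim] by simp
 qed
 ultimately show ?thesis by (simp add: L1_time_simps AE_lebesgue_on)
qed

lemma time_nonneg_bochner_int:
 fixes \<Gamma> :: "real \<times> (real \<times> 'a) => ennreal"
 assumes A: "A \<in> sets borel" and M: "sigma_finite_measure M"
  and \<Gamma>: "\<Gamma> \<in> bm (restrict_space lborel A \<otimes> (half_line \<otimes> M))"
  and fin: "(\<integral>\<^sup>+w. \<Gamma> w \<partial>(restrict_space lborel A \<otimes> (half_line \<otimes> M))) < top"
  and rep: "!!\<tau>. \<tau> \<in> A ==> time_nonneg_rep M (g \<tau>) (%w. \<Gamma> (\<tau>, w))"
 shows "time_nonneg_rep M (bochner_int (L1_time (L1 M)) (lebesgue_on A) g) (%w. \<integral>\<^sup>+\<tau>. \<Gamma> (\<tau>, w) \<partial>restrict_space lborel A)"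
proof -
 let ?N = "restrict_space lborel A" and ?Y = "half_line \<otimes> M"
 interpret M: sigma_finite_measure M by (rule M)
 interpret L: sigma_finite_measure half_line by (rule sigma_finite_half_line)
 interpret LM: pair_sigma_finite half_line M ..
 have Y: "sigma_finite_measure ?Y" by (rule LM.P.sigma_finite_measure_axioms)
 have N: "sigma_finite_measure ?N" by (rule sigma_finite_lborel_on[OF A])
 note nm = nonneg_marginal[OF N Y \<Gamma> fin]
 have r0: "represents ?N ?Y (%\<tau> w. enn2real (\<Gamma> (\<tau>, w))) (%w. enn2real (\<Gamma> w))"
  using represents_curry[OF N Y nm(1)] by simp
 note r1 = represents_lebesgue_on[OF A Y r0]
 have "integrable (lebesgue_on A \<otimes> ?Y) (%w. enn2real (\<Gamma> w))" using r1(1) by (simp add: represents_def)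
 then have t: "time_represents M (bochner_int (L1_time (L1 M)) (lebesgue_on A) g) (%w. LINT \<tau>|lebesgue_on A. enn2real (\<Gamma> (\<tau>, w)))"
  by (intro time_bochner_int[OF M sigma_finite_lebesgue_on[OF A]] AE_I2)
    (auto intro!: time_nonneg_rep_represents[OF M] rep)
 have "AE w in ?Y. (LINT \<tau>|lebesgue_on A. enn2real (\<Gamma> (\<tau>, w))) = enn2real (\<integral>\<^sup>+\<tau>. \<Gamma> (\<tau>, w) \<partial>?N)"
  using r1(2) nm(2) by eventually_elim simp
 then show ?thesis using nm(3,4) fin by (intro time_nonneg_repI[OF M t]) auto
qed

section \<open>Honesty as absence of escaping mass\<close>

lemma nonneg_rep_cong:
 assumes "!!x. x \<in> space M ==> \<Phi> x = \<Psi> x"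
 shows "nonneg_rep M \<phi> \<Phi> \<longleftrightarrow> nonneg_rep M \<phi> \<Psi>"
proof -
 have "\<Phi> \<in> bm M \<longleftrightarrow> \<Psi> \<in> bm M" by (intro measurable_cong assms)
 moreover have "(\<integral>\<^sup>+x. \<Phi> x \<partial>M) = (\<integral>\<^sup>+x. \<Psi> x \<partial>M)" by (intro nn_integral_cong assms)
 moreover have "(AE x in M. 0 <= \<phi> x & ennreal (\<phi> x) = \<Phi> x) \<longleftrightarrow> (AE x in M. 0 <= \<phi> x & ennreal (\<phi> x) = \<Psi> x)"
  by (intro AE_cong) (simp add: assms)
 ultimately show ?thesis by (simp add: nonneg_rep_def)
qed

lemma AE_half_line_shift:
 assumes P: "AE s in half_line. P s" and \<tau>: "0 <= \<tau>"
 shows "AE s in half_line. \<tau> <= s --> P (s - \<tau>)"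
proof -
 have "AE s in lborel. 0 <= s --> P s" using P by (simp add: AE_restrict_space_iff)
 then obtain N where N: "N \<in> null_sets lborel" "{s. \<not> (0 <= s --> P s)} \<subseteq> N"
  by (auto elim!: AE_E2 simp: eventually_ae_filter)
 have [measurable]: "N \<in> sets borel" using N by auto
 have "(\<integral>\<^sup>+s. indicator N s \<partial>lborel) = (\<integral>\<^sup>+s. indicator N (- \<tau> + 1 * s) \<partial>lborel)"
  by (subst nn_integral_real_affine[where c=1 and t="- \<tau>"]) auto
 moreover have "(\<integral>\<^sup>+s. indicator N s \<partial>lborel) = 0" using N by auto
 ultimately have "(\<integral>\<^sup>+s. indicator N (s - \<tau>) \<partial>lborel) = 0" by simp
 then have "AE s in lborel. (indicator N (s - \<tau>) :: ennreal) = 0"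
  by (subst (asm) nn_integral_0_iff_AE) auto
 then have "AE s in lborel. 0 <= s --> \<tau> <= s --> P (s - \<tau>)"
 proof eventually_elim
  fix s assume "(indicator N (s - \<tau>) :: ennreal) = 0"
  then have "s - \<tau> \<notin> N" by (simp add: indicator_def split: if_splits)
  then have "s - \<tau> \<notin> {s. \<not> (0 <= s --> P s)}" using subsetD[OF N(2), of "s - \<tau>"] by blast
  then show "0 <= s --> \<tau> <= s --> P (s - \<tau>)" by simp
 qed
 then show ?thesis by (simp add: AE_restrict_space_iff)
qed

text \<open>Concrete operators \<open>Ur\<close> and \<open>Br\<close> on real functions that realise a transport model on the positive cone.\<close>

locale represented_transport = continuous_transport M K E \<theta> k \<pi>
 for M :: "'a measure" and K :: "'k measure" and E \<theta> k \<pi> +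
 fixes Ur :: "('a => real) evolution" and Br :: "real => ('a => real) => 'a => real"
 assumes Ur_rep: "!!\<phi> \<Phi> s t. nonneg_rep M \<phi> \<Phi> ==> 0 <= s ==> s <= t
      ==> nonneg_rep M (Ur t s \<phi>) (%x. E t s x * \<Phi> (\<theta> t s x))"
  and Br_rep: "!!\<phi> \<Phi> t. nonneg_rep M \<phi> \<Phi> ==> 0 <= t
      ==> (\<integral>\<^sup>+x. (\<integral>\<^sup>+z. k t x z * \<Phi> (\<pi> x z) \<partial>K) \<partial>M) < top
      ==> nonneg_rep M (Br t \<phi>) (%x. \<integral>\<^sup>+z. k t x z * \<Phi> (\<pi> x z) \<partial>K)"
begin

text \<open>\<open>T n\<close> acts along the characteristics of time: its part at time \<open>t\<close> only sees its argument at time \<open>t - \<tau>\<close>.\<close>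

lemma T_local:
 assumes "!!x. x \<in> space M ==> G (t - \<tau>, x) = H (t - \<tau>, x)" "x \<in> space M" "\<tau> <= t"
 shows "T n \<tau> G (t, x) = T n \<tau> H (t, x)"
 using assms
proof (induction n arbitrary: \<tau> t x)
 case 0 then show ?case by (simp add: S_def \<theta>_space)
next
 case (Suc n)
 have "S (\<tau> - q) (Bo (T n q G)) (t, x) = S (\<tau> - q) (Bo (T n q H)) (t, x)" if q: "0 <= q" "q <= \<tau>" for q
 proof -
  have "Bo (T n q G) (t - (\<tau> - q), x') = Bo (T n q H) (t - (\<tau> - q), x')" if x': "x' \<in> space M" for x'
   unfolding Bo_def prod.case
  proof (intro nn_integral_cong arg_cong2[where f="(*)"] refl)
   fix z assume "z \<in> space K"
   show "T n q G (t - (\<tau> - q), \<pi> x' z) = T n q H (t - (\<tau> - q), \<pi> x' z)"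
    using Suc(2,4) q by (intro Suc.IH \<pi>_space x' \<open>z \<in> space K\<close>) (auto simp: algebra_simps)
  qed
  then show ?thesis using Suc(3) by (auto simp: S_def \<theta>_space)
 qed
 then show ?case unfolding T.simps
  by (intro nn_integral_cong) (auto split: split_indicator)
qed

lemma TT_local:
 assumes "!!x. x \<in> space M ==> G (t - \<tau>, x) = H (t - \<tau>, x)" "x \<in> space M" "\<tau> <= t"
 shows "TT \<tau> G (t, x) = TT \<tau> H (t, x)"
 unfolding TT_def using T_local[of G t \<tau> H x, OF assms] by (intro suminf_cong)

lemma state_borel: "\<Phi> \<in> bm M ==> (%(s, x). \<Phi> x) \<in> bm Y"
 using measurable_compose[OF measurable_from_Y(2)] by (simp add: split_beta')

text \<open>Induction on \<open>n\<close>. The domain condition for \<open>Br\<close> holds at almost every time because the mass produced by the first collision is finite, and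
\<open>T_split\<close> gives the order of the factors in which the series is defined, with the first collision split off.\<close>

lemma dyson_rep:
 assumes "nonneg_rep M \<phi> \<Phi>" "0 <= s" "s <= t"
 shows "nonneg_rep M (dyson (L1 M) Ur Br n t s \<phi>) (%x. T n (t - s) (%(_, x). \<Phi> x) (t, x))"
 using assms
proof (induction n arbitrary: \<phi> \<Phi> s t)
 case 0
 then show ?case using Ur_rep[OF 0] by (simp add: S_def)
next
 case (Suc n)
 let ?F = "%(_ :: real, x). \<Phi> x"
 note st = \<open>0 <= s\<close> \<open>s <= t\<close>
 have \<Phi>: "\<Phi> \<in> bm M" "(\<integral>\<^sup>+x. \<Phi> x \<partial>M) < top" using Suc(2) by (auto simp: nonneg_rep_def)
 have F: "?F \<in> bm Y" by (rule state_borel[OF \<Phi>(1)])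
 have massF: "mass s ?F = (\<integral>\<^sup>+x. \<Phi> x \<partial>M)" using st by (simp add: mass_def)
 let ?g = "%r. Bo (S (r - s) ?F)"
 let ?A = "{s..t}"
 have A: "?A \<in> sets borel" by simp
 have gfam: "(%(r, y). ?g r y) \<in> bm (borel \<otimes> Y)"
  by (intro Bo_family S_family measurable_const_family F) simp
 have gm: "(%r. mass r (?g r)) \<in> bm borel" by (intro mass_measurable gfam) simp
 have "(\<integral>\<^sup>+r\<in>{0+s..(t-s)+s}. mass r (?g r) \<partial>lborel) = (\<integral>\<^sup>+r\<in>{0..t-s}. mass (s + r) (Bo (S r ?F)) \<partial>lborel)"
  unfolding nn_integral_interval_shift[OF gm] by (simp add: add.commute)
 also have "... <= mass s ?F"
  using S_dissipative[OF F st(1), of "t - s"] st by (auto intro: order_trans[OF add_increasing[OF zero_le order_refl]])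
 finally have "(\<integral>\<^sup>+r. mass r (?g r) * indicator {s..t} r \<partial>lborel) ~= \<infinity>"
  using \<Phi>(2) unfolding massF by (auto simp: top_unique)
 then have "AE r in lborel. mass r (?g r) * indicator {s..t} r ~= \<infinity>"
  using gm by (intro nn_integral_PInf_AE) auto
 then have "AE r in lborel. r \<in> ?A --> mass r (?g r) ~= top"
  by eventually_elim (auto split: split_indicator_asm)
 then have finAE: "AE r in restrict_space lborel ?A. r \<in> ?A & mass r (?g r) ~= top"
  by (simp add: AE_restrict_space_iff)
 let ?\<Gamma> = "%w. T n (t - fst w) (?g (fst w)) (t, snd w)"
 have \<Gamma>m: "?\<Gamma> \<in> bm (borel \<otimes> M)"
  by (intro T_measurable measurable_reparam[OF gfam] measurable_into_Y) (use st in auto)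
 have \<Gamma>: "?\<Gamma> \<in> bm (restrict_space lborel ?A \<otimes> M)"
 proof -
  have "(%w. (fst w, snd w)) \<in> restrict_space lborel ?A \<otimes> M \<rightarrow>\<^sub>M borel \<otimes> M"
   by (intro measurable_Pair measurable_snd) (auto intro!: measurable_compose[OF measurable_fst] measurable_restrict_space1)
  from measurable_compose[OF this \<Gamma>m] show ?thesis by simp
 qed
 have rep: "AE r in restrict_space lborel ?A. nonneg_rep M (dyson (L1 M) Ur Br n t r (Br r (Ur r s \<phi>))) (%x. ?\<Gamma> (r, x))"
  using finAE
 proof eventually_elim
  fix r assume r: "r \<in> ?A & mass r (?g r) ~= top"
  then have r0: "0 <= r" "s <= r" "r <= t" using st by auto
  have gr: "?g r (r, x) = (\<integral>\<^sup>+z. k r x z * (E r s (\<pi> x z) * \<Phi> (\<theta> r s (\<pi> x z))) \<partial>K)" for x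
   using st by (simp add: Bo_def S_def)
  have "nonneg_rep M (Br r (Ur r s \<phi>)) (%x. ?g r (r, x))"
   unfolding gr
  proof (rule Br_rep[OF Ur_rep[OF Suc(2) st(1) r0(2)] r0(1)])
   have "(\<integral>\<^sup>+x. ?g r (r, x) \<partial>M) < top" using r r0 by (simp add: mass_def less_top)
   then show "(\<integral>\<^sup>+x. (\<integral>\<^sup>+z. k r x z * (E r s (\<pi> x z) * \<Phi> (\<theta> r s (\<pi> x z))) \<partial>K) \<partial>M) < top"
    unfolding gr .
  qed
  from Suc.IH[OF this r0(1,3)]
  have "nonneg_rep M (dyson (L1 M) Ur Br n t r (Br r (Ur r s \<phi>))) (%x. T n (t - r) (%(_, x). ?g r (r, x)) (t, x))" .
  also have "?this \<longleftrightarrow> nonneg_rep M (dyson (L1 M) Ur Br n t r (Br r (Ur r s \<phi>))) (%x. ?\<Gamma> (r, x))"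
   by (intro nonneg_rep_cong) (use r0 in \<open>auto intro!: T_local\<close>)
  finally show "nonneg_rep M (dyson (L1 M) Ur Br n t r (Br r (Ur r s \<phi>))) (%x. ?\<Gamma> (r, x))" .
 qed
 have \<Gamma>int: "(\<integral>\<^sup>+r. ?\<Gamma> (r, x) \<partial>restrict_space lborel ?A) = T (Suc n) (t - s) ?F (t, x)" if x: "x \<in> space M" for x
 proof -
  have y: "(t, x) \<in> space Y" using st x by (simp add: space_Y)
  have m: "(%r. T n (t - r) (?g r) (t, x)) \<in> bm borel"
   by (intro T_measurable gfam measurable_const y) simp
  have "(\<integral>\<^sup>+r. ?\<Gamma> (r, x) \<partial>restrict_space lborel ?A) = (\<integral>\<^sup>+r\<in>{0+s..(t-s)+s}. T n (t - r) (?g r) (t, x) \<partial>lborel)"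
   using nn_integral_restrict_space[of ?A lborel "%r. T n (t - r) (?g r) (t, x)"] by simp
  also have "... = (\<integral>\<^sup>+q\<in>{0..t-s}. T n (t - s - q) (Bo (T 0 q ?F)) (t, x) \<partial>lborel)"
   unfolding nn_integral_interval_shift[OF m] by (simp add: algebra_simps)
  also have "... = T (Suc n) (t - s) ?F (t, x)"
   using T_split[OF F y, of n 0 "t - s"] by simp
  finally show ?thesis .
 qed
 have fin: "(\<integral>\<^sup>+w. ?\<Gamma> w \<partial>(restrict_space lborel ?A \<otimes> M)) < top"
 proof -
  interpret A: sigma_finite_measure "restrict_space (lborel :: real measure) ?A" by (rule sigma_finite_lborel_on[OF A])
  interpret AM: pair_sigma_finite "restrict_space (lborel :: real measure) ?A" M ..
  have "(\<integral>\<^sup>+w. ?\<Gamma> w \<partial>(restrict_space lborel ?A \<otimes> M)) = (\<integral>\<^sup>+x. (\<integral>\<^sup>+r. ?\<Gamma> (r, x) \<partial>restrict_space lborel ?A) \<partial>M)"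
   using AM.nn_integral_snd[OF \<Gamma>] by simp
  also have "... = (\<integral>\<^sup>+x. T (Suc n) (t - s) ?F (t, x) \<partial>M)" by (intro nn_integral_cong \<Gamma>int)
  also have "... = mass (s + (t - s)) (T (Suc n) (t - s) ?F)" using st by (simp add: mass_def)
  also have "... <= (\<Sum>n\<le>Suc n. mass (s + (t - s)) (T n (t - s) ?F))" by (rule member_le_sum) auto
  also have "... <= mass s ?F"
   by (rule order_trans[OF add_increasing2[OF zero_le order_refl] fibre_contraction[OF F st(1), of "t - s"]]) (use st in simp)
  finally show ?thesis using \<Phi>(2) unfolding massF by simp
 qed
 have "nonneg_rep M (dyson (L1 M) Ur Br (Suc n) t s \<phi>) (%x. \<integral>\<^sup>+r. ?\<Gamma> (r, x) \<partial>restrict_space lborel ?A)"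
  unfolding dyson.simps by (rule nonneg_bochner_int[OF A sigma_finite_M \<Gamma> fin rep])
 also have "?this \<longleftrightarrow> nonneg_rep M (dyson (L1 M) Ur Br (Suc n) t s \<phi>) (%x. T (Suc n) (t - s) ?F (t, x))"
  by (intro nonneg_rep_cong \<Gamma>int)
 finally show ?case .
qed

lemma perturbed_rep:
 assumes r: "nonneg_rep M \<phi> \<Phi>" and st: "0 <= s" "s <= t"
 shows "nonneg_rep M (perturbed (L1 M) Ur Br t s \<phi>) (%x. TT (t - s) (%(_, x). \<Phi> x) (t, x))"
 unfolding perturbed_def TT_def
proof (rule nonneg_rep_suminf[OF dyson_rep[OF r st]])
 let ?F = "%(_ :: real, x). \<Phi> x"
 have \<Phi>: "\<Phi> \<in> bm M" "(\<integral>\<^sup>+x. \<Phi> x \<partial>M) < top" using r by (auto simp: nonneg_rep_def)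
 have "mass (s + (t - s)) (TT (t - s) ?F) <= mass s ?F" by (rule mass_TT_le[OF state_borel[OF \<Phi>(1)]]) (use st in auto)
 then show "(\<integral>\<^sup>+x. (\<Sum>n. T n (t - s) ?F (t, x)) \<partial>M) < top"
  using st \<Phi>(2) by (simp add: mass_def TT_def[abs_def])
qed

lemma lift_rep:
 assumes r: "time_nonneg_rep M f G" and \<tau>: "0 <= \<tau>"
  and W: "!!\<phi> \<Phi> s. nonneg_rep M \<phi> \<Phi> ==> \<tau> <= s ==> nonneg_rep M (W s (s - \<tau>) \<phi>) (%x. R (%(_, x). \<Phi> x) (s, x))"
  and local: "!!G H s x. (!!x. x \<in> space M ==> G (s - \<tau>, x) = H (s - \<tau>, x)) ==> x \<in> space M ==> \<tau> <= s ==> R G (s, x) = R H (s, x)"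
  and before: "!!s x. s < \<tau> ==> R G (s, x) = 0"
  and R: "R G \<in> bm Y" and fin: "tmass (R G) <= tmass G"
 shows "time_nonneg_rep M (lift_semigroup W \<tau> f) (R G)"
 unfolding time_nonneg_rep_def
proof (intro conjI R)
 show "(\<integral>\<^sup>+w. R G w \<partial>Y) < top"
  using fin r by (auto simp: tmass_def time_nonneg_rep_def intro: le_less_trans)
 have "AE s in half_line. nonneg_rep M (f s) (%x. G (s, x))" using r by (simp add: time_nonneg_rep_def)
 from AE_half_line_shift[OF this \<tau>]
 show "AE s in half_line. nonneg_rep M (lift_semigroup W \<tau> f s) (%x. R G (s, x))"
 proof eventually_elim
  fix s assume s: "\<tau> <= s --> nonneg_rep M (f (s - \<tau>)) (%x. G (s - \<tau>, x))"
  show "nonneg_rep M (lift_semigroup W \<tau> f s) (%x. R G (s, x))"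
  proof (cases "\<tau> <= s")
   case True
   then have "nonneg_rep M (W s (s - \<tau>) (f (s - \<tau>))) (%x. R (%(_, x). G (s - \<tau>, x)) (s, x))"
    using s by (intro W) auto
   also have "?this \<longleftrightarrow> nonneg_rep M (W s (s - \<tau>) (f (s - \<tau>))) (%x. R G (s, x))"
    by (intro nonneg_rep_cong local) (use True in auto)
   finally show ?thesis using True by (simp add: lift_semigroup_def)
  next
   case False
   then show ?thesis by (simp add: lift_semigroup_def before nonneg_rep_def zero_fun_def)
  qed
 qed
qed

lemma Tn_rep:
 assumes r: "time_nonneg_rep M f G" and \<tau>: "0 <= \<tau>"
 shows "time_nonneg_rep M (Tn (L1 M) Ur Br n \<tau> f) (T n \<tau> G)"
 unfolding Tn_def
proof (rule lift_rep[OF r \<tau>])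
 have G: "G \<in> bm Y" using r by (simp add: time_nonneg_rep_def)
 show "T n \<tau> G \<in> bm Y" by (rule T_borel[OF G])
 show "tmass (T n \<tau> G) <= tmass G" by (rule tmass_T_le[OF G \<tau>])
 show "nonneg_rep M (dyson (L1 M) Ur Br n s (s - \<tau>) \<phi>) (%x. T n \<tau> (%(_, x). \<Phi> x) (s, x))"
  if "nonneg_rep M \<phi> \<Phi>" "\<tau> <= s" for \<phi> \<Phi> s
  using dyson_rep[OF that(1), of "s - \<tau>" s n] that(2) \<tau> by simp
qed (auto intro: T_local T_before)

lemma TV_rep:
 assumes r: "time_nonneg_rep M f G" and \<tau>: "0 <= \<tau>"
 shows "time_nonneg_rep M (TV (L1 M) Ur Br \<tau> f) (TT \<tau> G)"
 unfolding TV_def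
proof (rule lift_rep[OF r \<tau>])
 have G: "G \<in> bm Y" using r by (simp add: time_nonneg_rep_def)
 show "TT \<tau> G \<in> bm Y" by (rule TT_borel[OF G])
 show "tmass (TT \<tau> G) <= tmass G" by (rule tmass_TT_le[OF G \<tau>])
 show "nonneg_rep M (perturbed (L1 M) Ur Br s (s - \<tau>) \<phi>) (%x. TT \<tau> (%(_, x). \<Phi> x) (s, x))"
  if "nonneg_rep M \<phi> \<Phi>" "\<tau> <= s" for \<phi> \<Phi> s
  using perturbed_rep[OF that(1), of "s - \<tau>" s] that(2) \<tau> by simp
 show "TT \<tau> G (s, x) = 0" if "s < \<tau>" for s x
  using T_before[OF that] by (simp add: TT_def)
qed (auto intro: TT_local)

lemma orbit_integral_rep:
 fixes R :: "real => real \<times> 'a => ennreal" and t :: real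
 assumes f: "!!\<tau>. 0 <= \<tau> ==> time_nonneg_rep M (g \<tau>) (R \<tau>)"
  and R: "(%(\<tau>, y). R \<tau> y) \<in> bm (borel \<otimes> Y)"
  and fin: "(\<integral>\<^sup>+\<tau>\<in>{0..t}. tmass (R \<tau>) \<partial>lborel) < top"
 shows "time_nonneg_rep M (bochner_int (L1_time (L1 M)) (lebesgue_on {0..t}) g) (%w. \<integral>\<^sup>+\<tau>\<in>{0..t}. R \<tau> w \<partial>lborel)"
proof -
 let ?\<Gamma> = "%w. R (fst w) (snd w)"
 have A: "{0..t} \<in> sets borel" by simp
 have \<Gamma>: "?\<Gamma> \<in> bm (restrict_space lborel {0..t} \<otimes> Y)"
  using family_restrict[OF R] by (simp add: split_beta')
 have "(\<integral>\<^sup>+w. ?\<Gamma> w \<partial>(restrict_space lborel {0..t} \<otimes> Y)) = (\<integral>\<^sup>+\<tau>\<in>{0..t}. tmass (R \<tau>) \<partial>lborel)"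
  unfolding set_nn_integral_restrict[OF A] tmass_def using Y.P.nn_integral_fst[OF \<Gamma>] by simp
 then have "(\<integral>\<^sup>+w. ?\<Gamma> w \<partial>(restrict_space lborel {0..t} \<otimes> Y)) < top" using fin by simp
 from time_nonneg_bochner_int[OF A sigma_finite_M \<Gamma> this, of g]
 show ?thesis using f by (simp add: set_nn_integral_restrict)
qed

lemma accum_rep:
 assumes r: "time_nonneg_rep M f G"
 shows "time_nonneg_rep M (bochner_int (L1_time (L1 M)) (lebesgue_on {0..t}) (%s. Tn (L1 M) Ur Br n s f)) (accum n t G)"
 unfolding accum_def[abs_def]
proof (rule orbit_integral_rep[OF Tn_rep[OF r]])
 have G: "G \<in> bm Y" "tmass G < top" using r by (auto simp: time_nonneg_rep_def tmass_def)
 show "(%(\<tau>, y). T n \<tau> G y) \<in> bm (borel \<otimes> Y)" by (intro T_G_family G) simp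
 have "(\<integral>\<^sup>+\<tau>\<in>{0..t}. tmass (T n \<tau> G) \<partial>lborel) <= tmass G * ennreal t" by (intro time_integral_le tmass_T_le G)
 also have "... < top" using G by (simp add: ennreal_mult_less_top)
 finally show "(\<integral>\<^sup>+\<tau>\<in>{0..t}. tmass (T n \<tau> G) \<partial>lborel) < top" .
qed

lemma TT_accum_rep:
 assumes r: "time_nonneg_rep M f G"
 shows "time_nonneg_rep M (bochner_int (L1_time (L1 M)) (lebesgue_on {0..t}) (%s. TV (L1 M) Ur Br s f)) (TT_accum t G)"
 unfolding TT_accum_def[abs_def]
proof (rule orbit_integral_rep[OF TV_rep[OF r]])
 have G: "G \<in> bm Y" "tmass G < top" using r by (auto simp: time_nonneg_rep_def tmass_def)
 show "(%(\<tau>, y). TT \<tau> G y) \<in> bm (borel \<otimes> Y)" by (intro TT_G_family G)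
 have "(\<integral>\<^sup>+\<tau>\<in>{0..t}. tmass (TT \<tau> G) \<partial>lborel) <= tmass G * ennreal t" by (intro time_integral_le tmass_TT_le G)
 also have "... < top" using G by (simp add: ennreal_mult_less_top)
 finally show "(\<integral>\<^sup>+\<tau>\<in>{0..t}. tmass (TT \<tau> G) \<partial>lborel) < top" .
qed

end

context represented_transport begin

lemma state_space_Car:
 "time_nonneg_rep M f G ==> f \<in> Car (L1_time (L1 M))"
 by (rule time_represents_Car[OF sigma_finite_M time_nonneg_rep_represents[OF sigma_finite_M]])

text \<open>The difference quotient equals that of gains minus losses, so its distance to the claimed derivative splits into two parts.\<close>

lemma difference_quotient_dist:
 assumes j: "time_nonneg_rep M j J" and h: "0 < h"
  and A: "A \<in> bm Y" "A0 \<in> bm Y" and C: "C \<in> bm Y" "C0 \<in> bm Y"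
  and id: "!!y. y \<in> space Y ==> TT h J y + A y = J y + C y"
  and int: "integrable Y (%w. enn2real (C0 w) - enn2real (A0 w))"
 shows "ennreal (Nrm (L1_time (L1 M)) ((1 / h) *\<^sub>R (TV (L1 M) Ur Br h j - j) - (%s x. enn2real (C0 (s, x)) - enn2real (A0 (s, x)))))
  <= dist1 (%y. C y / ennreal h) C0 + dist1 (%y. A y / ennreal h) A0" (is "?l <= ?c + ?a")
proof (cases "?c = top \<or> ?a = top")
 case True
 then show ?thesis by auto
next
 case False
 note [measurable] = A C
 have J: "J \<in> bm Y" "tmass J < top" using j by (auto simp: time_nonneg_rep_def tmass_def)
 have [measurable]: "J \<in> bm Y" "TT h J \<in> bm Y" using J TT_borel by auto
 let ?Q = "%w. (1 / h) * (enn2real (TT h J w) - enn2real (J w)) - (enn2real (C0 w) - enn2real (A0 w))"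
 let ?q = "(1 / h) *\<^sub>R (TV (L1 M) Ur Br h j - j) - (%s x. enn2real (C0 (s, x)) - enn2real (A0 (s, x)))"
 have rj: "time_represents M j (%w. enn2real (J w))"
  by (rule time_nonneg_rep_represents[OF sigma_finite_M j])
 have rTV: "time_represents M (TV (L1 M) Ur Br h j) (%w. enn2real (TT h J w))"
  by (rule time_nonneg_rep_represents[OF sigma_finite_M TV_rep[OF j]]) (use h in simp)
 have rg: "time_represents M (%s x. enn2real (C0 (s, x)) - enn2real (A0 (s, x))) (%w. enn2real (C0 w) - enn2real (A0 w))"
  using represents_curry[OF sigma_finite_half_line sigma_finite_M int] .
 have "time_represents M ((1 / h) *\<^sub>R (TV (L1 M) Ur Br h j + (-1) *\<^sub>R j) + (-1) *\<^sub>R (%s x. enn2real (C0 (s, x)) - enn2real (A0 (s, x))))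
   ((1 / h) *\<^sub>R ((%w. enn2real (TT h J w)) + (-1) *\<^sub>R (%w. enn2real (J w))) + (-1) *\<^sub>R (%w. enn2real (C0 w) - enn2real (A0 w)))"
  by (intro represents_add represents_scale rj rTV rg)
 moreover have "(1 / h) *\<^sub>R (TV (L1 M) Ur Br h j + (-1) *\<^sub>R j) + (-1) *\<^sub>R (%s x. enn2real (C0 (s, x)) - enn2real (A0 (s, x))) = ?q"
  by simp
 moreover have "(1 / h) *\<^sub>R ((%w. enn2real (TT h J w)) + (-1) *\<^sub>R (%w. enn2real (J w))) + (-1) *\<^sub>R (%w. enn2real (C0 w) - enn2real (A0 w)) = ?Q"
  by (simp add: fun_eq_iff scaleR_fun_def)
 ultimately have rq: "time_represents M ?q ?Q" by simp
 then have Qint: "integrable Y ?Q" by (simp add: represents_def)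
 have "?l = (\<integral>\<^sup>+w. ennreal \<bar>?Q w\<bar> \<partial>Y)"
  unfolding time_represents_Nrm[OF sigma_finite_M rq] by (rule integral_abs_eq_nn[OF Qint])
 also have "... <= (\<integral>\<^sup>+w. ediff (C w / ennreal h) (C0 w) + ediff (A w / ennreal h) (A0 w) \<partial>Y)"
 proof (rule nn_integral_mono_AE)
  have "AE w in Y. ediff (C w / ennreal h) (C0 w) ~= \<infinity>" "AE w in Y. ediff (A w / ennreal h) (A0 w) ~= \<infinity>"
   using False by (intro nn_integral_PInf_AE; simp add: dist1_def tmass_def)+
  moreover have "AE w in Y. J w ~= top" by (rule finite_AE) (use J in auto)
  moreover have "AE w in Y. TT h J w ~= top"
   by (rule finite_AE) (use tmass_TT_le[OF J(1), of h] J(2) h in \<open>auto simp: top_unique\<close>)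
  ultimately show "AE w in Y. ennreal \<bar>?Q w\<bar> <= ediff (C w / ennreal h) (C0 w) + ediff (A w / ennreal h) (A0 w)"
   using AE_space
  proof eventually_elim
   fix w assume w: "ediff (C w / ennreal h) (C0 w) ~= \<infinity>" "ediff (A w / ennreal h) (A0 w) ~= \<infinity>"
    "J w ~= top" "TT h J w ~= top" "w \<in> space Y"
   have fin: "C w / ennreal h ~= top" "C0 w ~= top" "A w / ennreal h ~= top" "A0 w ~= top"
    using w(1,2) by auto
   have CA: "C w ~= top" "A w ~= top"
    using fin h by (auto simp: ennreal_top_divide)
   have "enn2real (TT h J w) + enn2real (A w) = enn2real (J w) + enn2real (C w)"
    using arg_cong[OF id[OF w(5)], of enn2real] w CA by (simp add: enn2real_plus less_top)
   then have e: "(1 / h) * (enn2real (TT h J w) - enn2real (J w)) = enn2real (C w) / h - enn2real (A w) / h"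
    by (simp add: diff_divide_distrib[symmetric])
   have dv: "enn2real (u / ennreal h) = enn2real u / h" if "u ~= top" for u
    using that h by (cases u) (auto simp: divide_ennreal)
   have "\<bar>?Q w\<bar> <= \<bar>enn2real (C w / ennreal h) - enn2real (C0 w)\<bar> + \<bar>enn2real (A w / ennreal h) - enn2real (A0 w)\<bar>"
    unfolding e dv[OF CA(1)] dv[OF CA(2)] by linarith
   then have "ennreal \<bar>?Q w\<bar> <= ennreal (\<bar>enn2real (C w / ennreal h) - enn2real (C0 w)\<bar> + \<bar>enn2real (A w / ennreal h) - enn2real (A0 w)\<bar>)"
    by (rule ennreal_leI)
   also have "... = ediff (C w / ennreal h) (C0 w) + ediff (A w / ennreal h) (A0 w)"
    using fin by (simp add: ediff_finite)
   finally show "ennreal \<bar>?Q w\<bar> <= ediff (C w / ennreal h) (C0 w) + ediff (A w / ennreal h) (A0 w)" .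
  qed
 qed
 also have "... = ?c + ?a" unfolding dist1_def tmass_def by (rule nn_integral_add) measurable
 finally show ?thesis .
qed

text \<open>The right derivative is an admissible value of the generator, and any two admissible values have distance 0; the norm functional therefore takes the same value on them.\<close>

lemma generator_value:
 assumes j: "time_nonneg_rep M j J" and rd: "right_derivative J A0 C0"
  and A0: "A0 \<in> bm Y" "tmass A0 < top" and C0: "C0 \<in> bm Y" "tmass C0 < top"
 shows "norm_functional (L1_time (L1 M)) (generator (L1_time (L1 M)) (TV (L1 M) Ur Br) j)
    = enn2real (tmass C0) - enn2real (tmass A0)"
proof -
 let ?X = "L1_time (L1 M)" and ?TV = "TV (L1 M) Ur Br"
 let ?g = "%s x. enn2real (C0 (s, x)) - enn2real (A0 (s, x))"
 let ?G = "%w. enn2real (C0 w) - enn2real (A0 w)"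
 have real_int: "integrable Y (%w. enn2real (B w)) & (LINT w|Y. enn2real (B w)) = enn2real (tmass B)"
  if B: "B \<in> bm Y" "tmass B < top" for B
 proof
  have [measurable]: "B \<in> bm Y" by fact
  have "AE w in Y. B w ~= top" by (rule finite_AE) (use B in auto)
  then have e: "(\<integral>\<^sup>+w. ennreal (enn2real (B w)) \<partial>Y) = tmass B"
   unfolding tmass_def by (intro nn_integral_cong_AE) (auto simp: less_top elim!: eventually_mono)
  then show "integrable Y (%w. enn2real (B w))" using B by (intro integrableI_bounded) auto
  show "(LINT w|Y. enn2real (B w)) = enn2real (tmass B)"
   unfolding e[symmetric] by (rule integral_eq_nn_integral) auto
 qed
 have int: "integrable Y ?G" using real_int[OF A0] real_int[OF C0] by auto
 have Gval: "(LINT w|Y. ?G w) = enn2real (tmass C0) - enn2real (tmass A0)"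
  using real_int[OF A0] real_int[OF C0] by simp
 have rg: "time_represents M ?g ?G"
  using represents_curry[OF sigma_finite_half_line sigma_finite_M int] .
 obtain A C where AC: "!!h. 0 < h ==> A h \<in> bm Y" "!!h. 0 < h ==> C h \<in> bm Y"
   "!!h y. 0 < h ==> y \<in> space Y ==> TT h J y + A h y = J y + C h y"
  and lim: "((%h. dist1 (%y. A h y / ennreal h) A0) \<longlongrightarrow> 0) (at_right 0)"
   "((%h. dist1 (%y. C h y / ennreal h) C0) \<longlongrightarrow> 0) (at_right 0)"
  using rd unfolding right_derivative_def by blast
 have "((%h. ennreal (Nrm ?X ((1 / h) *\<^sub>R (?TV h j - j) - ?g))) \<longlongrightarrow> 0) (at_right 0)"
 proof (rule tendsto_0_le_ennreal)
  show "((%h. dist1 (%y. C h y / ennreal h) C0 + dist1 (%y. A h y / ennreal h) A0) \<longlongrightarrow> 0) (at_right 0)"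
   using tendsto_add[OF lim(2,1)] by simp
  show "ennreal (Nrm ?X ((1 / h) *\<^sub>R (?TV h j - j) - ?g)) <= dist1 (%y. C h y / ennreal h) C0 + dist1 (%y. A h y / ennreal h) A0"
   if h: "0 < h" for h
   by (rule difference_quotient_dist[OF j h AC(1)[OF h] A0(1) AC(2)[OF h] C0(1) AC(3)[OF h] int])
 qed
 then have "((%h. ennreal (Nrm ?X ((1 / h) *\<^sub>R (?TV h j - j) - ?g))) \<longlongrightarrow> ennreal 0) (at_right 0)" by simp
 moreover have Nrm0: "0 <= Nrm ?X f" for f by (simp add: L1_time_simps)
 ultimately have L: "((%h. Nrm ?X ((1 / h) *\<^sub>R (?TV h j - j) - ?g)) \<longlongrightarrow> 0) (at_right 0)"
  by (subst (asm) tendsto_ennreal_iff) auto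
 have ex: "is_generator_value ?X ?TV j ?g"
  unfolding is_generator_value_def
  using state_space_Car[OF j] time_represents_Car[OF sigma_finite_M rg] L by blast
 let ?g' = "generator ?X ?TV j"
 have "is_generator_value ?X ?TV j ?g'"
  unfolding generator_def by (rule someI[where P="is_generator_value ?X ?TV j", OF ex])
 then have g': "?g' \<in> Car ?X" and L': "((%h. Nrm ?X ((1 / h) *\<^sub>R (?TV h j - j) - ?g')) \<longlongrightarrow> 0) (at_right 0)"
  by (auto simp: is_generator_value_def)
 obtain G' where rg': "time_represents M ?g' G'" using time_represents_total[OF sigma_finite_M g'] by blast
 have G'int: "integrable Y G'" using rg' by (simp add: represents_def)
 have "\<bar>(LINT w|Y. G' w) - (LINT w|Y. ?G w)\<bar> <= Nrm ?X ((1 / h) *\<^sub>R (?TV h j - j) - ?g') + Nrm ?X ((1 / h) *\<^sub>R (?TV h j - j) - ?g)"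
  if h: "0 < h" for h
 proof -
  let ?u = "(1 / h) *\<^sub>R (?TV h j - j)"
  have rT: "time_nonneg_rep M (?TV h j) (TT h J)" by (rule TV_rep[OF j]) (use h in simp)
  obtain U where U: "time_represents M ((1 / h) *\<^sub>R (?TV h j + (-1) *\<^sub>R j)) U"
   using represents_scale[OF represents_add[OF time_nonneg_rep_represents[OF sigma_finite_M rT]
      represents_scale[OF time_nonneg_rep_represents[OF sigma_finite_M j]]]] by blast
  then have U: "time_represents M ?u U" by simp
  have Uint: "integrable Y U" using U by (simp add: represents_def)
  have d: "Nrm ?X (?u - f) = (LINT w|Y. \<bar>U w - F w\<bar>)" if "time_represents M f F" for f F
  proof -
   have "time_represents M (?u + (-1) *\<^sub>R f) (U + (-1) *\<^sub>R F)" by (intro represents_add U represents_scale that)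
   moreover have "?u + (-1) *\<^sub>R f = ?u - f" by simp
   moreover have "(U + (-1) *\<^sub>R F) w = U w - F w" for w by (simp add: scaleR_fun_def)
   ultimately show ?thesis using time_represents_Nrm[OF sigma_finite_M, of "?u - f" "U + (-1) *\<^sub>R F"] by simp
  qed
  have "\<bar>(LINT w|Y. G' w) - (LINT w|Y. ?G w)\<bar> = \<bar>(LINT w|Y. G' w - ?G w)\<bar>"
   using G'int int by (subst Bochner_Integration.integral_diff) auto
  also have "... <= (LINT w|Y. \<bar>G' w - ?G w\<bar>)" by (rule integral_abs_bound)
  also have "... <= (LINT w|Y. \<bar>U w - G' w\<bar> + \<bar>U w - ?G w\<bar>)"
   using G'int int Uint by (intro integral_mono) auto
  also have "... = (LINT w|Y. \<bar>U w - G' w\<bar>) + (LINT w|Y. \<bar>U w - ?G w\<bar>)"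
   using G'int int Uint by (intro Bochner_Integration.integral_add) auto
  finally show ?thesis unfolding d[OF rg'] d[OF rg] .
 qed
 then have "\<forall>\<^sub>F h in at_right 0. \<bar>(LINT w|Y. G' w) - (LINT w|Y. ?G w)\<bar>
    <= Nrm ?X ((1 / h) *\<^sub>R (?TV h j - j) - ?g') + Nrm ?X ((1 / h) *\<^sub>R (?TV h j - j) - ?g)"
  by (auto simp: eventually_at_right_field intro: exI[of _ 1])
 from tendsto_lowerbound[OF tendsto_add[OF L' L] this]
 have "(LINT w|Y. G' w) = (LINT w|Y. ?G w)" by (simp add: trivial_limit_at_right_real)
 then show ?thesis unfolding norm_functional_eq[OF sigma_finite_M rg'] Gval[symmetric] .
qed

text \<open>The contributions of the generator of the unperturbed semigroup cancel.\<close>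

lemma a_fun_eq: "a_fun F U B f = - norm_functional (L1_time F) (generator (L1_time F) (TV F U B) f)"
 by (simp add: a_fun_def B_hat_def gen_G_def)

lemma a_fun_accum:
 assumes r: "time_nonneg_rep M f G" and t: "0 <= t"
 shows "a_fun (L1 M) Ur Br (bochner_int (L1_time (L1 M)) (lebesgue_on {0..t}) (%s. Tn (L1 M) Ur Br n s f))
  = (case n of 0 => enn2real (tmass G) | Suc m => enn2real (gain m t G))
   - enn2real (tmass (T n t G)) - enn2real (gain n t G)"
proof -
 have G: "G \<in> bm Y" "tmass G < top" using r by (auto simp: time_nonneg_rep_def tmass_def)
 have Gn: "tmass G ~= top" using G by simp
 let ?A0 = "case n of 0 => G | Suc m => Bo (accum m t G)"
 let ?C0 = "%y. T n t G y + Bo (accum n t G) y"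
 have BJ: "Bo (accum m t G) \<in> bm Y" for m by (intro Bo_borel accum_borel G)
 have gf: "gain m t G < top" "tmass (T m t G) < top" for m
  using gain_le_tmass[OF G(1) t, of m] tmass_T_le[OF G(1) t, of m] G(2) by (auto intro: le_less_trans)
 have C0: "tmass ?C0 = tmass (T n t G) + gain n t G"
  unfolding tmass_Bo_accum[OF G(1), symmetric] by (intro tmass_add T_borel BJ G)
 have A0: "tmass ?A0 = (case n of 0 => tmass G | Suc m => gain m t G)"
  using tmass_Bo_accum[OF G(1)] by (simp split: nat.split)
 have "norm_functional (L1_time (L1 M)) (generator (L1_time (L1 M)) (TV (L1 M) Ur Br)
   (bochner_int (L1_time (L1 M)) (lebesgue_on {0..t}) (%s. Tn (L1 M) Ur Br n s f)))
   = enn2real (tmass ?C0) - enn2real (tmass ?A0)"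
 proof (rule generator_value[OF accum_rep[OF r] right_derivative_accum[OF G(1) Gn t]])
  show "?A0 \<in> bm Y" using G BJ by (simp split: nat.split)
  show "tmass ?A0 < top" unfolding A0 using G gf by (simp split: nat.split)
  show "?C0 \<in> bm Y" by (intro borel_measurable_add T_borel BJ G)
  show "tmass ?C0 < top" unfolding C0 using gf by simp
 qed
 then show ?thesis
  unfolding a_fun_eq C0 A0 using gf by (simp add: enn2real_plus split: nat.split)
qed

text \<open>The gains telescope and tend to the escaping mass.\<close>

lemma a_fun_sums:
 assumes r: "time_nonneg_rep M f G" and t: "0 <= t"
 shows "(%n. a_fun (L1 M) Ur Br (bochner_int (L1_time (L1 M)) (lebesgue_on {0..t}) (%s. Tn (L1 M) Ur Br n s f)))
   sums (enn2real (tmass G) - enn2real (tmass (TT t G)) - enn2real (escape t G))"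
proof -
 have G: "G \<in> bm Y" "tmass G < top" using r by (auto simp: time_nonneg_rep_def tmass_def)
 have fin: "gain m t G < top" "tmass (T m t G) < top" for m
  using gain_le_tmass[OF G(1) t, of m] tmass_T_le[OF G(1) t, of m] G(2) by (auto intro: le_less_trans)
 have fin2: "tmass (TT t G) < top" "escape t G < top"
  using TT_escape_le[OF G(1) t] G(2) by (auto simp: less_top[symmetric] top_unique)
 let ?a = "%n. (case n of 0 => enn2real (tmass G) | Suc m => enn2real (gain m t G))
   - enn2real (tmass (T n t G)) - enn2real (gain n t G)"
 have part: "(\<Sum>n\<le>N. ?a n) = enn2real (tmass G) - (\<Sum>n\<le>N. enn2real (tmass (T n t G))) - enn2real (gain N t G)" for N
  by (induction N) auto
 have "(%N. \<Sum>n\<le>N. tmass (T n t G)) ----> tmass (TT t G)"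
  unfolding tmass_TT[OF G(1)] using summable_LIMSEQ'[of "%i. tmass (T i t G)"] by simp
 then have "(%N. enn2real (\<Sum>n\<le>N. tmass (T n t G))) ----> enn2real (tmass (TT t G))"
  using fin2 by (intro tendsto_enn2real) auto
 moreover have "enn2real (\<Sum>n\<le>N. tmass (T n t G)) = (\<Sum>n\<le>N. enn2real (tmass (T n t G)))" for N
 proof (induction N)
  case (Suc N)
  have "(\<Sum>n\<le>N. tmass (T n t G)) < top" using fin by (simp del: T.simps)
  then show ?case using Suc fin(2)[of "Suc N"] by (simp add: enn2real_plus del: T.simps)
 qed simp
 ultimately have 1: "(%N. \<Sum>n\<le>N. enn2real (tmass (T n t G))) ----> enn2real (tmass (TT t G))" by simp
 have 2: "(%N. enn2real (gain N t G)) ----> enn2real (escape t G)"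
  using gain_tendsto_escape[OF G(1) t] fin2 by (intro tendsto_enn2real) auto
 have "(%N. \<Sum>n\<le>N. ?a n) ----> enn2real (tmass G) - enn2real (tmass (TT t G)) - enn2real (escape t G)"
  unfolding part by (intro tendsto_diff tendsto_const 1 2)
 then show ?thesis
  unfolding a_fun_accum[OF r t] sums_def_le .
qed

lemma a_hat_TT_accum:
 assumes r: "time_nonneg_rep M f G" and t: "0 <= t"
 shows "a_hat (L1 M) Ur Br (bochner_int (L1_time (L1 M)) (lebesgue_on {0..t}) (%s. TV (L1 M) Ur Br s f))
  = enn2real (tmass G) - enn2real (tmass (TT t G)) - enn2real (escape t G)"
proof -
 have G: "G \<in> bm Y" "tmass G ~= top" using r by (auto simp: time_nonneg_rep_def tmass_def)
 let ?F = "bochner_int (L1_time (L1 M)) (lebesgue_on {0..t}) (%s. TV (L1 M) Ur Br s f)"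
 note rF = TT_accum_rep[OF r, of t]
 let ?\<Gamma> = "TT_accum t G"
 have "(\<Sum>n. a_fun (L1 M) Ur Br (bochner_int (L1_time (L1 M)) (lebesgue_on {0..h}) (%s. Tn (L1 M) Ur Br n s ?F)))
   = enn2real (tmass ?\<Gamma>) - enn2real (tmass (TT h ?\<Gamma>)) - enn2real (escape h ?\<Gamma>)" if "0 < h" for h
  using a_fun_sums[OF rF, of h] that by (simp add: sums_unique[symmetric])
 then have "\<forall>\<^sub>F h in at_right 0. (1 / h) * (enn2real (tmass ?\<Gamma>) - enn2real (tmass (TT h ?\<Gamma>)) - enn2real (escape h ?\<Gamma>))
   = (1 / h) * (\<Sum>n. a_fun (L1 M) Ur Br (bochner_int (L1_time (L1 M)) (lebesgue_on {0..h}) (%s. Tn (L1 M) Ur Br n s ?F)))"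
  by (auto simp: eventually_at_right_field intro: exI[of _ 1])
 from Lim_transform_eventually[OF defect_limit[OF G t] this]
 show ?thesis unfolding a_hat_def by (intro tendsto_Lim) (simp_all add: trivial_limit_at_right_real)
qed

text \<open>The functional in the definition of honesty equals the loss of mass minus the escaping mass, so the defect of the balance is exactly the escaping mass.\<close>

theorem honest_iff_escape:
 "honest (L1 M) Ur Br \<longleftrightarrow>
  (\<forall>G t. G \<in> bm Y --> tmass G ~= top --> 0 <= t --> escape t G = 0)"
proof -
 have eq: "Nrm (L1_time (L1 M)) (TV (L1 M) Ur Br t f) = Nrm (L1_time (L1 M)) f
    - a_hat (L1 M) Ur Br (bochner_int (L1_time (L1 M)) (lebesgue_on {0..t}) (%s. TV (L1 M) Ur Br s f))
   \<longleftrightarrow> escape t G = 0" if r: "time_nonneg_rep M f G" and t: "0 <= t" for f G t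
 proof -
  have G: "G \<in> bm Y" "tmass G < top" using r by (auto simp: time_nonneg_rep_def tmass_def)
  have "escape t G ~= top" using TT_escape_le[OF G(1) t] G(2) by (auto simp: top_unique)
  then show ?thesis
   unfolding a_hat_TT_accum[OF r t] time_nonneg_rep_Nrm[OF sigma_finite_M r]
    time_nonneg_rep_Nrm[OF sigma_finite_M TV_rep[OF r t]] tmass_def[symmetric]
   by (auto simp: enn2real_eq_0_iff)
 qed
 show ?thesis
 proof
  assume h: "honest (L1 M) Ur Br"
  show "\<forall>G t. G \<in> bm Y --> tmass G ~= top --> 0 <= t --> escape t G = 0"
  proof (intro allI impI)
   fix G :: "real \<times> 'a => ennreal" and t :: real
   assume G: "G \<in> bm Y" "tmass G ~= top" and t: "0 <= t"
   have fin: "(\<integral>\<^sup>+w. G w \<partial>Y) < top" using G by (simp add: tmass_def less_top)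
   have "time_nonneg_rep M (%s x. enn2real (G (s, x))) G"
    by (rule time_nonneg_repI[OF sigma_finite_M _ G(1) fin AE_I2])
      (auto intro: represents_curry[OF sigma_finite_half_line sigma_finite_M nonneg_marginal(1)[OF sigma_finite_half_line sigma_finite_M G(1) fin]])
   then show "escape t G = 0"
    using h eq[of _ G t] time_nonneg_rep_Pos[OF sigma_finite_M] t unfolding honest_def by blast
  qed
 next
  assume e: "\<forall>G t. G \<in> bm Y --> tmass G ~= top --> 0 <= t --> escape t G = 0"
  show "honest (L1 M) Ur Br"
   unfolding honest_def
  proof (intro ballI allI impI)
   fix f and t :: real assume f: "f \<in> Pos (L1_time (L1 M))" and t: "0 <= t"
   obtain G where r: "time_nonneg_rep M f G" using Pos_time_nonneg_rep[OF sigma_finite_M f] by blast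
   then have "escape t G = 0" using e t by (auto simp: time_nonneg_rep_def tmass_def)
   then show "Nrm (L1_time (L1 M)) (TV (L1 M) Ur Br t f) = Nrm (L1_time (L1 M)) f
    - a_hat (L1 M) Ur Br (bochner_int (L1_time (L1 M)) (lebesgue_on {0..t}) (%s. TV (L1 M) Ur Br s f))"
    using eq[OF r t] by simp
  qed
 qed
qed

end

section \<open>Exponential decay along an integrable rate\<close>

text \<open>In a step of length \<open>d\<close>, the left Riemann sum of the decreasing exponential exceeds the integral by at most the square of \<open>d\<close>.\<close>

lemma exp_decrement_bound:
 fixes x d :: real
 assumes "0 <= x" "0 <= d"
 shows "exp (- x) * d <= exp (- x) - exp (- (x + d)) + d\<^sup>2"
proof -
 have "exp (- d) <= 1 / (1 + d)"
  using exp_ge_add_one_self[of d] assms(2) by (simp add: exp_minus field_simps)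
 moreover have "d - 1 + 1 / (1 + d) <= d\<^sup>2"
 proof -
  have "d - 1 + 1 / (1 + d) = d\<^sup>2 / (1 + d)" using assms(2) by (simp add: field_simps power2_eq_square)
  also have "... <= d\<^sup>2" using assms(2) by (simp add: divide_le_eq mult_left_le_one_le power2_eq_square) (simp add: algebra_simps)
  finally show ?thesis .
 qed
 ultimately have "d - 1 + exp (- d) <= d\<^sup>2" by linarith
 then have "exp (- x) * (d - 1 + exp (- d)) <= exp (- x) * d\<^sup>2" by (intro mult_left_mono) auto
 also have "... <= 1 * d\<^sup>2" using assms by (intro mult_right_mono) auto
 finally show ?thesis by (simp add: algebra_simps exp_add[symmetric])
qed

text \<open>Absorption at rate \<open>w\<close> and survival together have probability at most one. The rate is merely integrable, so instead of differentiating, the interval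
is cut where the integrated rate grows by equal steps.\<close>

lemma exp_decay_integral:
 fixes w :: "real => ennreal"
 assumes w[measurable]: "w \<in> bm borel" and st: "s <= t"
  and fin: "(\<integral>\<^sup>+q\<in>{s..t}. w q \<partial>lborel) < top"
 shows "ennreal (exp (- enn2real (\<integral>\<^sup>+q\<in>{s..t}. w q \<partial>lborel)))
   + (\<integral>\<^sup>+r\<in>{s..t}. w r * ennreal (exp (- enn2real (\<integral>\<^sup>+q\<in>{s..r}. w q \<partial>lborel))) \<partial>lborel) <= 1"
proof -
 let ?A = "%x y. \<integral>\<^sup>+q\<in>{x..y}. w q \<partial>lborel"
 let ?a = "%x. enn2real (?A s x)"
 let ?g = "%r. w r * ennreal (exp (- ?a r))"
 let ?I = "%x y. \<integral>\<^sup>+r\<in>{x..y}. ?g r \<partial>lborel"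
 have Afin: "?A x y < top" if "s <= x" "y <= t" for x y
 proof -
  have "?A x y <= ?A s t" using that by (intro nn_integral_mono) (auto split: split_indicator)
  then show ?thesis using fin by (rule le_less_trans)
 qed
 have split: "?A s y = ?A s x + ?A x y" if "s <= x" "x <= y" for x y
  by (rule nn_integral_interval_split[OF w that])
 have aA: "ennreal (?a y - ?a x) = ?A x y" "?a x <= ?a y" if "s <= x" "x <= y" "y <= t" for x y
 proof -
  have "?a y = ?a x + enn2real (?A x y)"
   using split[OF that(1,2)] Afin[of s x] Afin[of x y] that by (simp add: enn2real_plus)
  then show "ennreal (?a y - ?a x) = ?A x y" "?a x <= ?a y" using Afin[of x y] that by auto
 qed
 have gm[measurable]: "?g \<in> bm borel"
 proof -
  have "(%r. \<integral>\<^sup>+q. w q * indicator {q. s <= q & q <= r} q \<partial>lborel) \<in> bm borel"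
  proof (rule lborel.borel_measurable_nn_integral)
   have "{z \<in> space (borel \<otimes> lborel). s <= snd z & snd z <= fst z} \<in> sets (borel \<otimes> lborel)" by measurable
   then have "(%z. w (snd z) * indicator {z \<in> space (borel \<otimes> lborel). s <= snd z & snd z <= fst z} z) \<in> bm (borel \<otimes> lborel)"
    by measurable
   also have "?this \<longleftrightarrow> (%(r, q). w q * indicator {q. s <= q & q <= r} q) \<in> bm (borel \<otimes> lborel)"
    by (intro measurable_cong) (auto simp: space_pair_measure split: split_indicator)
   finally show "(%(r, q). w q * indicator {q. s <= q & q <= r} q) \<in> bm (borel \<otimes> lborel)" .
  qed
  moreover have "{q. s <= q & q <= r} = {s..r}" for r by auto
  ultimately have [measurable]: "(%r. ?A s r) \<in> bm borel" by simp
  show ?thesis by measurable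
 qed
 have step: "?I x y <= ennreal (exp (- ?a x) - exp (- ?a y) + (?a y - ?a x)\<^sup>2)" if xy: "s <= x" "x <= y" "y <= t" for x y
 proof -
  have "?I x y <= (\<integral>\<^sup>+r\<in>{x..y}. ennreal (exp (- ?a x)) * w r \<partial>lborel)"
  proof (intro nn_integral_mono)
   fix r
   have "?g r <= ennreal (exp (- ?a x)) * w r" if "x <= r" "r <= y"
    using aA(2)[of x r] that xy by (subst mult.commute) (intro mult_right_mono ennreal_leI, auto)
   then show "?g r * indicator {x..y} r <= ennreal (exp (- ?a x)) * w r * indicator {x..y} r"
    by (auto split: split_indicator)
  qed
  also have "... = ennreal (exp (- ?a x)) * ?A x y"
   by (subst nn_integral_cmult[symmetric]) (auto simp: mult.assoc)
  also have "... = ennreal (exp (- ?a x) * (?a y - ?a x))"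
   unfolding aA(1)[OF xy, symmetric] by (rule ennreal_mult[symmetric]) (use aA(2)[OF xy] in auto)
  also have "... <= ennreal (exp (- ?a x) - exp (- ?a y) + (?a y - ?a x)\<^sup>2)"
   using exp_decrement_bound[of "?a x" "?a y - ?a x"] aA(2)[OF xy] by (intro ennreal_leI) auto
  finally show ?thesis .
 qed
 have cont: "continuous_on {s..t} ?a"
 proof -
  let ?w = "%q. indicator {s..t} q * enn2real (w q)"
  have "AE q in lborel. w q * indicator {s..t} q ~= \<infinity>" using fin by (intro nn_integral_PInf_AE) auto
  then have wfin: "AE q in lborel. q \<in> {s..t} --> w q < top"
   by eventually_elim (auto simp: less_top split: split_indicator_asm)
  have e: "(\<integral>\<^sup>+q. ennreal (indicator {s..x} q * enn2real (w q)) \<partial>lborel) = ?A s x" if "x <= t" for x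
  proof (rule nn_integral_cong_AE)
   show "AE q in lborel. ennreal (indicator {s..x} q * enn2real (w q)) = w q * indicator {s..x} q"
    using wfin by eventually_elim (use that in \<open>auto split: split_indicator\<close>)
  qed
  have int: "set_integrable lborel {s..x} (%q. enn2real (w q))" if "x <= t" for x
   unfolding set_integrable_def real_scaleR_def
   by (rule integrableI_nonneg) (use e[OF that] Afin[of s x] that in \<open>auto split: split_indicator\<close>)
  have "?a x = integral {s..x} (%q. enn2real (w q))" if "x <= t" for x
  proof -
   have "(LINT q:{s..x}|lborel. enn2real (w q)) = enn2real (\<integral>\<^sup>+q. ennreal (indicator {s..x} q * enn2real (w q)) \<partial>lborel)"
    unfolding set_lebesgue_integral_def real_scaleR_def by (rule integral_eq_nn_integral) (auto split: split_indicator)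
   then show ?thesis using e[OF that] set_borel_integral_eq_integral(2)[OF int[OF that]] by simp
  qed
  moreover have "continuous_on {s..t} (%x. integral {s..x} (%q. enn2real (w q)))"
   by (intro indefinite_integral_continuous_1 set_borel_integral_eq_integral(1) int) simp
  ultimately show ?thesis by (subst continuous_on_cong[OF refl, of _ _ "%x. integral {s..x} (%q. enn2real (w q))"]) auto
 qed
 have as: "?a s = 0"
 proof -
  have "?A s s = (\<integral>\<^sup>+q. 0 \<partial>(lborel :: real measure))"
  proof (rule nn_integral_cong_AE)
   show "AE q in lborel. w q * indicator {s..s} q = 0"
    using AE_lborel_singleton[of s] by eventually_elim simp
  qed
  then show ?thesis by simp
 qed
 let ?L = "?a t"
 \<comment> \<open>The points are placed by the intermediate value theorem so that the integrated rate grows by \<open>?L / n\<close> in each step; the errors add up to \<open>?L\<^sup>2 / n\<close>.\<close>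
 have chain: "?I s t <= ennreal (1 - exp (- ?L) + ?L\<^sup>2 / real n)" if n: "0 < n" for n :: nat
 proof -
  have ex: "\<exists>x. s <= x & x <= t & ?a x = real i * (?L / real n) & ?I s x <= ennreal (1 - exp (- ?a x) + real i * (?L / real n)\<^sup>2)"
   if "i <= n" for i
   using that
  proof (induction i)
   case 0
   have "?I s s <= ennreal (exp (- ?a s) - exp (- ?a s) + (?a s - ?a s)\<^sup>2)" by (rule step) (use st in auto)
   then show ?case using st as by (intro exI[of _ s]) simp
  next
   case (Suc i)
   then obtain x where x: "s <= x" "x <= t" "?a x = real i * (?L / real n)"
     "?I s x <= ennreal (1 - exp (- ?a x) + real i * (?L / real n)\<^sup>2)" by auto
   have L0: "0 <= ?L / real n" by simp
   have "real (Suc i) * (?L / real n) <= real n * (?L / real n)"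
    using Suc(2) by (intro mult_right_mono) auto
   then have up: "real (Suc i) * (?L / real n) <= ?a t" using n by simp
   have lo: "?a x <= real (Suc i) * (?L / real n)" unfolding x(3) using L0 by (intro mult_right_mono) auto
   obtain y where y: "x <= y" "y <= t" "?a y = real (Suc i) * (?L / real n)"
    using IVT'[OF lo up x(2) continuous_on_subset[OF cont]] x(1) by auto
   have d: "?a y - ?a x = ?L / real n" unfolding x(3) y(3) by (simp add: algebra_simps add_divide_distrib)
   have "?I s y = ?I s x + ?I x y" by (rule nn_integral_interval_split[OF gm x(1) y(1)])
   also have "... <= ennreal (1 - exp (- ?a x) + real i * (?L / real n)\<^sup>2) + ennreal (exp (- ?a x) - exp (- ?a y) + (?a y - ?a x)\<^sup>2)"
    by (intro add_mono x(4) step x(1) y)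
   also have "... = ennreal ((1 - exp (- ?a x) + real i * (?L / real n)\<^sup>2) + (exp (- ?a x) - exp (- ?a y) + (?a y - ?a x)\<^sup>2))"
    using aA(2)[OF x(1) y(1,2)] by (intro ennreal_plus[symmetric]) auto
   also have "... = ennreal (1 - exp (- ?a y) + real (Suc i) * (?L / real n)\<^sup>2)"
    unfolding d by (simp add: algebra_simps)
   finally show ?case using x y by (intro exI[of _ y]) auto
  qed
  obtain x where x: "s <= x" "x <= t" "?a x = ?L" "?I s x <= ennreal (1 - exp (- ?L) + real n * (?L / real n)\<^sup>2)"
   using ex[of n] n by auto
  have "?I s t = ?I s x + ?I x t" by (rule nn_integral_interval_split[OF gm x(1,2)])
  also have "... <= ennreal (1 - exp (- ?L) + real n * (?L / real n)\<^sup>2) + ennreal (exp (- ?a x) - exp (- ?L) + (?L - ?a x)\<^sup>2)"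
   by (intro add_mono x(4) step x(1,2)) simp
  also have "... = ennreal (1 - exp (- ?L) + ?L\<^sup>2 / real n)"
   unfolding x(3) using n by (simp add: power2_eq_square)
  finally show ?thesis .
 qed
 have "(%n. ennreal (1 - exp (- ?L) + ?L\<^sup>2 / real (Suc n))) ----> ennreal (1 - exp (- ?L) + 0)"
  by (intro tendsto_ennrealI tendsto_add tendsto_const LIMSEQ_Suc[OF lim_const_over_n])
 then have "?I s t <= ennreal (1 - exp (- ?L))"
  using chain by (intro LIMSEQ_le_const) (auto intro!: exI[of _ 0] simp del: of_nat_Suc)
 then have "ennreal (exp (- ?L)) + ?I s t <= ennreal (exp (- ?L)) + ennreal (1 - exp (- ?L))"
  by (rule add_left_mono)
 also have "... = 1" by (subst ennreal_plus[symmetric]) auto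
 finally show ?thesis .
qed

section \<open>Continuity of translations in the space of integrable functions\<close>

definition translation_continuous :: "'e::euclidean_space => ('e => real) => bool" where
 "translation_continuous w f \<longleftrightarrow>
   ((%h. \<integral>\<^sup>+z. ennreal \<bar>f (z + h *\<^sub>R w) - f z\<bar> \<partial>lborel) \<longlongrightarrow> 0) (at_right 0)"

lemma nn_integral_lborel_translate:
 fixes f :: "'e::euclidean_space => ennreal"
 assumes "f \<in> bm borel"
 shows "(\<integral>\<^sup>+z. f (z + c) \<partial>lborel) = (\<integral>\<^sup>+z. f z \<partial>lborel)"
proof -
 have "(\<integral>\<^sup>+z. f z \<partial>lborel) = (\<integral>\<^sup>+z. f z \<partial>distr lborel borel ((+) c))" by (simp add: lborel_distr_plus)
 also have "... = (\<integral>\<^sup>+z. f (c + z) \<partial>lborel)" using assms by (intro nn_integral_distr) auto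
 finally show ?thesis by (simp add: add.commute)
qed

lemma tendsto_at_right_0_sequentially:
 fixes f :: "real => ennreal"
 assumes "!!X. (!!i. 0 < X i) ==> X ----> 0 ==> (%i::nat. f (X i)) ----> l"
 shows "(f \<longlongrightarrow> l) (at_right 0)"
 using assms by (auto simp: tendsto_at_iff_sequentially comp_def)

text \<open>For an open set, points of \<open>U\<close> stay in \<open>U\<close> under small translations, which controls one half of the symmetric difference; the other half has the same measure by translation invariance.\<close>

lemma translation_continuous_open:
 fixes U :: "'e::euclidean_space set"
 assumes U: "open U" and fin: "emeasure lborel U < \<infinity>"
 shows "translation_continuous w (indicator U)"
 unfolding translation_continuous_def
proof (rule tendsto_at_right_0_sequentially)
 fix X :: "nat => real" assume X: "!!i. 0 < X i" "X ----> 0"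
 have [measurable]: "U \<in> sets borel" using U by simp
 let ?u = "%i z. indicator U (z + X i *\<^sub>R w) :: real"
 have um[measurable]: "(%z. ?u i z) \<in> bm borel" for i by measurable
 let ?d = "%i. \<integral>\<^sup>+z. ennreal (indicator U z - indicator U z * ?u i z) \<partial>lborel"
 have d0: "?d ----> (\<integral>\<^sup>+z. 0 \<partial>(lborel :: 'e measure))"
 proof (rule nn_integral_dominated_convergence[where w="indicator U"])
  show "AE z in lborel. (%i. ennreal (indicator U z - indicator U z * ?u i z)) ----> 0"
  proof (rule AE_I2)
   fix z :: 'e
   show "(%i. ennreal (indicator U z - indicator U z * ?u i z)) ----> 0"
   proof (cases "z \<in> U")
    case True
    have "(%i. z + X i *\<^sub>R w) ----> z + 0 *\<^sub>R w" by (intro tendsto_intros X)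
    then have "\<forall>\<^sub>F i in sequentially. z + X i *\<^sub>R w \<in> U" using U True by (auto dest: topological_tendstoD)
    then have "\<forall>\<^sub>F i in sequentially. ennreal (indicator U z - indicator U z * ?u i z) = 0"
     by eventually_elim (use True in simp)
    then show ?thesis by (rule tendsto_eventually)
   qed simp
  qed
  show "(\<integral>\<^sup>+z. indicator U z \<partial>lborel) < \<infinity>" using fin by simp
 qed (auto split: split_indicator)
 have bound: "(\<integral>\<^sup>+z. ennreal \<bar>?u i z - indicator U z\<bar> \<partial>lborel) = ?d i + ?d i" for i
 proof -
  let ?m = "\<integral>\<^sup>+z. ennreal (indicator U z * ?u i z) \<partial>lborel"
  have m: "?m + ?d i = emeasure lborel U"
  proof -
   have "?m + ?d i = (\<integral>\<^sup>+z. ennreal (indicator U z * ?u i z) + ennreal (indicator U z - indicator U z * ?u i z) \<partial>lborel)"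
    by (rule nn_integral_add[symmetric]) auto
   also have "... = (\<integral>\<^sup>+z. indicator U z \<partial>lborel)" by (intro nn_integral_cong) (auto split: split_indicator)
   finally show ?thesis by simp
  qed
  let ?d' = "\<integral>\<^sup>+z. ennreal (?u i z - indicator U z * ?u i z) \<partial>lborel"
  have m': "?m + ?d' = emeasure lborel U"
  proof -
   have "?m + ?d' = (\<integral>\<^sup>+z. ennreal (indicator U z * ?u i z) + ennreal (?u i z - indicator U z * ?u i z) \<partial>lborel)"
    by (rule nn_integral_add[symmetric]) auto
   also have "... = (\<integral>\<^sup>+z. ennreal (?u i z) \<partial>lborel)" by (intro nn_integral_cong) (auto split: split_indicator)
   also have "... = (\<integral>\<^sup>+z. indicator U z \<partial>lborel)"
    by (subst nn_integral_lborel_translate[of "%z. ennreal (indicator U z)"]) (auto simp: ennreal_indicator)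
   finally show ?thesis by simp
  qed
  have "?m <= emeasure lborel U" unfolding m[symmetric] by simp
  then have "?m ~= top" using fin by (auto simp: top_unique)
  moreover have "?m + ?d' = ?m + ?d i" unfolding m m' ..
  ultimately have "?d' = ?d i" unfolding ennreal_add_left_cancel by simp
  moreover have "(\<integral>\<^sup>+z. ennreal \<bar>?u i z - indicator U z\<bar> \<partial>lborel)
    = (\<integral>\<^sup>+z. ennreal (indicator U z - indicator U z * ?u i z) + ennreal (?u i z - indicator U z * ?u i z) \<partial>lborel)"
   by (intro nn_integral_cong) (auto split: split_indicator)
  ultimately show ?thesis by (subst (asm) nn_integral_add) auto
 qed
 have "(%i. ?d i + ?d i) ----> 0 + 0" using d0 by (intro tendsto_add) simp_all
 then show "(%i. \<integral>\<^sup>+z. ennreal \<bar>?u i z - indicator U z\<bar> \<partial>lborel) ----> 0" unfolding bound by simp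
qed

lemma translation_continuous_approx:
 fixes f :: "'e::euclidean_space => real"
 assumes f[measurable]: "f \<in> bm borel"
  and approx: "!!e. 0 < e ==> \<exists>g. g \<in> bm borel & translation_continuous w g & (\<integral>\<^sup>+z. ennreal \<bar>f z - g z\<bar> \<partial>lborel) < ennreal e"
 shows "translation_continuous w f"
 unfolding translation_continuous_def
proof (rule order_tendstoI)
 fix e :: ennreal assume "0 < e"
 then obtain e' where e': "0 < e'" "e' < e" using dense by blast
 then have "e' < top" by (auto intro: less_le_trans simp: top_unique)
 define \<epsilon> where "\<epsilon> = enn2real e' / 3"
 have \<epsilon>: "0 < \<epsilon>" "ennreal \<epsilon> + (ennreal \<epsilon> + ennreal \<epsilon>) = e'"
  using e' \<open>e' < top\<close> by (auto simp: \<epsilon>_def enn2real_positive_iff simp flip: ennreal_plus)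
 obtain g where g[measurable]: "g \<in> bm borel" and tg: "translation_continuous w g"
  and fg: "(\<integral>\<^sup>+z. ennreal \<bar>f z - g z\<bar> \<partial>lborel) < ennreal \<epsilon>"
  using approx[OF \<epsilon>(1)] by blast
 have "\<forall>\<^sub>F h in at_right 0. (\<integral>\<^sup>+z. ennreal \<bar>g (z + h *\<^sub>R w) - g z\<bar> \<partial>lborel) < ennreal \<epsilon>"
  by (rule order_tendstoD(2)[OF tg[unfolded translation_continuous_def]]) (simp add: \<epsilon>(1) ennreal_less_zero_iff)
 then show "\<forall>\<^sub>F h in at_right 0. (\<integral>\<^sup>+z. ennreal \<bar>f (z + h *\<^sub>R w) - f z\<bar> \<partial>lborel) < e"
 proof eventually_elim
  fix h :: real assume h: "(\<integral>\<^sup>+z. ennreal \<bar>g (z + h *\<^sub>R w) - g z\<bar> \<partial>lborel) < ennreal \<epsilon>"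
  have "(\<integral>\<^sup>+z. ennreal \<bar>f (z + h *\<^sub>R w) - f z\<bar> \<partial>lborel)
   <= (\<integral>\<^sup>+z. ennreal \<bar>f (z + h *\<^sub>R w) - g (z + h *\<^sub>R w)\<bar> + (ennreal \<bar>g (z + h *\<^sub>R w) - g z\<bar> + ennreal \<bar>f z - g z\<bar>) \<partial>lborel)"
   by (intro nn_integral_mono) (simp flip: ennreal_plus)
  also have "... = (\<integral>\<^sup>+z. ennreal \<bar>f (z + h *\<^sub>R w) - g (z + h *\<^sub>R w)\<bar> \<partial>lborel)
    + ((\<integral>\<^sup>+z. ennreal \<bar>g (z + h *\<^sub>R w) - g z\<bar> \<partial>lborel) + (\<integral>\<^sup>+z. ennreal \<bar>f z - g z\<bar> \<partial>lborel))"
   by (simp add: nn_integral_add)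
  also have "(\<integral>\<^sup>+z. ennreal \<bar>f (z + h *\<^sub>R w) - g (z + h *\<^sub>R w)\<bar> \<partial>lborel) = (\<integral>\<^sup>+z. ennreal \<bar>f z - g z\<bar> \<partial>lborel)"
   by (rule nn_integral_lborel_translate[of "%z. ennreal \<bar>f z - g z\<bar>"]) simp
  also have "(\<integral>\<^sup>+z. ennreal \<bar>f z - g z\<bar> \<partial>lborel) + ((\<integral>\<^sup>+z. ennreal \<bar>g (z + h *\<^sub>R w) - g z\<bar> \<partial>lborel) + (\<integral>\<^sup>+z. ennreal \<bar>f z - g z\<bar> \<partial>lborel)) <= e'"
   unfolding \<epsilon>(2)[symmetric] by (intro add_mono less_imp_le fg h)
  finally show "(\<integral>\<^sup>+z. ennreal \<bar>f (z + h *\<^sub>R w) - f z\<bar> \<partial>lborel) < e" using e'(2) by (rule le_less_trans)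
 qed
qed simp

lemma translation_continuous_cmult:
 fixes f :: "'e::euclidean_space => real"
 assumes [measurable]: "f \<in> bm borel" and "translation_continuous w f"
 shows "translation_continuous w (%z. f z * c)"
proof -
 have "(\<integral>\<^sup>+z. ennreal \<bar>f (z + h *\<^sub>R w) * c - f z * c\<bar> \<partial>lborel) = ennreal \<bar>c\<bar> * (\<integral>\<^sup>+z. ennreal \<bar>f (z + h *\<^sub>R w) - f z\<bar> \<partial>lborel)" for h
  by (subst nn_integral_cmult[symmetric])
    (auto intro!: nn_integral_cong simp: ennreal_mult[symmetric] abs_mult[symmetric] algebra_simps)
 moreover have "((%h. ennreal \<bar>c\<bar> * (\<integral>\<^sup>+z. ennreal \<bar>f (z + h *\<^sub>R w) - f z\<bar> \<partial>lborel)) \<longlongrightarrow> ennreal \<bar>c\<bar> * 0) (at_right 0)"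
  using assms(2) unfolding translation_continuous_def by (intro ennreal_tendsto_cmult) auto
 ultimately show ?thesis by (simp add: translation_continuous_def)
qed

lemma translation_continuous_add:
 fixes f g :: "'e::euclidean_space => real"
 assumes [measurable]: "f \<in> bm borel" "g \<in> bm borel"
  and "translation_continuous w f" "translation_continuous w g"
 shows "translation_continuous w (%z. f z + g z)"
 unfolding translation_continuous_def
proof (rule tendsto_sandwich[OF _ _ tendsto_const])
 let ?D = "%f h. \<integral>\<^sup>+z. ennreal \<bar>f (z + h *\<^sub>R w) - f z\<bar> \<partial>(lborel :: 'e measure)"
 show "((%h. ?D f h + ?D g h) \<longlongrightarrow> 0) (at_right 0)"
  using tendsto_add[OF assms(3,4)[unfolded translation_continuous_def]] by simp
 have "?D (%z. f z + g z) h <= ?D f h + ?D g h" for h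
 proof -
  have "?D (%z. f z + g z) h <= (\<integral>\<^sup>+z. ennreal \<bar>f (z + h *\<^sub>R w) - f z\<bar> + ennreal \<bar>g (z + h *\<^sub>R w) - g z\<bar> \<partial>lborel)"
   by (intro nn_integral_mono) (simp flip: ennreal_plus)
  then show ?thesis by (simp add: nn_integral_add)
 qed
 then show "\<forall>\<^sub>F h in at_right 0. ?D (%z. f z + g z) h <= ?D f h + ?D g h" by simp
qed simp

text \<open>By outer regularity indicators of open sets approximate indicators of measurable sets, and these generate the integrable functions.\<close>

lemma integrable_translation_continuous:
 fixes f :: "'e::euclidean_space => real"
 assumes "integrable lborel f"
 shows "translation_continuous w f"
 using assms
proof (induct rule: integrable_induct)
 case (base A c)
 then have [measurable]: "A \<in> sets borel" by simp
 have "translation_continuous w (indicator A)"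
 proof (rule translation_continuous_approx)
  fix e :: real assume "0 < e"
  obtain U where U: "A \<subseteq> U" "open U" "emeasure lborel (U - A) < e"
   using outer_regular_lborel[of A e] \<open>0 < e\<close> by auto
  have [measurable]: "U \<in> sets borel" using U by simp
  have "emeasure lborel U <= emeasure lborel A + emeasure lborel (U - A)"
   using U by (subst plus_emeasure) (auto intro!: emeasure_mono)
  also have "... < \<infinity>" using base U by (auto intro: less_trans)
  finally have tU: "translation_continuous w (indicator U)" by (rule translation_continuous_open[OF U(2)])
  have "(\<integral>\<^sup>+z. ennreal \<bar>indicator A z - indicator U z\<bar> \<partial>lborel) = (\<integral>\<^sup>+z. indicator (U - A) z \<partial>lborel)"
   using U by (intro nn_integral_cong) (auto split: split_indicator)
  also have "... < e" using U by simp
  finally show "\<exists>g. g \<in> bm borel & translation_continuous w g & (\<integral>\<^sup>+z. ennreal \<bar>indicator A z - g z\<bar> \<partial>lborel) < ennreal e"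
   using tU by (intro exI[of _ "indicator U"]) auto
 qed simp
 then show ?case using translation_continuous_cmult[of "indicator A" w c] by simp
next
 case (add f g) then show ?case using translation_continuous_add[of f g w] by simp
next
 case (lim f s)
 have [measurable]: "f \<in> bm borel" "s i \<in> bm borel" for i
  using lim(1,5) by auto
 show ?case
 proof (rule translation_continuous_approx)
  fix e :: real assume "0 < e"
  have "(%i. \<integral>\<^sup>+z. ennreal (norm (f z - s i z)) \<partial>lborel) ----> 0"
  proof (rule nn_integral_dominated_convergence_norm[where w="%z. 2 * norm (f z)"])
   have "integrable lborel (%z. 2 * norm (f z))" using lim(5) by simp
   then have "(\<integral>\<^sup>+z. ennreal (norm (2 * norm (f z))) \<partial>lborel) < \<infinity>" unfolding integrable_iff_bounded by blast
   then show "(\<integral>\<^sup>+z. ennreal (2 * norm (f z)) \<partial>lborel) < \<infinity>" by simp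
  qed (use lim in auto)
  then have "\<forall>\<^sub>F i in sequentially. (\<integral>\<^sup>+z. ennreal (norm (f z - s i z)) \<partial>lborel) < ennreal e"
   by (rule order_tendstoD(2)) (use \<open>0 < e\<close> in \<open>simp add: ennreal_less_zero_iff\<close>)
  then obtain i where "(\<integral>\<^sup>+z. ennreal \<bar>f z - s i z\<bar> \<partial>lborel) < ennreal e" by (auto simp: eventually_sequentially)
  then show "\<exists>g. g \<in> bm borel & translation_continuous w g & (\<integral>\<^sup>+z. ennreal \<bar>f z - g z\<bar> \<partial>lborel) < ennreal e"
   using lim(2) by (intro exI[of _ "s i"]) auto
 qed simp
qed

text \<open>The damping factors tend to one only where \<open>f\<close> is non-zero; dominated convergence absorbs them into the continuity of translations.\<close>

lemma weighted_translation_tendsto: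
 fixes f :: "'e::euclidean_space => real" and c :: "nat => 'e => real"
 assumes f: "integrable lborel f" "!!z. 0 <= f z"
  and c[measurable]: "!!i. c i \<in> bm borel" and c01: "!!i z. 0 <= c i z" "!!i z. c i z <= 1"
  and lim: "AE z in lborel. f z ~= 0 --> (%i. c i z) ----> 1"
  and X: "!!i. 0 < X i" "X ----> 0"
 shows "(%i. \<integral>\<^sup>+z. ennreal \<bar>c i z * f (z + X i *\<^sub>R w) - f z\<bar> \<partial>lborel) ----> 0"
proof (rule tendsto_sandwich[OF _ _ tendsto_const])
 have [measurable]: "f \<in> bm borel" using f by auto
 let ?t = "%i. \<integral>\<^sup>+z. ennreal \<bar>f (z + X i *\<^sub>R w) - f z\<bar> \<partial>lborel"
 let ?d = "%i. \<integral>\<^sup>+z. ennreal ((1 - c i z) * f z) \<partial>lborel"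
 have t: "?t ----> 0"
  using integrable_translation_continuous[OF f(1), of w] X
  unfolding translation_continuous_def by (auto simp: tendsto_at_iff_sequentially comp_def)
 have d: "?d ----> (\<integral>\<^sup>+z. 0 \<partial>(lborel :: 'e measure))"
 proof (rule nn_integral_dominated_convergence[where w="%z. ennreal (f z)"])
  show "AE z in lborel. ennreal ((1 - c i z) * f z) <= ennreal (f z)" for i
   using f(2) c01 by (intro AE_I2 ennreal_leI mult_left_le_one_le) auto
  show "AE z in lborel. (%i. ennreal ((1 - c i z) * f z)) ----> 0"
   using lim
  proof eventually_elim
   fix z assume z: "f z ~= 0 --> (%i. c i z) ----> 1"
   show "(%i. ennreal ((1 - c i z) * f z)) ----> 0"
   proof (cases "f z = 0")
    case False
    then have "(%i. ennreal ((1 - c i z) * f z)) ----> ennreal ((1 - 1) * f z)"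
     using z by (intro tendsto_ennrealI tendsto_intros) auto
    then show ?thesis by simp
   qed simp
  qed
  show "(\<integral>\<^sup>+z. ennreal (f z) \<partial>lborel) < \<infinity>" using f by (simp add: integrable_iff_bounded)
 qed auto
 show "(%i. ?t i + ?d i) ----> 0" using tendsto_add[OF t d] by simp
 show "\<forall>\<^sub>F i in sequentially. (\<integral>\<^sup>+z. ennreal \<bar>c i z * f (z + X i *\<^sub>R w) - f z\<bar> \<partial>lborel) <= ?t i + ?d i"
 proof (rule always_eventually, rule allI)
  fix i
  have "(\<integral>\<^sup>+z. ennreal \<bar>c i z * f (z + X i *\<^sub>R w) - f z\<bar> \<partial>lborel)
    <= (\<integral>\<^sup>+z. ennreal \<bar>f (z + X i *\<^sub>R w) - f z\<bar> + ennreal ((1 - c i z) * f z) \<partial>lborel)"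
  proof (rule nn_integral_mono)
   fix z
   have "\<bar>c i z * f (z + X i *\<^sub>R w) - f z\<bar> = \<bar>c i z * (f (z + X i *\<^sub>R w) - f z) - (1 - c i z) * f z\<bar>"
    by (simp add: algebra_simps)
   also have "... <= c i z * \<bar>f (z + X i *\<^sub>R w) - f z\<bar> + (1 - c i z) * f z"
    using abs_triangle_ineq4[of "c i z * (f (z + X i *\<^sub>R w) - f z)" "(1 - c i z) * f z"] c01 f(2) by (simp add: abs_mult)
   also have "... <= \<bar>f (z + X i *\<^sub>R w) - f z\<bar> + (1 - c i z) * f z"
    using c01 by (intro add_right_mono mult_left_le_one_le) auto
   finally show "ennreal \<bar>c i z * f (z + X i *\<^sub>R w) - f z\<bar> <= ennreal \<bar>f (z + X i *\<^sub>R w) - f z\<bar> + ennreal ((1 - c i z) * f z)"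
    using c01 f(2) by (simp add: ennreal_leI flip: ennreal_plus)
  qed
  then show "(\<integral>\<^sup>+z. ennreal \<bar>c i z * f (z + X i *\<^sub>R w) - f z\<bar> \<partial>lborel) <= ?t i + ?d i"
   by (subst (asm) nn_integral_add) auto
 qed
qed simp

section \<open>The homogeneous problem\<close>

lemma closed_measure_support: "closed (measure_support \<mu>)"
proof -
 have "- measure_support \<mu> = \<Union>{S. open S & emeasure \<mu> S = 0}"
  by (auto simp: measure_support_def)
 then show ?thesis by (simp add: closed_def open_Union)
qed

text \<open>The standing assumptions on domain, velocity measure and rates, over any Euclidean space.\<close>

locale kinetic =
 fixes \<Omega> :: "'a::euclidean_space set"
  and \<mu> :: "'a measure"
  and \<Sigma> :: "real => 'a => real"
  and b :: "real => 'a => 'a => real"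
 assumes open_domain: "open \<Omega>"
  and sets_\<mu>: "sets \<mu> = sets borel"
  and sigma_finite_\<mu>: "sigma_finite_measure \<mu>"
  and \<Sigma>_measurable: "(%(t, v). \<Sigma> t v) \<in> bm (half_line \<otimes> velocities \<mu>)"
  and \<Sigma>_nonneg: "!!t v. 0 <= t ==> v \<in> measure_support \<mu> ==> 0 <= \<Sigma> t v"
  and \<Sigma>_integrable: "AE v in velocities \<mu>. \<forall>T\<ge>0. set_integrable lborel {0..T} (%t. \<Sigma> t v)"
  and b_measurable: "(%(t, v, v'). b t v v')
      \<in> bm (half_line \<otimes> (velocities \<mu> \<otimes> velocities \<mu>))"
  and b_nonneg: "!!t v v'. 0 <= t ==> v \<in> measure_support \<mu> ==> v' \<in> measure_support \<mu> ==> 0 <= b t v v'"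
  and scattering_le: "AE (t, v') in half_line \<otimes> velocities \<mu>.
      (\<integral>\<^sup>+ v. ennreal (b t v v') \<partial>velocities \<mu>) <= ennreal (\<Sigma> t v')"
begin

abbreviation V :: "'a measure" where "V \<equiv> velocities \<mu>"

lemma space_V: "space V = measure_support \<mu>"
 using sets_eq_imp_space_eq[OF sets_\<mu>] by (simp add: space_restrict_space)

lemma sigma_finite_V: "sigma_finite_measure V"
 by (intro sigma_finite_measure_restrict_space sigma_finite_\<mu>)
   (simp add: sets_\<mu> borel_closed closed_measure_support)

sublocale V: sigma_finite_measure V by (rule sigma_finite_V)
sublocale VV: pair_sigma_finite V V ..

text \<open>Velocities along which the collision rate is locally integrable.\<close>

definition regular :: "'a => bool" where
 "regular v \<longleftrightarrow> (\<forall>n::nat. (\<integral>\<^sup>+r\<in>{0..real n}. ennreal (\<Sigma> (max 0 r) v) \<partial>lborel) < \<infinity>)"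

text \<open>The collision rate, extended to negative times by its value at 0 and set to 0 at exceptional velocities, so that all integrals over bounded intervals of \<open>{0..}\<close> are finite and damping is multiplicative at every velocity.\<close>

definition rate :: "real => 'a => ennreal" where
 "rate r v = (if regular v then ennreal (\<Sigma> (max 0 r) v) else 0)"

definition damp :: "real => real => 'a => ennreal" where
 "damp t s v = ennreal (exp (- enn2real (\<integral>\<^sup>+r\<in>{s..t}. rate r v \<partial>lborel)))"

definition kernel :: "real => 'a => 'a => ennreal" where
 "kernel t v v' = ennreal (b (max 0 t) v v')"

lemma \<Sigma>_max_measurable: "(%(r, v). \<Sigma> (max 0 r) v) \<in> bm (borel \<otimes> V)"
proof -
 have "(%p. (max 0 (fst p), snd p)) \<in> (borel \<otimes> V) \<rightarrow>\<^sub>M (half_line \<otimes> V)"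
  by (rule measurable_Pair, rule measurable_restrict_space2) auto
 from measurable_compose[OF this \<Sigma>_measurable] show ?thesis by (simp add: split_beta')
qed

lemma kernel_measurable: "(%(t, v, v'). kernel t v v') \<in> bm (borel \<otimes> (V \<otimes> V))"
proof -
 have "(%p. (max 0 (fst p), snd p)) \<in> (borel \<otimes> (V \<otimes> V)) \<rightarrow>\<^sub>M (half_line \<otimes> (V \<otimes> V))"
  by (rule measurable_Pair, rule measurable_restrict_space2) auto
 from measurable_compose[OF this b_measurable]
 have "(%p. b (max 0 (fst p)) (fst (snd p)) (snd (snd p))) \<in> bm (borel \<otimes> (V \<otimes> V))"
  by (simp add: split_beta')
 then show ?thesis unfolding kernel_def by (simp add: split_beta')
qed

lemma kernel_compose:
 assumes "f \<in> bm P" "g \<in> P \<rightarrow>\<^sub>M V" "h \<in> P \<rightarrow>\<^sub>M V"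
 shows "(%p. kernel (f p) (g p) (h p)) \<in> bm P"
proof -
 have "(%p. (f p, g p, h p)) \<in> P \<rightarrow>\<^sub>M borel \<otimes> (V \<otimes> V)" using assms by measurable
 from measurable_compose[OF this kernel_measurable] show ?thesis by simp
qed

lemma regular_measurable [measurable]: "Measurable.pred V regular"
proof -
 have [measurable]: "(%v. \<integral>\<^sup>+r\<in>{0..real n}. ennreal (\<Sigma> (max 0 r) v) \<partial>lborel) \<in> bm V" for n :: nat
 proof (rule lborel.borel_measurable_nn_integral)
  have "(%p. (snd p, fst p)) \<in> (V \<otimes> lborel) \<rightarrow>\<^sub>M (borel \<otimes> V)" by measurable
  from measurable_compose[OF this \<Sigma>_max_measurable]
  have [measurable]: "(%p. \<Sigma> (max 0 (snd p)) (fst p)) \<in> bm (V \<otimes> lborel)" by simp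
  show "(%(v, r). ennreal (\<Sigma> (max 0 r) v) * indicator {0..real n} r) \<in> bm (V \<otimes> lborel)"
   unfolding split_beta' by measurable
 qed
 show ?thesis unfolding regular_def by measurable
qed

lemma AE_regular: "AE v in V. regular v"
 using \<Sigma>_integrable AE_space
proof eventually_elim
 fix v assume v: "\<forall>T\<ge>0. set_integrable lborel {0..T} (%t. \<Sigma> t v)" "v \<in> space V"
 show "regular v"
  unfolding regular_def
 proof
  fix n :: nat
  have "(\<integral>\<^sup>+r\<in>{0..real n}. ennreal (\<Sigma> (max 0 r) v) \<partial>lborel) = (\<integral>\<^sup>+r. ennreal (norm (indicator {0..real n} r *\<^sub>R \<Sigma> r v)) \<partial>lborel)"
   using v(2) \<Sigma>_nonneg by (intro nn_integral_cong) (auto simp: space_V split: split_indicator)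
  also have "... < \<infinity>" using v(1) unfolding set_integrable_def integrable_iff_bounded by simp
  finally show "(\<integral>\<^sup>+r\<in>{0..real n}. ennreal (\<Sigma> (max 0 r) v) \<partial>lborel) < \<infinity>" .
 qed
qed

lemma rate_measurable: "(%(r, v). rate r v) \<in> bm (borel \<otimes> V)"
proof -
 have [measurable]: "(%p. \<Sigma> (max 0 (fst p)) (snd p)) \<in> bm (borel \<otimes> V)"
  using \<Sigma>_max_measurable by (simp add: split_beta')
 show ?thesis unfolding rate_def split_beta' by measurable
qed

lemma rate_compose:
 assumes "f \<in> bm P" "g \<in> P \<rightarrow>\<^sub>M V"
 shows "(%p. rate (f p) (g p)) \<in> bm P"
proof -
 have "(%p. (f p, g p)) \<in> P \<rightarrow>\<^sub>M borel \<otimes> V" using assms by measurable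
 from measurable_compose[OF this rate_measurable] show ?thesis by simp
qed

lemma rate_section [measurable]: "v \<in> space V ==> (%r. rate r v) \<in> bm borel"
 by (rule rate_compose) auto

lemma rate_finite:
 assumes "0 <= s"
 shows "(\<integral>\<^sup>+r\<in>{s..t}. rate r v \<partial>lborel) < top"
proof (cases "regular v")
 case True
 have "(\<integral>\<^sup>+r\<in>{s..t}. rate r v \<partial>lborel) <= (\<integral>\<^sup>+r\<in>{0..real (nat \<lceil>t\<rceil>)}. ennreal (\<Sigma> (max 0 r) v) \<partial>lborel)"
  using assms True
  by (intro nn_integral_mono) (auto simp: rate_def split: split_indicator intro: order_trans[OF _ le_of_int_ceiling])
 also have "... < top" using True unfolding regular_def by simp
 finally show ?thesis .
qed (simp add: rate_def)

lemma damp_compose: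
 assumes [measurable]: "f \<in> bm P" "g \<in> bm P" "h \<in> P \<rightarrow>\<^sub>M V"
 shows "(%p. damp (f p) (g p) (h p)) \<in> bm P"
proof -
 have [measurable]: "(%p. \<integral>\<^sup>+r\<in>{g p..f p}. rate r (h p) \<partial>lborel) \<in> bm P"
 proof (rule lborel.borel_measurable_nn_integral)
  have [measurable]: "(%q. rate (snd q) (h (fst q))) \<in> bm (P \<otimes> lborel)"
   by (rule rate_compose) auto
  have [measurable]: "(%q. indicator {g (fst q)..f (fst q)} (snd q) :: ennreal) \<in> bm (P \<otimes> lborel)"
   by (rule indicator_interval_measurable) auto
  show "(%(p, r). rate r (h p) * indicator {g p..f p} r) \<in> bm (P \<otimes> lborel)"
   unfolding split_beta' by measurable
 qed
 show ?thesis unfolding damp_def by measurable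
qed

lemma damp_refl: "damp s s v = 1"
proof -
 have "(\<integral>\<^sup>+r\<in>{s..s}. rate r v \<partial>lborel) = (\<integral>\<^sup>+r. 0 \<partial>(lborel :: real measure))"
 proof (rule nn_integral_cong_AE)
  show "AE r in lborel. rate r v * indicator {s..s} r = 0"
   using AE_lborel_singleton[of s] by eventually_elim simp
 qed
 then show ?thesis by (simp add: damp_def)
qed

lemma damp_le_1: "damp t s v <= 1"
 by (simp add: damp_def)

lemma damp_comp:
 assumes "0 <= r" "r <= s" "s <= t" "v \<in> space V"
 shows "damp t r v = damp t s v * damp s r v"
proof -
 let ?A = "%x y. \<integral>\<^sup>+q\<in>{x..y}. rate q v \<partial>lborel"
 have "?A r t = ?A r s + ?A s t" using assms by (intro nn_integral_interval_split) auto
 then have "enn2real (?A r t) = enn2real (?A r s) + enn2real (?A s t)"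
  using assms rate_finite by (simp add: enn2real_plus)
 then show ?thesis by (simp add: damp_def ennreal_mult[symmetric] exp_add[symmetric])
qed

lemma exp_integral_eq_damp:
 assumes v: "v \<in> space V" "regular v" and s: "0 <= s"
 shows "ennreal (exp (- (LINT r:{s..t}|lborel. \<Sigma> r v))) = damp t s v"
proof -
 have "(%r. indicator {s..t} r * \<Sigma> (max 0 r) v) \<in> bm borel"
  using measurable_compose[OF measurable_Pair[OF measurable_ident measurable_const[OF v(1)]] \<Sigma>_max_measurable] by simp
 also have "?this \<longleftrightarrow> (%r. indicator {s..t} r * \<Sigma> r v) \<in> bm borel"
  using s by (intro measurable_cong) (auto split: split_indicator)
 finally have "(LINT r:{s..t}|lborel. \<Sigma> r v) = enn2real (\<integral>\<^sup>+r. ennreal (indicator {s..t} r * \<Sigma> r v) \<partial>lborel)"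
  unfolding set_lebesgue_integral_def real_scaleR_def
  using s v \<Sigma>_nonneg by (intro integral_eq_nn_integral) (auto simp: space_V split: split_indicator)
 also have "(\<integral>\<^sup>+r. ennreal (indicator {s..t} r * \<Sigma> r v) \<partial>lborel) = (\<integral>\<^sup>+r\<in>{s..t}. rate r v \<partial>lborel)"
  using s v by (intro nn_integral_cong) (auto simp: rate_def split: split_indicator)
 finally show ?thesis by (simp add: damp_def)
qed

lemma scatter_le_rate: "AE r in lborel. 0 <= r --> (AE v' in V. (\<integral>\<^sup>+v. kernel r v v' \<partial>V) <= rate r v')"
proof -
 have "AE r in half_line. AE v' in V. (\<integral>\<^sup>+v. ennreal (b r v v') \<partial>V) <= ennreal (\<Sigma> r v')"
 proof -
  interpret HV: pair_sigma_finite half_line V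
   by (intro pair_sigma_finite.intro sigma_finite_V sigma_finite_measure_restrict_space sigma_finite_lborel) simp
  show ?thesis using HV.AE_pair[OF scattering_le] by simp
 qed
 then have "AE r in lborel. 0 <= r --> (AE v' in V. (\<integral>\<^sup>+v. ennreal (b r v v') \<partial>V) <= ennreal (\<Sigma> r v'))"
  by (simp add: AE_restrict_space_iff)
 then show ?thesis
 proof eventually_elim
  fix r assume r: "0 <= r --> (AE v' in V. (\<integral>\<^sup>+v. ennreal (b r v v') \<partial>V) <= ennreal (\<Sigma> r v'))"
  show "0 <= r --> (AE v' in V. (\<integral>\<^sup>+v. kernel r v v' \<partial>V) <= rate r v')"
  proof
   assume "0 <= r"
   then have "AE v' in V. (\<integral>\<^sup>+v. ennreal (b r v v') \<partial>V) <= ennreal (\<Sigma> r v')" using r by blast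
   then show "AE v' in V. (\<integral>\<^sup>+v. kernel r v v' \<partial>V) <= rate r v'"
    using AE_regular by eventually_elim (simp add: kernel_def rate_def \<open>0 <= r\<close>)
  qed
 qed
qed

text \<open>After exchanging the velocities before and after the collision, the scattering rate is bounded by the collision rate, and \<open>exp_decay_integral\<close> applies at each velocity.\<close>

lemma homogeneous_dissipative:
 assumes \<Phi>[measurable]: "\<Phi> \<in> bm V" and st: "0 <= s" "s <= t"
 shows "(\<integral>\<^sup>+v. damp t s v * \<Phi> v \<partial>V)
   + (\<integral>\<^sup>+r\<in>{s..t}. (\<integral>\<^sup>+v. (\<integral>\<^sup>+v'. kernel r v v' * (damp r s v' * \<Phi> v') \<partial>V) \<partial>V) \<partial>lborel)
   <= (\<integral>\<^sup>+v. \<Phi> v \<partial>V)"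
proof -
 note [measurable] = kernel_compose damp_compose rate_compose indicator_interval_measurable
 have gain: "(\<integral>\<^sup>+v. (\<integral>\<^sup>+v'. kernel r v v' * (damp r s v' * \<Phi> v') \<partial>V) \<partial>V)
   <= (\<integral>\<^sup>+v'. rate r v' * (damp r s v' * \<Phi> v') \<partial>V)"
  if r: "AE v' in V. (\<integral>\<^sup>+v. kernel r v v' \<partial>V) <= rate r v'" for r
 proof -
  have "(\<integral>\<^sup>+v. (\<integral>\<^sup>+v'. kernel r v v' * (damp r s v' * \<Phi> v') \<partial>V) \<partial>V)
    = (\<integral>\<^sup>+v'. (\<integral>\<^sup>+v. kernel r v v' * (damp r s v' * \<Phi> v') \<partial>V) \<partial>V)"
   by (rule VV.Fubini') (simp add: split_beta')
  also have "... = (\<integral>\<^sup>+v'. (\<integral>\<^sup>+v. kernel r v v' \<partial>V) * (damp r s v' * \<Phi> v') \<partial>V)"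
   by (intro nn_integral_cong nn_integral_multc) simp
  also have "... <= (\<integral>\<^sup>+v'. rate r v' * (damp r s v' * \<Phi> v') \<partial>V)"
  proof (rule nn_integral_mono_AE)
   show "AE v' in V. (\<integral>\<^sup>+v. kernel r v v' \<partial>V) * (damp r s v' * \<Phi> v') <= rate r v' * (damp r s v' * \<Phi> v')"
    using r by eventually_elim (intro mult_right_mono, auto)
  qed
  finally show ?thesis .
 qed
 have "(\<integral>\<^sup>+r\<in>{s..t}. (\<integral>\<^sup>+v. (\<integral>\<^sup>+v'. kernel r v v' * (damp r s v' * \<Phi> v') \<partial>V) \<partial>V) \<partial>lborel)
   <= (\<integral>\<^sup>+r. (\<integral>\<^sup>+v'. rate r v' * (damp r s v' * \<Phi> v') * indicator {s..t} r \<partial>V) \<partial>lborel)"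
 proof (rule nn_integral_mono_AE)
  show "AE r in lborel. (\<integral>\<^sup>+v. (\<integral>\<^sup>+v'. kernel r v v' * (damp r s v' * \<Phi> v') \<partial>V) \<partial>V) * indicator {s..t} r
    <= (\<integral>\<^sup>+v'. rate r v' * (damp r s v' * \<Phi> v') * indicator {s..t} r \<partial>V)"
   using scatter_le_rate by eventually_elim (use st gain in \<open>auto split: split_indicator\<close>)
 qed
 also have "... = (\<integral>\<^sup>+v'. (\<integral>\<^sup>+r. rate r v' * (damp r s v' * \<Phi> v') * indicator {s..t} r \<partial>lborel) \<partial>V)"
 proof -
  interpret LV: pair_sigma_finite lborel V ..
  show ?thesis by (rule LV.Fubini'[symmetric]) (simp add: split_beta')
 qed
 also have "... = (\<integral>\<^sup>+v'. (\<integral>\<^sup>+r\<in>{s..t}. rate r v' * damp r s v' \<partial>lborel) * \<Phi> v' \<partial>V)"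
  by (intro nn_integral_cong) (subst nn_integral_multc[symmetric], auto simp: ac_simps intro!: nn_integral_cong)
 finally have "(\<integral>\<^sup>+v. damp t s v * \<Phi> v \<partial>V)
   + (\<integral>\<^sup>+r\<in>{s..t}. (\<integral>\<^sup>+v. (\<integral>\<^sup>+v'. kernel r v v' * (damp r s v' * \<Phi> v') \<partial>V) \<partial>V) \<partial>lborel)
   <= (\<integral>\<^sup>+v. damp t s v * \<Phi> v \<partial>V) + (\<integral>\<^sup>+v. (\<integral>\<^sup>+r\<in>{s..t}. rate r v * damp r s v \<partial>lborel) * \<Phi> v \<partial>V)"
  by (rule add_left_mono)
 also have "... = (\<integral>\<^sup>+v. (damp t s v + (\<integral>\<^sup>+r\<in>{s..t}. rate r v * damp r s v \<partial>lborel)) * \<Phi> v \<partial>V)"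
 proof -
  have [measurable]: "(%v. \<integral>\<^sup>+r\<in>{s..t}. rate r v * damp r s v \<partial>lborel) \<in> bm V"
   by (rule lborel.borel_measurable_nn_integral) (simp add: split_beta')
  show ?thesis by (subst nn_integral_add[symmetric]) (simp_all add: distrib_right)
 qed
 also have "... <= (\<integral>\<^sup>+v. 1 * \<Phi> v \<partial>V)"
  using exp_decay_integral[OF rate_section st(2) rate_finite[OF st(1)]]
  by (intro nn_integral_mono mult_right_mono) (auto simp: damp_def)
 finally show ?thesis by simp
qed

sublocale hom: transport V V damp "%t s v. v" kernel "%v v'. v'"
proof
 show "(%(t, s, x). damp t s x) \<in> bm (borel \<otimes> (borel \<otimes> V))"
  unfolding split_beta' by (intro damp_compose) auto
 show "(%(t, s, v). v) \<in> borel \<otimes> (borel \<otimes> V) \<rightarrow>\<^sub>M V" "(%(v, v'). v') \<in> V \<otimes> V \<rightarrow>\<^sub>M V"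
  unfolding split_beta' by auto
qed (auto intro: damp_comp homogeneous_dissipative kernel_measurable damp_refl)

end

lemma ediff_le_add: "ediff a b <= a + b"
 unfolding ediff_def by (intro max.boundedI order_trans[OF diff_le_self_ennreal]) simp_all

lemma weighted_translation_tendsto_ennreal:
 fixes f :: "'e::euclidean_space => ennreal" and c :: "nat => 'e => ennreal"
 assumes f[measurable]: "f \<in> bm borel" and fin: "(\<integral>\<^sup>+z. f z \<partial>lborel) < top"
  and c[measurable]: "!!i. c i \<in> bm borel" and c1: "!!i z. c i z <= 1"
  and lim: "AE z in lborel. f z ~= 0 --> (%i. c i z) ----> 1"
  and X: "!!i. 0 < X i" "X ----> 0"
 shows "(%i. \<integral>\<^sup>+z. ediff (c i z * f (z + X i *\<^sub>R w)) (f z) \<partial>lborel) ----> 0"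
proof -
 let ?f = "%z. enn2real (f z)" and ?c = "%i z. enn2real (c i z)"
 have ff: "AE z in lborel. f z ~= \<infinity>" using fin by (intro nn_integral_PInf_AE) auto
 have tf: "AE z in lborel. f (z + X i *\<^sub>R w) ~= \<infinity>" for i
  using fin nn_integral_lborel_translate[OF f, of "X i *\<^sub>R w"] by (intro nn_integral_PInf_AE) auto
 have cfin: "c i z < top" for i z using c1[of i z] by (rule le_less_trans) simp
 have "(\<integral>\<^sup>+z. ediff (c i z * f (z + X i *\<^sub>R w)) (f z) \<partial>lborel) = (\<integral>\<^sup>+z. ennreal \<bar>?c i z * ?f (z + X i *\<^sub>R w) - ?f z\<bar> \<partial>lborel)" for i
 proof (rule nn_integral_cong_AE)
  show "AE z in lborel. ediff (c i z * f (z + X i *\<^sub>R w)) (f z) = ennreal \<bar>?c i z * ?f (z + X i *\<^sub>R w) - ?f z\<bar>"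
   using ff tf[of i]
  proof eventually_elim
   fix z assume "f z ~= \<infinity>" "f (z + X i *\<^sub>R w) ~= \<infinity>"
   then show "ediff (c i z * f (z + X i *\<^sub>R w)) (f z) = ennreal \<bar>?c i z * ?f (z + X i *\<^sub>R w) - ?f z\<bar>"
    using cfin[of i z] by (subst ediff_finite) (auto simp: enn2real_mult ennreal_mult_eq_top_iff)
  qed
 qed
 moreover have "(%i. \<integral>\<^sup>+z. ennreal \<bar>?c i z * ?f (z + X i *\<^sub>R w) - ?f z\<bar> \<partial>lborel) ----> 0"
 proof (rule weighted_translation_tendsto)
  show "integrable lborel ?f"
  proof (rule integrableI_nonneg)
   have "(\<integral>\<^sup>+z. ennreal (?f z) \<partial>lborel) = (\<integral>\<^sup>+z. f z \<partial>lborel)"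
   proof (rule nn_integral_cong_AE)
    show "AE z in lborel. ennreal (?f z) = f z" using ff by eventually_elim (simp add: less_top)
   qed
   then show "(\<integral>\<^sup>+z. ennreal (?f z) \<partial>lborel) < \<infinity>" using fin by simp
  qed auto
  show "AE z in lborel. ?f z ~= 0 --> (%i. ?c i z) ----> 1"
   using lim
  proof eventually_elim
   fix z assume z: "f z ~= 0 --> (%i. c i z) ----> 1"
   show "?f z ~= 0 --> (%i. ?c i z) ----> 1"
   proof
    assume "?f z ~= 0"
    then have "(%i. c i z) ----> ennreal 1" using z by auto
    then show "(%i. ?c i z) ----> 1" by (rule tendsto_enn2real) simp
   qed
  qed
  show "?c i z <= 1" for i z using c1[of i z] enn2real_mono[of "c i z" 1] by simp
 qed (use X in auto)
 ultimately show ?thesis by simp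
qed

text \<open>Strong continuity for both problems: at a fixed velocity free transport is a damped translation, in time for the homogeneous problem and in time and space for the inhomogeneous
one. Dominated convergence over the velocities follows.\<close>

lemma fibred_translation_tendsto:
 fixes f :: "'e::euclidean_space \<times> 'b => ennreal" and C :: "nat => 'e \<times> 'b => ennreal"
 assumes N: "sigma_finite_measure N"
  and f[measurable]: "f \<in> bm (borel \<otimes> N)" and fin: "(\<integral>\<^sup>+p. f p \<partial>(lborel \<otimes> N)) < top"
  and C[measurable]: "!!i. C i \<in> bm (borel \<otimes> N)" and C1: "!!i p. C i p <= 1"
  and lim: "!!v. v \<in> space N ==> AE z in lborel. f (z, v) ~= 0 --> (%i. C i (z, v)) ----> 1"
  and w[measurable]: "w \<in> bm N"
  and X: "!!i. 0 < X i" "X ----> 0"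
 shows "(%i. \<integral>\<^sup>+p. ediff (C i p * f (fst p + X i *\<^sub>R w (snd p), snd p)) (f p) \<partial>(lborel \<otimes> N)) ----> 0"
proof -
 interpret N: sigma_finite_measure N by fact
 interpret LN: pair_sigma_finite "lborel :: 'e measure" N ..
 let ?D = "%i p. ediff (C i p * f (fst p + X i *\<^sub>R w (snd p), snd p)) (f p)"
 have sets: "sets (lborel \<otimes> N) = sets ((borel :: 'e measure) \<otimes> N)" by (intro sets_pair_measure_cong) simp_all
 note mc = measurable_cong_sets[OF sets refl]
 have shift[measurable]: "(%p. f (fst p + X i *\<^sub>R w (snd p), snd p)) \<in> bm (borel \<otimes> N)" for i
  by (rule measurable_compose[OF _ f]) measurable
 have D: "?D i \<in> bm (borel \<otimes> N)" for i by measurable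
 then have DL: "?D i \<in> bm (lborel \<otimes> N)" and fL: "f \<in> bm (lborel \<otimes> N)" for i
  using f by (simp_all only: mc)
 have fsec: "(%z. f (z, v)) \<in> bm borel" if "v \<in> space N" for v
  using that by (intro measurable_compose[OF _ f]) simp
 have J: "(\<integral>\<^sup>+p. ?D i p \<partial>(lborel \<otimes> N)) = (\<integral>\<^sup>+v. (\<integral>\<^sup>+z. ?D i (z, v) \<partial>lborel) \<partial>N)" for i
  by (rule LN.nn_integral_snd[OF DL, symmetric])
 have F: "(\<integral>\<^sup>+p. f p \<partial>(lborel \<otimes> N)) = (\<integral>\<^sup>+v. (\<integral>\<^sup>+z. f (z, v) \<partial>lborel) \<partial>N)"
  by (rule LN.nn_integral_snd[OF fL, symmetric])
 have sw: "(%v. \<integral>\<^sup>+z. g (z, v) \<partial>lborel) \<in> bm N" if "g \<in> bm (lborel \<otimes> N)" for g :: "'e \<times> 'b => ennreal"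
  using measurable_compose[OF measurable_pair_swap' that]
  by (intro lborel.borel_measurable_nn_integral) (simp add: split_beta')
 have "(%i. \<integral>\<^sup>+v. (\<integral>\<^sup>+z. ?D i (z, v) \<partial>lborel) \<partial>N) ----> (\<integral>\<^sup>+v. 0 \<partial>N)"
 proof (rule nn_integral_dominated_convergence[where w="%v. (\<integral>\<^sup>+z. f (z, v) \<partial>lborel) + (\<integral>\<^sup>+z. f (z, v) \<partial>lborel)"])
  show "(%v. \<integral>\<^sup>+z. ?D i (z, v) \<partial>lborel) \<in> bm N" for i by (rule sw[OF DL])
  note [measurable] = sw[OF fL]
  show "(%v. (\<integral>\<^sup>+z. f (z, v) \<partial>lborel) + (\<integral>\<^sup>+z. f (z, v) \<partial>lborel)) \<in> bm N" by measurable
  show "(\<integral>\<^sup>+v. (\<integral>\<^sup>+z. f (z, v) \<partial>lborel) + (\<integral>\<^sup>+z. f (z, v) \<partial>lborel) \<partial>N) < \<infinity>"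
   using fin unfolding F by (subst nn_integral_add) auto
  show "AE v in N. (\<integral>\<^sup>+z. ?D i (z, v) \<partial>lborel) <= (\<integral>\<^sup>+z. f (z, v) \<partial>lborel) + (\<integral>\<^sup>+z. f (z, v) \<partial>lborel)" for i
  proof (rule AE_I2)
   fix v assume v: "v \<in> space N"
   note [measurable] = fsec[OF v]
   have "(\<integral>\<^sup>+z. ?D i (z, v) \<partial>lborel) <= (\<integral>\<^sup>+z. f (z + X i *\<^sub>R w v, v) + f (z, v) \<partial>lborel)"
   proof (intro nn_integral_mono order_trans[OF ediff_le_add] add_right_mono)
    fix z show "C i (z, v) * f (fst (z, v) + X i *\<^sub>R w (snd (z, v)), snd (z, v)) <= f (z + X i *\<^sub>R w v, v)"
     using mult_right_mono[OF C1[of i "(z, v)"], of "f (z + X i *\<^sub>R w v, v)"] by simp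
   qed
   also have "... = (\<integral>\<^sup>+z. f (z + X i *\<^sub>R w v, v) \<partial>lborel) + (\<integral>\<^sup>+z. f (z, v) \<partial>lborel)"
    by (intro nn_integral_add measurable_compose[OF _ fsec[OF v]]) auto
   also have "(\<integral>\<^sup>+z. f (z + X i *\<^sub>R w v, v) \<partial>lborel) = (\<integral>\<^sup>+z. f (z, v) \<partial>lborel)"
    by (rule nn_integral_lborel_translate[OF fsec[OF v]])
   finally show "(\<integral>\<^sup>+z. ?D i (z, v) \<partial>lborel) <= (\<integral>\<^sup>+z. f (z, v) \<partial>lborel) + (\<integral>\<^sup>+z. f (z, v) \<partial>lborel)" .
  qed
  have "AE v in N. (\<integral>\<^sup>+z. f (z, v) \<partial>lborel) ~= \<infinity>"
   using fin unfolding F by (intro nn_integral_PInf_AE) auto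
  then show "AE v in N. (%i. \<integral>\<^sup>+z. ?D i (z, v) \<partial>lborel) ----> 0"
   using AE_space
  proof eventually_elim
   fix v assume v: "(\<integral>\<^sup>+z. f (z, v) \<partial>lborel) ~= \<infinity>" "v \<in> space N"
   have "(%z. C i (z, v)) \<in> bm borel" for i
    using v by (intro measurable_compose[OF _ C]) simp
   with fsec[OF v(2)] v(1) lim[OF v(2)] X C1
   have "(%i. \<integral>\<^sup>+z. ediff (C i (z, v) * f (z + X i *\<^sub>R w v, v)) (f (z, v)) \<partial>lborel) ----> 0"
    by (intro weighted_translation_tendsto_ennreal) (auto simp: less_top)
   then show "(%i. \<integral>\<^sup>+z. ?D i (z, v) \<partial>lborel) ----> 0" by simp
  qed
 qed simp
 then show ?thesis unfolding J by simp
qed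

context kinetic begin

lemma damp_tendsto:
 assumes v: "v \<in> space V" and s: "0 <= s" and X: "!!i. 0 < X i" "X ----> 0"
 shows "(%i. damp s (max 0 (s - X i)) v) ----> 1"
proof -
 note [measurable] = rate_section[OF v]
 have "(%i. \<integral>\<^sup>+r\<in>{max 0 (s - X i)..s}. rate r v \<partial>lborel) ----> (\<integral>\<^sup>+r. 0 \<partial>(lborel :: real measure))"
 proof (rule nn_integral_dominated_convergence[where w="%r. rate r v * indicator {0..s} r"])
  show "(\<integral>\<^sup>+r. rate r v * indicator {0..s} r \<partial>lborel) < \<infinity>" using rate_finite[where s=0 and t=s and v=v] by simp
  show "AE r in lborel. (%i. rate r v * indicator {max 0 (s - X i)..s} r) ----> 0"
   using AE_lborel_singleton[of s]
  proof eventually_elim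
   fix r :: real assume r: "r ~= s"
   have "\<forall>\<^sub>F i in sequentially. rate r v * indicator {max 0 (s - X i)..s} r = 0"
   proof (cases "r < s")
    case True
    then have "\<forall>\<^sub>F i in sequentially. X i < s - r" by (intro order_tendstoD(2)[OF X(2)]) simp
    then show ?thesis by eventually_elim (auto split: split_indicator)
   qed (use r in \<open>auto split: split_indicator\<close>)
   then show "(%i. rate r v * indicator {max 0 (s - X i)..s} r) ----> 0" by (rule tendsto_eventually)
  qed
 qed (auto split: split_indicator)
 then have "(%i. \<integral>\<^sup>+r\<in>{max 0 (s - X i)..s}. rate r v \<partial>lborel) ----> ennreal 0" by simp
 then have "(%i. enn2real (\<integral>\<^sup>+r\<in>{max 0 (s - X i)..s}. rate r v \<partial>lborel)) ----> 0"
  by (rule tendsto_enn2real) simp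
 then have "(%i. damp s (max 0 (s - X i)) v) ----> ennreal (exp (- 0))"
  unfolding damp_def by (intro tendsto_ennrealI tendsto_exp tendsto_minus)
 then show ?thesis by simp
qed

lemma U_factor_measurable:
 assumes "0 <= s"
 shows "(%v. exp (- (LINT r:{s..t}|lborel. \<Sigma> r v))) \<in> bm V"
proof -
 have "(%p. (snd p, fst p)) \<in> (V \<otimes> lborel) \<rightarrow>\<^sub>M (borel \<otimes> V)" by measurable
 from measurable_compose[OF this \<Sigma>_max_measurable]
 have [measurable]: "(%p. \<Sigma> (max 0 (snd p)) (fst p)) \<in> bm (V \<otimes> lborel)" by simp
 have "(%v. LINT r|lborel. indicator {s..t} r *\<^sub>R \<Sigma> (max 0 r) v) \<in> bm V"
  by (rule lborel.borel_measurable_lebesgue_integral) (unfold split_beta', measurable)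
 moreover have "(LINT r:{s..t}|lborel. \<Sigma> r v) = (LINT r|lborel. indicator {s..t} r *\<^sub>R \<Sigma> (max 0 r) v)" for v
  unfolding set_lebesgue_integral_def
  using assms by (intro Bochner_Integration.integral_cong) (auto split: split_indicator)
 ultimately have [measurable]: "(%v. LINT r:{s..t}|lborel. \<Sigma> r v) \<in> bm V" by simp
 show ?thesis by measurable
qed

lemma b_section_measurable:
 assumes "0 <= t"
 shows "(%(v, v'). b t v v') \<in> bm (V \<otimes> V)"
proof -
 have "(%p. (t, p)) \<in> V \<otimes> V \<rightarrow>\<^sub>M half_line \<otimes> (V \<otimes> V)"
  using assms by (intro measurable_Pair measurable_const measurable_ident_sets refl) simp
 from measurable_compose[OF this b_measurable] show ?thesis by simp
qed

lemma scattering_integral: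
 assumes t: "0 <= t" and v: "v \<in> space V" and [measurable]: "\<phi> \<in> bm V"
  and rep: "AE v' in V. 0 <= \<phi> v' & ennreal (\<phi> v') = \<Phi> v'"
 shows "(LINT v'|V. b t v v' * \<phi> v') = enn2real (\<integral>\<^sup>+v'. kernel t v v' * \<Phi> v' \<partial>V)"
proof -
 have [measurable]: "(%v'. b t v v') \<in> bm V"
  using measurable_compose[OF measurable_Pair1'[OF v] b_section_measurable[OF t]] by simp
 have "(LINT v'|V. b t v v' * \<phi> v') = enn2real (\<integral>\<^sup>+v'. ennreal (b t v v' * \<phi> v') \<partial>V)"
 proof (rule integral_eq_nn_integral)
  show "AE v' in V. 0 <= b t v v' * \<phi> v'"
   using rep AE_space by eventually_elim (use t v b_nonneg in \<open>simp add: space_V\<close>)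
 qed simp
 also have "(\<integral>\<^sup>+v'. ennreal (b t v v' * \<phi> v') \<partial>V) = (\<integral>\<^sup>+v'. kernel t v v' * \<Phi> v' \<partial>V)"
 proof (rule nn_integral_cong_AE)
  show "AE v' in V. ennreal (b t v v' * \<phi> v') = kernel t v v' * \<Phi> v'"
   using rep AE_space
  proof eventually_elim
   fix v' assume "0 <= \<phi> v' & ennreal (\<phi> v') = \<Phi> v'" "v' \<in> space V"
   then show "ennreal (b t v v' * \<phi> v') = kernel t v v' * \<Phi> v'"
    using t v b_nonneg by (auto simp: kernel_def space_V ennreal_mult dest: sym)
  qed
 qed
 finally show ?thesis .
qed

sublocale hom: represented_transport V V damp "%t s v. v" kernel "%v v'. v'" "U_hom \<Sigma>" "B_hom \<mu> b"
proof unfold_locales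
 fix G assume G: "G \<in> bm hom.Y" and fin: "hom.tmass G ~= top"
 show "((%h. hom.dist1 (hom.S h G) G) \<longlongrightarrow> 0) (at_right 0)"
 proof (rule tendsto_at_right_0_sequentially)
  fix X :: "nat => real" assume X: "!!i. 0 < X i" "X ----> 0"
  let ?f = "%p. G (max 0 (fst p), snd p) * indicator {0..} (fst p)"
  let ?C = "%i p. damp (fst p) (max 0 (fst p - X i)) (snd p)"
  let ?D = "%i p. ediff (?C i p * ?f (fst p + X i *\<^sub>R - 1, snd p)) (?f p)"
  have [measurable]: "(%p. G (max 0 (fst p), snd p)) \<in> bm (borel \<otimes> V)"
   by (rule measurable_compose[OF hom.measurable_into_Y G]) auto
  have [measurable]: "?C i \<in> bm (borel \<otimes> V)" for i by (intro damp_compose) auto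
  have sets: "sets (lborel \<otimes> V) = sets ((borel :: real measure) \<otimes> V)" by (intro sets_pair_measure_cong) simp_all
  note mc = measurable_cong_sets[OF sets refl]
  have fm: "?f \<in> bm (borel \<otimes> V)" by measurable
  have fin': "(\<integral>\<^sup>+p. ?f p \<partial>(lborel \<otimes> V)) < top"
  proof -
   have "(\<integral>\<^sup>+p. ?f p \<partial>(lborel \<otimes> V)) = (\<integral>\<^sup>+s. (\<integral>\<^sup>+v. ?f (s, v) \<partial>V) \<partial>lborel)"
    using fm by (intro V.nn_integral_fst[symmetric]) (simp add: mc)
   also have "... = hom.tmass G"
    unfolding hom.tmass_eq_mass[OF G] hom.mass_def
    by (intro nn_integral_cong) (auto split: split_indicator)
   finally show ?thesis using fin by (simp add: less_top)
  qed
  have main: "(%i. \<integral>\<^sup>+p. ?D i p \<partial>(lborel \<otimes> V)) ----> 0"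
  proof (rule fibred_translation_tendsto[where w="%_. - 1", OF sigma_finite_V fm fin' _ _ _ _ X])
   fix v assume v: "v \<in> space V"
   show "AE z in lborel. ?f (z, v) ~= 0 --> (%i. ?C i (z, v)) ----> 1"
    using damp_tendsto[OF v _ X] by (intro AE_I2) (auto split: split_indicator)
  qed (auto simp: damp_le_1)
  have le: "hom.dist1 (hom.S (X i) G) G <= (\<integral>\<^sup>+p. ?D i p \<partial>(lborel \<otimes> V))" for i
  proof -
   note [measurable] = hom.S_borel[OF G] G
   have Dm: "?D i \<in> bm (borel \<otimes> V)"
    by (intro borel_measurable_ediff borel_measurable_times_ennreal fm measurable_compose[OF _ fm]) auto
   have "hom.dist1 (hom.S (X i) G) G
     = (\<integral>\<^sup>+s. hom.mass s (%y. ediff (hom.S (X i) G y) (G y)) \<partial>lborel)"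
    unfolding hom.dist1_def by (rule hom.tmass_eq_mass) measurable
   also have "... <= (\<integral>\<^sup>+s. (\<integral>\<^sup>+v. ?D i (s, v) \<partial>V) \<partial>lborel)"
   proof (rule nn_integral_mono)
    fix s :: real
    show "hom.mass s (%y. ediff (hom.S (X i) G y) (G y)) <= (\<integral>\<^sup>+v. ?D i (s, v) \<partial>V)"
     unfolding hom.mass_def hom.S_def
     by (auto intro!: nn_integral_mono split: split_indicator simp: max_absorb2)
   qed
   also have "... = (\<integral>\<^sup>+p. ?D i p \<partial>(lborel \<otimes> V))"
    using Dm by (intro V.nn_integral_fst) (simp add: mc)
   finally show ?thesis .
  qed
  show "(%i. hom.dist1 (hom.S (X i) G) G) ----> 0"
   by (rule tendsto_sandwich[OF _ _ tendsto_const main]) (use le in auto)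
 qed
next
 fix \<phi> \<Phi> and s t :: real
 assume rep: "nonneg_rep V \<phi> \<Phi>" and st: "0 <= s" "s <= t"
 then have [measurable]: "\<phi> \<in> bm V" "\<Phi> \<in> bm V" by (simp_all add: nonneg_rep_def)
 note [measurable] = U_factor_measurable[OF st(1)] damp_compose
 show "nonneg_rep V (U_hom \<Sigma> t s \<phi>) (%v. damp t s v * \<Phi> v)"
 proof (rule nonneg_repI)
  show "U_hom \<Sigma> t s \<phi> \<in> bm V" unfolding U_hom_def by measurable
  show "(%v. damp t s v * \<Phi> v) \<in> bm V" by measurable
  have "(\<integral>\<^sup>+v. damp t s v * \<Phi> v \<partial>V) <= (\<integral>\<^sup>+v. \<Phi> v \<partial>V)"
   using mult_right_mono[OF damp_le_1[of t s], of "\<Phi> _"] by (intro nn_integral_mono) simp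
  also have "... < top" using rep by (simp add: nonneg_rep_def)
  finally show "(\<integral>\<^sup>+v. damp t s v * \<Phi> v \<partial>V) < top" .
  show "AE v in V. U_hom \<Sigma> t s \<phi> v = enn2real (damp t s v * \<Phi> v)"
   using nonneg_rep_AE[OF rep] AE_regular AE_space
   by eventually_elim (simp add: U_hom_def enn2real_mult exp_integral_eq_damp[OF _ _ st(1), symmetric])
 qed
next
 fix \<phi> \<Phi> and t :: real
 assume rep: "nonneg_rep V \<phi> \<Phi>" and t: "0 <= t"
  and fin: "(\<integral>\<^sup>+v. (\<integral>\<^sup>+v'. kernel t v v' * \<Phi> v' \<partial>V) \<partial>V) < top"
 from rep have [measurable]: "\<phi> \<in> bm V" "\<Phi> \<in> bm V"
  and eq: "AE v' in V. 0 <= \<phi> v' & ennreal (\<phi> v') = \<Phi> v'" by (simp_all add: nonneg_rep_def)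
 note [measurable] = kernel_compose b_section_measurable[OF t]
 have "(\<integral>\<^sup>+v'. scatter_rate \<mu> b t v' * ennreal \<bar>\<phi> v'\<bar> \<partial>V) = (\<integral>\<^sup>+v'. (\<integral>\<^sup>+v. kernel t v v' * \<Phi> v' \<partial>V) \<partial>V)"
 proof (rule nn_integral_cong_AE)
  show "AE v' in V. scatter_rate \<mu> b t v' * ennreal \<bar>\<phi> v'\<bar> = (\<integral>\<^sup>+v. kernel t v v' * \<Phi> v' \<partial>V)"
   using eq AE_space
  proof eventually_elim
   fix v' assume v': "0 <= \<phi> v' & ennreal (\<phi> v') = \<Phi> v'" "v' \<in> space V"
   have "(%v. kernel t v v') \<in> bm V" by (rule kernel_compose) (use v' in auto)
   then show "scatter_rate \<mu> b t v' * ennreal \<bar>\<phi> v'\<bar> = (\<integral>\<^sup>+v. kernel t v v' * \<Phi> v' \<partial>V)"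
    using v' t by (subst nn_integral_multc) (auto simp: scatter_rate_def kernel_def)
  qed
 qed
 also have "... = (\<integral>\<^sup>+v. (\<integral>\<^sup>+v'. kernel t v v' * \<Phi> v' \<partial>V) \<partial>V)"
  by (rule VV.Fubini'[symmetric]) (simp add: split_beta')
 finally have dom: "\<phi> \<in> dom_B_hom \<mu> b t"
  using fin nonneg_rep_integrable[OF rep] by (simp add: dom_B_hom_def E_hom_def L1_def)
 show "nonneg_rep V (B_hom \<mu> b t \<phi>) (%v. \<integral>\<^sup>+v'. kernel t v v' * \<Phi> v' \<partial>V)"
 proof (rule nonneg_repI[OF _ _ fin])
  show "B_hom \<mu> b t \<phi> \<in> bm V"
   using dom by (simp add: B_hom_def)
  show "(%v. \<integral>\<^sup>+v'. kernel t v v' * \<Phi> v' \<partial>V) \<in> bm V"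
   by (rule V.borel_measurable_nn_integral) (simp add: split_beta')
  show "AE v in V. B_hom \<mu> b t \<phi> v = enn2real (\<integral>\<^sup>+v'. kernel t v v' * \<Phi> v' \<partial>V)"
   using dom scattering_integral[OF t _ _ eq] by (intro AE_I2) (simp add: B_hom_def)
 qed
qed

end

section \<open>The inhomogeneous problem\<close>

context kinetic begin

text \<open>The segment travelled backwards stays in \<open>\<Omega>\<close>. The parameter runs over the fixed compact interval \<open>{0..1}\<close>, which makes the set of such
\<open>(h, x, v)\<close> open.\<close>

definition stays :: "real => 'a => 'a => bool" where
 "stays h x v \<longleftrightarrow> (\<forall>r\<in>{0..1}. x - (r * h) *\<^sub>R v \<in> \<Omega>)"

abbreviation D :: "'a measure" where "D \<equiv> restrict_space lborel \<Omega>"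
abbreviation PS :: "('a \<times> 'a) measure" where "PS \<equiv> D \<otimes> V"

definition damp_in :: "real => real => 'a \<times> 'a => ennreal" where
 "damp_in t s = (%(x, v). damp t s v * (if stays (t - s) x v then 1 else 0))"

text \<open>The backward characteristic. Where it has left \<open>\<Omega>\<close> it is replaced by the starting point, to remain in the phase space; \<open>damp_in\<close> vanishes there.\<close>

definition flow :: "real => real => 'a \<times> 'a => 'a \<times> 'a" where
 "flow t s = (%(x, v). (if x - (t - s) *\<^sub>R v \<in> \<Omega> then x - (t - s) *\<^sub>R v else x, v))"

lemma domain_borel [measurable]: "\<Omega> \<in> sets borel"
 using open_domain by (rule borel_open)

lemma space_D: "space D = \<Omega>"
 by (simp add: space_restrict_space)

lemma sigma_finite_D: "sigma_finite_measure D"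
 by (intro sigma_finite_measure_restrict_space sigma_finite_lborel) simp

sublocale D: sigma_finite_measure D by (rule sigma_finite_D)
sublocale DV: pair_sigma_finite D V ..

lemma phase_space_eq: "phase_space \<Omega> \<mu> = PS"
 by (simp add: phase_space_def)

lemma measurable_D:
 "f \<in> P \<rightarrow>\<^sub>M D \<longleftrightarrow> f \<in> bm P & (\<forall>p\<in>space P. f p \<in> \<Omega>)"
 by (auto simp: measurable_restrict_space2_iff)

lemma measurable_V_borel: "f \<in> P \<rightarrow>\<^sub>M V ==> f \<in> bm P"
 using measurable_cong_sets[OF refl sets_\<mu>, of P] by (auto simp: measurable_restrict_space2_iff)

lemma stays_iff:
 assumes "0 <= h"
 shows "stays h x v \<longleftrightarrow> (\<forall>q. 0 <= q & q <= h --> x - q *\<^sub>R v \<in> \<Omega>)"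
proof
 assume s: "stays h x v"
 show "\<forall>q. 0 <= q & q <= h --> x - q *\<^sub>R v \<in> \<Omega>"
 proof (intro allI impI)
  fix q assume q: "0 <= q & q <= h"
  then have "q / h \<in> {0..1}" "q / h * h = q" using assms by (auto simp: divide_le_eq)
  then show "x - q *\<^sub>R v \<in> \<Omega>" using s unfolding stays_def by metis
 qed
next
 assume "\<forall>q. 0 <= q & q <= h --> x - q *\<^sub>R v \<in> \<Omega>"
 then show "stays h x v" using assms unfolding stays_def by (auto simp: mult_left_le_one_le)
qed

lemma stays_endpoint: "stays h x v ==> x - h *\<^sub>R v \<in> \<Omega>"
 unfolding stays_def by (drule bspec[of _ _ 1]) auto

lemma stays_0: "stays 0 x v \<longleftrightarrow> x \<in> \<Omega>"
 by (auto simp: stays_def)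

lemma stays_add:
 assumes "0 <= h" "0 <= k"
 shows "stays (h + k) x v \<longleftrightarrow> stays h x v & stays k (x - h *\<^sub>R v) v"
proof -
 have "(\<forall>q. 0 <= q & q <= h + k --> x - q *\<^sub>R v \<in> \<Omega>) \<longleftrightarrow>
   (\<forall>q. 0 <= q & q <= h --> x - q *\<^sub>R v \<in> \<Omega>) & (\<forall>q. 0 <= q & q <= k --> x - (h + q) *\<^sub>R v \<in> \<Omega>)"
  (is "?L \<longleftrightarrow> ?A & ?B")
 proof (intro iffI conjI)
  assume L: ?L
  show ?A using L assms by auto
  show ?B using L assms by auto
 next
  assume AB: "?A & ?B"
  show ?L
  proof (intro allI impI)
   fix q assume q: "0 <= q & q <= h + k"
   show "x - q *\<^sub>R v \<in> \<Omega>"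
   proof (cases "q <= h")
    case False
    then show ?thesis using AB[THEN conjunct2, rule_format, of "q - h"] q by simp
   qed (use AB q in auto)
  qed
 qed
 then show ?thesis using assms by (simp add: stays_iff scaleR_add_left diff_diff_eq)
qed

text \<open>The complement is the projection of a closed set along a compact interval.\<close>

lemma open_stays: "open {p. stays (fst p) (fst (snd p)) (snd (snd p))}"
proof -
 let ?g = "%q :: real \<times> real \<times> 'a \<times> 'a. fst (snd (snd q)) - (fst q * fst (snd q)) *\<^sub>R snd (snd (snd q))"
 have "closed (?g -` (- \<Omega>))"
  using open_domain by (intro closed_vimage continuous_intros) auto
 then have "closed {p. \<exists>r. r \<in> {0..1} & (r, p) \<in> ?g -` (- \<Omega>)}"
  by (intro closed_compact_projection) auto
 moreover have "{p. \<exists>r. r \<in> {0..1} & (r, p) \<in> ?g -` (- \<Omega>)} = - {p. stays (fst p) (fst (snd p)) (snd (snd p))}"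
  by (auto simp: stays_def)
 ultimately show ?thesis by (simp add: closed_def)
qed

lemma stays_measurable:
 assumes [measurable]: "f \<in> bm P" "g \<in> bm P" "h \<in> bm P"
 shows "Measurable.pred P (%p. stays (f p) (g p) (h p))"
proof -
 let ?S = "{p. stays (fst p) (fst (snd p)) (snd (snd p))}"
 have [measurable]: "?S \<in> sets borel" by (rule borel_open[OF open_stays])
 have [measurable]: "(%p. (f p, g p, h p)) \<in> bm P" by (intro borel_measurable_Pair assms)
 have "Measurable.pred P (%p. (f p, g p, h p) \<in> ?S)" by measurable
 then show ?thesis by simp
qed

text \<open>As \<open>\<Omega>\<close> is open, a finite exit time is itself an exit, so the strict inequality excludes exits up to and including time \<open>h\<close>.\<close>

lemma less_exit_time_iff:
 assumes x: "x \<in> \<Omega>" and h: "0 <= h"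
 shows "ereal h < exit_time \<Omega> x v \<longleftrightarrow> stays h x v"
proof
 assume less: "ereal h < exit_time \<Omega> x v"
 show "stays h x v"
  unfolding stays_iff[OF h]
 proof (intro allI impI)
  fix q assume q: "0 <= q & q <= h"
  show "x - q *\<^sub>R v \<in> \<Omega>"
  proof (rule ccontr)
   assume n: "x - q *\<^sub>R v \<notin> \<Omega>"
   then have "q ~= 0" using x by auto
   then have "exit_time \<Omega> x v <= ereal q" using n q unfolding exit_time_def by (intro Inf_lower) auto
   also have "... <= ereal h" using q by simp
   finally show False using less by simp
  qed
 qed
next
 assume s: "stays h x v"
 let ?U = "(%q. x - q *\<^sub>R v) -` \<Omega>"
 have "open ?U" using open_domain by (intro open_vimage continuous_intros) auto
 moreover have "h \<in> ?U" using stays_endpoint[OF s] by simp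
 ultimately obtain \<delta> where \<delta>: "0 < \<delta>" "ball h \<delta> \<subseteq> ?U" using openE by metis
 have "ereal (h + \<delta>) <= exit_time \<Omega> x v"
  unfolding exit_time_def
 proof (rule Inf_greatest)
  fix e assume "e \<in> ereal ` {t. 0 < t & x - t *\<^sub>R v \<notin> \<Omega>}"
  then obtain q where q: "e = ereal q" "0 < q" "x - q *\<^sub>R v \<notin> \<Omega>" by auto
  have "h < q" using s q unfolding stays_iff[OF h] by (metis less_imp_le not_le)
  moreover have "q \<notin> ball h \<delta>" using q \<delta>(2) by auto
  ultimately have "h + \<delta> <= q" by (auto simp: dist_real_def)
  then show "ereal (h + \<delta>) <= e" using q by simp
 qed
 moreover have "ereal h < ereal (h + \<delta>)" using \<delta>(1) by simp
 ultimately show "ereal h < exit_time \<Omega> x v" by (rule less_le_trans[rotated])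
qed

lemma damp_in_compose:
 assumes [measurable]: "f \<in> bm P" "g \<in> bm P" "h \<in> P \<rightarrow>\<^sub>M PS"
 shows "(%p. damp_in (f p) (g p) (h p)) \<in> bm P"
proof -
 have V[measurable]: "(%p. snd (h p)) \<in> P \<rightarrow>\<^sub>M V" and D: "(%p. fst (h p)) \<in> P \<rightarrow>\<^sub>M D" by measurable
 have [measurable]: "(%p. fst (h p)) \<in> bm P" "(%p. snd (h p)) \<in> bm P"
  using D measurable_V_borel[OF V] by (simp_all add: measurable_D)
 have [measurable]: "Measurable.pred P (%p. stays (f p - g p) (fst (h p)) (snd (h p)))" by (rule stays_measurable) auto
 have [measurable]: "(%p. damp (f p) (g p) (snd (h p))) \<in> bm P" by (rule damp_compose) auto
 show ?thesis unfolding damp_in_def split_beta' by measurable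
qed

lemma flow_compose:
 assumes [measurable]: "f \<in> bm P" "g \<in> bm P" "h \<in> P \<rightarrow>\<^sub>M PS"
 shows "(%p. flow (f p) (g p) (h p)) \<in> P \<rightarrow>\<^sub>M PS"
proof -
 have V[measurable]: "(%p. snd (h p)) \<in> P \<rightarrow>\<^sub>M V" and D: "(%p. fst (h p)) \<in> P \<rightarrow>\<^sub>M D" by measurable
 have [measurable]: "(%p. fst (h p)) \<in> bm P" "(%p. snd (h p)) \<in> bm P"
  using D measurable_V_borel[OF V] by (simp_all add: measurable_D)
 have "(%p. if fst (h p) - (f p - g p) *\<^sub>R snd (h p) \<in> \<Omega> then fst (h p) - (f p - g p) *\<^sub>R snd (h p) else fst (h p)) \<in> bm P"
  by measurable
 then have [measurable]: "(%p. if fst (h p) - (f p - g p) *\<^sub>R snd (h p) \<in> \<Omega> then fst (h p) - (f p - g p) *\<^sub>R snd (h p) else fst (h p)) \<in> P \<rightarrow>\<^sub>M D"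
  using D by (auto simp: measurable_D)
 show ?thesis unfolding flow_def split_beta' by measurable
qed

definition marginal :: "('a \<times> 'a => ennreal) => 'a => ennreal" where
 "marginal \<Phi> v = (\<integral>\<^sup>+x. \<Phi> (x, v) \<partial>D)"

lemma marginal_measurable:
 assumes "(%(p, y). \<Phi> p y) \<in> bm (P \<otimes> PS)" "f \<in> P \<rightarrow>\<^sub>M V"
 shows "(%p. marginal (\<Phi> p) (f p)) \<in> bm P"
proof -
 have "(%q. (fst q, (snd q, f (fst q)))) \<in> P \<otimes> D \<rightarrow>\<^sub>M P \<otimes> PS" using assms(2) by measurable
 from measurable_compose[OF this assms(1)] show ?thesis
  unfolding marginal_def by (intro D.borel_measurable_nn_integral) (simp add: split_beta')
qed

lemma marginal_borel [measurable]: "\<Phi> \<in> bm PS ==> marginal \<Phi> \<in> bm V"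
 by (rule marginal_measurable[where \<Phi>="%_. \<Phi>"]) (simp_all add: split_beta')

lemma integral_marginal: "\<Phi> \<in> bm PS ==> (\<integral>\<^sup>+p. \<Phi> p \<partial>PS) = (\<integral>\<^sup>+v. marginal \<Phi> v \<partial>V)"
 unfolding marginal_def by (rule DV.nn_integral_snd[symmetric])

lemma section_borel_D: "\<Phi> \<in> bm PS ==> v \<in> space V ==> (%x. \<Phi> (x, v)) \<in> bm D"
 by (rule measurable_compose[of "%x. (x, v)"]) auto

text \<open>Extended by 0 outside \<open>\<Omega>\<close>, the density is translated, and Lebesgue measure is translation invariant; particles that leave \<open>\<Omega>\<close> only reduce the left-hand side.\<close>

lemma marginal_transport_le:
 assumes \<Phi>: "\<Phi> \<in> bm PS" and v: "v \<in> space V"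
 shows "marginal (%p. damp_in t s p * \<Phi> (flow t s p)) v <= damp t s v * marginal \<Phi> v"
proof -
 let ?f = "%x. \<Phi> (x, v) * indicator \<Omega> x"
 have f[measurable]: "?f \<in> bm borel"
  using section_borel_D[OF \<Phi> v] by (simp add: borel_measurable_restrict_space_iff_ennreal)
 have "marginal (%p. damp_in t s p * \<Phi> (flow t s p)) v
   = (\<integral>\<^sup>+x. damp_in t s (x, v) * \<Phi> (flow t s (x, v)) * indicator \<Omega> x \<partial>lborel)"
  unfolding marginal_def by (rule nn_integral_restrict_space) simp
 also have "... <= (\<integral>\<^sup>+x. damp t s v * ?f (x + - ((t - s) *\<^sub>R v)) \<partial>lborel)"
  by (intro nn_integral_mono) (auto simp: damp_in_def flow_def dest: stays_endpoint split: split_indicator)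
 also have "... = damp t s v * (\<integral>\<^sup>+x. ?f (x + - ((t - s) *\<^sub>R v)) \<partial>lborel)"
  by (rule nn_integral_cmult) (rule measurable_compose[OF _ f], simp)
 also have "(\<integral>\<^sup>+x. ?f (x + - ((t - s) *\<^sub>R v)) \<partial>lborel) = (\<integral>\<^sup>+x. ?f x \<partial>lborel)"
  by (rule nn_integral_lborel_translate[OF f])
 also have "... = marginal \<Phi> v"
  unfolding marginal_def by (rule nn_integral_restrict_space[symmetric]) simp
 finally show ?thesis .
qed

lemma marginal_scattering:
 assumes \<Psi>: "\<Psi> \<in> bm PS" and v: "v \<in> space V"
 shows "marginal (%p. \<integral>\<^sup>+v'. kernel t (snd p) v' * \<Psi> (fst p, v') \<partial>V) v = (\<integral>\<^sup>+v'. kernel t v v' * marginal \<Psi> v' \<partial>V)"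
proof -
 have [measurable]: "(%q. kernel t v (snd q)) \<in> bm (D \<otimes> V)"
  using v by (intro kernel_compose) auto
 have k: "(%v'. kernel t v v') \<in> bm V" using v by (intro kernel_compose) auto
 have "marginal (%p. \<integral>\<^sup>+v'. kernel t (snd p) v' * \<Psi> (fst p, v') \<partial>V) v = (\<integral>\<^sup>+x. (\<integral>\<^sup>+v'. kernel t v v' * \<Psi> (x, v') \<partial>V) \<partial>D)"
  by (simp add: marginal_def)
 also have "... = (\<integral>\<^sup>+v'. (\<integral>\<^sup>+x. kernel t v v' * \<Psi> (x, v') \<partial>D) \<partial>V)"
  by (rule DV.Fubini'[symmetric]) (use \<Psi> in \<open>simp add: split_beta'\<close>)
 also have "... = (\<integral>\<^sup>+v'. kernel t v v' * marginal \<Psi> v' \<partial>V)"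
  unfolding marginal_def by (intro nn_integral_cong nn_integral_cmult section_borel_D[OF \<Psi>])
 finally show ?thesis .
qed

text \<open>Marginals reduce the estimate to the homogeneous one.\<close>

lemma inhomogeneous_dissipative:
 assumes \<Phi>[measurable]: "\<Phi> \<in> bm PS" and st: "0 <= s" "s <= t"
 shows "(\<integral>\<^sup>+p. damp_in t s p * \<Phi> (flow t s p) \<partial>PS)
   + (\<integral>\<^sup>+r\<in>{s..t}. (\<integral>\<^sup>+p. (\<integral>\<^sup>+v'. kernel r (snd p) v' * (damp_in r s (fst p, v') * \<Phi> (flow r s (fst p, v'))) \<partial>V) \<partial>PS) \<partial>lborel)
   <= (\<integral>\<^sup>+p. \<Phi> p \<partial>PS)"
proof -
 have [measurable]: "(%p. damp_in r s p * \<Phi> (flow r s p)) \<in> bm PS" for r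
  by (intro borel_measurable_times_ennreal damp_in_compose measurable_compose[OF flow_compose \<Phi>]) auto
 have gain: "(\<integral>\<^sup>+p. (\<integral>\<^sup>+v'. kernel r (snd p) v' * (damp_in r s (fst p, v') * \<Phi> (flow r s (fst p, v'))) \<partial>V) \<partial>PS)
   <= (\<integral>\<^sup>+v. (\<integral>\<^sup>+v'. kernel r v v' * (damp r s v' * marginal \<Phi> v') \<partial>V) \<partial>V)" for r
 proof -
  have [measurable]: "(%q. kernel r (snd (fst q)) (snd q)) \<in> bm (PS \<otimes> V)"
   by (intro kernel_compose) auto
  have "(%q. (fst (fst q), snd q)) \<in> PS \<otimes> V \<rightarrow>\<^sub>M PS" by measurable
  note [measurable] = measurable_compose[OF this \<open>(%p. damp_in r s p * \<Phi> (flow r s p)) \<in> bm PS\<close>]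
  have "(%p. \<integral>\<^sup>+v'. kernel r (snd p) v' * (damp_in r s (fst p, v') * \<Phi> (flow r s (fst p, v'))) \<partial>V) \<in> bm PS"
   by (rule V.borel_measurable_nn_integral) (simp add: split_beta')
  then have "(\<integral>\<^sup>+p. (\<integral>\<^sup>+v'. kernel r (snd p) v' * (damp_in r s (fst p, v') * \<Phi> (flow r s (fst p, v'))) \<partial>V) \<partial>PS)
    = (\<integral>\<^sup>+v. marginal (%p. \<integral>\<^sup>+v'. kernel r (snd p) v' * (damp_in r s (fst p, v') * \<Phi> (flow r s (fst p, v'))) \<partial>V) v \<partial>V)"
   by (rule integral_marginal)
  also have "... = (\<integral>\<^sup>+v. (\<integral>\<^sup>+v'. kernel r v v' * marginal (%p. damp_in r s p * \<Phi> (flow r s p)) v' \<partial>V) \<partial>V)"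
   using marginal_scattering[where \<Psi>="%p. damp_in r s p * \<Phi> (flow r s p)"] by (intro nn_integral_cong) simp
  also have "... <= (\<integral>\<^sup>+v. (\<integral>\<^sup>+v'. kernel r v v' * (damp r s v' * marginal \<Phi> v') \<partial>V) \<partial>V)"
   by (intro nn_integral_mono mult_left_mono marginal_transport_le[OF \<Phi>]) auto
  finally show ?thesis .
 qed
 have loss: "(\<integral>\<^sup>+p. damp_in t s p * \<Phi> (flow t s p) \<partial>PS) <= (\<integral>\<^sup>+v. damp t s v * marginal \<Phi> v \<partial>V)"
  by (subst integral_marginal) (auto intro!: nn_integral_mono marginal_transport_le[OF \<Phi>])
 let ?gain = "%r. (\<integral>\<^sup>+p. (\<integral>\<^sup>+v'. kernel r (snd p) v' * (damp_in r s (fst p, v') * \<Phi> (flow r s (fst p, v'))) \<partial>V) \<partial>PS)"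
 have "(\<integral>\<^sup>+p. damp_in t s p * \<Phi> (flow t s p) \<partial>PS) + (\<integral>\<^sup>+r\<in>{s..t}. ?gain r \<partial>lborel)
   <= (\<integral>\<^sup>+v. damp t s v * marginal \<Phi> v \<partial>V)
    + (\<integral>\<^sup>+r\<in>{s..t}. (\<integral>\<^sup>+v. (\<integral>\<^sup>+v'. kernel r v v' * (damp r s v' * marginal \<Phi> v') \<partial>V) \<partial>V) \<partial>lborel)"
 proof (rule add_mono[OF loss], rule nn_integral_mono)
  fix r
  show "?gain r * indicator {s..t} r
    <= (\<integral>\<^sup>+v. (\<integral>\<^sup>+v'. kernel r v v' * (damp r s v' * marginal \<Phi> v') \<partial>V) \<partial>V) * indicator {s..t} r"
   by (rule mult_right_mono[OF gain zero_le])
 qed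
 also have "... <= (\<integral>\<^sup>+v. marginal \<Phi> v \<partial>V)"
  by (rule homogeneous_dissipative[OF marginal_borel[OF \<Phi>] st])
 also have "... = (\<integral>\<^sup>+p. \<Phi> p \<partial>PS)"
  by (rule integral_marginal[OF \<Phi>, symmetric])
 finally show ?thesis .
qed

sublocale inh: transport PS V damp_in flow "%t p. kernel t (snd p)" "%p v'. (fst p, v')"
proof
 show "(%(t, s, x). damp_in t s x) \<in> bm (borel \<otimes> (borel \<otimes> PS))"
  unfolding split_beta' by (rule damp_in_compose) auto
 show "(%(t, s, x). flow t s x) \<in> borel \<otimes> (borel \<otimes> PS) \<rightarrow>\<^sub>M PS"
  unfolding split_beta' by (rule flow_compose) auto
 show "(%(t, x, z). kernel t (snd x) z) \<in> bm (borel \<otimes> (PS \<otimes> V))"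
  unfolding split_beta' by (rule kernel_compose) auto
 show "(%(x, z). (fst x, z)) \<in> PS \<otimes> V \<rightarrow>\<^sub>M PS"
  unfolding split_beta' by measurable
next
 fix r s t :: real and p assume rst: "0 <= r" "r <= s" "s <= t" and p: "p \<in> space PS"
 obtain x v where xv: "p = (x, v)" "v \<in> space V" using p by (auto simp: space_pair_measure)
 have add: "stays (t - r) x v \<longleftrightarrow> stays (t - s) x v & stays (s - r) (x - (t - s) *\<^sub>R v) v"
  using stays_add[of "t - s" "s - r" x v] rst by simp
 show "damp_in t r p = damp_in t s p * damp_in s r (flow t s p)"
  unfolding xv using damp_comp[OF rst xv(2)] add stays_endpoint[of "t - s" x v]
  by (auto simp: damp_in_def flow_def)
 assume "damp_in t r p ~= 0"
 then have st: "stays (t - r) x v" by (auto simp: xv damp_in_def split: if_splits)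
 then have e: "x - (t - s) *\<^sub>R v \<in> \<Omega>" "x - (t - r) *\<^sub>R v \<in> \<Omega>"
  using add stays_endpoint by auto
 have eq: "x - (t - s) *\<^sub>R v - (s - r) *\<^sub>R v = x - (t - r) *\<^sub>R v" by (simp add: algebra_simps)
 show "flow t r p = flow s r (flow t s p)" by (simp only: xv flow_def case_prod_conv e eq if_True)
next
 fix \<Phi> :: "'a \<times> 'a => ennreal" and s t :: real
 assume "\<Phi> \<in> bm PS" "0 <= s" "s <= t"
 then show "(\<integral>\<^sup>+p. damp_in t s p * \<Phi> (flow t s p) \<partial>PS)
   + (\<integral>\<^sup>+r\<in>{s..t}. (\<integral>\<^sup>+p. (\<integral>\<^sup>+v'. kernel r (snd p) v' * (damp_in r s (fst p, v') * \<Phi> (flow r s (fst p, v'))) \<partial>V) \<partial>PS) \<partial>lborel)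
   <= (\<integral>\<^sup>+p. \<Phi> p \<partial>PS)" by (rule inhomogeneous_dissipative)
qed (auto simp: space_pair_measure space_D damp_in_def flow_def damp_refl stays_0)

end

context kinetic begin

lemma time_position_measurable:
 "(%p :: (real \<times> 'a) \<times> 'a. fst (fst p)) \<in> bm (borel \<otimes> V)"
 "(%p :: (real \<times> 'a) \<times> 'a. snd (fst p)) \<in> bm (borel \<otimes> V)"
 by (rule measurable_compose[OF measurable_fst], intro borel_measurable_continuous_onI continuous_intros)+

text \<open>Regrouping time and position as one Euclidean variable, in which free transport is a translation.\<close>

lemma inhomogeneous_tmass:
 assumes H: "H \<in> bm inh.Y"
 defines "A \<equiv> {p :: (real \<times> 'a) \<times> 'a. 0 <= fst (fst p) & snd (fst p) \<in> \<Omega>}"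
 shows "(%p. H (fst (fst p), (snd (fst p), snd p)) * indicator A p) \<in> bm (borel \<otimes> V)" (is "?H \<in> _")
  and "inh.tmass H = (\<integral>\<^sup>+p. H (fst (fst p), (snd (fst p), snd p)) * indicator A p \<partial>(lborel \<otimes> V))"
proof -
 let ?B = "borel \<otimes> V :: ((real \<times> 'a) \<times> 'a) measure"
 have [measurable]: "(%p. fst (fst p)) \<in> bm ?B" "(%p. snd (fst p)) \<in> bm ?B"
  by (rule time_position_measurable)+
 have "{p \<in> space ?B. 0 <= fst (fst p) & snd (fst p) \<in> \<Omega>} \<in> sets ?B" by measurable
 then have A: "A \<inter> space ?B \<in> sets ?B" by (simp add: A_def Int_def conj_commute)
 have sp: "space (restrict_space ?B A) \<subseteq> A" by (auto simp: space_restrict_space)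
 have "(%p. (fst (fst p), (snd (fst p), snd p))) \<in> restrict_space ?B A \<rightarrow>\<^sub>M inh.Y"
 proof (rule inh.measurable_into_Y)
  show "(%p. fst (fst p)) \<in> bm (restrict_space ?B A)" by (rule measurable_restrict_space1) simp
  have "(%p. snd (fst p)) \<in> bm (restrict_space ?B A)" by (rule measurable_restrict_space1) simp
  then have "(%p. snd (fst p)) \<in> restrict_space ?B A \<rightarrow>\<^sub>M D" using sp by (auto simp: measurable_D A_def)
  then show "(%p. (snd (fst p), snd p)) \<in> restrict_space ?B A \<rightarrow>\<^sub>M PS"
   by (rule measurable_Pair) (rule measurable_restrict_space1, simp)
 qed (use sp in \<open>auto simp: A_def\<close>)
 from measurable_compose[OF this H]
 show Hm: "?H \<in> bm ?B" using A by (simp add: borel_measurable_restrict_space_iff_ennreal)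
 have sets: "sets (lborel \<otimes> V) = sets ?B" by (intro sets_pair_measure_cong) simp_all
 have HL: "?H \<in> bm (lborel \<otimes> V)" using Hm unfolding measurable_cong_sets[OF sets refl] .
 have m: "inh.mass s H = (\<integral>\<^sup>+x. (\<integral>\<^sup>+v. ?H ((s, x), v) \<partial>V) \<partial>lborel)" for s
 proof (cases "0 <= s")
  case True
  have "inh.mass s H = (\<integral>\<^sup>+x. (\<integral>\<^sup>+v. H (s, (x, v)) \<partial>V) \<partial>D)"
   using V.nn_integral_fst[OF inh.section_borel[OF H True]] True
   by (simp add: inh.mass_def)
  also have "... = (\<integral>\<^sup>+x. (\<integral>\<^sup>+v. H (s, (x, v)) \<partial>V) * indicator \<Omega> x \<partial>lborel)"
   by (rule nn_integral_restrict_space) simp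
  also have "... = (\<integral>\<^sup>+x. (\<integral>\<^sup>+v. ?H ((s, x), v) \<partial>V) \<partial>lborel)"
   using True by (intro nn_integral_cong) (auto simp: A_def split: split_indicator)
  finally show ?thesis .
 qed (simp add: inh.mass_def A_def)
 have zm: "(%z. \<integral>\<^sup>+v. ?H (z, v) \<partial>V) \<in> bm (lborel \<otimes> lborel)"
  using V.borel_measurable_nn_integral_fst[OF HL] unfolding lborel_prod .
 have "inh.tmass H = (\<integral>\<^sup>+s. (\<integral>\<^sup>+x. (\<integral>\<^sup>+v. ?H ((s, x), v) \<partial>V) \<partial>lborel) \<partial>lborel)"
  unfolding inh.tmass_eq_mass[OF H] m ..
 also have "... = (\<integral>\<^sup>+z. (\<integral>\<^sup>+v. ?H (z, v) \<partial>V) \<partial>(lborel \<otimes> lborel))"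
  by (rule lborel.nn_integral_fst[OF zm])
 also have "... = (\<integral>\<^sup>+p. ?H p \<partial>(lborel \<otimes> V))"
  unfolding lborel_prod by (rule V.nn_integral_fst[OF HL])
 finally show "inh.tmass H = (\<integral>\<^sup>+p. ?H p \<partial>(lborel \<otimes> V))" .
qed

lemma eventually_stays:
 assumes "x \<in> \<Omega>" "X ----> 0"
 shows "\<forall>\<^sub>F i in sequentially. stays (X i) x v"
proof -
 have "(%i. (X i, x, v)) ----> (0, x, v)" using assms by (intro tendsto_Pair tendsto_const)
 from topological_tendstoD[OF this open_stays] show ?thesis using assms by (simp add: stays_0)
qed

lemma U_inhom_eq:
 assumes "p \<in> space PS" "s <= t"
 shows "U_inhom \<Omega> \<Sigma> t s \<phi> p
  = exp (- (LINT r:{s..t}|lborel. \<Sigma> r (snd p))) * \<phi> (flow t s p) * (if stays (t - s) (fst p) (snd p) then 1 else 0)"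
 using assms less_exit_time_iff[of "fst p" "t - s" "snd p"] stays_endpoint[of "t - s" "fst p" "snd p"]
 by (auto simp: U_inhom_def flow_def space_pair_measure space_D split_beta)

lemma transported_borel:
 assumes \<Phi>: "\<Phi> \<in> bm PS"
 shows "(%p. damp_in t s p * \<Phi> (flow t s p)) \<in> bm PS"
proof -
 have [measurable]: "damp_in t s \<in> bm PS"
  using damp_in_compose[of "%_. t" PS "%_. s" "%p. p"] by simp
 have "flow t s \<in> PS \<rightarrow>\<^sub>M PS" using flow_compose[of "%_. t" PS "%_. s" "%p. p"] by simp
 note [measurable] = measurable_compose[OF this \<Phi>]
 show ?thesis by measurable
qed

lemma transported_integral_le:
 assumes "\<Phi> \<in> bm PS" "0 <= s" "s <= t"
 shows "(\<integral>\<^sup>+p. damp_in t s p * \<Phi> (flow t s p) \<partial>PS) <= (\<integral>\<^sup>+p. \<Phi> p \<partial>PS)"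
 using inhomogeneous_dissipative[OF assms] by (rule order_trans[rotated]) simp

text \<open>Dissipativity applied to the indicator of a null set: free transport does not charge null sets.\<close>

lemma damp_in_AE:
 assumes P: "AE p in PS. P p" and st: "0 <= s" "s <= t"
 shows "AE p in PS. damp_in t s p ~= 0 --> P (flow t s p)"
proof -
 obtain N where N: "N \<in> sets PS" "emeasure PS N = 0" "{p \<in> space PS. \<not> P p} \<subseteq> N"
  using AE_E[OF P] by blast
 have m: "(%p. damp_in t s p * indicator N (flow t s p)) \<in> bm PS"
  using N(1) by (intro transported_borel) simp
 have "(\<integral>\<^sup>+p. damp_in t s p * indicator N (flow t s p) \<partial>PS) <= (\<integral>\<^sup>+p. indicator N p \<partial>PS)"
  by (rule transported_integral_le[OF _ st]) (use N(1) in simp)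
 then have "(\<integral>\<^sup>+p. damp_in t s p * indicator N (flow t s p) \<partial>PS) = 0" using N by simp
 then have "AE p in PS. damp_in t s p * indicator N (flow t s p) = 0"
  using m by (simp add: nn_integral_0_iff_AE)
 then show ?thesis using AE_space
 proof eventually_elim
  fix p assume p: "damp_in t s p * indicator N (flow t s p) = 0" "p \<in> space PS"
  have "flow t s p \<in> space PS" by (rule inh.\<theta>_space[OF p(2)])
  then show "damp_in t s p ~= 0 --> P (flow t s p)" using p(1) N(3) by (auto simp: indicator_def split: if_splits)
 qed
qed

lemma AE_phase_space_velocity:
 assumes "AE v in V. P v"
 shows "AE p in PS. P (snd p)"
proof -
 obtain N where N: "{v \<in> space V. \<not> P v} \<subseteq> N" "emeasure V N = 0" "N \<in> sets V"
  by (rule AE_E[OF assms])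
 have "emeasure PS (space D \<times> N) = 0"
  unfolding V.emeasure_pair_measure_Times[OF sets.top N(3)] N(2) by simp
 then have "space D \<times> N \<in> null_sets PS" by (rule null_setsI) (rule pair_measureI[OF sets.top N(3)])
 then show ?thesis by (rule AE_I') (use N(1) in \<open>auto simp: space_pair_measure\<close>)
qed

sublocale inh: represented_transport PS V damp_in flow "%t p. kernel t (snd p)" "%p v'. (fst p, v')"
 "U_inhom \<Omega> \<Sigma>" "B_inhom \<Omega> \<mu> b"
proof unfold_locales
 fix G assume G: "G \<in> bm inh.Y" and fin: "inh.tmass G ~= top"
 let ?A = "{p :: (real \<times> 'a) \<times> 'a. 0 <= fst (fst p) & snd (fst p) \<in> \<Omega>}"
 let ?f = "%p. G (fst (fst p), (snd (fst p), snd p)) * indicator ?A p"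
 show "((%h. inh.dist1 (inh.S h G) G) \<longlongrightarrow> 0) (at_right 0)"
 proof (rule tendsto_at_right_0_sequentially)
  fix X :: "nat => real" assume X: "!!i. 0 < X i" "X ----> 0"
  let ?w = "%v :: 'a. (- 1 :: real, - v)"
  let ?C = "%i p. damp (fst (fst p)) (max 0 (fst (fst p) - X i)) (snd p)
    * (if stays (X i) (snd (fst p)) (snd p) then 1 else 0 :: ennreal)"
  let ?D = "%i p. ediff (?C i p * ?f (fst p + X i *\<^sub>R ?w (snd p), snd p)) (?f p)"
  have fm: "?f \<in> bm (borel \<otimes> V)" by (rule inhomogeneous_tmass(1)[OF G])
  have fin': "(\<integral>\<^sup>+p. ?f p \<partial>(lborel \<otimes> V)) < top"
   using fin inhomogeneous_tmass(2)[OF G] by (simp add: less_top)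
  have id_V: "(%v. v) \<in> bm V" by (rule measurable_V_borel) simp
  have Cm: "?C i \<in> bm (borel \<otimes> V)" for i
  proof -
   let ?B = "borel \<otimes> V :: ((real \<times> 'a) \<times> 'a) measure"
   have [measurable]: "(%p. fst (fst p)) \<in> bm ?B" "(%p. snd (fst p)) \<in> bm ?B"
    by (rule time_position_measurable)+
   have [measurable]: "(%p. snd p) \<in> bm ?B" by (rule measurable_V_borel) simp
   have [measurable]: "Measurable.pred ?B (%p. stays (X i) (snd (fst p)) (snd p))" by (rule stays_measurable) simp_all
   have [measurable]: "(%p. damp (fst (fst p)) (max 0 (fst (fst p) - X i)) (snd p)) \<in> bm ?B"
    by (rule damp_compose) simp_all
   show ?thesis by measurable
  qed
  have main: "(%i. \<integral>\<^sup>+p. ?D i p \<partial>(lborel \<otimes> V)) ----> 0"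
  proof (rule fibred_translation_tendsto[where w="?w", OF sigma_finite_V fm fin' Cm _ _ _ X])
   show "?C i p <= 1" for i p using damp_le_1 by simp
   show "?w \<in> bm V" using id_V by (intro borel_measurable_Pair) simp_all
   fix v assume v: "v \<in> space V"
   show "AE z in lborel. ?f (z, v) ~= 0 --> (%i. ?C i (z, v)) ----> 1"
   proof (rule AE_I2, rule impI)
    fix z :: "real \<times> 'a" assume "?f (z, v) ~= 0"
    then have z: "0 <= fst z" "snd z \<in> \<Omega>" by (auto simp: indicator_def split: if_splits)
    have "(%i. damp (fst z) (max 0 (fst z - X i)) v) ----> 1" by (rule damp_tendsto[OF v z(1) X])
    moreover have "\<forall>\<^sub>F i in sequentially. damp (fst z) (max 0 (fst z - X i)) v = ?C i (z, v)"
     using eventually_stays[OF z(2) X(2), of v] by eventually_elim simp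
    ultimately show "(%i. ?C i (z, v)) ----> 1" by (rule Lim_transform_eventually)
   qed
  qed
  have le: "inh.dist1 (inh.S (X i) G) G <= (\<integral>\<^sup>+p. ?D i p \<partial>(lborel \<otimes> V))" for i
  proof -
   note [measurable] = inh.S_borel[OF G] G
   have "inh.dist1 (inh.S (X i) G) G
     = (\<integral>\<^sup>+p. ediff (inh.S (X i) G (fst (fst p), (snd (fst p), snd p))) (G (fst (fst p), (snd (fst p), snd p))) * indicator ?A p \<partial>(lborel \<otimes> V))"
    unfolding inh.dist1_def by (rule inhomogeneous_tmass(2)) measurable
   also have "... <= (\<integral>\<^sup>+p. ?D i p \<partial>(lborel \<otimes> V))"
   proof (rule nn_integral_mono)
    fix p :: "(real \<times> 'a) \<times> 'a"
    obtain s x v where p: "p = ((s, x), v)" by (metis surj_pair)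
    show "ediff (inh.S (X i) G (fst (fst p), (snd (fst p), snd p))) (G (fst (fst p), (snd (fst p), snd p))) * indicator ?A p <= ?D i p"
    proof (cases "0 <= s & x \<in> \<Omega>")
     case True
     have "inh.S (X i) G (s, (x, v)) = ?C i p * ?f (fst p + X i *\<^sub>R ?w (snd p), snd p)"
      using True stays_endpoint[of "X i" x v]
      by (auto simp: p inh.S_def damp_in_def flow_def max_absorb2)
     then show ?thesis using True by (simp add: p)
    qed (auto simp: p)
   qed
   finally show ?thesis .
  qed
  show "(%i. inh.dist1 (inh.S (X i) G) G) ----> 0"
   by (rule tendsto_sandwich[OF _ _ tendsto_const main]) (use le in auto)
 qed
next
 fix \<phi> \<Phi> and s t :: real
 assume rep: "nonneg_rep PS \<phi> \<Phi>" and st: "0 <= s" "s <= t"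
 then have \<phi>: "\<phi> \<in> bm PS" and \<Phi>: "\<Phi> \<in> bm PS" by (simp_all add: nonneg_rep_def)
 show "nonneg_rep PS (U_inhom \<Omega> \<Sigma> t s \<phi>) (%p. damp_in t s p * \<Phi> (flow t s p))"
 proof (rule nonneg_repI)
  have flow: "flow t s \<in> PS \<rightarrow>\<^sub>M PS" using flow_compose[of "%_. t" PS "%_. s" "%p. p"] by simp
  have [measurable]: "(%p. fst p) \<in> bm PS" "(%p. snd p) \<in> bm PS"
   using measurable_fst[of D V] by (auto simp: measurable_D intro: measurable_V_borel)
  have [measurable]: "Measurable.pred PS (%p. stays (t - s) (fst p) (snd p))" by (rule stays_measurable) simp_all
  note [measurable] = measurable_compose[OF flow \<phi>] measurable_compose[OF measurable_snd U_factor_measurable[OF st(1)]]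
  have "(%p. exp (- (LINT r:{s..t}|lborel. \<Sigma> r (snd p))) * \<phi> (flow t s p) * (if stays (t - s) (fst p) (snd p) then 1 else 0)) \<in> bm PS"
   by measurable
  then show "U_inhom \<Omega> \<Sigma> t s \<phi> \<in> bm PS"
   by (rule measurable_cong[THEN iffD2, rotated]) (rule U_inhom_eq[OF _ st(2)])
  show "(%p. damp_in t s p * \<Phi> (flow t s p)) \<in> bm PS"
   by (rule transported_borel[OF \<Phi>])
  have "(\<integral>\<^sup>+p. damp_in t s p * \<Phi> (flow t s p) \<partial>PS) <= (\<integral>\<^sup>+p. \<Phi> p \<partial>PS)"
   by (rule transported_integral_le[OF \<Phi> st])
  also have "... < top" using rep by (simp add: nonneg_rep_def)
  finally show "(\<integral>\<^sup>+p. damp_in t s p * \<Phi> (flow t s p) \<partial>PS) < top" .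
  show "AE p in PS. U_inhom \<Omega> \<Sigma> t s \<phi> p = enn2real (damp_in t s p * \<Phi> (flow t s p))"
   using damp_in_AE[OF nonneg_rep_AE[OF rep] st] AE_phase_space_velocity[OF AE_regular] AE_space
  proof eventually_elim
   fix p assume p: "damp_in t s p ~= 0 --> \<phi> (flow t s p) = enn2real (\<Phi> (flow t s p))" "regular (snd p)" "p \<in> space PS"
   have v: "snd p \<in> space V" using p(3) by (auto simp: space_pair_measure)
   have e: "exp (- (LINT r:{s..t}|lborel. \<Sigma> r (snd p))) = enn2real (damp t s (snd p))"
    by (simp add: exp_integral_eq_damp[OF v p(2) st(1), symmetric])
   show "U_inhom \<Omega> \<Sigma> t s \<phi> p = enn2real (damp_in t s p * \<Phi> (flow t s p))"
    unfolding U_inhom_eq[OF p(3) st(2)] e using p(1)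
    by (auto simp: damp_in_def enn2real_mult split_beta damp_def)
  qed
 qed
next
 fix \<phi> \<Phi> and t :: real
 assume rep: "nonneg_rep PS \<phi> \<Phi>" and t: "0 <= t"
  and fin: "(\<integral>\<^sup>+p. (\<integral>\<^sup>+v'. kernel t (snd p) v' * \<Phi> (fst p, v') \<partial>V) \<partial>PS) < top"
 from rep have \<phi>[measurable]: "\<phi> \<in> bm PS" and \<Phi>[measurable]: "\<Phi> \<in> bm PS"
  and eq: "AE p in PS. 0 <= \<phi> p & ennreal (\<phi> p) = \<Phi> p" by (simp_all add: nonneg_rep_def)
 have pair: "(%q. (fst (fst q), snd q)) \<in> PS \<otimes> V \<rightarrow>\<^sub>M PS" by measurable
 have "(%q. (snd (fst q), snd q)) \<in> PS \<otimes> V \<rightarrow>\<^sub>M V \<otimes> V" by measurable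
 note [measurable] = measurable_compose[OF pair \<phi>] measurable_compose[OF pair \<Phi>]
  measurable_compose[OF this b_section_measurable[OF t], simplified]
 have [measurable]: "(%q. kernel t (snd (fst q)) (snd q)) \<in> bm (PS \<otimes> V)" by (rule kernel_compose) auto
 have Bm: "(%p. \<integral>\<^sup>+v'. kernel t (snd p) v' * \<Phi> (fst p, v') \<partial>V) \<in> bm PS"
  by (rule V.borel_measurable_nn_integral) (simp add: split_beta')
 have k: "(%v. kernel t v v') \<in> bm V" if "v' \<in> space V" for v' using that by (intro kernel_compose) auto
 have "(\<integral>\<^sup>+(x, v). scatter_rate \<mu> b t v * ennreal \<bar>\<phi> (x, v)\<bar> \<partial>PS)
   = (\<integral>\<^sup>+p. (\<integral>\<^sup>+v. kernel t v (snd p) \<partial>V) * \<Phi> p \<partial>PS)"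
 proof (rule nn_integral_cong_AE)
  show "AE p in PS. (case p of (x, v) => scatter_rate \<mu> b t v * ennreal \<bar>\<phi> (x, v)\<bar>) = (\<integral>\<^sup>+v. kernel t v (snd p) \<partial>V) * \<Phi> p"
   using eq by eventually_elim (use t in \<open>auto simp: scatter_rate_def kernel_def split_beta\<close>)
 qed
 also have "... = (\<integral>\<^sup>+v'. marginal (%p. (\<integral>\<^sup>+v. kernel t v (snd p) \<partial>V) * \<Phi> p) v' \<partial>V)"
 proof (rule integral_marginal)
  have [measurable]: "(%p. \<integral>\<^sup>+v. kernel t v (snd p) \<partial>V) \<in> bm PS"
   by (rule V.borel_measurable_nn_integral) (unfold split_beta', rule kernel_compose, auto)
  show "(%p. (\<integral>\<^sup>+v. kernel t v (snd p) \<partial>V) * \<Phi> p) \<in> bm PS" by measurable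
 qed
 also have "... = (\<integral>\<^sup>+v'. (\<integral>\<^sup>+v. kernel t v v' * marginal \<Phi> v' \<partial>V) \<partial>V)"
  unfolding marginal_def
  by (intro nn_integral_cong) (simp add: nn_integral_cmult section_borel_D[OF \<Phi>] nn_integral_multc k)
 also have "... = (\<integral>\<^sup>+v. (\<integral>\<^sup>+v'. kernel t v v' * marginal \<Phi> v' \<partial>V) \<partial>V)"
  by (rule VV.Fubini'[symmetric]) (unfold split_beta', intro borel_measurable_times_ennreal kernel_compose measurable_compose[OF measurable_snd marginal_borel[OF \<Phi>]], auto)
 also have "... = (\<integral>\<^sup>+v. marginal (%p. \<integral>\<^sup>+v'. kernel t (snd p) v' * \<Phi> (fst p, v') \<partial>V) v \<partial>V)"
  by (intro nn_integral_cong marginal_scattering[OF \<Phi>, symmetric])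
 also have "... = (\<integral>\<^sup>+p. (\<integral>\<^sup>+v'. kernel t (snd p) v' * \<Phi> (fst p, v') \<partial>V) \<partial>PS)"
  by (rule integral_marginal[OF Bm, symmetric])
 finally have dom: "\<phi> \<in> dom_B_inhom \<Omega> \<mu> b t"
  using fin nonneg_rep_integrable[OF rep] by (simp add: dom_B_inhom_def E_inhom_def L1_def phase_space_eq)
 show "nonneg_rep PS (B_inhom \<Omega> \<mu> b t \<phi>) (%p. \<integral>\<^sup>+v'. kernel t (snd p) v' * \<Phi> (fst p, v') \<partial>V)"
 proof (rule nonneg_repI[OF _ Bm fin])
  have "(%p. LINT v'|V. b t (snd p) v' * \<phi> (fst p, v')) \<in> bm PS"
   by (rule V.borel_measurable_lebesgue_integral) (simp add: split_beta')
  then show "B_inhom \<Omega> \<mu> b t \<phi> \<in> bm PS"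
   using dom by (simp add: B_inhom_def split_beta')
  have "AE x in D. AE v' in V. 0 <= \<phi> (x, v') & ennreal (\<phi> (x, v')) = \<Phi> (x, v')"
   using DV.AE_pair[OF eq] by simp
  moreover have "AE p in PS. P (fst p)" if P: "AE x in D. P x" for P
  proof -
   obtain N where N: "{x \<in> space D. \<not> P x} \<subseteq> N" "emeasure D N = 0" "N \<in> sets D"
    by (rule AE_E[OF P])
   have "emeasure PS (N \<times> space V) = 0"
    unfolding V.emeasure_pair_measure_Times[OF N(3) sets.top] N(2) by simp
   then have "N \<times> space V \<in> null_sets PS" by (rule null_setsI) (rule pair_measureI[OF N(3) sets.top])
   then show ?thesis by (rule AE_I') (use N(1) in \<open>auto simp: space_pair_measure\<close>)
  qed
  ultimately have "AE p in PS. AE v' in V. 0 <= \<phi> (fst p, v') & ennreal (\<phi> (fst p, v')) = \<Phi> (fst p, v')" by blast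
  then show "AE p in PS. B_inhom \<Omega> \<mu> b t \<phi> p = enn2real (\<integral>\<^sup>+v'. kernel t (snd p) v' * \<Phi> (fst p, v') \<partial>V)"
   using AE_space
  proof eventually_elim
   fix p assume p: "AE v' in V. 0 <= \<phi> (fst p, v') & ennreal (\<phi> (fst p, v')) = \<Phi> (fst p, v')" "p \<in> space PS"
   have "snd p \<in> space V" "(%v'. \<phi> (fst p, v')) \<in> bm V"
    using p(2) measurable_compose[OF measurable_Pair1' \<phi>] by (auto simp: space_pair_measure space_D)
   then show "B_inhom \<Omega> \<mu> b t \<phi> p = enn2real (\<integral>\<^sup>+v'. kernel t (snd p) v' * \<Phi> (fst p, v') \<partial>V)"
    using scattering_integral[OF t _ _ p(1)] dom by (simp add: B_inhom_def split_beta)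
  qed
 qed
qed

section \<open>Comparison of the two problems\<close>

definition spatial_marginal :: "(real \<times> 'a \<times> 'a => ennreal) => real \<times> 'a => ennreal" where
 "spatial_marginal G = (%(s, v). marginal (%p. G (s, p)) v)"

lemma spatial_marginal_borel:
 assumes G: "G \<in> bm inh.Y"
 shows "spatial_marginal G \<in> bm hom.Y"
proof -
 have "(%q. (fst (fst q), (snd q, snd (fst q)))) \<in> hom.Y \<otimes> D \<rightarrow>\<^sub>M inh.Y" by measurable
 from measurable_compose[OF this G] show ?thesis
  unfolding spatial_marginal_def marginal_def split_beta'
  by (intro D.borel_measurable_nn_integral) (simp add: split_beta')
qed

lemma spatial_marginal_tmass:
 assumes G: "G \<in> bm inh.Y"
 shows "hom.tmass (spatial_marginal G) = inh.tmass G"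
 unfolding hom.tmass_eq_mass[OF spatial_marginal_borel[OF G]] inh.tmass_eq_mass[OF G]
  hom.mass_def inh.mass_def
 using inh.section_borel[OF G]
 by (intro nn_integral_cong) (auto simp: spatial_marginal_def integral_marginal)

lemma spatial_marginal_S_le:
 assumes G: "G \<in> bm inh.Y" and t: "0 <= t" and y: "y \<in> space hom.Y"
 shows "spatial_marginal (inh.S t G) y <= hom.S t (spatial_marginal G) y"
proof -
 obtain s v where y': "y = (s, v)" "0 <= s" "v \<in> space V" using y by (auto simp: hom.space_Y)
 show ?thesis
 proof (cases "t <= s")
  case True
  have "marginal (%p. damp_in s (s - t) p * G (s - t, flow s (s - t) p)) v <= damp s (s - t) v * marginal (%p. G (s - t, p)) v"
   using marginal_transport_le[OF inh.section_borel[OF G] y'(3)] True by simp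
  then show ?thesis using True by (simp add: y' spatial_marginal_def inh.S_def hom.S_def split_beta')
 qed (simp add: y' spatial_marginal_def inh.S_def marginal_def)
qed

lemma spatial_marginal_Bo:
 assumes G: "G \<in> bm inh.Y" and y: "y \<in> space hom.Y"
 shows "spatial_marginal (inh.Bo G) y = hom.Bo (spatial_marginal G) y"
 using marginal_scattering[OF inh.section_borel[OF G]] y
 by (auto simp: hom.space_Y spatial_marginal_def inh.Bo_def hom.Bo_def split_beta)

lemma spatial_marginal_time_integral:
 assumes A: "A \<in> sets borel" and G: "(%(q, y). G q y) \<in> bm (borel \<otimes> inh.Y)"
  and y: "y \<in> space hom.Y"
 shows "spatial_marginal (%y. \<integral>\<^sup>+q\<in>A. G q y \<partial>lborel) y = (\<integral>\<^sup>+q\<in>A. spatial_marginal (G q) y \<partial>(lborel :: real measure))"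
proof -
 obtain s v where y': "y = (s, v)" "0 <= s" "v \<in> space V" using y by (auto simp: hom.space_Y)
 interpret LD: pair_sigma_finite "lborel :: real measure" D ..
 have "(%w. (fst w, (s, (snd w, v)))) \<in> lborel \<otimes> D \<rightarrow>\<^sub>M borel \<otimes> inh.Y"
 proof (rule measurable_Pair)
  have "(%w. (snd w, v)) \<in> lborel \<otimes> D \<rightarrow>\<^sub>M PS"
   by (rule measurable_Pair[OF measurable_snd measurable_const[OF y'(3)]])
  then show "(%w. (s, (snd w, v))) \<in> lborel \<otimes> D \<rightarrow>\<^sub>M inh.Y"
   by (intro inh.measurable_into_Y) (use y'(2) in simp_all)
 qed simp
 from measurable_compose[OF this G]
 have m[measurable]: "(%w. G (fst w) (s, (snd w, v))) \<in> bm (lborel \<otimes> D)" by simp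
 have sec: "(%x. G q (s, (x, v))) \<in> bm D" for q
  using measurable_compose[OF measurable_Pair1' m, of q] by simp
 have "spatial_marginal (%y. \<integral>\<^sup>+q\<in>A. G q y \<partial>lborel) y = (\<integral>\<^sup>+x. (\<integral>\<^sup>+q. G q (s, (x, v)) * indicator A q \<partial>lborel) \<partial>D)"
  by (simp add: y' spatial_marginal_def marginal_def)
 also have "... = (\<integral>\<^sup>+q. (\<integral>\<^sup>+x. G q (s, (x, v)) * indicator A q \<partial>D) \<partial>lborel)"
  using A by (intro LD.Fubini') (simp add: split_beta')
 also have "... = (\<integral>\<^sup>+q\<in>A. spatial_marginal (G q) y \<partial>lborel)"
  by (intro nn_integral_cong) (simp add: y' spatial_marginal_def marginal_def nn_integral_multc sec)
 finally show ?thesis .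
qed

text \<open>Induction on \<open>n\<close>: marginals commute with scattering and time integrals, transport decreases them, and the homogeneous operators are monotone.\<close>

lemma spatial_marginal_T_le:
 assumes G: "G \<in> bm inh.Y" and t: "0 <= t" and y: "y \<in> space hom.Y"
 shows "spatial_marginal (inh.T n t G) y <= hom.T n t (spatial_marginal G) y"
 using t y
proof (induction n arbitrary: t y)
 case 0 then show ?case using spatial_marginal_S_le[OF G] by simp
next
 case (Suc n)
 let ?B = "%q. inh.Bo (inh.T n q G)"
 have Bf: "(%(q, y). ?B q y) \<in> bm (borel \<otimes> inh.Y)" by (rule inh.Bo_T_family[OF G])
 have Bb: "?B q \<in> bm inh.Y" for q
  by (intro inh.Bo_borel inh.T_borel G)
 have fam: "(%(q, y). inh.S (t - q) (?B q) y) \<in> bm (borel \<otimes> inh.Y)"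
  by (rule inh.S_family[OF Bf]) simp
 have step: "spatial_marginal (inh.S (t - q) (?B q)) y
   <= hom.S (t - q) (hom.Bo (hom.T n q (spatial_marginal G))) y" if q: "0 <= q" "q <= t" for q
 proof -
  have "spatial_marginal (inh.S (t - q) (?B q)) y <= hom.S (t - q) (spatial_marginal (?B q)) y"
   using q by (intro spatial_marginal_S_le[OF Bb] Suc.prems) simp
  also have "... <= hom.S (t - q) (hom.Bo (hom.T n q (spatial_marginal G))) y"
  proof -
   have "spatial_marginal (?B q) z <= hom.Bo (hom.T n q (spatial_marginal G)) z"
    if z: "z \<in> space hom.Y" for z
   proof -
    have "spatial_marginal (?B q) z = hom.Bo (spatial_marginal (inh.T n q G)) z"
     by (rule spatial_marginal_Bo[OF inh.T_borel[OF G] z])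
    also have "... <= hom.Bo (hom.T n q (spatial_marginal G)) z"
     using z unfolding hom.Bo_def
     by (auto intro!: nn_integral_mono mult_left_mono Suc.IH[OF q(1)] simp: hom.space_Y split_beta)
    finally show ?thesis .
   qed
   then show ?thesis using Suc.prems
    by (auto simp: hom.S_def hom.space_Y intro!: mult_left_mono split: if_splits)
  qed
  finally show ?thesis .
 qed
 have "spatial_marginal (inh.T (Suc n) t G) y = (\<integral>\<^sup>+q\<in>{0..t}. spatial_marginal (inh.S (t - q) (?B q)) y \<partial>lborel)"
  unfolding inh.T.simps by (rule spatial_marginal_time_integral[OF _ fam Suc.prems(2)]) simp
 also have "... <= hom.T (Suc n) t (spatial_marginal G) y"
  unfolding hom.T.simps by (intro nn_integral_mono) (auto intro!: step split: split_indicator)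
 finally show ?case .
qed

lemma inhomogeneous_escape_le:
 assumes G: "G \<in> bm inh.Y" and t: "0 <= t"
 shows "inh.escape t G <= hom.escape t (spatial_marginal G)"
proof -
 have "inh.gain n t G <= hom.gain n t (spatial_marginal G)" for n
  unfolding inh.gain_def hom.gain_def
 proof (intro nn_integral_mono)
  fix r :: real
  have "inh.tmass (inh.Bo (inh.T n r G)) <= hom.tmass (hom.Bo (hom.T n r (spatial_marginal G)))"
   if "0 <= r"
  proof -
   have "inh.tmass (inh.Bo (inh.T n r G)) = hom.tmass (spatial_marginal (inh.Bo (inh.T n r G)))"
    by (intro spatial_marginal_tmass[symmetric] inh.Bo_borel inh.T_borel G)
   also have "... = hom.tmass (hom.Bo (spatial_marginal (inh.T n r G)))"
    by (intro hom.tmass_cong spatial_marginal_Bo inh.T_borel G)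
   also have "... <= hom.tmass (hom.Bo (hom.T n r (spatial_marginal G)))"
    unfolding hom.Bo_def
    by (intro hom.tmass_mono)
      (auto intro!: nn_integral_mono mult_left_mono spatial_marginal_T_le[OF G that] simp: hom.space_Y split_beta)
   finally show ?thesis .
  qed
  then show "inh.tmass (inh.Bo (inh.T n r G)) * indicator {0..t} r
    <= hom.tmass (hom.Bo (hom.T n r (spatial_marginal G))) * indicator {0..t} r"
   by (auto split: split_indicator)
 qed
 then show ?thesis
  unfolding inh.escape_def hom.escape_def by (intro INF_mono) auto
qed

theorem honest_homogeneous_imp_inhomogeneous:
 assumes "honest (E_hom \<mu>) (U_hom \<Sigma>) (B_hom \<mu> b)"
 shows "honest (E_inhom \<Omega> \<mu>) (U_inhom \<Omega> \<Sigma>) (B_inhom \<Omega> \<mu> b)"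
 unfolding E_inhom_def phase_space_eq inh.honest_iff_escape
proof (intro allI impI)
 fix G and t :: real
 assume G: "G \<in> bm inh.Y" "inh.tmass G ~= top" and t: "0 <= t"
 have "hom.escape t (spatial_marginal G) = 0"
  using assms[unfolded E_hom_def hom.honest_iff_escape] spatial_marginal_borel[OF G(1)] G(2) t
  by (simp add: spatial_marginal_tmass[OF G(1)])
 then show "inh.escape t G = 0"
  using inhomogeneous_escape_le[OF G(1) t] by simp
qed

end

theorem theorem5p13:
  fixes \<Omega> :: "(real^'d) set"
    and \<mu> :: "(real^'d) measure"
    and \<Sigma> :: "real \<Rightarrow> real^'d \<Rightarrow> real"
    and b :: "real \<Rightarrow> real^'d \<Rightarrow> real^'d \<Rightarrow> real"
  assumes "open \<Omega>"
    and "sets \<mu> = sets borel"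
    and "sigma_finite_measure \<mu>"
    and "(\<lambda>(t, v). \<Sigma> t v) \<in> borel_measurable (half_line \<Otimes>\<^sub>M velocities \<mu>)"
    and "\<And>t v. 0 \<le> t \<Longrightarrow> v \<in> measure_support \<mu> \<Longrightarrow> 0 \<le> \<Sigma> t v"
    and "AE v in velocities \<mu>. \<forall>T\<ge>0. set_integrable lborel {0..T} (\<lambda>t. \<Sigma> t v)"
    and "(\<lambda>(t, v, v'). b t v v')
           \<in> borel_measurable (half_line \<Otimes>\<^sub>M (velocities \<mu> \<Otimes>\<^sub>M velocities \<mu>))"
    and "\<And>t v v'. 0 \<le> t \<Longrightarrow> v \<in> measure_support \<mu> \<Longrightarrow> v' \<in> measure_support \<mu> \<Longrightarrow> 0 \<le> b t v v'"
    and "AE (t, v') in half_line \<Otimes>\<^sub>M velocities \<mu>.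
           (\<integral>\<^sup>+ v. ennreal (b t v v') \<partial>velocities \<mu>) \<le> ennreal (\<Sigma> t v')"
    and "honest (E_hom \<mu>) (U_hom \<Sigma>) (B_hom \<mu> b)"
  shows "honest (E_inhom \<Omega> \<mu>) (U_inhom \<Omega> \<Sigma>) (B_inhom \<Omega> \<mu> b)"
proof -
  interpret kinetic \<Omega> \<mu> \<Sigma> b by (rule kinetic.intro) (fact assms)+
  show ?thesis by (rule honest_homogeneous_imp_inhomogeneous) fact
qed

end
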